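(* Let $n\ge 2$, let $\Omega\subset\mathbb{R}^n$ be a bounded open set, and let $f\in L^p(\Omega)$, $p\ge 1$, be non-negative. Let $u$ be a solution to $|\nabla u|=f$ a.e. in $\Omega$, $u=0$ on $\partial\Omega$, and let $u^{G}$ be the unique spherically decreasing solution to $|\nabla u^{G}|=f_\sharp$ a.e. in $\Omega^\sharp$, $u^{G}=0$ on $\partial\Omega^\sharp$. Let $(u^\sharp)^{G}$ be the unique spherically decreasing solution to $|\nabla (u^\sharp)^{G}|=|\nabla u^\sharp|_\sharp$ a.e. in $\Omega^\sharp$, $(u^\sharp)^{G}=0$ on $\partial\Omega^\sharp$. Then $$\|u\|_{L^1(\Omega)}\le \|(u^\sharp)^{G}\|_{L^1(\Omega^\sharp)}\le \|u^{G}\|_{L^1(\Omega^\sharp)}.$$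
   Context: $|E|$ denotes Lebesgue measure, $\omega_n$ the measure of the unit ball of $\mathbb{R}^n$, and $\Omega^\sharp$ the ball centred at the origin with $|\Omega^\sharp|=|\Omega|$. Solutions: a solution of $|\nabla u|=f$ a.e. in $\Omega$, $u=0$ on $\partial\Omega$, is any (generalized) solution, i.e. any $u\in W^{1,p}_0(\Omega)$ with $|\nabla u|=f$ a.e. in $\Omega$. Likewise on $\Omega^\sharp$. Spherically decreasing means radially symmetric about the origin and decreasing in $|x|$. Rearrangements: for a measurable function $g$ on a bounded open set $D$ (here $D=\Omega$ or $D=\Omega^\sharp$), $\mu_g(t)=|\{x\in D:|g(x)|>t\}|$ for $t\ge 0$; $g^*(s)=\inf\{t\ge0:\mu_g(t)<s\}$ is the decreasing rearrangement; $g_*(s)=g^*(|D|-s)$, $s\in[0,|D|]$, is the increasing rearrangement; $g^\sharp(x)=g^*(\omega_n|x|^n)$ and $g_\sharp(x)=g_*(\omega_n|x|^n)$, $x\in\Omega^\sharp$, are the spherically decreasing (Schwarz) and spherically increasing rearrangements. *)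

theory Defs
  imports "HOL-Analysis.Analysis"
begin

section \<open>Rearrangements\<close>

definition distr_fun :: "'a::euclidean_space set \<Rightarrow> ('a \<Rightarrow> real) \<Rightarrow> real \<Rightarrow> real" where
  "distr_fun D g t = measure lebesgue {x \<in> D. \<bar>g x\<bar> > t}"

text \<open>
  For \<open>s \<le> 0\<close> the infimum is over the empty set; mathematically it is infinite, here it is an
  unspecified real. For the spherical rearrangements below only the centre of the ball is
  affected for the decreasing one, and only points off the open ball for the increasing one,
  so all almost-everywhere statements are insensitive to this.
\<close>
definition decr_rearr :: "'a::euclidean_space set \<Rightarrow> ('a \<Rightarrow> real) \<Rightarrow> real \<Rightarrow> real" where
  "decr_rearr D g s = Inf {t. 0 \<le> t \<and> distr_fun D g t < s}"

definition incr_rearr :: "'a::euclidean_space set \<Rightarrow> ('a \<Rightarrow> real) \<Rightarrow> real \<Rightarrow> real" where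
  "incr_rearr D g s = decr_rearr D g (measure lebesgue D - s)"

definition sharp_ball :: "'a::euclidean_space set \<Rightarrow> 'a set" where
  "sharp_ball D = ball 0 (root DIM('a) (measure lebesgue D / unit_ball_vol DIM('a)))"

lemma measure_sharp_ball:
  fixes D :: "'a::euclidean_space set"
  shows "measure lebesgue (sharp_ball D) = measure lebesgue D"
proof -
  have "unit_ball_vol (real DIM('a)) \<noteq> 0"
    by (metis less_irrefl of_nat_0_le_iff unit_ball_vol_pos)
  then show ?thesis
    by (simp add: sharp_ball_def content_ball)
qed

definition sph_decr_rearr :: "'a::euclidean_space set \<Rightarrow> ('a \<Rightarrow> real) \<Rightarrow> 'a \<Rightarrow> real" where
  "sph_decr_rearr D g x = decr_rearr D g (unit_ball_vol DIM('a) * norm x ^ DIM('a))"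

definition sph_incr_rearr :: "'a::euclidean_space set \<Rightarrow> ('a \<Rightarrow> real) \<Rightarrow> 'a \<Rightarrow> real" where
  "sph_incr_rearr D g x = incr_rearr D g (unit_ball_vol DIM('a) * norm x ^ DIM('a))"

text \<open>
  Radial and non-increasing in \<open>norm x\<close>, as a property of the almost-everywhere class: an
  element of a Sobolev space has no preferred pointwise values. The profile need not have a
  finite value at the centre.
\<close>
definition spherically_decreasing_on :: "'a::euclidean_space set \<Rightarrow> ('a \<Rightarrow> real) \<Rightarrow> bool" where
  "spherically_decreasing_on D u \<longleftrightarrow>
     (\<exists>\<phi>. antimono_on (norm ` (D - {0})) \<phi> \<and> (AE x in lebesgue_on D. u x = \<phi> (norm x)))"

section \<open>Lebesgue and Sobolev spaces\<close>

definition in_Lp :: "'a::euclidean_space set \<Rightarrow> real \<Rightarrow> ('a \<Rightarrow> 'b::euclidean_space) \<Rightarrow> bool" where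
  "in_Lp D p v \<longleftrightarrow> v \<in> borel_measurable (lebesgue_on D) \<and>
     integrable (lebesgue_on D) (\<lambda>x. norm (v x) powr p)"

text \<open>Meaningful only for \<open>v\<close> in $L^p$: a non-integrable power has Bochner integral \<open>0\<close>.\<close>
definition Lp_norm :: "'a::euclidean_space set \<Rightarrow> real \<Rightarrow> ('a \<Rightarrow> 'b::euclidean_space) \<Rightarrow> real" where
  "Lp_norm D p v = (LINT x|lebesgue_on D. norm (v x) powr p) powr (1 / p)"

definition partial_deriv :: "'a::euclidean_space \<Rightarrow> ('a \<Rightarrow> real) \<Rightarrow> 'a \<Rightarrow> real" where
  "partial_deriv b \<phi> x = frechet_derivative \<phi> (at x) b"

primrec C_k :: "nat \<Rightarrow> ('a::euclidean_space \<Rightarrow> real) \<Rightarrow> bool" where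
  "C_k 0 \<phi> \<longleftrightarrow> continuous_on UNIV \<phi>"
| "C_k (Suc k) \<phi> \<longleftrightarrow> (\<forall>x. \<phi> differentiable (at x)) \<and> (\<forall>b\<in>Basis. C_k k (partial_deriv b \<phi>))"

definition test_function :: "'a::euclidean_space set \<Rightarrow> ('a \<Rightarrow> real) \<Rightarrow> bool" where
  "test_function D \<phi> \<longleftrightarrow> (\<forall>k. C_k k \<phi>) \<and>
     compact (closure {x. \<phi> x \<noteq> 0}) \<and> closure {x. \<phi> x \<noteq> 0} \<subseteq> D"

definition has_weak_gradient ::
    "'a::euclidean_space set \<Rightarrow> ('a \<Rightarrow> real) \<Rightarrow> ('a \<Rightarrow> 'a) \<Rightarrow> bool" where
  "has_weak_gradient D u g \<longleftrightarrow>
     (\<forall>K. compact K \<and> K \<subseteq> D \<longrightarrow> u absolutely_integrable_on K \<and> g absolutely_integrable_on K) \<and>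
     (\<forall>\<phi>. test_function D \<phi> \<longrightarrow> (\<forall>b\<in>Basis.
        (LINT x|lebesgue_on D. u x * partial_deriv b \<phi> x) = - (LINT x|lebesgue_on D. (g x \<bullet> b) * \<phi> x)))"

text \<open>A representative; weak gradients are unique up to null sets on open \<open>D\<close>.\<close>
definition weak_gradient :: "'a::euclidean_space set \<Rightarrow> ('a \<Rightarrow> real) \<Rightarrow> 'a \<Rightarrow> 'a" where
  "weak_gradient D u = (SOME g. has_weak_gradient D u g)"

definition in_W1p :: "'a::euclidean_space set \<Rightarrow> real \<Rightarrow> ('a \<Rightarrow> real) \<Rightarrow> bool" where
  "in_W1p D p u \<longleftrightarrow> in_Lp D p u \<and> (\<exists>g. has_weak_gradient D u g \<and> in_Lp D p g)"

definition W1p_norm :: "'a::euclidean_space set \<Rightarrow> real \<Rightarrow> ('a \<Rightarrow> real) \<Rightarrow> real" where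
  "W1p_norm D p u = Lp_norm D p u + Lp_norm D p (weak_gradient D u)"

text \<open>The closure of the test functions in $W^{1,p}$.\<close>
definition in_W1p_0 :: "'a::euclidean_space set \<Rightarrow> real \<Rightarrow> ('a \<Rightarrow> real) \<Rightarrow> bool" where
  "in_W1p_0 D p u \<longleftrightarrow> in_W1p D p u \<and>
     (\<forall>e>0. \<exists>\<phi>. test_function D \<phi> \<and> W1p_norm D p (\<lambda>x. u x - \<phi> x) < e)"

definition eikonal_solution ::
    "'a::euclidean_space set \<Rightarrow> real \<Rightarrow> ('a \<Rightarrow> real) \<Rightarrow> ('a \<Rightarrow> real) \<Rightarrow> bool" where
  "eikonal_solution D p f u \<longleftrightarrow> in_W1p_0 D p u \<and>
     (AE x in lebesgue_on D. norm (weak_gradient D u x) = f x)"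

end

theory Submission
  imports Defs
begin

text \<open>
  For a radially decreasing \<open>w\<close> vanishing on the boundary of a ball, integrating \<open>x \<bullet> \<nabla>w\<close> by parts
  gives \<open>n * \<integral> \<bar>w\<bar> = \<integral> \<bar>x\<bar> \<bar>\<nabla>w\<bar>\<close>, so all norms in question are integrals of a radial derivative
  against \<open>\<bar>x\<bar>\<close>. Let \<open>c s\<close> be the perimeter of a ball of volume \<open>s\<close> and \<open>\<mu>\<close> the distribution function
  of \<open>u\<close>. The Brunn--Minkowski inequality, applied to the superlevel sets of approximating test
  functions, yields \<open>\<integral> c (\<mu> \<tau>) d\<tau> \<le> \<integral> \<bar>\<nabla>u\<bar>\<close>, the integrals being over \<open>t' < \<tau> < t\<close> and \<open>t' < \<bar>u\<bar> < t\<close>.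
  Hence the image under \<open>\<mu>\<close> of the measure with density \<open>c (\<mu> \<tau>)\<close> has itself a density \<open>h\<close>,
  and \<open>\<integral> (h - k)\<^sup>+ \<le> \<integral> (\<bar>\<nabla>u\<bar> - k)\<^sup>+\<close> for every \<open>k \<ge> 0\<close>. The decreasing rearrangement of \<open>u\<close> has the
  weak gradient \<open>- h (\<omega> \<bar>x\<bar> ^ n) x / \<bar>x\<bar>\<close>. Finally, among all \<open>v\<close> on the ball whose excess integrals
  are bounded by those of \<open>f\<close>, the increasing rearrangement of \<open>f\<close> maximises \<open>\<integral> \<bar>x\<bar> v\<close>; this is
  used once for \<open>f = \<bar>\<nabla>u\<^sup>\<sharp>\<bar>\<close> and once for the given \<open>f\<close>.
\<close>

section \<open>The Brunn--Minkowski inequality for open sets\<close>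

text \<open>A general Sobolev \<open>u\<close> offers neither a differentiable distribution function
  nor regular level sets, so the classical route (coarea formula, isoperimetric inequality on level
  sets, differentiation of \<open>\<mu>\<close>) is replaced at each point. Perimeter enters as the
  first-order growth of volume under enlargement, which makes Brunn--Minkowski the geometric input;
  test functions supply the open sets. The derivative of \<open>\<mu>\<close> is never taken: the
  push-forward of \<open>c (\<mu> \<tau>) d\<tau>\<close> under \<open>\<mu>\<close> is insensitive
  to jumps and plateaus. Its absolute continuity is where integrability of the gradient matters,
  since the excess integrals over \<open>k\<close> vanish as \<open>k\<close> grows. The density
  \<open>h\<close> does double duty. \<open>weak_gradient\<close> is a choice, meaningful once some
  weak gradient exists, so one has to be exhibited for the rearrangement; \<open>h\<close> is its
  length. And \<open>n \<integral> \<bar>u\<bar> = \<integral> \<bar>x\<bar> h\<close> follows from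
  the layer cake alone, without reference to boundary values of the rearrangement.\<close>

lemma powr_prod_superadditive:
  fixes x y :: "'b \<Rightarrow> real"
  assumes S: "finite S" "S \<noteq> {}" and x: "\<And>i. i \<in> S \<Longrightarrow> 0 < x i" and y: "\<And>i. i \<in> S \<Longrightarrow> 0 < y i"
  shows "(\<Prod>i\<in>S. x i) powr (1 / card S) + (\<Prod>i\<in>S. y i) powr (1 / card S)
    \<le> (\<Prod>i\<in>S. x i + y i) powr (1 / card S)"
proof -
  let ?P = "(\<Prod>i\<in>S. x i + y i) powr (1 / card S)"
  have P: "0 < (\<Prod>i\<in>S. x i + y i)" using x y by (intro prod_pos) (simp add: add_pos_pos)
  \<comment> \<open>Arithmetic-geometric mean applied to the ratios
    \<open>z i / (x i + y i)\<close>. For \<open>z = x\<close> and \<open>z = y\<close> the two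
    means add up to 1, which leaves exactly the right-hand side.\<close>
  have ratio: "(\<Prod>i\<in>S. z i) powr (1 / card S) \<le> ?P * (\<Sum>i\<in>S. z i / (x i + y i) / card S)"
    if z: "\<And>i. i \<in> S \<Longrightarrow> 0 < z i" for z
  proof -
    have "(\<Prod>i\<in>S. z i) powr (1 / card S) = (\<Prod>i\<in>S. x i + y i) powr (1 / card S) * (\<Prod>i\<in>S. z i / (x i + y i)) powr (1 / card S)"
      using P z by (simp add: prod_dividef powr_mult[symmetric] prod_nonneg less_imp_le)
    also have "\<dots> \<le> ?P * (\<Sum>i\<in>S. z i / (x i + y i) / card S)"
      using arith_geom_mean[OF S, of "\<lambda>i. z i / (x i + y i)"] x y z
      by (intro mult_left_mono) (auto simp: less_imp_le add_pos_pos)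
    finally show ?thesis .
  qed
  have "x i / (x i + y i) / card S + y i / (x i + y i) / card S = 1 / card S" if "i \<in> S" for i
    using x[OF that] y[OF that] by (simp add: add_divide_distrib[symmetric])
  then have "(\<Sum>i\<in>S. x i / (x i + y i) / card S) + (\<Sum>i\<in>S. y i / (x i + y i) / card S)
      = (\<Sum>i\<in>S. 1 / card S)"
    unfolding sum.distrib[symmetric] by (intro sum.cong refl)
  also have "\<dots> = 1" using S by simp
  finally have sum1: "(\<Sum>i\<in>S. x i / (x i + y i) / card S) + (\<Sum>i\<in>S. y i / (x i + y i) / card S) = 1" .
  have "(\<Prod>i\<in>S. x i) powr (1 / card S) + (\<Prod>i\<in>S. y i) powr (1 / card S)
      \<le> ?P * ((\<Sum>i\<in>S. x i / (x i + y i) / card S) + (\<Sum>i\<in>S. y i / (x i + y i) / card S))"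
    unfolding distrib_left by (intro add_mono ratio x y)
  then show ?thesis unfolding sum1 by simp
qed

section \<open>Minkowski sums and the inequality for boxes\<close>

text \<open>Written as a union of singletons because \<open>open_sums\<close> is stated in this
  shape.\<close>

definition mink_sum :: "'a::plus set \<Rightarrow> 'a set \<Rightarrow> 'a set" where
  "mink_sum A B = (\<Union>x\<in>A. \<Union>y\<in>B. {x + y})"

lemma mem_mink_sum: "z \<in> mink_sum A B \<longleftrightarrow> (\<exists>x\<in>A. \<exists>y\<in>B. z = x + y)"
  by (auto simp: mink_sum_def)

lemma mink_sum_mono: "A \<subseteq> A' \<Longrightarrow> B \<subseteq> B' \<Longrightarrow> mink_sum A B \<subseteq> mink_sum A' B'"
  unfolding mink_sum_def by blast

lemma mink_sum_commute: "mink_sum A B = mink_sum B (A::'a::ab_semigroup_add set)"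
  unfolding set_eq_iff mem_mink_sum by (metis add.commute)

lemma fmeasurable_lborel_open_bounded: "open A \<Longrightarrow> bounded A \<Longrightarrow> A \<in> fmeasurable lborel"
  using emeasure_bounded_finite[of A] by (intro fmeasurableI) auto

lemma open_mink_sum: "open A \<Longrightarrow> open (mink_sum A (B::'a::real_normed_vector set))"
  unfolding mink_sum_def by (rule open_sums) simp

lemma fmeasurable_mink_sum:
  assumes "open A" "bounded A" "bounded (B::'a::euclidean_space set)"
  shows "mink_sum A B \<in> fmeasurable lborel"
  using bounded_sums[of A B] assms
  by (intro fmeasurable_lborel_open_bounded open_mink_sum) (auto simp: mink_sum_def)

text \<open>A point of the large box is split coordinate by coordinate: a strict choice of
  \<open>s\<close> exists because the lower bounds \<open>a\<close> and \<open>z - d\<close> both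
  stay below the upper bounds \<open>b\<close> and \<open>z - c\<close>.\<close>

lemma mink_sum_boxes:
  fixes a b c d :: "'a::euclidean_space"
  assumes "box a b \<noteq> {}" "box c d \<noteq> {}"
  shows "box (a + c) (b + d) \<subseteq> mink_sum (box a b) (box c d)"
proof
  fix z assume z: "z \<in> box (a + c) (b + d)"
  have lt: "a \<bullet> i < b \<bullet> i" "c \<bullet> i < d \<bullet> i" if "i \<in> Basis" for i
    using assms that by (auto simp: box_ne_empty)
  have ex: "\<exists>s. a \<bullet> i < s \<and> s < b \<bullet> i \<and> c \<bullet> i < z \<bullet> i - s \<and> z \<bullet> i - s < d \<bullet> i" if i: "i \<in> Basis" for i
  proof -
    have "a \<bullet> i + c \<bullet> i < z \<bullet> i" "z \<bullet> i < b \<bullet> i + d \<bullet> i"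
      using z i by (auto simp: mem_box inner_add_left)
    then have "max (a \<bullet> i) (z \<bullet> i - d \<bullet> i) < min (b \<bullet> i) (z \<bullet> i - c \<bullet> i)"
      using lt[OF i] by auto
    from dense[OF this] show ?thesis by (auto simp: algebra_simps)
  qed
  then obtain s where s: "\<And>i. i \<in> Basis \<Longrightarrow> a \<bullet> i < s i \<and> s i < b \<bullet> i \<and> c \<bullet> i < z \<bullet> i - s i \<and> z \<bullet> i - s i < d \<bullet> i"
    by metis
  define x where "x = (\<Sum>i\<in>Basis. s i *\<^sub>R i)"
  have "x \<in> box a b" "z - x \<in> box c d"
    using s by (auto simp: mem_box x_def inner_diff_left)
  then show "z \<in> mink_sum (box a b) (box c d)" unfolding mem_mink_sum by (intro bexI[of _ x] bexI[of _ "z - x"]) auto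
qed

text \<open>Side lengths add, so for boxes Brunn--Minkowski is the superadditivity of the geometric
  mean of the side lengths.\<close>

lemma measure_mink_sum_boxes:
  fixes a b c d :: "'a::euclidean_space"
  assumes ne: "box a b \<noteq> {}" "box c d \<noteq> {}"
  shows "measure lborel (box a b) powr (1 / DIM('a)) + measure lborel (box c d) powr (1 / DIM('a))
    \<le> measure lborel (mink_sum (box a b) (box c d)) powr (1 / DIM('a))"
proof -
  have lt: "a \<bullet> i < b \<bullet> i" "c \<bullet> i < d \<bullet> i" if "i \<in> Basis" for i
    using assms that by (auto simp: box_ne_empty)
  have "measure lborel (box a b) powr (1 / DIM('a)) + measure lborel (box c d) powr (1 / DIM('a))
      = (\<Prod>i\<in>Basis. (b - a) \<bullet> i) powr (1 / DIM('a)) + (\<Prod>i\<in>Basis. (d - c) \<bullet> i) powr (1 / DIM('a))"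
    using lt by (simp add: measure_lborel_box_eq less_imp_le)
  also have "\<dots> \<le> (\<Prod>i\<in>Basis. (b - a) \<bullet> i + (d - c) \<bullet> i) powr (1 / DIM('a))"
    by (intro powr_prod_superadditive) (use lt in \<open>auto simp: inner_diff_left\<close>)
  also have "\<dots> = measure lborel (box (a + c) (b + d)) powr (1 / DIM('a))"
    using lt by (simp add: measure_lborel_box_eq less_imp_le add_mono inner_add_left inner_diff_left algebra_simps)
  also have "\<dots> \<le> measure lborel (mink_sum (box a b) (box c d)) powr (1 / DIM('a))"
  proof (intro powr_mono2 measure_mono_fmeasurable mink_sum_boxes ne)
    show "mink_sum (box a b) (box c d) \<in> fmeasurable lborel"
      by (intro fmeasurable_mink_sum) (auto simp: bounded_box open_box)
  qed auto
  finally show ?thesis .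
qed

section \<open>Disjoint box families and the cutting argument\<close>

text \<open>The objects of the Hadwiger--Ohmann induction. Empty boxes are excluded so that the
  cardinality counts pieces of positive volume.\<close>

definition box_family :: "'a::euclidean_space set set \<Rightarrow> bool" where
  "box_family P \<longleftrightarrow> finite P \<and> P \<noteq> {} \<and> disjoint P \<and> (\<forall>X\<in>P. X \<noteq> {} \<and> (\<exists>a b. X = box a b))"

lemma box_family_open: "box_family P \<Longrightarrow> open (\<Union>P)"
  by (auto simp: box_family_def open_box intro!: open_Union)

lemma box_family_bounded: "box_family P \<Longrightarrow> bounded (\<Union>P)"
  by (auto simp: box_family_def bounded_box intro!: bounded_Union)

lemma measure_pos_open: "open A \<Longrightarrow> bounded A \<Longrightarrow> A \<noteq> {} \<Longrightarrow> 0 < measure lborel (A::'a::euclidean_space set)"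
proof -
  assume A: "open A" "bounded A" "A \<noteq> {}"
  then obtain x e where xe: "e > 0" "ball x e \<subseteq> A" by (meson all_not_in_conv open_contains_ball)
  have "0 < measure lborel (ball x e)" using xe by simp
  also have "\<dots> \<le> measure lborel A"
    using xe A by (intro measure_mono_fmeasurable fmeasurable_lborel_open_bounded) auto
  finally show ?thesis .
qed

text \<open>Traces on \<open>H\<close> with the empty ones dropped: the count then decreases
  strictly as soon as one box misses \<open>H\<close>.\<close>

definition slab_family :: "'a::euclidean_space set \<Rightarrow> 'a set set \<Rightarrow> 'a set set" where
  "slab_family H P = (\<lambda>X. X \<inter> H) ` {X \<in> P. X \<inter> H \<noteq> {}}"

lemma slab_family_Union: "\<Union>(slab_family H P) = \<Union>P \<inter> H"
  by (auto simp: slab_family_def)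

lemma slab_family_card: "finite P \<Longrightarrow> card (slab_family H P) \<le> card P"
  unfolding slab_family_def
  by (rule order_trans[OF card_image_le]) (auto intro: card_mono)

lemma slab_family_card_less: "finite P \<Longrightarrow> X \<in> P \<Longrightarrow> X \<inter> H = {} \<Longrightarrow> card (slab_family H P) < card P"
  unfolding slab_family_def
  by (rule le_less_trans[OF card_image_le]) (auto intro!: psubset_card_mono)

lemma box_family_slab:
  fixes P :: "'a::euclidean_space set set"
  assumes P: "box_family P" and H: "\<And>a b::'a. \<exists>a' b'. box a b \<inter> H = box a' b'" and ne: "\<Union>P \<inter> H \<noteq> {}"
  shows "box_family (slab_family H P)"
  unfolding box_family_def
proof (intro conjI ballI)
  show "finite (slab_family H P)" using P by (auto simp: box_family_def slab_family_def)
  show "slab_family H P \<noteq> {}" using ne by (auto simp: slab_family_def)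
  show "disjoint (slab_family H P)"
    using P unfolding box_family_def slab_family_def disjoint_def by blast
  show "X \<noteq> {}" if "X \<in> slab_family H P" for X using that by (auto simp: slab_family_def)
  show "\<exists>a b. X = box a b" if X: "X \<in> slab_family H P" for X
  proof -
    obtain Y where Y: "Y \<in> P" "X = Y \<inter> H" using X by (auto simp: slab_family_def)
    then obtain a b where "Y = box a b" using P unfolding box_family_def by blast
    then show ?thesis using H[of a b] Y by auto
  qed
qed

lemma box_Int_halfspace:
  fixes a b k :: "'a::euclidean_space"
  assumes k: "k \<in> Basis"
  shows "\<exists>a' b'. box a b \<inter> {x. x \<bullet> k < c} = box a' b'"
    and "\<exists>a' b'. box a b \<inter> {x. c < x \<bullet> k} = box a' b'"
proof -
  have "box a b \<inter> {x. x \<bullet> k < c} = box a (\<Sum>i\<in>Basis. (if i = k then min (b \<bullet> k) c else b \<bullet> i) *\<^sub>R i)"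
    using k by (auto simp: mem_box set_eq_iff split: if_splits)
  then show "\<exists>a' b'. box a b \<inter> {x. x \<bullet> k < c} = box a' b'" by blast
  have "box a b \<inter> {x. c < x \<bullet> k} = box (\<Sum>i\<in>Basis. (if i = k then max (a \<bullet> k) c else a \<bullet> i) *\<^sub>R i) b"
    using k by (auto simp: mem_box set_eq_iff split: if_splits)
  then show "\<exists>a' b'. box a b \<inter> {x. c < x \<bullet> k} = box a' b'" by blast
qed

lemma measure_split_halfspace:
  fixes A :: "'a::euclidean_space set"
  assumes "open A" "bounded A" and k: "k \<in> Basis"
  shows "measure lborel A = measure lborel (A \<inter> {x. x \<bullet> k < c}) + measure lborel (A \<inter> {x. c < x \<bullet> k})"
proof -
  have [measurable]: "A \<in> sets borel" using assms by simp
  have o: "open (A \<inter> {x. x \<bullet> k < c})" "open (A \<inter> {x. c < x \<bullet> k})"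
    using assms by (auto intro!: open_Int open_Collect_less continuous_intros)
  have "measure lborel A = measure lborel (A \<inter> {x. x \<bullet> k < c} \<union> A \<inter> {x. c < x \<bullet> k})"
    using AE_lborel_inner_neq[OF k, of c] by (intro measure_eq_AE) (auto simp: o borel_open)
  also have "\<dots> = measure lborel (A \<inter> {x. x \<bullet> k < c}) + measure lborel (A \<inter> {x. c < x \<bullet> k})"
  proof -
    have 0: "A \<inter> {x. x \<bullet> k < c} \<inter> (A \<inter> {x. c < x \<bullet> k}) = {}" by auto
    show ?thesis
      by (subst measure_Un3) (use o assms 0 in \<open>auto intro!: fmeasurable_lborel_open_bounded intro: bounded_Int\<close>)
  qed
  finally show ?thesis .
qed

text \<open>The volume below a moving hyperplane is continuous in \<open>d\<close>, since single
  hyperplanes are null and dominated convergence applies; the intermediate value theorem does the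
  rest.\<close>

lemma halfspace_fraction:
  fixes A :: "'a::euclidean_space set"
  assumes A: "open A" "bounded A" and k: "k \<in> Basis" and t: "0 < t" "t < measure lborel A"
  shows "\<exists>d. measure lborel (A \<inter> {x. x \<bullet> k < d}) = t"
proof -
  have [measurable]: "A \<in> sets borel" using assms by simp
  obtain K where K: "\<And>x. x \<in> A \<Longrightarrow> norm x \<le> K" using A by (auto simp: bounded_iff)
  have fin: "emeasure lborel A < \<infinity>" using A emeasure_bounded_finite by blast
  define g where "g d = (LINT x|lborel. indicator (A \<inter> {x. x \<bullet> k < d}) x :: real)" for d
  have g: "g d = measure lborel (A \<inter> {x. x \<bullet> k < d})" for d by (simp add: g_def)
  have cont: "continuous_on UNIV g"
    unfolding continuous_on_sequentially
  proof (intro ballI allI impI, unfold comp_def g_def, elim conjE)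
    fix X d assume X: "X \<longlonglongrightarrow> (d::real)"
    show "(\<lambda>n. LINT x|lborel. indicator (A \<inter> {x. x \<bullet> k < X n}) x :: real) \<longlonglongrightarrow> (LINT x|lborel. indicator (A \<inter> {x. x \<bullet> k < d}) x)"
    proof (rule integral_dominated_convergence[where w="indicator A"])
      show "AE x in lborel. (\<lambda>n. indicator (A \<inter> {x. x \<bullet> k < X n}) x :: real) \<longlonglongrightarrow> indicator (A \<inter> {x. x \<bullet> k < d}) x"
        using AE_lborel_inner_neq[OF k, of d]
      proof eventually_elim
        fix x assume "x \<bullet> k \<noteq> d"
        then consider "x \<bullet> k < d" | "d < x \<bullet> k" by linarith
        then have "\<forall>\<^sub>F n in sequentially. (x \<bullet> k < X n) = (x \<bullet> k < d)"
          by cases (use order_tendstoD[OF X, of "x \<bullet> k"] in \<open>auto elim!: eventually_mono\<close>)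
        then have "\<forall>\<^sub>F n in sequentially. indicator (A \<inter> {x. x \<bullet> k < X n}) x = (indicator (A \<inter> {x. x \<bullet> k < d}) x :: real)"
          by eventually_elim (auto simp: indicator_def)
        then show "(\<lambda>n. indicator (A \<inter> {x. x \<bullet> k < X n}) x :: real) \<longlonglongrightarrow> indicator (A \<inter> {x. x \<bullet> k < d}) x"
          by (rule tendsto_eventually)
      qed
    qed (use fin in \<open>auto simp: indicator_def\<close>)
  qed
  have b: "\<bar>x \<bullet> k\<bar> \<le> K" if "x \<in> A" for x using Basis_le_norm[OF k, of x] K[OF that] by linarith
  have "A \<inter> {x. x \<bullet> k < - K} = {}" using b by force
  then have lo: "g (- K) = 0" by (simp add: g)
  \<comment> \<open>The half-space is open, hence \<open>K + 1\<close> rather than \<open>K\<close>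
    to capture all of \<open>A\<close>.\<close>
  have "A \<inter> {x. x \<bullet> k < K + 1} = A" using b by force
  then have hi: "g (K + 1) = measure lborel A" by (simp add: g)
  have "A \<noteq> {}" using t by auto
  then have "0 \<le> K" using K norm_ge_zero order_trans by blast
  then have "\<exists>d. - K \<le> d \<and> d \<le> K + 1 \<and> g d = t"
    using t lo hi by (intro IVT') (auto intro: continuous_on_subset[OF cont])
  then show ?thesis by (auto simp: g)
qed

definition bm_ineq :: "'a::euclidean_space set \<Rightarrow> 'a set \<Rightarrow> bool" where
  "bm_ineq A B \<longleftrightarrow> measure lborel A powr (1 / DIM('a)) + measure lborel B powr (1 / DIM('a))
     \<le> measure lborel (mink_sum A B) powr (1 / DIM('a))"

lemma bm_ineq_commute: "bm_ineq A B \<longleftrightarrow> bm_ineq B A"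
  unfolding bm_ineq_def by (subst mink_sum_commute) (simp add: add.commute)

text \<open>If both sets are cut in the same volume ratio \<open>\<rho>\<close>, the inequality for
  a pair of pieces says that the volume of their sum is at least \<open>T\<close> times the volume
  of the first piece, with one factor \<open>T\<close> for both pairs. In this form it is linear in
  the volumes and can be added up over the disjoint sums.\<close>

lemma bm_ineq_cut:
  fixes A B :: "'a::euclidean_space set"
  assumes A: "open A" "bounded A" and B: "open B" "bounded B"
    and AL: "measure lborel A = measure lborel A1 + measure lborel A2" "0 < measure lborel A1" "0 < measure lborel A2"
    and BL: "measure lborel B = measure lborel B1 + measure lborel B2"
      "measure lborel B1 = \<rho> * measure lborel A1" "measure lborel B2 = \<rho> * measure lborel A2" "0 < \<rho>"
    and op: "open A1" "open A2" and sub: "A1 \<subseteq> A" "A2 \<subseteq> A" "B1 \<subseteq> B" "B2 \<subseteq> B"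
    and disj: "mink_sum A1 B1 \<inter> mink_sum A2 B2 = {}"
    and bm: "bm_ineq A1 B1" "bm_ineq A2 B2"
  shows "bm_ineq A B"
proof -
  let ?n = "real DIM('a)" and ?m = "measure lborel :: 'a set \<Rightarrow> real"
  define T where "T = (1 + \<rho> powr (1 / ?n)) powr ?n"
  have n: "?n > 0" by simp
  have lower: "?m A' * T \<le> ?m (mink_sum A' B')"
    if "bm_ineq A' B'" "?m B' = \<rho> * ?m A'" "0 < ?m A'" for A' B'
  proof -
    have "?m A' powr (1 / ?n) * (1 + \<rho> powr (1 / ?n)) \<le> ?m (mink_sum A' B') powr (1 / ?n)"
      using that BL by (simp add: bm_ineq_def powr_mult algebra_simps)
    then have "(?m A' powr (1 / ?n) * (1 + \<rho> powr (1 / ?n))) powr ?n \<le> (?m (mink_sum A' B') powr (1 / ?n)) powr ?n"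
      by (intro powr_mono2) (auto intro!: mult_nonneg_nonneg add_nonneg_nonneg)
    then show ?thesis
      using that by (simp add: powr_powr powr_mult T_def)
  qed
  have bd: "bounded A1" "bounded A2" "bounded B1" "bounded B2"
    using A B sub by (meson bounded_subset)+
  note fm = fmeasurable_mink_sum[OF op(1) bd(1) bd(3)] fmeasurable_mink_sum[OF op(2) bd(2) bd(4)]
  have "?m A * T \<le> ?m (mink_sum A1 B1) + ?m (mink_sum A2 B2)"
    using lower[OF bm(1) BL(2) AL(2)] lower[OF bm(2) BL(3) AL(3)] AL by (simp add: algebra_simps)
  also have "\<dots> = ?m (mink_sum A1 B1 \<union> mink_sum A2 B2)"
    using disj fm by (subst measure_Un3) auto
  also have "\<dots> \<le> ?m (mink_sum A B)"
    using sub fm fmeasurable_mink_sum[OF A B(2)]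
    by (intro measure_mono_fmeasurable Un_least mink_sum_mono sets.Un) (auto dest: fmeasurableD)
  finally have "(?m A * T) powr (1 / ?n) \<le> ?m (mink_sum A B) powr (1 / ?n)"
    by (intro powr_mono2) (auto simp: T_def)
  moreover have "(?m A * T) powr (1 / ?n) = ?m A powr (1 / ?n) + (\<rho> * ?m A) powr (1 / ?n)"
    using BL(4) by (simp add: powr_mult powr_powr T_def algebra_simps)
  moreover have "\<rho> * ?m A = ?m B" using AL BL by (simp add: algebra_simps)
  ultimately show ?thesis by (simp add: bm_ineq_def)
qed

text \<open>The cut through the first family separates two of its boxes, so each half contains fewer
  boxes. The parallel cut through the second family is placed so that it divides the volume in the
  same proportion, and it does not increase the number of boxes on either side. The induction
  hypothesis thus covers both halves.\<close>

lemma bm_ineq_family_cut: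
  fixes P Q :: "'a::euclidean_space set set"
  assumes P: "box_family P" and Q: "box_family Q" and k: "k \<in> Basis"
    and X: "X1 \<in> P" "X2 \<in> P" "X1 \<subseteq> {x. x \<bullet> k < c}" "X2 \<subseteq> {x. c < x \<bullet> k}"
    and IH: "\<And>P' Q' :: 'a set set. box_family P' \<Longrightarrow> box_family Q' \<Longrightarrow> card P' + card Q' < card P + card Q \<Longrightarrow> bm_ineq (\<Union>P') (\<Union>Q')"
  shows "bm_ineq (\<Union>P) (\<Union>Q)"
proof -
  let ?m = "measure lborel :: 'a set \<Rightarrow> real"
  let ?L = "\<lambda>c. {x. x \<bullet> k < c}" and ?G = "\<lambda>c. {x. c < x \<bullet> k}"
  have o: "open (?L c)" "open (?G c)" for c by (auto intro!: open_Collect_less continuous_intros)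
  note Po = box_family_open[OF P] box_family_bounded[OF P]
  note Qo = box_family_open[OF Q] box_family_bounded[OF Q]
  have X0: "X1 \<noteq> {}" "X2 \<noteq> {}" "finite P" "finite Q" "\<Union>Q \<noteq> {}" using P Q X by (auto simp: box_family_def)
  have ne: "\<Union>P \<inter> ?L c \<noteq> {}" "\<Union>P \<inter> ?G c \<noteq> {}" using X X0 by blast+
  have pos: "0 < ?m (\<Union>P \<inter> ?L c)" "0 < ?m (\<Union>P \<inter> ?G c)"
    using ne Po o by (auto intro!: measure_pos_open intro: bounded_Int)
  have Qpos: "0 < ?m (\<Union>Q)" using Qo X0 by (intro measure_pos_open) auto
  note sumP = measure_split_halfspace[OF Po k, of c]
  define \<rho> where "\<rho> = ?m (\<Union>Q) / ?m (\<Union>P)"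
  have \<rho>: "0 < \<rho>" using Qpos pos sumP by (simp add: \<rho>_def)
  have \<rho>Q: "?m (\<Union>Q) = \<rho> * ?m (\<Union>P)" using pos sumP by (simp add: \<rho>_def)
  obtain d where d: "?m (\<Union>Q \<inter> ?L d) = \<rho> * ?m (\<Union>P \<inter> ?L c)"
    using halfspace_fraction[OF Qo k, of "\<rho> * ?m (\<Union>P \<inter> ?L c)"] pos \<rho> \<rho>Q sumP by (auto simp: algebra_simps)
  note sumQ = measure_split_halfspace[OF Qo k, of d]
  have d2: "?m (\<Union>Q \<inter> ?G d) = \<rho> * ?m (\<Union>P \<inter> ?G c)" using sumP sumQ d \<rho>Q by (simp add: algebra_simps)
  have Qne: "\<Union>Q \<inter> ?L d \<noteq> {}" "\<Union>Q \<inter> ?G d \<noteq> {}" using d d2 pos \<rho> by auto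
  note hL = box_Int_halfspace(1)[OF k] and hG = box_Int_halfspace(2)[OF k]
  have "card (slab_family (?L c) P) < card P" using X X0 by (intro slab_family_card_less[of _ X2]) force+
  then have bmL: "bm_ineq (\<Union>(slab_family (?L c) P)) (\<Union>(slab_family (?L d) Q))"
    using slab_family_card[of Q "?L d"] X0 ne Qne P Q hL
    by (intro IH box_family_slab) auto
  have "card (slab_family (?G c) P) < card P" using X X0 by (intro slab_family_card_less[of _ X1]) force+
  then have bmG: "bm_ineq (\<Union>(slab_family (?G c) P)) (\<Union>(slab_family (?G d) Q))"
    using slab_family_card[of Q "?G d"] X0 ne Qne P Q hG
    by (intro IH box_family_slab) auto
  show ?thesis
  proof (rule bm_ineq_cut[OF Po Qo sumP pos sumQ d d2 \<rho>])
    \<comment> \<open>The two partial sums lie on opposite sides of the hyperplane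
      \<open>x \<bullet> k = c + d\<close>.\<close>
    show "mink_sum (\<Union>P \<inter> ?L c) (\<Union>Q \<inter> ?L d) \<inter> mink_sum (\<Union>P \<inter> ?G c) (\<Union>Q \<inter> ?G d) = {}"
    proof -
      have "z \<bullet> k < c + d" if "z \<in> mink_sum (\<Union>P \<inter> ?L c) (\<Union>Q \<inter> ?L d)" for z
        using that by (auto simp: mem_mink_sum inner_add_left)
      moreover have "c + d < z \<bullet> k" if "z \<in> mink_sum (\<Union>P \<inter> ?G c) (\<Union>Q \<inter> ?G d)" for z
        using that by (auto simp: mem_mink_sum inner_add_left)
      ultimately show ?thesis by (meson disjoint_iff less_asym)
    qed
  qed (use bmL bmG Po o in \<open>auto simp: slab_family_Union\<close>)
qed

text \<open>Otherwise the coordinate intervals overlap in every direction, and a point chosen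
  coordinatewise lies in both boxes.\<close>

lemma disjoint_boxes_separated:
  fixes a b c d :: "'a::euclidean_space"
  assumes ne: "box a b \<noteq> {}" "box c d \<noteq> {}" and "box a b \<inter> box c d = {}"
  obtains k where "k \<in> Basis" "b \<bullet> k \<le> c \<bullet> k \<or> d \<bullet> k \<le> a \<bullet> k"
proof (rule ccontr)
  note witness = that
  assume n: "\<not> thesis"
  have lt: "a \<bullet> i < b \<bullet> i" "c \<bullet> i < d \<bullet> i" "c \<bullet> i < b \<bullet> i" "a \<bullet> i < d \<bullet> i" if i: "i \<in> Basis" for i
    using ne n witness[OF i] i by (auto simp: box_ne_empty not_le[symmetric])
  have "\<exists>s. max (a \<bullet> i) (c \<bullet> i) < s \<and> s < min (b \<bullet> i) (d \<bullet> i)" if "i \<in> Basis" for i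
    using lt[OF that] by (intro dense) auto
  then obtain s where s: "\<And>i. i \<in> Basis \<Longrightarrow> max (a \<bullet> i) (c \<bullet> i) < s i \<and> s i < min (b \<bullet> i) (d \<bullet> i)" by metis
  have "(\<Sum>i\<in>Basis. s i *\<^sub>R i) \<in> box a b \<inter> box c d" using s by (auto simp: mem_box)
  with assms show False by auto
qed

lemma bm_ineq_box_families:
  fixes P Q :: "'a::euclidean_space set set"
  assumes "box_family P" "box_family Q"
  shows "bm_ineq (\<Union>P) (\<Union>Q)"
  using assms
proof (induction "card P + card Q" arbitrary: P Q rule: less_induct)
  case less
  \<comment> \<open>Only the total number of boxes is fixed here, so that the same argument serves
    with the two families exchanged.\<close>
  have two: "bm_ineq (\<Union>P') (\<Union>Q')" if P': "box_family P'" and Q': "box_family Q'" and X: "X1 \<in> P'" "X2 \<in> P'" "X1 \<noteq> X2"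
    and eq: "card P' + card Q' = card P + card Q" for P' Q' and X1 X2 :: "'a set"
  proof -
    obtain a b c d where ab: "X1 = box a b" "X2 = box c d" using P' X unfolding box_family_def by meson
    have ne: "box a b \<noteq> {}" "box c d \<noteq> {}" "box a b \<inter> box c d = {}"
      using P' X ab by (auto simp: box_family_def disjoint_def)
    have IH: "bm_ineq (\<Union>P'') (\<Union>Q'')" if "box_family P''" "box_family Q''" "card P'' + card Q'' < card P' + card Q'" for P'' Q'' :: "'a set set"
      using less.hyps that eq by auto
    obtain k where k: "k \<in> Basis" "b \<bullet> k \<le> c \<bullet> k \<or> d \<bullet> k \<le> a \<bullet> k" using disjoint_boxes_separated[OF ne] .
    then consider "b \<bullet> k \<le> c \<bullet> k" | "d \<bullet> k \<le> a \<bullet> k" by auto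
    then show ?thesis
    proof cases
      case 1
      show ?thesis
        by (rule bm_ineq_family_cut[OF P' Q' k(1) X(1,2), of "b \<bullet> k"]) (use IH 1 k(1) ab in \<open>force simp: mem_box\<close>)+
    next
      case 2
      show ?thesis
        by (rule bm_ineq_family_cut[OF P' Q' k(1) X(2,1), of "d \<bullet> k"]) (use IH 2 k(1) ab in \<open>force simp: mem_box\<close>)+
    qed
  qed
  have fin: "finite P" "finite Q" "P \<noteq> {}" "Q \<noteq> {}" using less.prems by (auto simp: box_family_def)
  consider X1 X2 where "X1 \<in> P" "X2 \<in> P" "X1 \<noteq> X2" | X1 X2 where "X1 \<in> Q" "X2 \<in> Q" "X1 \<noteq> X2"
    | X Y where "P = {X}" "Q = {Y}" using fin by (metis is_singletonI' is_singletonE)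
  then show ?case
  proof cases
    case 1
    then show ?thesis using two less.prems by blast
  next
    case 2
    then show ?thesis using two[OF less.prems(2,1) 2] by (simp add: bm_ineq_commute)
  next
    case 3
    then obtain a b c d where "X = box a b" "Y = box c d" "box a b \<noteq> {}" "box c d \<noteq> {}"
      using less.prems unfolding box_family_def by (metis insertI1)
    then show ?thesis using 3 measure_mink_sum_boxes[of a b c d] by (simp add: bm_ineq_def)
  qed
qed

text \<open>An open set is a countable union of closed boxes. A finite part of nearly full measure
  is redivided into non-overlapping closed boxes, whose interiors lose only null boundaries.\<close>

lemma box_family_approx:
  fixes A :: "'a::euclidean_space set"
  assumes A: "open A" "bounded A" "A \<noteq> {}" and t: "t < measure lborel A"
  shows "\<exists>P. box_family P \<and> \<Union>P \<subseteq> A \<and> t < measure lborel (\<Union>P)"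
proof -
  obtain D where D: "countable D" "\<And>X. X \<in> D \<Longrightarrow> \<exists>a b. X = cbox a b" "\<Union>D = A"
    using open_countable_Union_open_cbox[OF A(1)] by metis
  have Dne: "D \<noteq> {}" using D A by auto
  let ?F = "\<lambda>N. \<Union>i\<le>N. from_nat_into D i"
  have "(\<Union>N. ?F N) = \<Union>(range (from_nat_into D))" by auto
  then have F: "(\<Union>N. ?F N) = A" using D Dne by (simp add: range_from_nat_into)
  have cb: "\<exists>a b. from_nat_into D i = cbox a b" for i using D(2) from_nat_into[OF Dne] by blast
  have meas: "?F N \<in> sets lborel" for N
    using cb by (intro sets.finite_UN) (metis borel_closed closed_cbox finite_atMost sets_lborel)+
  have "(\<lambda>N. measure lborel (?F N)) \<longlonglongrightarrow> measure lborel (\<Union>N. ?F N)"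
    using A emeasure_bounded_finite[of A] meas
    by (intro Lim_measure_incseq) (simp_all only: F image_subset_iff, auto simp: incseq_def)
  \<comment> \<open>Comparing with \<open>max t 0\<close> also forces the union to have positive
    measure, so that the family is nonempty.\<close>
  then have "\<forall>\<^sub>F N in sequentially. max t 0 < measure lborel (?F N)"
    using t measure_pos_open[OF A] unfolding F by (intro order_tendstoD) auto
  then obtain N where N: "max t 0 < measure lborel (?F N)" by (meson eventually_sequentially order_refl)
  obtain p where p: "p division_of (?F N)"
    by (rule elementary_unions_intervals[of "from_nat_into D ` {..N}"]) (use cb in auto)
  define P where "P = {interior K |K. K \<in> p \<and> interior K \<noteq> {}}"
  have pcb: "\<exists>a b. K = cbox a b" if "K \<in> p" for K using division_ofD(4)[OF p that] .
  have Pop: "open X" if "X \<in> P" for X using that by (auto simp: P_def)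
  have fin: "finite p" using p by auto
  have "\<Union>p - \<Union>P \<subseteq> (\<Union>K\<in>p. K - interior K)" by (auto simp: P_def)
  moreover have "(\<Union>K\<in>p. K - interior K) \<in> null_sets lborel"
  proof (intro null_sets.finite_UN fin)
    fix K assume "K \<in> p"
    then obtain a b where "K = cbox a b" using pcb by blast
    then show "K - interior K \<in> null_sets lborel" by (simp add: null_sets_cbox_Diff_box interior_cbox)
  qed
  moreover have "\<Union>P \<subseteq> \<Union>p" using interior_subset by (auto simp: P_def)
  moreover have Pb: "\<Union>P \<in> sets lborel" using Pop by (auto intro!: borel_open)
  ultimately have "\<Union>P \<union> (\<Union>K\<in>p. K - interior K) \<supseteq> \<Union>p" and nul: "(\<Union>K\<in>p. K - interior K) \<in> null_sets lborel"
    by auto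
  have sub: "\<Union>P \<subseteq> A"
  proof -
    have "?F N \<subseteq> (\<Union>N. ?F N)" by (rule UN_upper) simp
    then show ?thesis using \<open>\<Union>P \<subseteq> \<Union>p\<close> unfolding division_ofD(6)[OF p] F by (rule order_trans[rotated])
  qed
  have bP: "\<Union>P \<in> fmeasurable lborel"
    using Pop by (intro fmeasurable_lborel_open_bounded bounded_subset[OF A(2) sub] open_Union) auto
  have "max t 0 < measure lborel (\<Union>p)" using N division_ofD(6)[OF p] by simp
  also have "\<dots> \<le> measure lborel (\<Union>P \<union> (\<Union>K\<in>p. K - interior K))"
  proof (rule measure_mono_fmeasurable)
    have "(\<Union>K\<in>p. K - interior K) \<in> fmeasurable lborel" using nul by (intro fmeasurableI) auto
    with bP show "\<Union>P \<union> (\<Union>K\<in>p. K - interior K) \<in> fmeasurable lborel" by (rule fmeasurable.Un)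
    show "\<Union>p \<in> sets lborel" unfolding division_ofD(6)[OF p] by (rule meas)
  qed fact
  also have "\<dots> = measure lborel (\<Union>P)"
    using nul Pb by (intro measure_Un_null_set) auto
  finally have gt: "max t 0 < measure lborel (\<Union>P)" .
  have "box_family P"
    unfolding box_family_def
  proof (intro conjI ballI)
    show "finite P" using fin by (simp add: P_def)
    show "P \<noteq> {}" using gt by auto
    show "disjoint P"
    proof (rule disjointI)
      fix X Y assume "X \<in> P" "Y \<in> P" "X \<noteq> Y"
      then obtain K L where "K \<in> p" "L \<in> p" "X = interior K" "Y = interior L" "K \<noteq> L" by (auto simp: P_def)
      then show "X \<inter> Y = {}" using division_ofD(5)[OF p] by simp
    qed
    show "X \<noteq> {}" if "X \<in> P" for X using that by (auto simp: P_def)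
    show "\<exists>a b. X = box a b" if "X \<in> P" for X using that pcb by (auto simp: P_def) (metis interior_cbox)
  qed
  with gt sub show ?thesis by auto
qed

text \<open>Inner approximation by box families: the sum of the approximants stays inside the sum of
  the sets, so a limit is taken on the left-hand side alone.\<close>

lemma Brunn_Minkowski_open:
  fixes A B :: "'a::euclidean_space set"
  assumes A: "open A" "bounded A" "A \<noteq> {}" and B: "open B" "bounded B" "B \<noteq> {}"
  shows "measure lborel A powr (1 / DIM('a)) + measure lborel B powr (1 / DIM('a))
     \<le> measure lborel (mink_sum A B) powr (1 / DIM('a))"
proof -
  have approx: "\<exists>P. \<forall>k. box_family (P k) \<and> \<Union>(P k) \<subseteq> S \<and> measure lborel S - inverse (Suc k) < measure lborel (\<Union>(P k))"
    if "open S" "bounded S" "S \<noteq> {}" for S :: "'a set"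
  proof (rule choice, rule allI)
    fix k :: nat
    show "\<exists>P. box_family P \<and> \<Union>P \<subseteq> S \<and> measure lborel S - inverse (Suc k) < measure lborel (\<Union>P)"
      by (rule box_family_approx[OF that]) simp
  qed
  obtain P where P: "\<And>k. box_family (P k)" "\<And>k. \<Union>(P k) \<subseteq> A"
      "\<And>k. measure lborel A - inverse (Suc k) < measure lborel (\<Union>(P k))" using approx[OF A] by auto
  obtain Q where Q: "\<And>k. box_family (Q k)" "\<And>k. \<Union>(Q k) \<subseteq> B"
      "\<And>k. measure lborel B - inverse (Suc k) < measure lborel (\<Union>(Q k))" using approx[OF B] by auto
  have lim: "(\<lambda>k. measure lborel (\<Union>(R k))) \<longlonglongrightarrow> measure lborel S"
    if "open S" "bounded S" "\<And>k. box_family (R k)" "\<And>k. \<Union>(R k) \<subseteq> S"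
      "\<And>k. measure lborel S - inverse (Suc k) < measure lborel (\<Union>(R k))" for R and S :: "'a set"
  proof (rule tendsto_sandwich)
    show "(\<lambda>k. measure lborel S - inverse (real (Suc k))) \<longlonglongrightarrow> measure lborel S"
      using LIMSEQ_inverse_real_of_nat_add_minus[of "measure lborel S"] by simp
    show "\<forall>\<^sub>F k in sequentially. measure lborel (\<Union>(R k)) \<le> measure lborel S"
      using that borel_open[OF box_family_open[OF that(3)]]
      by (intro always_eventually allI measure_mono_fmeasurable fmeasurable_lborel_open_bounded) simp_all
  qed (use that in \<open>auto intro!: always_eventually less_imp_le\<close>)
  have lhs: "(\<lambda>k. measure lborel (\<Union>(P k)) powr (1 / DIM('a)) + measure lborel (\<Union>(Q k)) powr (1 / DIM('a)))
     \<longlonglongrightarrow> measure lborel A powr (1 / DIM('a)) + measure lborel B powr (1 / DIM('a))"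
    using measure_pos_open[OF A] measure_pos_open[OF B]
    by (intro tendsto_intros lim A B P Q) auto
  show ?thesis
  proof (rule LIMSEQ_le_const2[OF lhs], intro exI allI impI)
    fix k
    have "bm_ineq (\<Union>(P k)) (\<Union>(Q k))" using P Q bm_ineq_box_families by blast
    moreover have "measure lborel (mink_sum (\<Union>(P k)) (\<Union>(Q k))) \<le> measure lborel (mink_sum A B)"
      using A B borel_open[OF open_mink_sum[OF box_family_open[OF P(1)]]]
      by (intro measure_mono_fmeasurable mink_sum_mono fmeasurable_mink_sum P(2) Q(2)) auto
    ultimately show "measure lborel (\<Union>(P k)) powr (1 / DIM('a)) + measure lborel (\<Union>(Q k)) powr (1 / DIM('a))
       \<le> measure lborel (mink_sum A B) powr (1 / DIM('a))"
      unfolding bm_ineq_def by (meson measure_nonneg order_trans powr_mono2 zero_le_divide_1_iff of_nat_0_le_iff)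
  qed
qed

section \<open>Volume growth of neighbourhoods\<close>

text \<open>Since \<open>0 powr a = 0\<close>, the value at \<open>s = 0\<close> is 0; levels beyond
  the essential supremum of \<open>\<bar>u\<bar>\<close> therefore contribute nothing to integrals
  of \<open>c (\<mu> \<tau>)\<close>.\<close>

definition ball_perimeter :: "real \<Rightarrow> real \<Rightarrow> real" where
  "ball_perimeter n s = n * unit_ball_vol n powr (1 / n) * s powr (1 - 1 / n)"

text \<open>The isoperimetric inequality for a finite enlargement. With \<open>X\<close> and
  \<open>Y\<close> the n-th roots of the volumes of \<open>A\<close> and of the ball,
  Brunn--Minkowski bounds the right-hand side below by \<open>(X + Y) ^ n\<close>. Bernoulli's
  inequality keeps the two terms \<open>X ^ n + n * X ^ (n - 1) * Y\<close>, which are the left-hand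
  side.\<close>

lemma measure_enlarge_ge:
  fixes A :: "'a::euclidean_space set"
  assumes A: "open A" "bounded A" and e: "0 < e"
  shows "measure lborel A + e * ball_perimeter DIM('a) (measure lborel A) \<le> measure lborel (mink_sum A (ball 0 e))"
proof (cases "A = {}")
  case True
  then show ?thesis by (simp add: mink_sum_def ball_perimeter_def)
next
  case False
  let ?n = "DIM('a)" and ?a = "measure lborel A" and ?w = "unit_ball_vol DIM('a)"
  define X where "X = ?a powr (1 / ?n)"
  define Y where "Y = e * ?w powr (1 / ?n)"
  have a: "0 < ?a" using measure_pos_open A False by blast
  have X: "0 < X" using a by (simp add: X_def)
  have Y: "0 \<le> Y" using e by (simp add: Y_def)
  have Xn: "X ^ ?n = ?a" using a by (simp add: X_def powr_realpow[symmetric] powr_powr)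
  have "measure lborel (ball (0::'a) e) powr (1 / ?n) = Y"
  proof -
    have "measure lborel (ball (0::'a) e) = ?w * e ^ ?n" using e content_ball[of e "0::'a"] by simp
    moreover have "(?w * e ^ ?n) powr (1 / ?n) = e * ?w powr (1 / ?n)"
      using e by (simp only: powr_realpow[symmetric] powr_powr powr_mult zero_le_power less_imp_le) simp
    ultimately show ?thesis by (simp only: Y_def)
  qed
  then have "X + Y \<le> measure lborel (mink_sum A (ball 0 e)) powr (1 / ?n)"
    using Brunn_Minkowski_open[OF A False, of "ball 0 e"] e by (simp add: X_def)
  then have "(X + Y) ^ ?n \<le> (measure lborel (mink_sum A (ball 0 e)) powr (1 / ?n)) ^ ?n"
    using X Y by (intro power_mono) auto
  also have "\<dots> = measure lborel (mink_sum A (ball 0 e))"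
    by (cases "measure lborel (mink_sum A (ball 0 e)) = 0")
      (auto simp: powr_realpow[symmetric] powr_powr zero_less_measure_iff)
  finally have up: "(X + Y) ^ ?n \<le> measure lborel (mink_sum A (ball 0 e))" .
  have "?a + e * ball_perimeter ?n ?a = X ^ ?n * (1 + ?n * (Y / X))"
  proof -
    have "?a powr (1 - 1 / ?n) = ?a / X" using a by (simp add: powr_diff X_def)
    moreover have "a + e * (n * W * (a / X)) = a * (1 + n * (e * W / X))" for a e n W :: real
      by (simp add: algebra_simps)
    ultimately show ?thesis unfolding Xn ball_perimeter_def Y_def by (simp only:)
  qed
  also have "\<dots> \<le> X ^ ?n * (1 + Y / X) ^ ?n"
    using X Y by (intro mult_left_mono Bernoulli_inequality) (auto intro: order_trans[of _ 0])
  also have "\<dots> = (X + Y) ^ ?n"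
    using X by (simp add: power_mult_distrib[symmetric] distrib_left)
  finally show ?thesis using up by simp
qed

section \<open>Test functions\<close>

lemma partial_deriv_eq: "(\<phi> has_derivative \<phi>') (at x) \<Longrightarrow> partial_deriv b \<phi> x = \<phi>' b"
  unfolding partial_deriv_def by (metis frechet_derivative_at)

lemma C_k_Suc_D: "C_k (Suc k) \<phi> \<Longrightarrow> C_k k \<phi>"
proof (induction k arbitrary: \<phi>)
  case 0
  then show ?case
    by (auto intro!: continuous_at_imp_continuous_on differentiable_imp_continuous_within)
next
  case (Suc k)
  then show ?case by (metis C_k.simps(2))
qed

lemma C_k_const: "C_k k (\<lambda>x. c)"
proof (induction k arbitrary: c)
  case (Suc k)
  have "partial_deriv b (\<lambda>x. c) = (\<lambda>x. 0)" for b :: 'a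
    by (intro ext) (simp add: partial_deriv_eq[OF has_derivative_const])
  then show ?case using Suc by simp
qed auto

lemma C_k_inner: "C_k k (\<lambda>x. x \<bullet> v)"
proof (cases k)
  case (Suc j)
  have "partial_deriv b (\<lambda>x. x \<bullet> v) = (\<lambda>x. b \<bullet> v)" for b
    by (intro ext partial_deriv_eq) (auto intro!: derivative_eq_intros)
  then show ?thesis using Suc C_k_const[of j] by (auto simp: inner_commute[of _ v] intro!: bounded_linear_imp_differentiable bounded_linear_inner_right)
qed (auto intro!: continuous_intros)

lemma C_k_add:
  assumes "C_k k f" "C_k k g"
  shows "C_k k (\<lambda>x. f x + g x)"
  using assms
proof (induction k arbitrary: f g)
  case (Suc k)
  have "partial_deriv b (\<lambda>x. f x + g x) = (\<lambda>x. partial_deriv b f x + partial_deriv b g x)" for b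
  proof
    fix x
    have "f differentiable (at x)" "g differentiable (at x)" using Suc.prems by auto
    from has_derivative_add[OF this[unfolded frechet_derivative_works]]
    show "partial_deriv b (\<lambda>x. f x + g x) x = partial_deriv b f x + partial_deriv b g x"
      by (subst partial_deriv_eq, assumption) (simp add: partial_deriv_def)
  qed
  then show ?case using Suc by simp
qed (auto intro: continuous_intros)

lemma partial_deriv_mult:
  assumes "f differentiable (at x)" "g differentiable (at x)"
  shows "partial_deriv b (\<lambda>x. f x * g x) x = partial_deriv b f x * g x + f x * partial_deriv b g x"
  using partial_deriv_eq[OF has_derivative_mult[OF assms[unfolded frechet_derivative_works]], of b]
  unfolding partial_deriv_def by (simp add: algebra_simps)

lemma C_k_mult:
  assumes "C_k k f" "C_k k g"
  shows "C_k k (\<lambda>x. f x * g x)"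
  using assms
proof (induction k arbitrary: f g)
  case (Suc k)
  have "partial_deriv b (\<lambda>x. f x * g x) = (\<lambda>x. partial_deriv b f x * g x + f x * partial_deriv b g x)" for b
    using Suc.prems by (intro ext partial_deriv_mult) auto
  then show ?case using Suc C_k_Suc_D[OF Suc.prems(1)] C_k_Suc_D[OF Suc.prems(2)]
    by (auto intro!: C_k_add)
qed (auto intro: continuous_intros)

lemma C_k_diff: "C_k k f \<Longrightarrow> C_k k g \<Longrightarrow> C_k k (\<lambda>x. f x - g x)"
  using C_k_add[of k f "\<lambda>x. (-1) * g x"] C_k_mult[OF C_k_const, of k g "-1"] by simp

lemma C_k_prod: "(\<And>i. i \<in> I \<Longrightarrow> C_k k (f i)) \<Longrightarrow> C_k k (\<lambda>x. \<Prod>i\<in>I. f i x)"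
  by (induction I rule: infinite_finite_induct) (auto intro: C_k_const C_k_mult)

text \<open>Any compact set outside of which \<open>\<phi>\<close> vanishes may stand in for the
  closure of the support, so products and derivatives are handled without computing
  supports.\<close>

lemma test_functionI:
  assumes "\<And>k. C_k k \<phi>" "compact K" "K \<subseteq> D" "\<And>x. x \<notin> K \<Longrightarrow> \<phi> x = 0"
  shows "test_function D \<phi>"
proof -
  have "{x. \<phi> x \<noteq> 0} \<subseteq> K" using assms by auto
  then have "closure {x. \<phi> x \<noteq> 0} \<subseteq> K" using assms compact_imp_closed closure_minimal by blast
  then show ?thesis unfolding test_function_def
    using assms by (meson closed_closure compact_closure bounded_subset compact_imp_bounded order_trans closure_subset)
qed

lemma test_functionE:
  assumes "test_function D \<phi>"
  obtains K where "compact K" "K \<subseteq> D" "\<And>x. x \<notin> K \<Longrightarrow> \<phi> x = 0"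
  using assms closure_subset unfolding test_function_def by (metis (mono_tags, lifting) mem_Collect_eq subsetD)

lemma test_function_mult: "test_function D \<phi> \<Longrightarrow> (\<And>k. C_k k f) \<Longrightarrow> test_function D (\<lambda>x. f x * \<phi> x)"
proof -
  assume \<phi>: "test_function D \<phi>" and f: "\<And>k. C_k k f"
  obtain K where "compact K" "K \<subseteq> D" "\<And>x. x \<notin> K \<Longrightarrow> \<phi> x = 0" using test_functionE[OF \<phi>] by metis
  then show ?thesis
    using \<phi> f by (intro test_functionI[of _ K]) (auto simp: test_function_def intro!: C_k_mult)
qed

lemma test_function_mono: "test_function D \<phi> \<Longrightarrow> D \<subseteq> E \<Longrightarrow> test_function E \<phi>"
  by (auto simp: test_function_def)

section \<open>Smooth bump functions\<close>

text \<open>The functions \<open>p(1/t) exp(-\<epsilon>/t)\<close>, extended by 0, form a family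
  closed under differentiation; carrying the polynomial along turns smoothness into an induction.
  The parameter \<open>\<epsilon>\<close> is what later drives the bumps to indicators.\<close>

definition flat_exp :: "real \<Rightarrow> real poly \<Rightarrow> real \<Rightarrow> real" where
  "flat_exp \<epsilon> p t = (if t > 0 then poly p (1 / t) * exp (- \<epsilon> / t) else 0)"

lemma poly_exp_tendsto_0:
  assumes "0 < (\<epsilon>::real)"
  shows "((\<lambda>y. poly q y * exp (- \<epsilon> * y)) \<longlongrightarrow> 0) at_top"
proof -
  have mono: "((\<lambda>y. coeff q i * y ^ i * exp (- \<epsilon> * y)) \<longlongrightarrow> 0) at_top" for i
  proof -
    have "filterlim (\<lambda>y. \<epsilon> * y) at_top at_top"
      using assms by (rule filterlim_tendsto_pos_mult_at_top[OF tendsto_const _ filterlim_ident])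
    from filterlim_compose[OF tendsto_power_div_exp_0[of i] this]
    have "((\<lambda>y. coeff q i / \<epsilon> ^ i * ((\<epsilon> * y) ^ i / exp (\<epsilon> * y))) \<longlongrightarrow> coeff q i / \<epsilon> ^ i * 0) at_top"
      by (intro tendsto_intros)
    moreover have "coeff q i / \<epsilon> ^ i * ((\<epsilon> * y) ^ i / exp (\<epsilon> * y)) = coeff q i * y ^ i * exp (- \<epsilon> * y)" for y
      using assms by (simp add: power_mult_distrib exp_minus divide_inverse)
    ultimately show ?thesis by simp
  qed
  have "((\<lambda>y. \<Sum>i\<le>degree q. coeff q i * y ^ i * exp (- \<epsilon> * y)) \<longlongrightarrow> (\<Sum>i\<le>degree q. 0)) at_top"
    by (intro tendsto_sum mono)
  then show ?thesis by (simp add: poly_altdef sum_distrib_right)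
qed

text \<open>With \<open>y = 1/t\<close> one has \<open>dy/dt = - y^2\<close>, so \<open>p\<close>
  turns into \<open>y^2 * (\<epsilon> p - p')\<close>; the two leading \<open>pCons 0\<close> are
  the factor \<open>y^2\<close>.\<close>

lemma flat_exp_has_derivative:
  assumes e: "0 < \<epsilon>"
  shows "(flat_exp \<epsilon> p has_real_derivative flat_exp \<epsilon> (pCons 0 (pCons 0 (smult \<epsilon> p - pderiv p))) t) (at t)"
proof -
  let ?p' = "pCons 0 (pCons 0 (smult \<epsilon> p - pderiv p))"
  consider "t > 0" | "t < 0" | "t = 0" by linarith
  then show ?thesis
  proof cases
    case 1
    have "((\<lambda>t. poly p (1 / t) * exp (- \<epsilon> / t)) has_real_derivative
        poly (pderiv p) (1 / t) * (- 1 / t\<^sup>2) * exp (- \<epsilon> / t) + poly p (1 / t) * (exp (- \<epsilon> / t) * (\<epsilon> / t\<^sup>2))) (at t)"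
      using 1 by (auto intro!: derivative_eq_intros DERIV_chain2[OF poly_DERIV] simp: power2_eq_square)
    also have "poly (pderiv p) (1 / t) * (- 1 / t\<^sup>2) * exp (- \<epsilon> / t) + poly p (1 / t) * (exp (- \<epsilon> / t) * (\<epsilon> / t\<^sup>2))
        = flat_exp \<epsilon> ?p' t"
      using 1 by (simp add: flat_exp_def power2_eq_square algebra_simps divide_simps)
    finally show ?thesis
      by (rule DERIV_cong_ev[THEN iffD1, rotated -1])
        (use eventually_nhds_in_open[of "{0<..}" t] 1 in \<open>auto simp: flat_exp_def elim!: eventually_mono\<close>)
  next
    case 2
    have "((\<lambda>t. 0) has_real_derivative 0) (at t)" by simp
    then show ?thesis
      by (rule DERIV_cong_ev[THEN iffD1, rotated -1])
        (use eventually_nhds_in_open[of "{..<0}" t] 2 in \<open>auto simp: flat_exp_def elim!: eventually_mono\<close>)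
  next
    case 3
    \<comment> \<open>At the origin the right-hand difference quotient is again a polynomial times
      an exponential in \<open>1/h\<close>, with \<open>pCons 0 p\<close> absorbing the division by
      \<open>h\<close>.\<close>
    have "((\<lambda>h. flat_exp \<epsilon> p h / h) \<longlongrightarrow> 0) (at_right 0)"
    proof -
      have "((\<lambda>h. poly (pCons 0 p) (inverse h) * exp (- \<epsilon> * inverse h)) \<longlongrightarrow> 0) (at_right 0)"
        using filterlim_compose[OF poly_exp_tendsto_0[OF e] filterlim_inverse_at_top_right] .
      moreover have "\<forall>\<^sub>F h in at_right 0. poly (pCons 0 p) (inverse h) * exp (- \<epsilon> * inverse h) = flat_exp \<epsilon> p h / h"
        using eventually_at_right_less[of 0] by eventually_elim (simp add: flat_exp_def field_simps)
      ultimately show ?thesis by (rule Lim_transform_eventually)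
    qed
    moreover have "((\<lambda>h. flat_exp \<epsilon> p h / h) \<longlongrightarrow> 0) (at_left 0)"
      by (rule tendsto_eventually) (auto simp: flat_exp_def eventually_at_filter)
    ultimately show ?thesis using 3 unfolding has_field_derivative_iff
      by (simp add: filterlim_at_split flat_exp_def)
  qed
qed

text \<open>Induction over the order with the polynomial left arbitrary, since differentiation along
  \<open>b\<close> replaces \<open>p\<close> by another polynomial and multiplies by the constant
  \<open>b \<bullet> v\<close>.\<close>

lemma C_k_flat_exp_inner:
  assumes e: "0 < \<epsilon>"
  shows "C_k k (\<lambda>x. flat_exp \<epsilon> p (x \<bullet> v - a))"
proof (induction k arbitrary: p)
  have der: "((\<lambda>x. flat_exp \<epsilon> p (x \<bullet> v - a)) has_derivative
      (\<lambda>h. flat_exp \<epsilon> (pCons 0 (pCons 0 (smult \<epsilon> p - pderiv p))) (x \<bullet> v - a) * (h \<bullet> v))) (at x)" for p x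
    by (rule has_derivative_compose[OF _ flat_exp_has_derivative[OF e, unfolded has_field_derivative_def]])
       (auto intro!: derivative_eq_intros)
  {
    case 0
    show ?case using der by (auto intro!: continuous_at_imp_continuous_on has_derivative_continuous)
  next
    case (Suc k)
    have "partial_deriv b (\<lambda>x. flat_exp \<epsilon> p (x \<bullet> v - a)) =
       (\<lambda>x. flat_exp \<epsilon> (pCons 0 (pCons 0 (smult \<epsilon> p - pderiv p))) (x \<bullet> v - a) * (b \<bullet> v))" for b
      by (intro ext partial_deriv_eq der)
    then show ?case using der Suc by (auto simp: differentiable_def intro!: C_k_mult C_k_const)
  }
qed

text \<open>On the box it equals \<open>exp (- \<epsilon> * S)\<close> with \<open>S\<close> the sum
  of the reciprocal distances to the faces. Hence it tends to the indicator of the open box as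
  \<open>\<epsilon>\<close> tends to 0.\<close>

definition box_bump :: "real \<Rightarrow> 'a::euclidean_space \<Rightarrow> 'a \<Rightarrow> 'a \<Rightarrow> real" where
  "box_bump \<epsilon> a c x = (\<Prod>b\<in>Basis. flat_exp \<epsilon> 1 (x \<bullet> b - a \<bullet> b) * flat_exp \<epsilon> 1 (x \<bullet> (- b) - (- (c \<bullet> b))))"

lemma C_k_box_bump: "0 < \<epsilon> \<Longrightarrow> C_k k (box_bump \<epsilon> a c)"
  unfolding box_bump_def[abs_def] by (intro C_k_prod C_k_mult C_k_flat_exp_inner)

lemma box_bump_le_1: "0 < \<epsilon> \<Longrightarrow> 0 \<le> box_bump \<epsilon> a c x \<and> box_bump \<epsilon> a c x \<le> 1"
  unfolding box_bump_def
  by (intro conjI prod_nonneg prod_le_1) (auto simp: flat_exp_def intro!: mult_le_one)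

lemma box_bump_eq_0: "x \<notin> box a c \<Longrightarrow> box_bump \<epsilon> a c x = 0"
  by (auto simp: box_bump_def mem_box flat_exp_def)

lemma box_bump_tendsto: "(\<lambda>j. box_bump (inverse (Suc j)) a c x) \<longlonglongrightarrow> indicator (box a c) x"
proof (cases "x \<in> box a c")
  case True
  have lim: "(\<lambda>j. flat_exp (inverse (Suc j)) 1 t) \<longlonglongrightarrow> 1" if "0 < t" for t
  proof -
    have "(\<lambda>j. exp (- inverse (real (Suc j)) / t)) \<longlonglongrightarrow> exp (- 0 / t)"
      by (intro tendsto_intros LIMSEQ_inverse_real_of_nat) (use that in auto)
    moreover have "flat_exp (inverse (Suc j)) 1 t = exp (- inverse (real (Suc j)) / t)" for j
      using that unfolding flat_exp_def by simp
    ultimately show ?thesis by (simp only: minus_zero div_0 exp_zero)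
  qed
  have "(\<lambda>j. box_bump (inverse (Suc j)) a c x) \<longlonglongrightarrow> (\<Prod>b\<in>(Basis::'a set). 1 * 1)"
    unfolding box_bump_def
  proof (rule tendsto_prod)
    fix b :: 'a assume b: "b \<in> Basis"
    have "0 < x \<bullet> b - a \<bullet> b" "0 < x \<bullet> (- b) - (- (c \<bullet> b))" using True b by (auto simp: mem_box)
    from tendsto_mult[OF lim[OF this(1)] lim[OF this(2)]]
    show "(\<lambda>j. flat_exp (inverse (Suc j)) 1 (x \<bullet> b - a \<bullet> b) * flat_exp (inverse (Suc j)) 1 (x \<bullet> (- b) - (- (c \<bullet> b)))) \<longlonglongrightarrow> 1 * 1" .
  qed
  moreover have eq: "(\<Prod>b\<in>(Basis::'a set). 1 * 1) = (indicator (box a c) x :: real)"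
    unfolding indicator_simps(1)[OF True] by simp
  ultimately show ?thesis by (simp only: eq)
qed (simp add: box_bump_eq_0)

lemma test_function_C_k: "test_function D \<phi> \<Longrightarrow> C_k k \<phi>"
  by (simp add: test_function_def)

lemma test_function_continuous: "test_function D \<phi> \<Longrightarrow> continuous_on UNIV \<phi>"
  using test_function_C_k[of D \<phi> 0] by simp

lemma integral_lebesgue_on_support:
  fixes g :: "'a::euclidean_space \<Rightarrow> 'b::{banach, second_countable_topology}"
  assumes "D \<in> sets lebesgue" "\<And>x. x \<notin> D \<Longrightarrow> g x = 0"
  shows "(LINT x|lebesgue_on D. g x) = (LINT x|lebesgue. g x)"
  using assms by (subst integral_restrict_space) (auto intro!: Bochner_Integration.integral_cong simp: indicator_def)

lemma box_neighbourhood: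
  fixes x :: "'a::euclidean_space"
  assumes "open U" "x \<in> U"
  obtains a c where "x \<in> box a c" "cbox a c \<subseteq> U"
proof -
  obtain e where e: "e > 0" "ball x e \<subseteq> U" using assms openE by blast
  obtain a c where ac: "x \<in> box a c" "box a c \<subseteq> ball x (e/2)"
    using rational_boxes[of "e/2" x] e by auto
  have "cbox a c = closure (box a c)" using ac by (intro closure_box[symmetric]) auto
  also have "\<dots> \<subseteq> cball x (e/2)" using ac closure_minimal[of "box a c" "cball x (e/2)"] ball_subset_cball by blast
  also have "\<dots> \<subseteq> U" using e by (intro order_trans[OF _ e(2)]) (simp add: cball_subset_ball_iff)
  finally show ?thesis using ac that by blast
qed

text \<open>Smooth form of the indicator of a union: one minus the product of
  \<open>1 - bump\<close> over finitely many boxes covering \<open>K\<close>. The limit is the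
  indicator of the open set \<open>W\<close> formed by these boxes, which lies between
  \<open>K\<close> and \<open>U\<close>; the compact set \<open>L\<close> carries all the
  approximants.\<close>

lemma test_function_approx_indicator:
  fixes K :: "'a::euclidean_space set"
  assumes K: "compact K" and U: "open U" "K \<subseteq> U"
  obtains W L \<psi> where "open W" "K \<subseteq> W" "compact L" "W \<subseteq> L" "L \<subseteq> U"
    "\<And>j::nat. test_function U (\<psi> j)" "\<And>j x. 0 \<le> \<psi> j x" "\<And>j x. \<psi> j x \<le> 1" "\<And>j x. x \<notin> L \<Longrightarrow> \<psi> j x = 0"
    "\<And>x. (\<lambda>j. \<psi> j x) \<longlonglongrightarrow> indicator W x"
proof -
  let ?C = "{(a, c). cbox a c \<subseteq> U}" and ?f = "\<lambda>i. box (fst i) (snd i) :: 'a set"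
  have "K \<subseteq> (\<Union>i\<in>?C. ?f i)"
  proof
    fix x assume "x \<in> K"
    then obtain a c where "x \<in> box a c" "cbox a c \<subseteq> U" using box_neighbourhood[OF U(1)] U(2) by blast
    then show "x \<in> (\<Union>i\<in>?C. ?f i)" by (intro UN_I[of "(a, c)"]) auto
  qed
  then obtain I where I: "I \<subseteq> ?C" "finite I" "K \<subseteq> (\<Union>i\<in>I. ?f i)"
    using compactE_image[OF K, of ?C ?f] by (auto simp: open_box)
  define W where "W = (\<Union>i\<in>I. ?f i)"
  define L where "L = (\<Union>i\<in>I. cbox (fst i) (snd i))"
  let ?b = "\<lambda>j i. box_bump (inverse (real (Suc j))) (fst i) (snd i)"
  define \<psi> where "\<psi> j x = 1 - (\<Prod>i\<in>I. 1 - ?b j i x)" for j x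
  have pos: "0 < inverse (real (Suc j))" for j by simp
  have W: "open W" by (auto simp: W_def open_box)
  have L: "compact L" using I by (auto simp: L_def)
  have WL: "W \<subseteq> L" unfolding W_def L_def by (intro UN_mono) (auto simp: box_subset_cbox)
  have "cbox (fst i) (snd i) \<subseteq> U" if "i \<in> I" for i using that I(1) by (cases i) auto
  then have LU: "L \<subseteq> U" by (auto simp: L_def)
  have b01: "0 \<le> 1 - ?b j i x \<and> 1 - ?b j i x \<le> 1" for j i x
    using box_bump_le_1[OF pos, of j "fst i" "snd i" x] by linarith
  have p01: "0 \<le> (\<Prod>i\<in>I. 1 - ?b j i x) \<and> (\<Prod>i\<in>I. 1 - ?b j i x) \<le> 1" for x j
    using b01 by (intro conjI prod_nonneg prod_le_1) blast+
  have z: "\<psi> j x = 0" if nx: "x \<notin> L" for j x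
  proof -
    have "?b j i x = 0" if "i \<in> I" for i
      using nx that WL by (intro box_bump_eq_0) (auto simp: W_def)
    then show ?thesis by (simp add: \<psi>_def)
  qed
  have Ck: "C_k k (\<psi> j)" for j k
    unfolding \<psi>_def[abs_def] by (intro C_k_diff C_k_const C_k_prod C_k_box_bump pos)
  have lim: "(\<lambda>j. \<psi> j x) \<longlonglongrightarrow> indicator W x" for x
  proof -
    have "(\<lambda>j. \<psi> j x) \<longlonglongrightarrow> 1 - (\<Prod>i\<in>I. 1 - indicator (?f i) x)"
      unfolding \<psi>_def by (intro tendsto_intros box_bump_tendsto)
    moreover have "1 - (\<Prod>i\<in>I. 1 - indicator (?f i) x) = (indicator W x :: real)"
    proof (cases "x \<in> W")
      case True
      then obtain i where "i \<in> I" "x \<in> ?f i" by (auto simp: W_def)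
      then have "(\<Prod>i\<in>I. 1 - indicator (?f i) x) = (0::real)" using I(2) by (intro prod_zero) (auto intro!: bexI[of _ i])
      then show ?thesis using True by simp
    next
      case False
      then have "(\<Prod>i\<in>I. 1 - indicator (?f i) x) = (1::real)" by (intro prod.neutral) (auto simp: W_def)
      then show ?thesis using False by simp
    qed
    ultimately show ?thesis by simp
  qed
  show ?thesis
  proof (rule that[OF W _ L WL LU _ _ _ z lim])
    show "K \<subseteq> W" using I by (simp add: W_def)
    show "test_function U (\<psi> j)" for j using Ck L LU z by (rule test_functionI)
    show "0 \<le> \<psi> j x" for j x unfolding \<psi>_def using p01[of j x] by linarith
    show "\<psi> j x \<le> 1" for j x unfolding \<psi>_def using p01[of j x] by linarith
  qed
qed

section \<open>The fundamental lemma of the calculus of variations\<close>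

text \<open>Two limits: test functions converge to the indicator of an open set around
  \<open>K\<close>, and these open sets then shrink to \<open>K\<close>. Dominated convergence uses
  one integrable majorant for both, namely \<open>\<bar>G\<bar>\<close> on the compact set
  \<open>L0\<close>.\<close>

lemma test_integral_nonneg_imp_compact_integral_nonneg:
  fixes G :: "'a::euclidean_space \<Rightarrow> real"
  assumes D: "open D" and G: "\<And>K. compact K \<Longrightarrow> K \<subseteq> D \<Longrightarrow> G absolutely_integrable_on K"
    and nn: "\<And>\<psi>. test_function D \<psi> \<Longrightarrow> (\<And>x. 0 \<le> \<psi> x) \<Longrightarrow> 0 \<le> (LINT x|lebesgue_on D. G x * \<psi> x)"
    and K: "compact K" "K \<subseteq> D"
  shows "0 \<le> (LINT x:K|lebesgue. G x)"
proof -
  obtain W0 L0 where W0: "open W0" "K \<subseteq> W0" "compact L0" "W0 \<subseteq> L0" "L0 \<subseteq> D"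
    using test_function_approx_indicator[OF K(1) D K(2)] by metis
  \<comment> \<open>The intersection with \<open>W0\<close> keeps all supports in \<open>L0\<close>;
    the union of balls makes the neighbourhoods shrink to the closed set \<open>K\<close>.\<close>
  define U where "U m = W0 \<inter> (\<Union>x\<in>K. ball x (inverse (real (Suc m))))" for m
  have U: "open (U m)" "K \<subseteq> U m" for m using W0 by (auto simp: U_def)
  have Dm: "D \<in> sets lebesgue" using D by simp
  have intL: "integrable lebesgue (\<lambda>x. indicator L0 x * \<bar>G x\<bar>)"
    using integrable_abs[OF G[OF W0(3,5), unfolded set_integrable_def]] by (simp add: abs_mult)
  have GL: "(\<lambda>x. indicator L0 x * G x) \<in> borel_measurable lebesgue"
    using G[OF W0(3,5)] unfolding set_integrable_def by auto
  have "\<exists>W. open W \<and> K \<subseteq> W \<and> W \<subseteq> U m \<and> 0 \<le> (LINT x|lebesgue. indicator W x * G x)" for m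
  proof -
    obtain W L \<psi> where W: "open W" "K \<subseteq> W" "compact L" "W \<subseteq> L" "L \<subseteq> U m"
      and \<psi>: "\<And>j::nat. test_function (U m) (\<psi> j)" "\<And>j x. 0 \<le> \<psi> j x" "\<And>j x. \<psi> j x \<le> 1" "\<And>j x. x \<notin> L \<Longrightarrow> \<psi> j x = 0"
        "\<And>x. (\<lambda>j. \<psi> j x) \<longlonglongrightarrow> indicator W x"
      by (rule test_function_approx_indicator[OF K(1) U(1)[of m] U(2)[of m]]) (rule that)
    have LL0: "L \<subseteq> L0" using W W0 by (auto simp: U_def)
    have z0: "\<psi> j x = 0" if "x \<notin> L0" for j x using \<psi>(4) LL0 that by blast
    have cont: "continuous_on UNIV (\<psi> j)" for j using \<psi>(1) by (rule test_function_continuous)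
    have lim: "(\<lambda>j. LINT x|lebesgue. G x * \<psi> j x) \<longlonglongrightarrow> (LINT x|lebesgue. indicator W x * G x)"
    proof (rule integral_dominated_convergence[OF _ _ intL])
      have "(\<lambda>x. (indicator L0 x * G x) * \<psi> j x) \<in> borel_measurable lebesgue" for j
        using borel_measurable_continuous_onI[OF cont[of j]] by (intro borel_measurable_times GL) (simp add: measurable_completion)
      moreover have "(\<lambda>x. (indicator L0 x * G x) * \<psi> j x) = (\<lambda>x. G x * \<psi> j x)" for j
      proof
        show "(indicator L0 x * G x) * \<psi> j x = G x * \<psi> j x" for x
          by (cases "x \<in> L0") (auto simp: z0)
      qed
      ultimately show "(\<lambda>x. G x * \<psi> j x) \<in> borel_measurable lebesgue" for j by (simp only:)
      have "(\<lambda>x. indicator W x * (indicator L0 x * G x)) = (\<lambda>x. indicator W x * G x)"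
        using W LL0 by (intro ext) (auto simp: indicator_def)
      moreover have "(\<lambda>x. indicator W x * (indicator L0 x * G x)) \<in> borel_measurable lebesgue"
        using W(1) by (intro borel_measurable_times GL borel_measurable_indicator) auto
      ultimately show "(\<lambda>x. indicator W x * G x) \<in> borel_measurable lebesgue" by (simp only:)
      show "AE x in lebesgue. (\<lambda>j. G x * \<psi> j x) \<longlonglongrightarrow> indicator W x * G x"
        by (intro AE_I2) (subst mult.commute, intro tendsto_mult \<psi>(5) tendsto_const)
      show "AE x in lebesgue. norm (G x * \<psi> j x) \<le> indicator L0 x * \<bar>G x\<bar>" for j
        using \<psi>(2,3) z0 by (intro AE_I2) (auto simp: indicator_def abs_mult mult_left_le)
    qed
    have "0 \<le> (LINT x|lebesgue. indicator W x * G x)"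
    proof (rule LIMSEQ_le_const[OF lim], intro exI allI impI)
      fix j
      have tD: "test_function D (\<psi> j)" by (rule test_function_mono[OF \<psi>(1)]) (use W0 in \<open>auto simp: U_def\<close>)
      have "(LINT x|lebesgue_on D. G x * \<psi> j x) = (LINT x|lebesgue. G x * \<psi> j x)"
      proof (intro integral_lebesgue_on_support Dm)
        fix x assume "x \<notin> D"
        then have "x \<notin> L0" using W0 by blast
        then show "G x * \<psi> j x = 0" by (simp add: z0)
      qed
      with nn[OF tD \<psi>(2)] show "0 \<le> (LINT x|lebesgue. G x * \<psi> j x)" by simp
    qed
    then show ?thesis using W by (auto intro: order_trans)
  qed
  then obtain W where "\<And>m. open (W m) \<and> K \<subseteq> W m \<and> W m \<subseteq> U m \<and> 0 \<le> (LINT x|lebesgue. indicator (W m) x * G x)"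
    by metis
  then have W: "\<And>m. open (W m)" "\<And>m. K \<subseteq> W m" "\<And>m. W m \<subseteq> U m" "\<And>m. 0 \<le> (LINT x|lebesgue. indicator (W m) x * G x)"
    by blast+
  have lim: "(\<lambda>m. LINT x|lebesgue. indicator (W m) x * G x) \<longlonglongrightarrow> (LINT x|lebesgue. indicator K x * G x)"
  proof (rule integral_dominated_convergence[OF _ _ intL])
    have sub: "W m \<subseteq> L0" for m using W(3)[of m] W0 by (auto simp: U_def)
    have meas: "(\<lambda>x. indicator S x * (indicator L0 x * G x)) \<in> borel_measurable lebesgue" if "S \<in> sets borel" for S
      using that by (intro borel_measurable_times GL borel_measurable_indicator) auto
    have eq: "indicator S x * (indicator L0 x * G x) = indicator S x * G x" if "S \<subseteq> L0" for S x
      using that by (auto simp: indicator_def)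
    show "(\<lambda>x. indicator (W m) x * G x) \<in> borel_measurable lebesgue" for m
      using meas[of "W m"] W(1)[of m] sub[of m] by (simp add: eq)
    have "K \<subseteq> L0" using W0 by auto
    then show "(\<lambda>x. indicator K x * G x) \<in> borel_measurable lebesgue"
      using meas[of K] K(1) by (simp add: eq borel_compact)
    show "AE x in lebesgue. norm (indicator (W m) x * G x) \<le> indicator L0 x * \<bar>G x\<bar>" for m
      using sub[of m] by (intro AE_I2) (auto simp: indicator_def)
    show "AE x in lebesgue. (\<lambda>m. indicator (W m) x * G x) \<longlonglongrightarrow> indicator K x * G x"
    proof (intro AE_I2 tendsto_mult tendsto_const)
      fix x
      show "(\<lambda>m. indicator (W m) x) \<longlonglongrightarrow> (indicator K x :: real)"
      proof (cases "x \<in> K")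
        case True
        then show ?thesis using W(2) by (auto simp: indicator_def subset_iff)
      next
        case False
        have "closed K" using K compact_imp_closed by blast
        then have "open (- K)" "x \<in> - K" using False by (auto simp: open_Compl)
        then obtain e where "e > 0" "ball x e \<subseteq> - K" by (rule openE)
        then have e: "e > 0" "ball x e \<inter> K = {}" by auto
        have "\<forall>\<^sub>F m in sequentially. inverse (real (Suc m)) < e"
          using order_tendstoD(2)[OF LIMSEQ_inverse_real_of_nat e(1)] .
        then have "\<forall>\<^sub>F m in sequentially. indicator (W m) x = (indicator K x :: real)"
        proof eventually_elim
          case (elim m)
          have "x \<notin> U m" using e elim by (auto simp: U_def disjoint_iff dist_commute)
          then show ?case using False W(3)[of m] by (auto simp: indicator_def)
        qed
        then show ?thesis by (rule tendsto_eventually)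
      qed
    qed
  qed
  have "0 \<le> (LINT x|lebesgue. indicator K x * G x)"
    using W(4) by (intro LIMSEQ_le_const[OF lim]) auto
  then show ?thesis by (simp add: set_lebesgue_integral_def)
qed

text \<open>The part of a compact set where \<open>G\<close> is negative is, up to a null set, a
  countable union of compact sets. On each of these the integral of \<open>G\<close> is at least 0
  by the preceding lemma although \<open>G\<close> is negative there, so each is null.\<close>

lemma AE_nonneg_if_test_integral_nonneg:
  fixes G :: "'a::euclidean_space \<Rightarrow> real"
  assumes D: "open D" and G: "\<And>K. compact K \<Longrightarrow> K \<subseteq> D \<Longrightarrow> G absolutely_integrable_on K"
    and nn: "\<And>\<psi>. test_function D \<psi> \<Longrightarrow> (\<And>x. 0 \<le> \<psi> x) \<Longrightarrow> 0 \<le> (LINT x|lebesgue_on D. G x * \<psi> x)"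
  shows "AE x in lebesgue_on D. 0 \<le> G x"
proof -
  have ae: "AE x in lebesgue. x \<in> K \<longrightarrow> 0 \<le> G x" if K: "compact K" "K \<subseteq> D" for K
  proof -
    have int: "integrable lebesgue (\<lambda>x. indicator K x * G x)"
      using G[OF K] by (simp add: set_integrable_def)
    define S where "S = {x \<in> space lebesgue. indicator K x * G x < 0}"
    have S: "S \<in> sets lebesgue" using borel_measurable_integrable[OF int] unfolding S_def by measurable
    have Sneg: "x \<in> K \<and> G x < 0" if "x \<in> S" for x
      using that by (cases "x \<in> K") (auto simp: S_def)
    then have SK: "S \<subseteq> K" by auto
    obtain C T where CT: "fsigma C" "T \<in> null_sets lebesgue" "C \<union> T = S" "disjnt C T"
      using lebesgue_set_almost_fsigma[OF S] .
    obtain F :: "nat \<Rightarrow> 'a set" where "range F \<subseteq> Collect compact" "C = (\<Union>n. F n)"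
      using fsigma_Union_compact[THEN iffD1, OF CT(1)] by blast
    then have F: "\<And>n. compact (F n)" "C = (\<Union>n. F n)" by auto
    have null: "F n \<in> null_sets lebesgue" for n
    proof -
      have FK: "F n \<subseteq> S" "F n \<subseteq> D" using F CT SK K by blast+
      have int': "integrable lebesgue (\<lambda>x. - (indicator (F n) x * G x))"
        using G[OF F(1) FK(2)] by (simp add: set_integrable_def)
      have neg: "0 \<le> - (indicator (F n) x * G x)" for x
        using FK(1) Sneg[of x] by (cases "x \<in> F n") auto
      have "0 \<le> (LINT x:F n|lebesgue. G x)"
        by (rule test_integral_nonneg_imp_compact_integral_nonneg[OF D G nn F(1) FK(2)])
      then have "(LINT x|lebesgue. - (indicator (F n) x * G x)) \<le> 0" by (simp add: set_lebesgue_integral_def)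
      moreover have "0 \<le> (LINT x|lebesgue. - (indicator (F n) x * G x))" using neg by (intro integral_nonneg_AE AE_I2)
      ultimately have "AE x in lebesgue. - (indicator (F n) x * G x) = 0"
        using integral_nonneg_eq_0_iff_AE[OF int'] neg by simp
      then have "AE x in lebesgue. x \<notin> F n"
      proof eventually_elim
        case (elim x)
        then show ?case using FK(1) Sneg[of x] by (cases "x \<in> F n") auto
      qed
      then show ?thesis using F(1)[of n] by (auto simp: AE_iff_null_sets lmeasurable_compact fmeasurableD)
    qed
    have "S \<in> null_sets lebesgue" using CT F null by (auto intro!: null_sets.Un)
    then have "AE x in lebesgue. x \<notin> S" by (rule AE_not_in)
    then show ?thesis by eventually_elim (auto simp: S_def indicator_def)
  qed
  obtain F :: "nat \<Rightarrow> 'a set" where F: "\<And>n. compact (F n)" "D = (\<Union>n. F n)"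
    using open_Union_compact_subsets[OF D] by metis
  have "AE x in lebesgue. \<forall>n. x \<in> F n \<longrightarrow> 0 \<le> G x"
    using F by (intro AE_all_countable[THEN iffD2] allI ae) auto
  then have "AE x in lebesgue. x \<in> D \<longrightarrow> 0 \<le> G x" by eventually_elim (use F in auto)
  then show ?thesis using D by (subst AE_restrict_space_iff) auto
qed

lemma AE_zero_if_test_integral_zero:
  fixes G :: "'a::euclidean_space \<Rightarrow> real"
  assumes D: "open D" and G: "\<And>K. compact K \<Longrightarrow> K \<subseteq> D \<Longrightarrow> G absolutely_integrable_on K"
    and z: "\<And>\<psi>. test_function D \<psi> \<Longrightarrow> (LINT x|lebesgue_on D. G x * \<psi> x) = 0"
  shows "AE x in lebesgue_on D. G x = 0"
proof -
  have "AE x in lebesgue_on D. 0 \<le> G x"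
    using z by (intro AE_nonneg_if_test_integral_nonneg D G) simp_all
  moreover have "AE x in lebesgue_on D. 0 \<le> - G x"
  proof (intro AE_nonneg_if_test_integral_nonneg D)
    show "(\<lambda>x. - G x) absolutely_integrable_on K" if "compact K" "K \<subseteq> D" for K
      using G[OF that] unfolding set_integrable_def scaleR_minus_right by (rule integrable_minus)
    show "0 \<le> (LINT x|lebesgue_on D. - G x * \<psi> x)" if "test_function D \<psi>" for \<psi>
      using z[OF that] by simp
  qed
  ultimately show ?thesis by eventually_elim simp
qed

section \<open>Weak gradients\<close>

lemma
  fixes f :: "'a::euclidean_space \<Rightarrow> 'b::{banach, second_countable_topology}"
  shows lborel_integrable_translation: "integrable lborel f \<Longrightarrow> integrable lborel (\<lambda>x. f (c + x))"
    and lborel_integral_translation: "f \<in> borel_measurable borel \<Longrightarrow> (LINT x|lborel. f (c + x)) = (LINT x|lborel. f x)"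
proof -
  show "integrable lborel (\<lambda>x. f (c + x))" if "integrable lborel f"
    using that integrable_distr[of "(+) c" lborel borel f] by (simp add: lborel_distr_plus)
  show "(LINT x|lborel. f (c + x)) = (LINT x|lborel. f x)" if "f \<in> borel_measurable borel"
    using that integral_distr[of "(+) c" lborel borel f] by (simp add: lborel_distr_plus)
qed

text \<open>Averaging \<open>Dv\<close> over translations by \<open>t *\<^sub>R b\<close>, \<open>0 \<le> t \<le> 1\<close>, turns its integral into that of
  \<open>F (b + x) - F x\<close>.\<close>

lemma integral_directional_derivative_eq_0:
  fixes F Dv :: "'a::euclidean_space \<Rightarrow> real" and b :: 'a
  assumes F: "integrable lborel F" and Dv: "integrable lborel Dv"
    and cont: "\<And>x. continuous_on {0..1} (\<lambda>t. F (t *\<^sub>R b + x))"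
    and fin: "\<And>x. finite (E x)"
    and der: "\<And>x t. t \<in> {0<..<1} - E x \<Longrightarrow> ((\<lambda>t. F (t *\<^sub>R b + x)) has_vector_derivative Dv (t *\<^sub>R b + x)) (at t)"
  shows "(LINT x|lborel. Dv x) = 0"
proof -
  have [measurable]: "Dv \<in> borel_measurable borel" "F \<in> borel_measurable borel"
    using borel_measurable_integrable[OF Dv] borel_measurable_integrable[OF F] by simp_all
  define f where "f t x = indicator {0..1} t * Dv (t *\<^sub>R b + x)" for t :: real and x
  have meas: "case_prod f \<in> borel_measurable (lborel \<Otimes>\<^sub>M lborel)"
    unfolding f_def by measurable
  have nf: "(LINT x|lborel. \<bar>f t x\<bar>) = indicator {0..1} t * (LINT x|lborel. \<bar>Dv x\<bar>)" for t
    using lborel_integral_translation[of "\<lambda>x. \<bar>Dv x\<bar>" "t *\<^sub>R b"] by (simp add: f_def abs_mult)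
  have int: "integrable (lborel \<Otimes>\<^sub>M lborel) (case_prod f)"
  proof (rule lborel_pair.Fubini_integrable[OF meas])
    show "integrable lborel (\<lambda>t. LINT x|lborel. norm (case_prod f (t, x)))"
      by (simp add: nf)
    show "AE t in lborel. integrable lborel (\<lambda>x. case_prod f (t, x))"
      using lborel_integrable_translation[OF Dv] by (intro AE_I2) (simp add: f_def)
  qed
  have "AE x in lborel. integrable lborel (\<lambda>t. f t x)"
    using lborel_pair.AE_integrable_snd[OF int] .
  then have inner: "AE x in lborel. (LINT t|lborel. f t x) = F (b + x) - F x"
  proof eventually_elim
    case (elim x)
    have 1: "((\<lambda>t. f t x) has_integral (LINT t|lborel. f t x)) UNIV"
      using has_integral_integral_lborel[OF elim] .
    \<comment> \<open>This version of the fundamental theorem tolerates finitely many points without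
      derivative on each line, which admits functions with kinks along spheres.\<close>
    have "((\<lambda>t. Dv (t *\<^sub>R b + x)) has_integral (F (1 *\<^sub>R b + x) - F (0 *\<^sub>R b + x))) {0..1}"
      by (rule fundamental_theorem_of_calculus_interior_strong[OF fin _ der cont]) auto
    then have 2: "((\<lambda>t. if t \<in> {0..1} then Dv (t *\<^sub>R b + x) else 0) has_integral (F (b + x) - F x)) UNIV"
      by (subst has_integral_restrict_UNIV) simp
    have "(\<lambda>t. if t \<in> {0..1} then Dv (t *\<^sub>R b + x) else 0) = (\<lambda>t. f t x)"
      by (auto simp: f_def indicator_def)
    with 1 2 show ?case using has_integral_unique by metis
  qed
  have "(LINT x|lborel. Dv x) = (LINT t|lborel. indicator {0..1::real} t * (LINT x|lborel. Dv x))"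
    by simp
  also have "\<dots> = (LINT t|lborel. LINT x|lborel. f t x)"
    using lborel_integral_translation[of Dv] by (simp add: f_def)
  also have "\<dots> = (LINT x|lborel. LINT t|lborel. f t x)"
    using lborel_pair.Fubini_integral[OF int] by simp
  also have "\<dots> = (LINT x|lborel. F (b + x) - F x)"
    using inner by (intro integral_cong_AE) (auto simp: f_def)
  also have "\<dots> = 0"
    using lborel_integral_translation[of F b] lborel_integrable_translation[OF F, of b] F by simp
  finally show ?thesis .
qed

section \<open>Gradients of test functions and integration by parts\<close>

definition grad :: "('a::euclidean_space \<Rightarrow> real) \<Rightarrow> 'a \<Rightarrow> 'a" where
  "grad \<phi> x = (\<Sum>b\<in>Basis. partial_deriv b \<phi> x *\<^sub>R b)"

lemma grad_inner_Basis: "b \<in> Basis \<Longrightarrow> grad \<phi> x \<bullet> b = partial_deriv b \<phi> x"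
  by (simp add: grad_def)

lemma has_derivative_grad:
  assumes "\<phi> differentiable (at x)"
  shows "(\<phi> has_derivative (\<lambda>h. grad \<phi> x \<bullet> h)) (at x)"
proof -
  let ?d = "frechet_derivative \<phi> (at x)"
  have d: "(\<phi> has_derivative ?d) (at x)" using assms frechet_derivative_works by blast
  interpret bounded_linear ?d using d by (rule has_derivative_bounded_linear)
  have "?d h = grad \<phi> x \<bullet> h" for h
  proof -
    have "?d h = ?d (\<Sum>b\<in>Basis. (h \<bullet> b) *\<^sub>R b)" by (simp only: euclidean_representation)
    also have "\<dots> = (\<Sum>b\<in>Basis. (h \<bullet> b) * ?d b)" by (simp add: sum scaleR)
    also have "\<dots> = grad \<phi> x \<bullet> h"
      unfolding grad_def partial_deriv_def inner_sum_left inner_scaleR_left by (simp add: inner_commute mult.commute)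
    finally show ?thesis .
  qed
  then have "?d = (\<lambda>h. grad \<phi> x \<bullet> h)" by auto
  with d show ?thesis by simp
qed

lemma has_vector_derivative_line:
  assumes "\<phi> differentiable (at (t *\<^sub>R b + x))"
  shows "((\<lambda>t. \<phi> (t *\<^sub>R b + x)) has_vector_derivative partial_deriv b \<phi> (t *\<^sub>R b + x)) (at t)"
proof -
  have "((\<lambda>t. t *\<^sub>R b + x) has_derivative (\<lambda>h. h *\<^sub>R b)) (at t)"
    by (auto intro!: derivative_eq_intros)
  from has_derivative_compose[OF this assms[unfolded frechet_derivative_works]]
  have "((\<lambda>t. \<phi> (t *\<^sub>R b + x)) has_derivative (\<lambda>h. frechet_derivative \<phi> (at (t *\<^sub>R b + x)) (h *\<^sub>R b))) (at t)" .
  moreover have "frechet_derivative \<phi> (at (t *\<^sub>R b + x)) (h *\<^sub>R b) = h *\<^sub>R partial_deriv b \<phi> (t *\<^sub>R b + x)" for h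
    using linear_cmul[OF linear_frechet_derivative[OF assms]] by (simp add: partial_deriv_def)
  ultimately show ?thesis by (simp add: has_vector_derivative_def)
qed

lemma test_function_differentiable: "test_function D \<phi> \<Longrightarrow> \<phi> differentiable (at x)"
  using test_function_C_k[of D \<phi> "Suc 0"] by simp

lemma partial_deriv_outside_support:
  assumes K: "compact K" "\<And>x. x \<notin> K \<Longrightarrow> \<phi> x = 0" and x: "x \<notin> K"
  shows "partial_deriv b \<phi> x = 0"
proof -
  have "\<forall>\<^sub>F y in nhds x. y \<in> - K"
    using x K(1) by (intro eventually_nhds_in_open) (auto simp: compact_imp_closed open_Compl)
  then have ev: "\<forall>\<^sub>F y in nhds x. \<phi> y = 0" by eventually_elim (use K in auto)
  have "(\<phi> has_derivative (\<lambda>h. 0)) (at x)"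
    by (rule has_derivative_transform_eventually[OF has_derivative_const[of 0]])
      (use ev K(2)[OF x] in \<open>auto simp: eventually_nhds_conv_at elim: eventually_mono\<close>)
  then show ?thesis by (simp add: partial_deriv_eq)
qed

lemma test_function_partial_deriv:
  assumes \<phi>: "test_function D \<phi>" and b: "b \<in> Basis"
  shows "test_function D (partial_deriv b \<phi>)"
proof -
  obtain K where K: "compact K" "K \<subseteq> D" "\<And>x. x \<notin> K \<Longrightarrow> \<phi> x = 0" using test_functionE[OF \<phi>] by metis
  show ?thesis
  proof (rule test_functionI[OF _ K(1,2)])
    show "C_k k (partial_deriv b \<phi>)" for k
      using test_function_C_k[OF \<phi>, of "Suc k"] b by simp
    show "partial_deriv b \<phi> x = 0" if "x \<notin> K" for x
      using K that by (intro partial_deriv_outside_support)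
  qed
qed

lemma test_function_bounded:
  assumes \<phi>: "test_function D \<phi>"
  obtains C where "0 < C" "\<And>x. \<bar>\<phi> x\<bar> \<le> C"
proof -
  obtain K where K: "compact K" "K \<subseteq> D" "\<And>x. x \<notin> K \<Longrightarrow> \<phi> x = 0" using test_functionE[OF \<phi>] by metis
  have "compact (\<phi> ` K)"
    using K(1) test_function_continuous[OF \<phi>] by (intro compact_continuous_image) (auto intro: continuous_on_subset)
  then obtain C where C: "C > 0" "\<forall>y\<in>\<phi> ` K. norm y \<le> C" using compact_imp_bounded bounded_pos by metis
  have "\<bar>\<phi> x\<bar> \<le> C" for x using C K(3)[of x] by (cases "x \<in> K") auto
  then show ?thesis using C that by blast
qed

lemma integrable_lborel_compact_support:
  fixes f :: "'a::euclidean_space \<Rightarrow> 'b::{banach, second_countable_topology}"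
  assumes "compact K" "\<And>x. x \<notin> K \<Longrightarrow> f x = 0" "continuous_on UNIV f"
  shows "integrable lborel f"
proof -
  have "integrable lborel (\<lambda>x. indicator K x *\<^sub>R f x)"
    using assms by (intro borel_integrable_compact) (auto intro: continuous_on_subset)
  moreover have "(\<lambda>x. indicator K x *\<^sub>R f x) = f" using assms(2) by (auto simp: indicator_def)
  ultimately show ?thesis by simp
qed

lemma test_function_integrable:
  assumes \<phi>: "test_function D \<phi>" and f: "continuous_on UNIV f"
  shows "integrable lborel (\<lambda>x. f x * \<phi> x :: real)"
proof -
  obtain K where K: "compact K" "K \<subseteq> D" "\<And>x. x \<notin> K \<Longrightarrow> \<phi> x = 0" using test_functionE[OF \<phi>] by metis
  show ?thesis
    by (rule integrable_lborel_compact_support[OF K(1)])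
      (use K(3) f test_function_continuous[OF \<phi>] in \<open>auto intro!: continuous_intros\<close>)
qed

lemma test_function_measurable: "test_function D \<phi> \<Longrightarrow> \<phi> \<in> borel_measurable borel"
  by (intro borel_measurable_continuous_onI test_function_continuous)

lemma integral_lebesgue_on_test:
  fixes g :: "'a::euclidean_space \<Rightarrow> real"
  assumes "D \<in> sets lebesgue" "test_function D \<psi>" "g \<in> borel_measurable borel"
  shows "(LINT x|lebesgue_on D. g x * \<psi> x) = (LINT x|lborel. g x * \<psi> x)"
proof -
  obtain K where K: "compact K" "K \<subseteq> D" "\<And>x. x \<notin> K \<Longrightarrow> \<psi> x = 0" using test_functionE[OF assms(2)] by metis
  have "(LINT x|lebesgue_on D. g x * \<psi> x) = (LINT x|lebesgue. g x * \<psi> x)"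
    by (intro integral_lebesgue_on_support assms) (use K in auto)
  also have "\<dots> = (LINT x|lborel. g x * \<psi> x)"
    using assms(3) test_function_measurable[OF assms(2)] by (intro integral_completion) simp
  finally show ?thesis .
qed

text \<open>The product of \<open>w\<close> and \<open>\<psi>\<close> has compact support, so its
  directional derivative integrates to 0. The sets \<open>E x\<close> leave room for kinks of
  \<open>w\<close> at finitely many points of each line parallel to \<open>b\<close>, as the radial
  cutoffs have them.\<close>

lemma test_function_integral_by_parts:
  fixes w w' :: "'a::euclidean_space \<Rightarrow> real"
  assumes \<psi>: "test_function D \<psi>" and w: "continuous_on UNIV w" and int: "integrable lborel (\<lambda>x. w' x * \<psi> x)"
    and fin: "\<And>x. finite (E x)" and b: "b \<in> Basis"
    and der: "\<And>x t. t \<notin> E x \<Longrightarrow> ((\<lambda>t. w (t *\<^sub>R b + x)) has_vector_derivative w' (t *\<^sub>R b + x)) (at t)"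
  shows "(LINT x|lborel. w x * partial_deriv b \<psi> x) = - (LINT x|lborel. w' x * \<psi> x)"
proof -
  have int': "integrable lborel (\<lambda>x. w x * partial_deriv b \<psi> x)"
    by (intro test_function_integrable[OF test_function_partial_deriv[OF \<psi> b]] w)
  have "(LINT x|lborel. w x * partial_deriv b \<psi> x + w' x * \<psi> x) = 0"
  proof (rule integral_directional_derivative_eq_0[where F="\<lambda>x. w x * \<psi> x" and b=b, OF _ _ _ fin])
    show "integrable lborel (\<lambda>x. w x * \<psi> x)" by (intro test_function_integrable[OF \<psi>] w)
    show "integrable lborel (\<lambda>x. w x * partial_deriv b \<psi> x + w' x * \<psi> x)" using int int' by simp
    show "continuous_on {0..1} (\<lambda>t. w (t *\<^sub>R b + x) * \<psi> (t *\<^sub>R b + x))" for x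
      by (intro continuous_intros continuous_on_compose2[OF w] continuous_on_compose2[OF test_function_continuous[OF \<psi>]]) auto
    show "((\<lambda>t. w (t *\<^sub>R b + x) * \<psi> (t *\<^sub>R b + x)) has_vector_derivative
       w (t *\<^sub>R b + x) * partial_deriv b \<psi> (t *\<^sub>R b + x) + w' (t *\<^sub>R b + x) * \<psi> (t *\<^sub>R b + x)) (at t)"
      if "t \<in> {0<..<1} - E x" for x t
      using that has_vector_derivative_mult[OF der has_vector_derivative_line[OF test_function_differentiable[OF \<psi>]], of t x]
      by simp
  qed
  then show ?thesis using int int' by simp
qed

lemma smooth_integral_by_parts:
  fixes w :: "'a::euclidean_space \<Rightarrow> real"
  assumes \<psi>: "test_function D \<psi>" and w: "C_k (Suc 0) w" and b: "b \<in> Basis"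
  shows "(LINT x|lborel. w x * partial_deriv b \<psi> x) = - (LINT x|lborel. partial_deriv b w x * \<psi> x)"
proof (rule test_function_integral_by_parts[OF \<psi> _ _ _ b, where E="\<lambda>_. {}"])
  show "continuous_on UNIV w" using C_k_Suc_D[OF w] by simp
  have "continuous_on UNIV (partial_deriv b w)" using w b by simp
  then show "integrable lborel (\<lambda>x. partial_deriv b w x * \<psi> x)" by (rule test_function_integrable[OF \<psi>])
  show "((\<lambda>t. w (t *\<^sub>R b + x)) has_vector_derivative partial_deriv b w (t *\<^sub>R b + x)) (at t)" for x t
    using w by (intro has_vector_derivative_line) simp
qed auto

lemma absolutely_integrable_on_compact_of_lborel:
  fixes f :: "'a::euclidean_space \<Rightarrow> 'b::euclidean_space"
  assumes f: "continuous_on UNIV f" and K: "compact K"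
  shows "f absolutely_integrable_on K"
proof -
  have "integrable lborel (\<lambda>x. indicator K x *\<^sub>R f x)"
    using assms by (intro borel_integrable_compact) (auto intro: continuous_on_subset)
  then show ?thesis unfolding set_integrable_def by (intro integrable_completion[THEN iffD2]) auto
qed

lemma continuous_on_grad:
  assumes "C_k (Suc 0) \<phi>"
  shows "continuous_on UNIV (grad \<phi>)"
  using assms unfolding grad_def[abs_def] by (intro continuous_intros) auto

lemma has_weak_gradient_smooth:
  fixes \<phi> :: "'a::euclidean_space \<Rightarrow> real"
  assumes D: "open D" and \<phi>: "C_k (Suc 0) \<phi>"
  shows "has_weak_gradient D \<phi> (grad \<phi>)"
  unfolding has_weak_gradient_def
proof (intro conjI allI impI ballI)
  have c: "continuous_on UNIV \<phi>" "continuous_on UNIV (grad \<phi>)" using C_k_Suc_D[OF \<phi>] continuous_on_grad[OF \<phi>] by auto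
  show "\<phi> absolutely_integrable_on K" "grad \<phi> absolutely_integrable_on K" if "compact K \<and> K \<subseteq> D" for K
    using that c by (auto intro: absolutely_integrable_on_compact_of_lborel)
  fix \<psi> and b :: 'a assume \<psi>: "test_function D \<psi>" and b: "b \<in> Basis"
  have cb: "continuous_on UNIV (partial_deriv b \<phi>)" using \<phi> b by simp
  have "(LINT x|lebesgue_on D. \<phi> x * partial_deriv b \<psi> x) = (LINT x|lborel. \<phi> x * partial_deriv b \<psi> x)"
    using D c by (intro integral_lebesgue_on_test test_function_partial_deriv \<psi> b) (auto intro: borel_measurable_continuous_onI)
  also have "\<dots> = - (LINT x|lborel. partial_deriv b \<phi> x * \<psi> x)"
    by (rule smooth_integral_by_parts[OF \<psi> \<phi> b])
  also have "(LINT x|lborel. partial_deriv b \<phi> x * \<psi> x) = (LINT x|lebesgue_on D. partial_deriv b \<phi> x * \<psi> x)"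
    using D cb by (intro integral_lebesgue_on_test[symmetric] \<psi>) (auto intro: borel_measurable_continuous_onI)
  finally show "(LINT x|lebesgue_on D. \<phi> x * partial_deriv b \<psi> x) = - (LINT x|lebesgue_on D. (grad \<phi> x \<bullet> b) * \<psi> x)"
    using b by (simp add: grad_inner_Basis)
qed

lemma has_weak_gradient_test: "open D \<Longrightarrow> test_function E \<phi> \<Longrightarrow> has_weak_gradient D \<phi> (grad \<phi>)"
  by (rule has_weak_gradient_smooth) (auto intro: test_function_C_k simp del: C_k.simps)

lemma integrable_mult_test_function:
  fixes G :: "'a::euclidean_space \<Rightarrow> real"
  assumes D: "open D" and G: "\<And>K. compact K \<Longrightarrow> K \<subseteq> D \<Longrightarrow> G absolutely_integrable_on K"
    and \<psi>: "test_function D \<psi>"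
  shows "integrable (lebesgue_on D) (\<lambda>x. G x * \<psi> x)"
proof -
  obtain K where K: "compact K" "K \<subseteq> D" "\<And>x. x \<notin> K \<Longrightarrow> \<psi> x = 0" using test_functionE[OF \<psi>] by metis
  obtain C where C: "0 < C" "\<And>x. \<bar>\<psi> x\<bar> \<le> C" using test_function_bounded[OF \<psi>] by metis
  have GK: "integrable lebesgue (\<lambda>x. indicator K x * G x)" using G[OF K(1,2)] by (simp add: set_integrable_def)
  have \<psi>m: "\<psi> \<in> borel_measurable lebesgue" using test_function_measurable[OF \<psi>] by (simp add: measurable_completion)
  have "integrable lebesgue (\<lambda>x. (indicator K x * G x) * \<psi> x)"
  proof (rule Bochner_Integration.integrable_bound[where f="\<lambda>x. C * (indicator K x * G x)"])
    show "integrable lebesgue (\<lambda>x. C * (indicator K x * G x))" using GK by simp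
    show "(\<lambda>x. (indicator K x * G x) * \<psi> x) \<in> borel_measurable lebesgue"
      using borel_measurable_integrable[OF GK] \<psi>m by (rule borel_measurable_times)
    have "\<bar>indicator K x * G x\<bar> * \<bar>\<psi> x\<bar> \<le> C * \<bar>indicator K x * G x\<bar>" for x
      using mult_left_mono[OF C(2), of "\<bar>indicator K x * G x\<bar>" x] by (simp add: mult.commute)
    then show "AE x in lebesgue. norm ((indicator K x * G x) * \<psi> x) \<le> norm (C * (indicator K x * G x))"
      using C(1) by (intro AE_I2) (simp add: abs_mult)
  qed
  moreover have "(\<lambda>x. (indicator K x * G x) * \<psi> x) = (\<lambda>x. indicator D x *\<^sub>R (G x * \<psi> x))"
  proof
    fix x show "(indicator K x * G x) * \<psi> x = indicator D x *\<^sub>R (G x * \<psi> x)"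
      using K by (cases "x \<in> K") auto
  qed
  ultimately show ?thesis using D by (subst integrable_restrict_space) auto
qed

section \<open>Linearity, uniqueness and measurability of weak gradients\<close>

lemma has_weak_gradient_diff:
  assumes D: "open D" and u: "has_weak_gradient D u g" and v: "has_weak_gradient D v h"
  shows "has_weak_gradient D (\<lambda>x. u x - v x) (\<lambda>x. g x - h x)"
  unfolding has_weak_gradient_def
proof (intro conjI allI impI ballI)
  have ai: "u absolutely_integrable_on K" "g absolutely_integrable_on K" "v absolutely_integrable_on K" "h absolutely_integrable_on K"
    if "compact K" "K \<subseteq> D" for K using u v that by (auto simp: has_weak_gradient_def)
  show "(\<lambda>x. u x - v x) absolutely_integrable_on K" "(\<lambda>x. g x - h x) absolutely_integrable_on K"
    if "compact K \<and> K \<subseteq> D" for K using that ai by (auto intro: set_integral_diff(1))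
  fix \<phi> and b :: 'a assume \<phi>: "test_function D \<phi>" and b: "b \<in> Basis"
  note pd = test_function_partial_deriv[OF \<phi> b]
  have aib: "(\<lambda>x. g x \<bullet> b) absolutely_integrable_on K" "(\<lambda>x. h x \<bullet> b) absolutely_integrable_on K"
    if "compact K" "K \<subseteq> D" for K
    using ai(2,4)[OF that] integrable_inner_left[of b] unfolding set_integrable_def by (auto simp: inner_scaleR_left[symmetric] simp del: inner_scaleR_left)
  show "(LINT x|lebesgue_on D. (u x - v x) * partial_deriv b \<phi> x) = - (LINT x|lebesgue_on D. (g x - h x) \<bullet> b * \<phi> x)"
    using u v \<phi> b integrable_mult_test_function[OF D ai(1) pd] integrable_mult_test_function[OF D ai(3) pd]
      integrable_mult_test_function[OF D aib(1) \<phi>] integrable_mult_test_function[OF D aib(2) \<phi>]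
    by (simp add: left_diff_distrib inner_diff_left has_weak_gradient_def)
qed

text \<open>The difference of two weak gradients is a weak gradient of 0, hence each of its
  components annihilates all test functions.\<close>

lemma has_weak_gradient_unique:
  assumes D: "open D" and g: "has_weak_gradient D u g" and h: "has_weak_gradient D u h"
  shows "AE x in lebesgue_on D. g x = h x"
proof -
  have d: "has_weak_gradient D (\<lambda>x. 0) (\<lambda>x. g x - h x)"
    using has_weak_gradient_diff[OF D g h] by simp
  have "AE x in lebesgue_on D. (g x - h x) \<bullet> b = 0" if b: "b \<in> Basis" for b
  proof (rule AE_zero_if_test_integral_zero[OF D])
    show "(\<lambda>x. (g x - h x) \<bullet> b) absolutely_integrable_on K" if "compact K" "K \<subseteq> D" for K
    proof -
      have "integrable lebesgue (\<lambda>x. (indicator K x *\<^sub>R (g x - h x)) \<bullet> b)"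
        using d that by (intro integrable_inner_left) (simp add: has_weak_gradient_def set_integrable_def)
      then show ?thesis by (simp add: set_integrable_def)
    qed
    show "(LINT x|lebesgue_on D. (g x - h x) \<bullet> b * \<psi> x) = 0" if "test_function D \<psi>" for \<psi>
      using d that b unfolding has_weak_gradient_def by fastforce
  qed
  then have "AE x in lebesgue_on D. \<forall>b\<in>Basis. (g x - h x) \<bullet> b = 0"
    by (subst AE_finite_all) auto
  then show ?thesis
    by eventually_elim (auto simp: inner_diff_left intro: euclidean_eqI)
qed

text \<open>The choice made by \<open>weak_gradient\<close> is legitimate as soon as one weak
  gradient is known.\<close>

lemma has_weak_gradient_weak_gradient: "has_weak_gradient D u g \<Longrightarrow> has_weak_gradient D u (weak_gradient D u)"
  unfolding weak_gradient_def by (rule someI[of "has_weak_gradient D u"])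

text \<open>A weak gradient comes with integrability on compact subsets only; an exhaustion of
  \<open>D\<close> by compact sets yields measurability on all of \<open>D\<close>.\<close>

lemma measurable_lebesgue_on_if_compact:
  fixes g :: "'a::euclidean_space \<Rightarrow> 'b::euclidean_space"
  assumes D: "open D" and g: "\<And>K. compact K \<Longrightarrow> K \<subseteq> D \<Longrightarrow> g absolutely_integrable_on K"
  shows "g \<in> borel_measurable (lebesgue_on D)"
proof -
  obtain C :: "nat \<Rightarrow> 'a set" where C: "\<And>n. compact (C n)" "\<And>n. C n \<subseteq> D"
      "\<And>K. compact K \<Longrightarrow> K \<subseteq> D \<Longrightarrow> \<exists>N. \<forall>n\<ge>N. K \<subseteq> (C n)"
    by (rule open_Union_compact_subsets[OF D]) (rule that)
  show ?thesis
  proof (rule borel_measurable_LIMSEQ_metric)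
    show "(\<lambda>x. indicator (C n) x *\<^sub>R g x) \<in> borel_measurable (lebesgue_on D)" for n
      using g[OF C(1,2)] unfolding set_integrable_def by (intro measurable_restrict_space1) auto
    fix x assume "x \<in> space (lebesgue_on D)"
    then have "compact {x}" "{x} \<subseteq> D" by auto
    from C(3)[OF this] have "\<forall>\<^sub>F n in sequentially. x \<in> C n" by (auto simp: eventually_sequentially)
    then have "\<forall>\<^sub>F n in sequentially. indicator (C n) x *\<^sub>R g x = g x" by eventually_elim simp
    then show "(\<lambda>n. indicator (C n) x *\<^sub>R g x) \<longlonglongrightarrow> g x" by (rule tendsto_eventually)
  qed
qed

section \<open>Functions vanishing on the boundary\<close>

lemma in_Lp_diff:
  fixes v w :: "'a::euclidean_space \<Rightarrow> 'b::euclidean_space"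
  assumes v: "in_Lp D p v" and w: "in_Lp D p w" and p: "1 \<le> p"
  shows "in_Lp D p (\<lambda>x. v x - w x)"
  unfolding in_Lp_def
proof
  have [measurable]: "v \<in> borel_measurable (lebesgue_on D)" "w \<in> borel_measurable (lebesgue_on D)"
    using v w by (auto simp: in_Lp_def)
  show "(\<lambda>x. v x - w x) \<in> borel_measurable (lebesgue_on D)" by measurable
  have le: "norm (a - b) powr p \<le> 2 powr p * (norm a powr p + norm b powr p)" for a b :: 'b
  proof -
    have "norm (a - b) powr p \<le> (2 * max (norm a) (norm b)) powr p"
      using norm_triangle_ineq4[of a b] p by (intro powr_mono2) auto
    also have "\<dots> = 2 powr p * max (norm a) (norm b) powr p" by (simp add: powr_mult)
    also have "\<dots> \<le> 2 powr p * (norm a powr p + norm b powr p)"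
      by (intro mult_left_mono) (auto simp: max_def)
    finally show ?thesis .
  qed
  show "integrable (lebesgue_on D) (\<lambda>x. norm (v x - w x) powr p)"
  proof (rule Bochner_Integration.integrable_bound)
    show "integrable (lebesgue_on D) (\<lambda>x. 2 powr p * (norm (v x) powr p + norm (w x) powr p))"
      using v w by (auto simp: in_Lp_def)
    show "AE x in lebesgue_on D. norm (norm (v x - w x) powr p) \<le> norm (2 powr p * (norm (v x) powr p + norm (w x) powr p))"
      using le by (intro AE_I2) auto
  qed measurable
qed

lemma in_Lp_bounded:
  fixes f :: "'a::euclidean_space \<Rightarrow> 'b::euclidean_space"
  assumes D: "D \<in> lmeasurable" and f: "f \<in> borel_measurable borel" and C: "\<And>x. norm (f x) \<le> C" and p: "0 \<le> p"
  shows "in_Lp D p f"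
  unfolding in_Lp_def
proof
  interpret finite_measure "lebesgue_on D" using D by (rule finite_measure_lebesgue_on)
  have "f \<in> borel_measurable lebesgue" using f by (simp add: measurable_completion)
  then show [measurable]: "f \<in> borel_measurable (lebesgue_on D)" by (rule measurable_restrict_space1)
  show "integrable (lebesgue_on D) (\<lambda>x. norm (f x) powr p)"
    by (rule integrable_const_bound[where B="C powr p"])
      (use C p in \<open>auto intro!: AE_I2 powr_mono2\<close>)
qed

text \<open>Splitting at height \<open>e\<close>: below it \<open>norm v\<close> is at most
  \<open>e\<close>, above it \<open>norm v\<close> is at most
  \<open>e powr (1 - p) * norm v powr p\<close>. The free parameter makes the bound small together
  with the integral of the p-th power, also for \<open>p = 1\<close>.\<close>

lemma L1_bound_of_Lp:
  fixes v :: "'a::euclidean_space \<Rightarrow> 'b::euclidean_space"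
  assumes D: "D \<in> lmeasurable" and p: "1 \<le> p" and v: "in_Lp D p v"
  shows "integrable (lebesgue_on D) v"
    and "0 < e \<Longrightarrow> (LINT x|lebesgue_on D. norm (v x)) \<le> e * measure lebesgue D + e powr (1 - p) * (LINT x|lebesgue_on D. norm (v x) powr p)"
proof -
  interpret finite_measure "lebesgue_on D" using D by (rule finite_measure_lebesgue_on)
  have [measurable]: "v \<in> borel_measurable (lebesgue_on D)" and ip: "integrable (lebesgue_on D) (\<lambda>x. norm (v x) powr p)"
    using v by (auto simp: in_Lp_def)
  have le: "t \<le> e + e powr (1 - p) * t powr p" if "0 < e" "0 \<le> t" for e t :: real
  proof (cases "t \<le> e")
    case True
    moreover have "0 \<le> e powr (1 - p) * t powr p" by simp
    ultimately show ?thesis by linarith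
  next
    case False
    then have "t = t powr (1 - p) * t powr p" using that by (simp add: powr_add[symmetric])
    also have "\<dots> \<le> e powr (1 - p) * t powr p"
      using False that p by (intro mult_right_mono powr_mono2') auto
    finally show ?thesis using that by linarith
  qed
  show int: "integrable (lebesgue_on D) v"
  proof (rule Bochner_Integration.integrable_bound)
    show "integrable (lebesgue_on D) (\<lambda>x. 1 + 1 powr (1 - p) * norm (v x) powr p)" using ip by auto
    show "AE x in lebesgue_on D. norm (v x) \<le> norm (1 + 1 powr (1 - p) * norm (v x) powr p)"
    proof (rule AE_I2)
      show "norm (v x) \<le> norm (1 + 1 powr (1 - p) * norm (v x) powr p)" for x
        using le[of 1 "norm (v x)"] by simp
    qed
  qed simp
  assume e: "0 < e"
  have "(LINT x|lebesgue_on D. norm (v x)) \<le> (LINT x|lebesgue_on D. e + e powr (1 - p) * norm (v x) powr p)"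
    using int ip le[OF e] by (intro integral_mono) auto
  also have "\<dots> = e * measure lebesgue D + e powr (1 - p) * (LINT x|lebesgue_on D. norm (v x) powr p)"
    using ip D by (simp add: measure_restrict_space fmeasurableD)
  finally show "(LINT x|lebesgue_on D. norm (v x)) \<le> e * measure lebesgue D + e powr (1 - p) * (LINT x|lebesgue_on D. norm (v x) powr p)" .
qed

lemma Lp_small_imp_L1_small:
  assumes D: "D \<in> lmeasurable" and p: "1 \<le> p" and \<eta>: "0 < \<eta>"
  obtains \<epsilon> where "0 < \<epsilon>" "\<And>v :: 'a::euclidean_space \<Rightarrow> 'b::euclidean_space. in_Lp D p v \<Longrightarrow> Lp_norm D p v < \<epsilon> \<Longrightarrow> (LINT x|lebesgue_on D. norm (v x)) < \<eta>"
proof -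
  \<comment> \<open>Each of the two terms of the split bound is to be at most
    \<open>\<eta> / 2\<close>; the summand 1 keeps the denominator positive when \<open>D\<close> is
    a null set.\<close>
  define e where "e = \<eta> / (2 * (measure lebesgue D + 1))"
  define \<delta> where "\<delta> = \<eta> / (2 * e powr (1 - p))"
  have m: "0 < measure lebesgue D + 1" by (simp add: add_nonneg_pos)
  have e: "0 < e" using \<eta> m by (simp add: e_def)
  have \<delta>: "0 < \<delta>" using \<eta> e by (simp add: \<delta>_def)
  show ?thesis
  proof (rule that)
    show "0 < \<delta> powr (1 / p)" using \<delta> by simp
    fix v :: "'a \<Rightarrow> 'b" assume v: "in_Lp D p v" "Lp_norm D p v < \<delta> powr (1 / p)"
    let ?I = "LINT x|lebesgue_on D. norm (v x) powr p"
    have "?I < \<delta>"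
    proof (rule ccontr)
      assume "\<not> ?I < \<delta>"
      then have "\<delta> powr (1 / p) \<le> ?I powr (1 / p)" using \<delta> p by (intro powr_mono2) auto
      with v show False by (simp add: Lp_norm_def)
    qed
    then have "e powr (1 - p) * ?I < e powr (1 - p) * \<delta>" using e by (intro mult_strict_left_mono) auto
    also have "\<dots> = \<eta> / 2" using e by (simp add: \<delta>_def)
    finally have 1: "e powr (1 - p) * ?I < \<eta> / 2" .
    have "e * measure lebesgue D \<le> e * (measure lebesgue D + 1)" using e by (intro mult_left_mono) auto
    also have "\<dots> = \<eta> / 2"
    proof -
      have "\<eta> / (2 * X) * X = \<eta> / 2" if "0 < X" for X :: real using that by simp
      from this[OF m] show ?thesis by (simp only: e_def)
    qed
    finally show "(LINT x|lebesgue_on D. norm (v x)) < \<eta>"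
      using 1 L1_bound_of_Lp(2)[OF D p v(1) e] by linarith
  qed
qed

text \<open>Integrability of the p-th power is known for some weak gradient; uniqueness almost
  everywhere carries it over to the chosen representative.\<close>

lemma in_W1p_weak_gradient:
  assumes D: "open D" and u: "in_W1p D p u"
  shows "has_weak_gradient D u (weak_gradient D u)" and "in_Lp D p (weak_gradient D u)"
proof -
  obtain g where g: "has_weak_gradient D u g" "in_Lp D p g" using u by (auto simp: in_W1p_def)
  show wg: "has_weak_gradient D u (weak_gradient D u)" using g(1) by (rule has_weak_gradient_weak_gradient)
  have [measurable]: "weak_gradient D u \<in> borel_measurable (lebesgue_on D)"
    using wg by (intro measurable_lebesgue_on_if_compact D) (auto simp: has_weak_gradient_def)
  have [measurable]: "g \<in> borel_measurable (lebesgue_on D)" using g by (simp add: in_Lp_def)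
  have "integrable (lebesgue_on D) (\<lambda>x. norm (weak_gradient D u x) powr p) \<longleftrightarrow> integrable (lebesgue_on D) (\<lambda>x. norm (g x) powr p)"
    using has_weak_gradient_unique[OF D wg g(1)] by (intro integrable_cong_AE) auto
  then show "in_Lp D p (weak_gradient D u)" using g(2) by (simp add: in_Lp_def)
qed

lemma grad_test_bounded:
  fixes \<phi> :: "'a::euclidean_space \<Rightarrow> real"
  assumes \<phi>: "test_function D \<phi>"
  obtains C where "0 < C" "\<And>x. norm (grad \<phi> x) \<le> C"
proof -
  have "\<exists>C. 0 < C \<and> (\<forall>x. \<bar>partial_deriv b \<phi> x\<bar> \<le> C)" if "b \<in> Basis" for b
    using test_function_bounded[OF test_function_partial_deriv[OF \<phi> that]] by metis
  then obtain C where C: "\<And>b. b \<in> Basis \<Longrightarrow> 0 < C b \<and> (\<forall>x. \<bar>partial_deriv b \<phi> x\<bar> \<le> C b)" by metis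
  have "norm (grad \<phi> x) \<le> (\<Sum>b\<in>(Basis::'a set). C b)" for x
    unfolding grad_def using C by (intro sum_norm_le) auto
  moreover have "0 < (\<Sum>b\<in>(Basis::'a set). C b)" using C by (intro sum_pos) auto
  ultimately show ?thesis using that by blast
qed

lemma continuous_on_grad_test: "test_function D \<phi> \<Longrightarrow> continuous_on UNIV (grad \<phi>)"
  by (intro continuous_on_grad test_function_C_k)

lemma in_Lp_test:
  assumes D: "D \<in> lmeasurable" and p: "0 \<le> p" and \<phi>: "test_function E \<phi>"
  shows "in_Lp D p \<phi>" "in_Lp D p (grad \<phi>)"
proof -
  obtain C where "\<And>x. \<bar>\<phi> x\<bar> \<le> C" using test_function_bounded[OF \<phi>] by metis
  then show "in_Lp D p \<phi>" by (intro in_Lp_bounded[OF D test_function_measurable[OF \<phi>] _ p]) auto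
  obtain C' where "\<And>x. norm (grad \<phi> x) \<le> C'" using grad_test_bounded[OF \<phi>] by metis
  then show "in_Lp D p (grad \<phi>)"
    by (intro in_Lp_bounded[OF D _ _ p] borel_measurable_continuous_onI continuous_on_grad_test[OF \<phi>])
qed

lemma lmeasurable_open_bounded: "open D \<Longrightarrow> bounded D \<Longrightarrow> D \<in> lmeasurable"
  by (rule lmeasurable_open)

lemma W1p_0_integrable:
  assumes D: "open D" "bounded D" and p: "1 \<le> p" and u: "in_W1p_0 D p u"
  shows "integrable (lebesgue_on D) u" "integrable (lebesgue_on D) (weak_gradient D u)"
    "has_weak_gradient D u (weak_gradient D u)"
proof -
  have W: "in_W1p D p u" using u by (simp add: in_W1p_0_def)
  note Dm = lmeasurable_open_bounded[OF D]
  show "integrable (lebesgue_on D) u" using W by (intro L1_bound_of_Lp(1)[OF Dm p]) (simp add: in_W1p_def)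
  show "integrable (lebesgue_on D) (weak_gradient D u)"
    using in_W1p_weak_gradient(2)[OF D(1) W] by (rule L1_bound_of_Lp(1)[OF Dm p])
  show "has_weak_gradient D u (weak_gradient D u)" using in_W1p_weak_gradient(1)[OF D(1) W] .
qed

text \<open>The definition speaks of the chosen weak gradient of \<open>u - \<phi>\<close> in the
  p-norm. By uniqueness it may be replaced by the difference of \<open>weak_gradient D u\<close> and
  \<open>grad \<phi>\<close>, and on a bounded domain the p-norm controls the 1-norm.\<close>

lemma W1p_0_approx:
  fixes u :: "'a::euclidean_space \<Rightarrow> real"
  assumes D: "open D" "bounded D" and p: "1 \<le> p" and u: "in_W1p_0 D p u" and \<eta>: "0 < \<eta>"
  obtains \<phi> where "test_function D \<phi>" "(LINT x|lebesgue_on D. \<bar>u x - \<phi> x\<bar>) < \<eta>"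
    "(LINT x|lebesgue_on D. norm (weak_gradient D u x - grad \<phi> x)) < \<eta>"
proof -
  have W: "in_W1p D p u" using u by (simp add: in_W1p_0_def)
  note Dm = lmeasurable_open_bounded[OF D]
  obtain \<epsilon>1 where e1: "0 < \<epsilon>1" "\<And>v :: 'a \<Rightarrow> real. in_Lp D p v \<Longrightarrow> Lp_norm D p v < \<epsilon>1 \<Longrightarrow> (LINT x|lebesgue_on D. norm (v x)) < \<eta>"
    using Lp_small_imp_L1_small[OF Dm p \<eta>] by blast
  obtain \<epsilon>2 where e2: "0 < \<epsilon>2" "\<And>v :: 'a \<Rightarrow> 'a. in_Lp D p v \<Longrightarrow> Lp_norm D p v < \<epsilon>2 \<Longrightarrow> (LINT x|lebesgue_on D. norm (v x)) < \<eta>"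
    using Lp_small_imp_L1_small[OF Dm p \<eta>] by blast
  obtain \<phi> where \<phi>: "test_function D \<phi>" "W1p_norm D p (\<lambda>x. u x - \<phi> x) < min \<epsilon>1 \<epsilon>2"
    using u e1 e2 unfolding in_W1p_0_def by (meson min_less_iff_conj)
  have nn: "0 \<le> Lp_norm D p (v :: 'a \<Rightarrow> 'c::euclidean_space)" for v by (simp add: Lp_norm_def)
  note wg = in_W1p_weak_gradient[OF D(1) W]
  have 1: "Lp_norm D p (\<lambda>x. u x - \<phi> x) < \<epsilon>1" and 2: "Lp_norm D p (weak_gradient D (\<lambda>x. u x - \<phi> x)) < \<epsilon>2"
    using \<phi>(2) nn[of "\<lambda>x. u x - \<phi> x"] nn[of "weak_gradient D (\<lambda>x. u x - \<phi> x)"] by (auto simp: W1p_norm_def)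
  note dg = has_weak_gradient_diff[OF D(1) wg(1) has_weak_gradient_test[OF D(1) \<phi>(1)]]
  note dwg = has_weak_gradient_weak_gradient[OF dg]
  have [measurable]: "weak_gradient D (\<lambda>x. u x - \<phi> x) \<in> borel_measurable (lebesgue_on D)"
     "(\<lambda>x. weak_gradient D u x - grad \<phi> x) \<in> borel_measurable (lebesgue_on D)"
    using dwg dg by (intro measurable_lebesgue_on_if_compact D; auto simp: has_weak_gradient_def)+
  have "(LINT x|lebesgue_on D. norm (weak_gradient D (\<lambda>x. u x - \<phi> x) x) powr p)
      = (LINT x|lebesgue_on D. norm (weak_gradient D u x - grad \<phi> x) powr p)"
    using has_weak_gradient_unique[OF D(1) dwg dg] by (intro integral_cong_AE) auto
  with 2 have 3: "Lp_norm D p (\<lambda>x. weak_gradient D u x - grad \<phi> x) < \<epsilon>2" by (simp add: Lp_norm_def)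
  have p0: "0 \<le> p" using p by simp
  show ?thesis
  proof (rule that[OF \<phi>(1)])
    have "in_Lp D p (\<lambda>x. u x - \<phi> x)"
      using W by (intro in_Lp_diff p in_Lp_test[OF Dm p0 \<phi>(1)]) (simp add: in_W1p_def)
    from e1(2)[OF this 1] show "(LINT x|lebesgue_on D. \<bar>u x - \<phi> x\<bar>) < \<eta>" by simp
    have "in_Lp D p (\<lambda>x. weak_gradient D u x - grad \<phi> x)"
      by (intro in_Lp_diff p in_Lp_test[OF Dm p0 \<phi>(1)] wg(2))
    from e2(2)[OF this 3] show "(LINT x|lebesgue_on D. norm (weak_gradient D u x - grad \<phi> x)) < \<eta>" .
  qed
qed

section \<open>Pairing with the position field\<close>

lemma test_function_integral_eq:
  fixes \<phi> :: "'a::euclidean_space \<Rightarrow> real"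
  assumes \<phi>: "test_function D \<phi>"
  shows "(LINT x|lborel. x \<bullet> grad \<phi> x) = - (real DIM('a) * (LINT x|lborel. \<phi> x))"
proof -
  have int: "integrable lborel (\<lambda>x. (x \<bullet> b) * partial_deriv b \<phi> x)" if "b \<in> Basis" for b
    by (intro test_function_integrable[OF test_function_partial_deriv[OF \<phi> that]] continuous_intros)
  have eq: "(LINT x|lborel. (x \<bullet> b) * partial_deriv b \<phi> x) = - (LINT x|lborel. \<phi> x)" if b: "b \<in> Basis" for b
  proof -
    have "partial_deriv b (\<lambda>x. x \<bullet> b) x = 1" for x
      using b by (subst partial_deriv_eq[where \<phi>'="\<lambda>h. h \<bullet> b"]) (auto intro!: derivative_eq_intros)
    with smooth_integral_by_parts[OF \<phi> C_k_inner b, of b] show ?thesis by simp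
  qed
  have "(LINT x|lborel. x \<bullet> grad \<phi> x) = (LINT x|lborel. (\<Sum>b\<in>Basis. (x \<bullet> b) * partial_deriv b \<phi> x))"
    by (simp add: grad_def inner_sum_right mult.commute)
  also have "\<dots> = (\<Sum>b\<in>(Basis::'a set). - (LINT x|lborel. \<phi> x))"
    using int by (subst Bochner_Integration.integral_sum) (auto simp: eq)
  finally show ?thesis by simp
qed

text \<open>Since \<open>\<bar>\<phi>\<bar>\<close> need not be differentiable, the position field
  is paired with \<open>sqrt (\<phi>^2 + e^2) - e\<close>. This function is differentiable, vanishes
  exactly where \<open>\<phi>\<close> does, and its gradient is that of \<open>\<phi>\<close> times
  \<open>\<phi> / q\<close>, a factor of modulus at most 1.\<close>

lemma test_function_L1_bound:
  fixes \<phi> :: "'a::euclidean_space \<Rightarrow> real"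
  assumes \<phi>: "test_function D \<phi>" and D: "D \<in> lmeasurable"
  shows "real DIM('a) * (LINT x|lborel. \<bar>\<phi> x\<bar>) \<le> (LINT x|lborel. norm x * norm (grad \<phi> x))"
proof -
  let ?n = "real DIM('a)"
  obtain K where K: "compact K" "K \<subseteq> D" "\<And>x. x \<notin> K \<Longrightarrow> \<phi> x = 0" using test_functionE[OF \<phi>] by metis
  have K': "partial_deriv b \<phi> x = 0" if "x \<notin> K" for b x
    using K(1,3) that by (rule partial_deriv_outside_support)
  note cont = test_function_continuous[OF \<phi>]
  have contp: "continuous_on UNIV (partial_deriv b \<phi>)" if "b \<in> Basis" for b
    using test_function_continuous[OF test_function_partial_deriv[OF \<phi> that]] .
  note contg = continuous_on_grad_test[OF \<phi>]
  have gK: "grad \<phi> x = 0" if "x \<notin> K" for x using K' that by (simp add: grad_def)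
  have intg: "integrable lborel (\<lambda>x. norm x * norm (grad \<phi> x))"
    by (rule integrable_lborel_compact_support[OF K(1)]) (use contg gK in \<open>auto intro!: continuous_intros\<close>)
  have int\<phi>: "integrable lborel \<phi>" by (rule integrable_lborel_compact_support[OF K(1,3) cont])
  have approx: "?n * (LINT x|lborel. \<bar>\<phi> x\<bar>) \<le> (LINT x|lborel. norm x * norm (grad \<phi> x)) + ?n * (e * measure lborel K)"
    if e: "0 < e" for e
  proof -
    define q where "q x = sqrt ((\<phi> x)\<^sup>2 + e\<^sup>2)" for x
    have q: "0 < q x" "\<bar>\<phi> x\<bar> \<le> q x" for x
      using e by (auto simp: q_def sum_power2_gt_zero_iff real_sqrt_sum_squares_ge1)
    have qK: "q x = e" if "x \<notin> K" for x using K(3)[OF that] e by (simp add: q_def)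
    have cq: "continuous_on UNIV q" unfolding q_def by (intro continuous_intros cont)
    have intq: "integrable lborel (\<lambda>x. q x - e)"
      by (rule integrable_lborel_compact_support[OF K(1)]) (use qK cq in \<open>auto intro!: continuous_intros\<close>)
    have intd: "integrable lborel (\<lambda>x. (x \<bullet> b) * (\<phi> x / q x * partial_deriv b \<phi> x))" if b: "b \<in> Basis" for b
      by (rule integrable_lborel_compact_support[OF K(1)])
        (use K' cq cont contp[OF b] q(1) in \<open>auto intro!: continuous_intros simp: less_imp_neq[symmetric] order_less_imp_not_eq2\<close>)
    have zero: "(LINT x|lborel. (q x - e) + (x \<bullet> b) * (\<phi> x / q x * partial_deriv b \<phi> x)) = 0" if b: "b \<in> Basis" for b
    proof (rule integral_directional_derivative_eq_0[where F="\<lambda>x. (x \<bullet> b) * (q x - e)" and b=b and E="\<lambda>_. {}"])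
      show "integrable lborel (\<lambda>x. (x \<bullet> b) * (q x - e))"
        by (rule integrable_lborel_compact_support[OF K(1)]) (use qK cq in \<open>auto intro!: continuous_intros\<close>)
      show "integrable lborel (\<lambda>x. (q x - e) + (x \<bullet> b) * (\<phi> x / q x * partial_deriv b \<phi> x))" using intq intd[OF b] by simp
      show "continuous_on {0..1} (\<lambda>t. ((t *\<^sub>R b + x) \<bullet> b) * (q (t *\<^sub>R b + x) - e))" for x
        by (intro continuous_intros continuous_on_compose2[OF cq]) auto
      fix x t
      let ?z = "t *\<^sub>R b + x"
      have 1: "((\<lambda>t. \<phi> (t *\<^sub>R b + x)) has_real_derivative partial_deriv b \<phi> ?z) (at t)"
        using has_vector_derivative_line[OF test_function_differentiable[OF \<phi>]]
        by (simp add: has_real_derivative_iff_has_vector_derivative)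
      have 2: "((\<lambda>t. (t *\<^sub>R b + x) \<bullet> b) has_real_derivative 1) (at t)"
        using b by (auto simp: inner_add_left intro!: derivative_eq_intros)
      have "((\<lambda>t. sqrt ((g t)\<^sup>2 + e\<^sup>2)) has_real_derivative (g t / sqrt ((g t)\<^sup>2 + e\<^sup>2) * g')) (at t)"
        if g: "(g has_real_derivative g') (at t)" for g :: "real \<Rightarrow> real" and g'
      proof -
        have "0 < (g t)\<^sup>2 + e\<^sup>2" using e by (simp add: add_nonneg_pos)
        then show ?thesis by (auto intro!: derivative_eq_intros g simp: field_simps)
      qed
      from this[OF 1] have 3: "((\<lambda>t. q (t *\<^sub>R b + x)) has_real_derivative (\<phi> ?z / q ?z * partial_deriv b \<phi> ?z)) (at t)"
        unfolding q_def .
      have "((\<lambda>t. ((t *\<^sub>R b + x) \<bullet> b) * (q (t *\<^sub>R b + x) - e)) has_real_derivative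
        1 * (q ?z - e) + (\<phi> ?z / q ?z * partial_deriv b \<phi> ?z - 0) * (?z \<bullet> b)) (at t)"
        by (intro DERIV_mult 2 DERIV_diff 3 DERIV_const)
      then show "((\<lambda>t. ((t *\<^sub>R b + x) \<bullet> b) * (q (t *\<^sub>R b + x) - e)) has_vector_derivative
        (q ?z - e) + (?z \<bullet> b) * (\<phi> ?z / q ?z * partial_deriv b \<phi> ?z)) (at t)"
        by (simp add: has_real_derivative_iff_has_vector_derivative mult.commute)
    qed auto
    have eq: "(LINT x|lborel. q x - e) = (LINT x|lborel. - ((x \<bullet> b) * (\<phi> x / q x * partial_deriv b \<phi> x)))" if b: "b \<in> Basis" for b
      unfolding Bochner_Integration.integral_minus
      using Bochner_Integration.integral_add[OF intq intd[OF b]] zero[OF b] by linarith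
    have "?n * (LINT x|lborel. q x - e) = (\<Sum>b\<in>(Basis::'a set). (LINT x|lborel. - ((x \<bullet> b) * (\<phi> x / q x * partial_deriv b \<phi> x))))"
    proof -
      have "(\<Sum>b\<in>(Basis::'a set). (LINT x|lborel. - ((x \<bullet> b) * (\<phi> x / q x * partial_deriv b \<phi> x)))) = (\<Sum>b\<in>(Basis::'a set). (LINT x|lborel. q x - e))"
        by (intro sum.cong refl eq[symmetric])
      then show ?thesis by simp
    qed
    also have "\<dots> = (LINT x|lborel. (\<Sum>b\<in>Basis. - ((x \<bullet> b) * (\<phi> x / q x * partial_deriv b \<phi> x))))"
      using intd by (subst Bochner_Integration.integral_sum) auto
    also have "\<dots> \<le> (LINT x|lborel. norm x * norm (grad \<phi> x))"
    proof (intro integral_mono intg)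
      show "integrable lborel (\<lambda>x. \<Sum>b\<in>Basis. - ((x \<bullet> b) * (\<phi> x / q x * partial_deriv b \<phi> x)))" using intd by auto
      fix x
      have "(\<Sum>b\<in>Basis. - ((x \<bullet> b) * (\<phi> x / q x * partial_deriv b \<phi> x))) = - (\<phi> x / q x) * (x \<bullet> grad \<phi> x)"
        by (simp add: grad_def inner_sum_right sum_distrib_left sum_negf mult_ac)
      also have "\<dots> \<le> \<bar>\<phi> x / q x\<bar> * \<bar>x \<bullet> grad \<phi> x\<bar>"
        using abs_ge_minus_self[of "\<phi> x / q x * (x \<bullet> grad \<phi> x)"] by (simp only: abs_mult mult_minus_left)
      also have "\<dots> \<le> 1 * (norm x * norm (grad \<phi> x))"
        using q[of x] by (intro mult_mono Cauchy_Schwarz_ineq2) (auto simp: abs_divide)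
      finally show "(\<Sum>b\<in>Basis. - ((x \<bullet> b) * (\<phi> x / q x * partial_deriv b \<phi> x))) \<le> norm x * norm (grad \<phi> x)" by simp
    qed
    finally have up: "?n * (LINT x|lborel. q x - e) \<le> (LINT x|lborel. norm x * norm (grad \<phi> x))" .
    have intK: "integrable lborel (\<lambda>x. e * indicator K x)"
      using emeasure_compact_finite[OF K(1)] K(1) by (intro integrable_mult_right) (auto simp: borel_compact)
    \<comment> \<open>The subtracted constant costs at most \<open>e\<close> on the compact set
      carrying \<open>\<phi>\<close> and nothing outside.\<close>
    have "(LINT x|lborel. \<bar>\<phi> x\<bar>) \<le> (LINT x|lborel. (q x - e) + e * indicator K x)"
    proof (intro integral_mono integrable_abs int\<phi> Bochner_Integration.integrable_add intq intK)
      show "\<bar>\<phi> x\<bar> \<le> q x - e + e * indicator K x" for x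
        using q(2)[of x] qK[of x] K(3)[of x] by (cases "x \<in> K") auto
    qed
    also have "\<dots> = (LINT x|lborel. q x - e) + e * measure lborel K"
      using intq intK K(1) by simp
    finally have "?n * (LINT x|lborel. \<bar>\<phi> x\<bar>) \<le> ?n * ((LINT x|lborel. q x - e) + e * measure lborel K)"
      by (rule mult_left_mono) simp
    then show ?thesis using up by (simp add: distrib_left)
  qed
  show ?thesis
  proof (rule field_le_epsilon)
    fix e :: real assume e: "0 < e"
    define e' where "e' = e / (?n * (measure lborel K + 1))"
    have pos: "0 < ?n * (measure lborel K + 1)" by (intro mult_pos_pos) (auto simp: add_nonneg_pos)
    have e': "0 < e'" using e pos by (simp add: e'_def)
    have "?n * (e' * measure lborel K) \<le> e' * (?n * (measure lborel K + 1))"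
      using e' by (simp add: algebra_simps)
    also have "\<dots> = e"
    proof -
      have "e / P * P = e" if "0 < P" for P using that by simp
      from this[OF pos] show ?thesis by (simp only: e'_def)
    qed
    finally show "?n * (LINT x|lborel. \<bar>\<phi> x\<bar>) \<le> (LINT x|lborel. norm x * norm (grad \<phi> x)) + e"
      using approx[OF e'] by linarith
  qed
qed

lemma lebesgue_on_eq_lborel:
  fixes g :: "'a::euclidean_space \<Rightarrow> real"
  assumes "D \<in> sets lebesgue" "\<And>x. x \<notin> D \<Longrightarrow> g x = 0" "g \<in> borel_measurable borel"
  shows "(LINT x|lebesgue_on D. g x) = (LINT x|lborel. g x)"
  using assms by (simp add: integral_lebesgue_on_support integral_completion)

lemma integrable_mult_bounded:
  fixes f g :: "'a \<Rightarrow> real"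
  assumes f: "integrable M f" and g: "g \<in> borel_measurable M" and C: "AE x in M. \<bar>g x\<bar> \<le> C"
  shows "integrable M (\<lambda>x. g x * f x)"
proof (rule Bochner_Integration.integrable_bound)
  show "integrable M (\<lambda>x. C * f x)" using f by simp
  show "(\<lambda>x. g x * f x) \<in> borel_measurable M" using f g by simp
  show "AE x in M. norm (g x * f x) \<le> norm (C * f x)"
    using C by eventually_elim (auto simp: abs_mult intro!: mult_right_mono)
qed

lemma borel_measurable_lebesgue_on:
  "f \<in> borel_measurable borel \<Longrightarrow> f \<in> borel_measurable (lebesgue_on D)"
  by (intro measurable_restrict_space1) (simp add: measurable_completion)

text \<open>The identity and the bound pass from test functions to \<open>u\<close> by approximation
  in the 1-norm: \<open>x\<close> is bounded on \<open>D\<close>, so products of the gradients with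
  \<open>x\<close> converge as well.\<close>

lemma
  fixes u :: "'a::euclidean_space \<Rightarrow> real"
  assumes D: "open D" "bounded D" and p: "1 \<le> p" and u: "in_W1p_0 D p u"
  shows W1p_0_integral_eq: "real DIM('a) * (LINT x|lebesgue_on D. u x) = - (LINT x|lebesgue_on D. x \<bullet> weak_gradient D u x)"
    and W1p_0_L1_bound: "real DIM('a) * (LINT x|lebesgue_on D. \<bar>u x\<bar>) \<le> (LINT x|lebesgue_on D. norm x * norm (weak_gradient D u x))"
    and W1p_0_inner_integrable: "integrable (lebesgue_on D) (\<lambda>x. x \<bullet> weak_gradient D u x)"
    and W1p_0_norm_integrable: "integrable (lebesgue_on D) (\<lambda>x. norm x * norm (weak_gradient D u x))"
proof -
  let ?n = "real DIM('a)" and ?M = "lebesgue_on D" and ?g = "weak_gradient D u"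
  obtain R where R: "0 < R" "\<And>x. x \<in> D \<Longrightarrow> norm x \<le> R" using D(2) bounded_pos by metis
  have Dm: "D \<in> lmeasurable" and Ds: "D \<in> sets lebesgue" using D lmeasurable_open_bounded by auto
  note int = W1p_0_integrable[OF D p u]
  have [measurable]: "?g \<in> borel_measurable ?M" using int(2) by auto
  have [measurable]: "(\<lambda>x. x) \<in> borel_measurable ?M" by (rule borel_measurable_lebesgue_on) simp
  have normR: "AE x in ?M. \<bar>norm x\<bar> \<le> R" using R by (intro AE_I2) auto
  have intn: "integrable ?M (\<lambda>x. norm x * norm (h x))" if "integrable ?M h" for h :: "'a \<Rightarrow> 'a"
    by (rule integrable_mult_bounded[OF integrable_norm[OF that] _ normR]) (rule borel_measurable_lebesgue_on, simp)
  have inti: "integrable ?M (\<lambda>x. x \<bullet> h x)" if h: "integrable ?M h" for h :: "'a \<Rightarrow> 'a"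
  proof (rule Bochner_Integration.integrable_bound[OF intn[OF h]])
    have [measurable]: "h \<in> borel_measurable ?M" using h by auto
    show "(\<lambda>x. x \<bullet> h x) \<in> borel_measurable ?M" by measurable
    show "AE x in ?M. norm (x \<bullet> h x) \<le> norm (norm x * norm (h x))"
      by (intro AE_I2) (auto intro: Cauchy_Schwarz_ineq2)
  qed
  show "integrable ?M (\<lambda>x. x \<bullet> ?g x)" using int(2) by (rule inti)
  show "integrable ?M (\<lambda>x. norm x * norm (?g x))" using int(2) by (rule intn)
  have approx: "\<exists>\<phi>. test_function D \<phi> \<and> integrable ?M \<phi> \<and> integrable ?M (grad \<phi>) \<and> (LINT x|?M. \<bar>u x - \<phi> x\<bar>) < \<eta> \<and>
      (LINT x|?M. norm x * norm (?g x - grad \<phi> x)) \<le> R * \<eta>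
      \<and> (LINT x|lborel. \<phi> x) = (LINT x|?M. \<phi> x) \<and> (LINT x|lborel. \<bar>\<phi> x\<bar>) = (LINT x|?M. \<bar>\<phi> x\<bar>)
      \<and> (LINT x|lborel. x \<bullet> grad \<phi> x) = (LINT x|?M. x \<bullet> grad \<phi> x)
      \<and> (LINT x|lborel. norm x * norm (grad \<phi> x)) = (LINT x|?M. norm x * norm (grad \<phi> x))" if \<eta>: "0 < \<eta>" for \<eta>
  proof -
    obtain \<phi> where \<phi>: "test_function D \<phi>" "(LINT x|?M. \<bar>u x - \<phi> x\<bar>) < \<eta>" "(LINT x|?M. norm (?g x - grad \<phi> x)) < \<eta>"
      using W1p_0_approx[OF D p u \<eta>] by metis
    obtain K where K: "compact K" "K \<subseteq> D" "\<And>x. x \<notin> K \<Longrightarrow> \<phi> x = 0" using test_functionE[OF \<phi>(1)] by metis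
    have gK: "grad \<phi> x = 0" if "x \<notin> D" for x
    proof -
      have "x \<notin> K" using that K(2) by blast
      have "partial_deriv b \<phi> x = 0" for b using K(1,3) \<open>x \<notin> K\<close> by (rule partial_deriv_outside_support)
      then show ?thesis by (simp add: grad_def)
    qed
    have 0: "\<phi> x = 0" if "x \<notin> D" for x using that K(2) by (intro K(3)) blast
    have [measurable]: "\<phi> \<in> borel_measurable borel" "grad \<phi> \<in> borel_measurable borel"
      by (intro test_function_measurable[OF \<phi>(1)] borel_measurable_continuous_onI continuous_on_grad_test[OF \<phi>(1)])+
    have i: "integrable ?M \<phi>" "integrable ?M (grad \<phi>)"
      by (intro L1_bound_of_Lp(1)[OF Dm, of 1] in_Lp_test[OF Dm _ \<phi>(1)]; simp)+
    have "(LINT x|?M. norm x * norm (?g x - grad \<phi> x)) \<le> (LINT x|?M. R * norm (?g x - grad \<phi> x))"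
      using i int(2) R by (intro integral_mono intn) (auto intro!: mult_right_mono)
    also have "\<dots> \<le> R * \<eta>" using \<phi>(3) R by simp
    finally show ?thesis
      using \<phi> i gK 0 by (intro exI[of _ \<phi>]) (auto intro!: lebesgue_on_eq_lborel[symmetric] Ds)
  qed
  show "?n * (LINT x|?M. u x) = - (LINT x|?M. x \<bullet> ?g x)"
  proof -
    have le: "\<bar>?n * (LINT x|?M. u x) + (LINT x|?M. x \<bullet> ?g x)\<bar> \<le> e" if e: "0 < e" for e
    proof -
      \<comment> \<open>The error is at most \<open>n * \<eta>\<close> from the function and
        \<open>R * \<eta>\<close> from the gradient, where \<open>R\<close> bounds
        \<open>norm x\<close> on \<open>D\<close>.\<close>
      define \<eta> where "\<eta> = e / (?n + R)"
      have nR: "0 < ?n + R" using R by (simp add: add_nonneg_pos)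
      have \<eta>: "0 < \<eta>" "(?n + R) * \<eta> = e" using e nR by (auto simp: \<eta>_def)
      obtain \<phi> where \<phi>: "test_function D \<phi>" "integrable ?M \<phi>" "integrable ?M (grad \<phi>)" "(LINT x|?M. \<bar>u x - \<phi> x\<bar>) < \<eta>"
        "(LINT x|?M. norm x * norm (?g x - grad \<phi> x)) \<le> R * \<eta>"
        "(LINT x|lborel. \<phi> x) = (LINT x|?M. \<phi> x)" "(LINT x|lborel. x \<bullet> grad \<phi> x) = (LINT x|?M. x \<bullet> grad \<phi> x)"
        using approx[OF \<eta>(1)] by blast
      have "?n * (LINT x|?M. u x) + (LINT x|?M. x \<bullet> ?g x) = ?n * (LINT x|?M. u x - \<phi> x) + (LINT x|?M. x \<bullet> (?g x - grad \<phi> x))"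
        using test_function_integral_eq[OF \<phi>(1)] int(1,2) \<phi>(2,3,6,7) inti by (simp add: inner_diff_right algebra_simps)
      moreover have "\<bar>LINT x|?M. u x - \<phi> x\<bar> \<le> \<eta>"
        using integral_abs_bound[of ?M "\<lambda>x. u x - \<phi> x"] \<phi>(4) by linarith
      moreover have "\<bar>LINT x|?M. x \<bullet> (?g x - grad \<phi> x)\<bar> \<le> R * \<eta>"
      proof -
        have "\<bar>LINT x|?M. x \<bullet> (?g x - grad \<phi> x)\<bar> \<le> (LINT x|?M. \<bar>x \<bullet> (?g x - grad \<phi> x)\<bar>)" by (rule integral_abs_bound)
        also have "\<dots> \<le> (LINT x|?M. norm x * norm (?g x - grad \<phi> x))"
          using \<phi>(3) int(2) by (intro integral_mono integrable_abs inti intn Cauchy_Schwarz_ineq2) auto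
        finally show ?thesis using \<phi>(5) by linarith
      qed
      moreover have "\<bar>?n * (LINT x|?M. u x - \<phi> x)\<bar> \<le> ?n * \<eta>"
        unfolding abs_mult using calculation(2) by (simp add: mult_left_mono)
      ultimately show ?thesis using \<eta>(2) by (simp add: distrib_right)
    qed
    have "\<bar>?n * (LINT x|?M. u x) + (LINT x|?M. x \<bullet> ?g x)\<bar> \<le> 0"
    proof (rule field_le_epsilon)
      fix e :: real assume "0 < e"
      from le[OF this] show "\<bar>?n * (LINT x|?M. u x) + (LINT x|?M. x \<bullet> ?g x)\<bar> \<le> 0 + e" by linarith
    qed
    then show ?thesis by linarith
  qed
  show "?n * (LINT x|?M. \<bar>u x\<bar>) \<le> (LINT x|?M. norm x * norm (?g x))"
  proof (rule field_le_epsilon)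
    fix e :: real assume e: "0 < e"
    define \<eta> where "\<eta> = e / (?n + R)"
    have nR: "0 < ?n + R" using R by (simp add: add_nonneg_pos)
    have \<eta>: "0 < \<eta>" "(?n + R) * \<eta> = e" using e nR by (auto simp: \<eta>_def)
    obtain \<phi> where \<phi>: "test_function D \<phi>" "integrable ?M \<phi>" "integrable ?M (grad \<phi>)" "(LINT x|?M. \<bar>u x - \<phi> x\<bar>) < \<eta>"
      "(LINT x|?M. norm x * norm (?g x - grad \<phi> x)) \<le> R * \<eta>"
      "(LINT x|lborel. \<bar>\<phi> x\<bar>) = (LINT x|?M. \<bar>\<phi> x\<bar>)" "(LINT x|lborel. norm x * norm (grad \<phi> x)) = (LINT x|?M. norm x * norm (grad \<phi> x))"
      using approx[OF \<eta>(1)] by blast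
    have "(LINT x|?M. \<bar>u x\<bar>) \<le> (LINT x|?M. \<bar>u x - \<phi> x\<bar> + \<bar>\<phi> x\<bar>)"
      using int(1) \<phi>(2) by (intro integral_mono) auto
    also have "\<dots> = (LINT x|?M. \<bar>u x - \<phi> x\<bar>) + (LINT x|?M. \<bar>\<phi> x\<bar>)" using int(1) \<phi>(2) by simp
    finally have "?n * (LINT x|?M. \<bar>u x\<bar>) \<le> ?n * (\<eta> + (LINT x|?M. \<bar>\<phi> x\<bar>))"
      using \<phi>(4) by (intro mult_left_mono) auto
    also have "\<dots> \<le> ?n * \<eta> + (LINT x|?M. norm x * norm (grad \<phi> x))"
      using test_function_L1_bound[OF \<phi>(1) Dm] \<phi>(6,7) by (simp add: distrib_left)
    also have "(LINT x|?M. norm x * norm (grad \<phi> x)) \<le> (LINT x|?M. norm x * norm (?g x - grad \<phi> x) + norm x * norm (?g x))"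
    proof (intro integral_mono intn \<phi>(3) Bochner_Integration.integrable_add int(2) Bochner_Integration.integrable_diff)
      show "norm x * norm (grad \<phi> x) \<le> norm x * norm (?g x - grad \<phi> x) + norm x * norm (?g x)" for x
        unfolding distrib_left[symmetric] using norm_triangle_ineq3[of "grad \<phi> x" "?g x"]
        by (intro mult_left_mono) (auto simp: norm_minus_commute)
    qed
    also have "\<dots> = (LINT x|?M. norm x * norm (?g x - grad \<phi> x)) + (LINT x|?M. norm x * norm (?g x))"
      using \<phi>(3) int(2) by (intro Bochner_Integration.integral_add intn) auto
    finally show "?n * (LINT x|?M. \<bar>u x\<bar>) \<le> (LINT x|?M. norm x * norm (?g x)) + e"
      using \<phi>(5) \<eta>(2) by (simp add: distrib_right)
  qed
qed

section \<open>Radial cutoffs\<close>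

text \<open>For a unit vector \<open>b\<close> the squared norm along the line is a monic quadratic
  polynomial in \<open>t\<close>.\<close>

lemma finite_norm_line_eq:
  fixes b x :: "'a::euclidean_space"
  assumes b: "norm b = 1"
  shows "finite {t. norm (t *\<^sub>R b + x) = \<rho>}"
proof -
  let ?p = "[:x \<bullet> x - \<rho>\<^sup>2, 2 * (b \<bullet> x), 1:]"
  have "{t. norm (t *\<^sub>R b + x) = \<rho>} \<subseteq> {t. poly ?p t = 0}"
  proof
    fix t assume "t \<in> {t. norm (t *\<^sub>R b + x) = \<rho>}"
    then have "(t *\<^sub>R b + x) \<bullet> (t *\<^sub>R b + x) = \<rho>\<^sup>2" by (simp add: power2_norm_eq_inner[symmetric])
    moreover have "b \<bullet> b = 1" using b by (simp add: norm_eq_1)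
    ultimately show "t \<in> {t. poly ?p t = 0}"
      by (simp add: inner_add_left inner_add_right inner_commute algebra_simps)
  qed
  moreover have "finite {t. poly ?p t = 0}" by (rule poly_roots_finite) simp
  ultimately show ?thesis by (rule finite_subset)
qed

lemma radial_cutoff_integrable:
  fixes \<psi> :: "'a::euclidean_space \<Rightarrow> real"
  assumes \<psi>: "test_function D \<psi>" and b: "b \<in> Basis" and \<kappa>: "0 < \<kappa>"
  shows "integrable lborel (\<lambda>x. (if \<kappa> * norm x ^ N < s then \<kappa> * (N * norm x ^ (N - 1)) * (sgn x \<bullet> b) else 0) * \<psi> x)"
    (is "integrable lborel (\<lambda>x. ?w x * \<psi> x)")
proof (rule Bochner_Integration.integrable_bound)
  show "integrable lborel (\<lambda>x. (\<kappa> * (N * norm x ^ (N - 1))) * \<psi> x)"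
    by (intro test_function_integrable[OF \<psi>] continuous_intros)
  show "(\<lambda>x. ?w x * \<psi> x) \<in> borel_measurable lborel"
    using test_function_measurable[OF \<psi>] by measurable
  have "\<bar>sgn x \<bullet> b\<bar> \<le> 1" for x :: 'a
    using Cauchy_Schwarz_ineq2[of "sgn x" b] b by (auto simp: norm_sgn split: if_splits)
  then have bound: "\<bar>?w x\<bar> \<le> \<kappa> * (N * norm x ^ (N - 1))" for x
    using \<kappa> by (auto simp: abs_mult mult_left_le)
  show "AE x in lborel. norm (?w x * \<psi> x) \<le> norm (\<kappa> * (N * norm x ^ (N - 1)) * \<psi> x)"
  proof (rule AE_I2)
    have "\<bar>a * p\<bar> \<le> \<bar>c * p\<bar>" if "\<bar>a\<bar> \<le> c" for a c p :: real
      using that mult_right_mono[OF that, of "\<bar>p\<bar>"] by (simp add: abs_mult)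
    from this[OF bound] show "norm (?w x * \<psi> x) \<le> norm (\<kappa> * (N * norm x ^ (N - 1)) * \<psi> x)" for x
      unfolding real_norm_def .
  qed
qed

text \<open>Two uses: \<open>\<kappa>\<close> an inverse power of a radius \<open>r\<close>, with
  growing exponent, approximates the indicator of the ball of radius \<open>r\<close>;
  \<open>\<kappa>\<close> the unit ball volume, with the dimension as exponent, gives
  \<open>s\<close> minus the volume of the ball through \<open>x\<close>.\<close>

lemma radial_cutoff_integral_by_parts:
  fixes \<psi> :: "'a::euclidean_space \<Rightarrow> real"
  assumes \<psi>: "test_function D \<psi>" and b: "b \<in> Basis" and \<kappa>: "0 < \<kappa>" and N: "1 \<le> N"
  shows "(LINT x|lborel. max 0 (s - \<kappa> * norm x ^ N) * partial_deriv b \<psi> x)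
    = (LINT x|lborel. (if \<kappa> * norm x ^ N < s then \<kappa> * (N * norm x ^ (N - 1)) * (sgn x \<bullet> b) else 0) * \<psi> x)"
proof -
  let ?w = "\<lambda>x::'a. max 0 (s - \<kappa> * norm x ^ N)"
  let ?w' = "\<lambda>x::'a. - (if \<kappa> * norm x ^ N < s then \<kappa> * (N * norm x ^ (N - 1)) * (sgn x \<bullet> b) else 0)"
  have nb: "norm b = 1" using b by simp
  have "(LINT x|lborel. ?w x * partial_deriv b \<psi> x) = - (LINT x|lborel. ?w' x * \<psi> x)"
  \<comment> \<open>The cutoff can fail to be differentiable on the sphere where it reaches 0 and at
    the origin; a line meets both in finitely many points.\<close>
  proof (rule test_function_integral_by_parts[OF \<psi> _ _ _ b,
        where E="\<lambda>x. {t. norm (t *\<^sub>R b + x) = root N (s / \<kappa>)} \<union> {t. norm (t *\<^sub>R b + x) = 0}"])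
    show "continuous_on UNIV ?w" by (intro continuous_intros)
    show "finite ({t. norm (t *\<^sub>R b + x) = root N (s / \<kappa>)} \<union> {t. norm (t *\<^sub>R b + x) = 0})" for x
      using finite_norm_line_eq[OF nb] by blast
    show "integrable lborel (\<lambda>x. ?w' x * \<psi> x)"
      using radial_cutoff_integrable[OF \<psi> b \<kappa>, of N s] by simp
    fix x t assume "t \<notin> {t. norm (t *\<^sub>R b + x) = root N (s / \<kappa>)} \<union> {t. norm (t *\<^sub>R b + x) = 0}"
    then have nz: "t *\<^sub>R b + x \<noteq> 0" and ne: "norm (t *\<^sub>R b + x) \<noteq> root N (s / \<kappa>)" by auto
    let ?z = "t *\<^sub>R b + x"
    have ne': "\<kappa> * norm ?z ^ N \<noteq> s"
    proof
      assume "\<kappa> * norm ?z ^ N = s"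
      then have "norm ?z ^ N = s / \<kappa>" using \<kappa> by (simp add: field_simps)
      then have "norm ?z = root N (s / \<kappa>)" using N by (metis norm_ge_zero real_root_power_cancel less_le_trans zero_less_one)
      with ne show False by simp
    qed
    have "((\<lambda>t. t *\<^sub>R b + x) has_derivative (\<lambda>h. h *\<^sub>R b)) (at t)" by (auto intro!: derivative_eq_intros)
    from has_derivative_compose[OF this has_derivative_norm[OF nz]]
    have dn: "((\<lambda>t. norm (t *\<^sub>R b + x)) has_real_derivative (sgn ?z \<bullet> b)) (at t)"
      by (simp add: has_field_derivative_def mult_commute_abs inner_commute)
    define h where "h t = s - \<kappa> * norm (t *\<^sub>R b + x) ^ N" for t
    have dp: "(h has_real_derivative - (\<kappa> * (N * norm ?z ^ (N - 1)) * (sgn ?z \<bullet> b))) (at t)"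
      unfolding h_def by (rule derivative_eq_intros dn refl | simp)+
    note cont = DERIV_isCont[OF dp, unfolded isCont_def tendsto_at_iff_tendsto_nhds]
    have "((\<lambda>t. ?w (t *\<^sub>R b + x)) has_real_derivative ?w' ?z) (at t)"
    proof (cases "\<kappa> * norm ?z ^ N < s")
      case True
      have "\<forall>\<^sub>F t' in nhds t. 0 < h t'"
        using order_tendstoD(1)[OF cont, of 0] True by (simp add: h_def)
      then have "\<forall>\<^sub>F t' in nhds t. h t' = ?w (t' *\<^sub>R b + x)" by eventually_elim (simp add: h_def)
      from DERIV_cong_ev[OF refl this refl, THEN iffD1, OF dp] show ?thesis using True by simp
    next
      case False
      have "\<forall>\<^sub>F t' in nhds t. h t' < 0"
        using order_tendstoD(2)[OF cont, of 0] False ne' by (simp add: h_def)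
      then have "\<forall>\<^sub>F t' in nhds t. 0 = ?w (t' *\<^sub>R b + x)" by eventually_elim (simp add: h_def)
      from DERIV_cong_ev[OF refl this refl, THEN iffD1, OF DERIV_const] show ?thesis using False by simp
    qed
    then show "((\<lambda>t. ?w (t *\<^sub>R b + x)) has_vector_derivative ?w' ?z) (at t)"
      by (simp add: has_real_derivative_iff_has_vector_derivative)
  qed
  then show ?thesis by simp
qed

section \<open>Radially decreasing functions\<close>

text \<open>The hypothesis on \<open>\<Psi>\<close> says that the vector field with components \<open>\<Psi> b\<close> points outwards.\<close>

lemma outward_field_ball_divergence_nonneg:
  fixes \<Psi> :: "'a::euclidean_space \<Rightarrow> 'a \<Rightarrow> real"
  assumes \<Psi>: "\<And>b. b \<in> Basis \<Longrightarrow> test_function D (\<Psi> b)" and out: "\<And>x. 0 \<le> (\<Sum>b\<in>Basis. (x \<bullet> b) * \<Psi> b x)"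
    and r: "0 < r"
  shows "0 \<le> (LINT x|lborel. indicator (ball 0 r) x * (\<Sum>b\<in>Basis. partial_deriv b (\<Psi> b) x))" (is ?open)
    and "0 \<le> (LINT x|lborel. indicator (cball 0 r) x * (\<Sum>b\<in>Basis. partial_deriv b (\<Psi> b) x))" (is ?closed)
proof -
  define dv where "dv x = (\<Sum>b\<in>Basis. partial_deriv b (\<Psi> b) x)" for x
  have pd: "test_function D (partial_deriv b (\<Psi> b))" if "b \<in> Basis" for b
    using \<Psi>[OF that] that by (rule test_function_partial_deriv)
  have [measurable]: "dv \<in> borel_measurable borel"
    unfolding dv_def[abs_def] using test_function_measurable[OF pd] by (intro borel_measurable_sum)
  have [measurable]: "ball 0 t \<in> sets borel" "cball 0 t \<in> sets borel" for t :: real by simp_all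
  have int: "integrable lborel dv"
    unfolding dv_def[abs_def] using test_function_integrable[OF pd continuous_on_const[of UNIV 1]] by (intro Bochner_Integration.integrable_sum) simp
  have main: "0 \<le> (LINT x|lborel. indicator (ball 0 r) x * dv x)" if r: "0 < r" for r
  proof -
    \<comment> \<open>That is \<open>1 - (norm x / r) ^ (N + 1)\<close> cut off at 0: continuous,
      between 0 and 1, and tending to the indicator of the ball. It decreases along rays, so after
      integration by parts the outward field is tested against a nonnegative weight.\<close>
    let ?w = "\<lambda>N x::'a. max 0 (1 - inverse (r ^ Suc N) * norm x ^ Suc N)"
    have w_le: "0 \<le> ?w N x \<and> ?w N x \<le> 1" for N x using r by simp
    have lim: "(\<lambda>N. LINT x|lborel. ?w N x * dv x) \<longlonglongrightarrow> (LINT x|lborel. indicator (ball 0 r) x * dv x)"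
    proof (rule integral_dominated_convergence[where w="\<lambda>x. \<bar>dv x\<bar>"])
      show "integrable lborel (\<lambda>x. \<bar>dv x\<bar>)" using int by (rule integrable_abs)
      show "AE x in lborel. norm (?w N x * dv x) \<le> \<bar>dv x\<bar>" for N
        unfolding real_norm_def abs_mult using w_le[of N] by (intro AE_I2 mult_left_le_one_le) auto
      show "AE x in lborel. (\<lambda>N. ?w N x * dv x) \<longlonglongrightarrow> indicator (ball 0 r) x * dv x"
      proof (intro AE_I2 tendsto_mult tendsto_const)
        fix x :: 'a
        have eq: "inverse (r ^ Suc N) * norm x ^ Suc N = (norm x / r) ^ Suc N" for N
          by (simp add: power_divide divide_inverse power_inverse mult.commute power_mult_distrib)
        show "(\<lambda>N. ?w N x) \<longlonglongrightarrow> indicator (ball 0 r) x"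
        proof (cases "norm x < r")
          case True
          have "(\<lambda>N. (norm x / r) ^ Suc N) \<longlonglongrightarrow> 0"
            using True r by (intro LIMSEQ_Suc LIMSEQ_power_zero) auto
          then have "(\<lambda>N. ?w N x) \<longlonglongrightarrow> max 0 (1 - 0)" unfolding eq by (intro tendsto_intros)
          then show ?thesis using True by simp
        next
          case False
          then have "1 \<le> norm x / r" using r by simp
          then have "?w N x = 0" for N unfolding eq using one_le_power[of "norm x / r" "Suc N"] by simp
          then show ?thesis using False by simp
        qed
      qed
    qed measurable
    show ?thesis
    proof (rule LIMSEQ_le_const[OF lim], intro exI allI impI)
      fix N
      let ?\<kappa> = "inverse (r ^ Suc N)"
      define v where "v b x = (if ?\<kappa> * norm x ^ Suc N < 1 then ?\<kappa> * (Suc N * norm x ^ (Suc N - 1)) * (sgn x \<bullet> b) else 0) * \<Psi> b x" for b x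
      have \<kappa>: "0 < ?\<kappa>" using r by simp
      have w: "continuous_on UNIV (?w N)" by (intro continuous_intros)
      have parts: "(LINT x|lborel. ?w N x * partial_deriv b (\<Psi> b) x) = (LINT x|lborel. v b x)" if b: "b \<in> Basis" for b
        unfolding v_def by (rule radial_cutoff_integral_by_parts[OF \<Psi>[OF b] b \<kappa>]) simp
      have intv: "integrable lborel (v b)" if b: "b \<in> Basis" for b
        unfolding v_def by (rule radial_cutoff_integrable[OF \<Psi>[OF b] b \<kappa>])
      have "(LINT x|lborel. ?w N x * dv x) = (\<Sum>b\<in>Basis. (LINT x|lborel. ?w N x * partial_deriv b (\<Psi> b) x))"
        unfolding dv_def sum_distrib_left using test_function_integrable[OF pd w] by (intro Bochner_Integration.integral_sum)
      also have "\<dots> = (\<Sum>b\<in>Basis. (LINT x|lborel. v b x))" by (intro sum.cong refl parts)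
      also have "\<dots> = (LINT x|lborel. (\<Sum>b\<in>Basis. v b x))"
        using intv by (intro Bochner_Integration.integral_sum[symmetric])
      also have "0 \<le> \<dots>"
      proof (intro integral_nonneg_AE AE_I2)
        fix x :: 'a
        have "(\<Sum>b\<in>Basis. (sgn x \<bullet> b) * \<Psi> b x) = inverse (norm x) * (\<Sum>b\<in>Basis. (x \<bullet> b) * \<Psi> b x)"
          by (simp add: sgn_div_norm sum_distrib_left mult_ac)
        then have "0 \<le> (\<Sum>b\<in>Basis. (sgn x \<bullet> b) * \<Psi> b x)" using out[of x] by simp
        then have "0 \<le> ?\<kappa> * (Suc N * norm x ^ N) * (\<Sum>b\<in>Basis. (sgn x \<bullet> b) * \<Psi> b x)"
          using r by (intro mult_nonneg_nonneg) auto
        then show "0 \<le> (\<Sum>b\<in>Basis. v b x)"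
          unfolding v_def by (cases "?\<kappa> * norm x ^ Suc N < 1") (simp_all add: sum_distrib_left mult_ac)
      qed
      finally show "0 \<le> (LINT x|lborel. ?w N x * dv x)" .
    qed
  qed
  show ?open unfolding dv_def[symmetric] using main[OF r] .
  \<comment> \<open>The closed ball is the decreasing limit of slightly larger open balls.\<close>
  have lim: "(\<lambda>k. LINT x|lborel. indicator (ball 0 (r + inverse (Suc k))) x * dv x) \<longlonglongrightarrow> (LINT x|lborel. indicator (cball 0 r) x * dv x)"
  proof (rule integral_dominated_convergence[where w="\<lambda>x. \<bar>dv x\<bar>"])
    show "integrable lborel (\<lambda>x. \<bar>dv x\<bar>)" using int by (rule integrable_abs)
    show "AE x in lborel. norm (indicator (ball 0 (r + inverse (Suc k))) x * dv x) \<le> \<bar>dv x\<bar>" for k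
      by (intro AE_I2) (auto simp: indicator_def)
    show "AE x in lborel. (\<lambda>k. indicator (ball 0 (r + inverse (Suc k))) x * dv x) \<longlonglongrightarrow> indicator (cball 0 r) x * dv x"
    proof (intro AE_I2 tendsto_mult tendsto_const)
      fix x :: 'a
      show "(\<lambda>k. indicator (ball 0 (r + inverse (real (Suc k)))) x) \<longlonglongrightarrow> (indicator (cball 0 r) x :: real)"
      proof (cases "norm x \<le> r")
        case True
        have "norm x < r + inverse (real (Suc k))" for k
          using True by (intro le_less_trans[OF True]) simp
        then have "indicator (ball 0 (r + inverse (real (Suc k)))) x = (indicator (cball 0 r) x :: real)" for k
          using True by (simp add: indicator_def)
        then show ?thesis by (intro tendsto_eventually always_eventually) simp
      next
        case False
        have "\<forall>\<^sub>F k in sequentially. inverse (real (Suc k)) < norm x - r"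
          using False by (intro order_tendstoD(2)[OF LIMSEQ_inverse_real_of_nat]) simp
        then have "\<forall>\<^sub>F k in sequentially. indicator (ball 0 (r + inverse (real (Suc k)))) x = (indicator (cball 0 r) x :: real)"
          by eventually_elim (use False in \<open>auto simp: indicator_def\<close>)
        then show ?thesis by (rule tendsto_eventually)
      qed
    qed
  qed measurable
  show ?closed unfolding dv_def[symmetric]
  proof (rule LIMSEQ_le_const[OF lim], intro exI allI impI)
    fix k
    have "0 < r + inverse (real (Suc k))" using r by (simp add: add_pos_pos)
    then show "0 \<le> (LINT x|lborel. indicator (ball 0 (r + inverse (Suc k))) x * dv x)" by (rule main)
  qed
qed

text \<open>The radius is the supremum of the norms, and the ball is closed or open according to
  whether it is attained. The origin stays out because a radial profile is constrained only away
  from it.\<close>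

lemma radially_down_closed_cases:
  fixes S :: "'a::euclidean_space set"
  assumes down: "\<And>x y. x \<in> S \<Longrightarrow> y \<noteq> 0 \<Longrightarrow> norm y \<le> norm x \<Longrightarrow> y \<in> S"
    and bd: "\<And>x. x \<in> S \<Longrightarrow> norm x \<le> \<rho>" and z: "0 \<notin> S"
  shows "S = {} \<or> (\<exists>r>0. S = ball 0 r - {0}) \<or> (\<exists>r>0. S = cball 0 r - {0})"
proof (cases "S = {}")
  case False
  define r where "r = Sup (norm ` S)"
  have ba: "bdd_above (norm ` S)" using bd by (intro bdd_aboveI[of _ \<rho>]) auto
  have le: "norm x \<le> r" if "x \<in> S" for x unfolding r_def using that ba by (intro cSup_upper) auto
  have lt: "y \<in> S" if y: "y \<noteq> 0" "norm y < r" for y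
  proof -
    obtain x where "x \<in> S" "norm y < norm x"
      using y(2) False less_cSup_iff[OF _ ba, of "norm y"] unfolding r_def by auto
    then show ?thesis using down[of x y] y by simp
  qed
  obtain x0 where x0: "x0 \<in> S" using False by auto
  have "0 < norm x0" using x0 z by auto
  then have r: "0 < r" using le[OF x0] by linarith
  show ?thesis
  proof (cases "\<exists>x\<in>S. norm x = r")
    case True
    then have "S = cball 0 r - {0}" using le down z by fastforce
    then show ?thesis using r by blast
  next
    case False
    then have "S = ball 0 r - {0}" using le lt z by fastforce
    then show ?thesis using r by blast
  qed
qed simp

text \<open>Reduces to balls, since the missing origin is a null set. Measurability of
  \<open>S\<close> is a by-product of the classification.\<close>

lemma outward_field_down_closed_divergence_nonneg:
  fixes \<Psi> :: "'a::euclidean_space \<Rightarrow> 'a \<Rightarrow> real"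
  assumes \<Psi>: "\<And>b. b \<in> Basis \<Longrightarrow> test_function D (\<Psi> b)" and out: "\<And>x. 0 \<le> (\<Sum>b\<in>Basis. (x \<bullet> b) * \<Psi> b x)"
    and down: "\<And>x y. x \<in> S \<Longrightarrow> y \<noteq> 0 \<Longrightarrow> norm y \<le> norm x \<Longrightarrow> y \<in> S"
    and bd: "\<And>x. x \<in> S \<Longrightarrow> norm x \<le> \<rho>" and z: "0 \<notin> S"
  shows "0 \<le> (LINT x|lborel. indicator S x * (\<Sum>b\<in>Basis. partial_deriv b (\<Psi> b) x))"
    and "S \<in> sets borel"
proof -
  define dv where "dv x = (\<Sum>b\<in>Basis. partial_deriv b (\<Psi> b) x)" for x
  have [measurable]: "dv \<in> borel_measurable borel"
    unfolding dv_def[abs_def] using test_function_measurable[OF test_function_partial_deriv[OF \<Psi>]] by (intro borel_measurable_sum)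
  have punct: "(LINT x|lborel. indicator (T - {0}) x * dv x) = (LINT x|lborel. indicator T x * dv x)"
    if [measurable]: "T \<in> sets borel" for T
    using AE_lborel_singleton[of "0::'a"] by (intro integral_cong_AE) (auto simp: indicator_def)
  have c: "S = {} \<or> (\<exists>r>0. S = ball 0 r - {0}) \<or> (\<exists>r>0. S = cball 0 r - {0})"
    by (rule radially_down_closed_cases[OF _ bd z]) (use down in blast)
  have op: "0 \<le> (LINT x|lborel. indicator (ball 0 r) x * dv x)" if "0 < r" for r
    unfolding dv_def by (rule outward_field_ball_divergence_nonneg(1)[OF \<Psi> out that])
  have cl: "0 \<le> (LINT x|lborel. indicator (cball 0 r) x * dv x)" if "0 < r" for r
    unfolding dv_def by (rule outward_field_ball_divergence_nonneg(2)[OF \<Psi> out that])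
  show "0 \<le> (LINT x|lborel. indicator S x * (\<Sum>b\<in>Basis. partial_deriv b (\<Psi> b) x))"
    unfolding dv_def[symmetric] using c by (elim disjE exE conjE) (simp_all add: punct op cl)
  show "S \<in> sets borel" using c by (elim disjE exE conjE) simp_all
qed

text \<open>The left-hand side is minus the integral of \<open>w\<close> times the divergence of the
  field. By the layer cake, \<open>w\<close> is an integral of indicators of superlevel sets; these
  are balls up to the origin, and over them the divergence of an outward field has nonnegative
  integral.\<close>

lemma radial_decreasing_outward_field:
  fixes \<Psi> :: "'a::euclidean_space \<Rightarrow> 'a \<Rightarrow> real"
  assumes \<Psi>: "\<And>b. b \<in> Basis \<Longrightarrow> test_function (ball 0 R) (\<Psi> b)" and out: "\<And>x. 0 \<le> (\<Sum>b\<in>Basis. (x \<bullet> b) * \<Psi> b x)"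
    and anti: "antimono_on (norm ` (ball (0::'a) R - {0})) \<phi>"
    and w: "AE x in lebesgue_on (ball 0 R). w x = \<phi> (norm x)"
    and g: "has_weak_gradient (ball 0 R) w g"
  shows "(\<Sum>b\<in>Basis. (LINT x|lebesgue_on (ball 0 R). (g x \<bullet> b) * \<Psi> b x)) \<le> 0"
proof (cases "0 < R")
  case False
  then have e: "ball (0::'a) R = {}" by simp
  show ?thesis unfolding e by simp
next
  case R: True
  let ?B = "ball (0::'a) R"
  define dv where "dv x = (\<Sum>b\<in>Basis. partial_deriv b (\<Psi> b) x)" for x
  have pd: "test_function ?B (partial_deriv b (\<Psi> b))" if "b \<in> Basis" for b
    using \<Psi>[OF that] that by (rule test_function_partial_deriv)
  have "\<exists>K. compact K \<and> K \<subseteq> ?B \<and> (\<forall>x. x \<notin> K \<longrightarrow> \<Psi> b x = 0)" if "b \<in> Basis" for b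
    using test_functionE[OF \<Psi>[OF that]] by metis
  then obtain K where K: "\<And>b. b \<in> Basis \<Longrightarrow> compact (K b) \<and> K b \<subseteq> ?B \<and> (\<forall>x. x \<notin> K b \<longrightarrow> \<Psi> b x = 0)" by metis
  define L where "L = (\<Union>b\<in>Basis. K b)"
  have L: "compact L" "L \<subseteq> ?B" using K unfolding L_def by auto
  have dv0: "dv x = 0" if "x \<notin> L" for x
    unfolding dv_def
  proof (intro sum.neutral ballI)
    fix b :: 'a assume b: "b \<in> Basis"
    have "compact (K b)" "\<And>y. y \<notin> K b \<Longrightarrow> \<Psi> b y = 0" "x \<notin> K b" using K b that by (auto simp: L_def)
    then show "partial_deriv b (\<Psi> b) x = 0" by (rule partial_deriv_outside_support)
  qed
  \<comment> \<open>The profile may be unbounded towards the sphere of radius \<open>R\<close>; a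
    radius \<open>\<rho>\<close> below \<open>R\<close> that encloses the support of the field
    supplies a finite reference value.\<close>
  obtain \<rho> where \<rho>: "0 < \<rho>" "\<rho> < R" "\<And>x. x \<in> L \<Longrightarrow> norm x \<le> \<rho>"
  proof (cases "L = {}")
    case True
    then show ?thesis using that[of "R/2"] R by auto
  next
    case False
    obtain x0 where x0: "x0 \<in> L" "\<And>x. x \<in> L \<Longrightarrow> norm x \<le> norm x0"
      using continuous_attains_sup[OF L(1) False, of norm] by (auto intro: continuous_intros)
    have "norm x0 < R" using x0 L by auto
    then show ?thesis using that[of "max (norm x0) (R/2)"] R x0 by (auto simp: le_max_iff_disj)
  qed
  have rad: "t \<in> norm ` (?B - {0})" if "0 < t" "t < R" for t
  proof -
    obtain b :: 'a where b: "b \<in> Basis" using nonempty_Basis by blast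
    have "t *\<^sub>R b \<in> ?B - {0}" "norm (t *\<^sub>R b) = t" using that b by (auto simp: nonzero_Basis)
    then show ?thesis by (metis image_eqI)
  qed
  \<comment> \<open>Subtracting \<open>\<phi> \<rho>\<close> makes the function nonnegative, as the
    layer cake requires, and leaves the integral unchanged because the divergence of a compactly
    supported field integrates to 0. The measurability of \<open>m\<close> is read off from the
    shape of its superlevel sets.\<close>
  define m where "m x = (if x \<noteq> 0 \<and> norm x \<le> \<rho> then \<phi> (norm x) - \<phi> \<rho> else 0)" for x :: 'a
  have anti': "\<phi> t \<le> \<phi> s" if "0 < s" "s \<le> t" "t < R" for s t
    using monotone_onD[OF anti rad rad, of s t] that by auto
  have m0: "0 \<le> m x" for x using anti'[of "norm x" \<rho>] \<rho> by (auto simp: m_def)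
  have lev: "(0::real) \<le> (LINT x|lborel. indicator {x. t < m x} x * dv x)" "{x. t < m x} \<in> sets borel" if t: "0 \<le> t" for t
  proof -
    have down: "y \<in> {x. t < m x}" if x: "x \<in> {x. t < m x}" and y: "y \<noteq> 0" "norm y \<le> norm x" for x y
    proof -
      have "x \<noteq> 0" "norm x \<le> \<rho>" "t < \<phi> (norm x) - \<phi> \<rho>" using x t by (auto simp: m_def split: if_splits)
      then show ?thesis using y anti'[of "norm y" "norm x"] \<rho> by (auto simp: m_def)
    qed
    have bd: "norm x \<le> \<rho>" if "x \<in> {x. t < m x}" for x using that t by (auto simp: m_def split: if_splits)
    have z: "0 \<notin> {x. t < m x}" using t by (auto simp: m_def)
    show "(0::real) \<le> (LINT x|lborel. indicator {x. t < m x} x * dv x)" "{x. t < m x} \<in> sets borel"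
      unfolding dv_def using outward_field_down_closed_divergence_nonneg[of "?B" \<Psi> "{x. t < m x}" \<rho>, OF \<Psi> out down bd z] by auto
  qed
  have [measurable]: "m \<in> borel_measurable borel"
  proof (rule borel_measurable_iff_greater[THEN iffD2], intro allI)
    fix a :: real
    have "{x. a < m x} = UNIV" if "a < 0" using that m0 by (auto intro: less_le_trans)
    then show "{w \<in> space borel. a < m w} \<in> sets borel" using lev(2)[of a] by (cases "a < 0") auto
  qed
  have [measurable]: "dv \<in> borel_measurable borel"
    unfolding dv_def[abs_def] using test_function_measurable[OF pd] by (intro borel_measurable_sum)
  have Bs: "?B \<in> sets lebesgue" by simp
  have wai: "w absolutely_integrable_on C" "g absolutely_integrable_on C" if "compact C" "C \<subseteq> ?B" for C
    using g that by (auto simp: has_weak_gradient_def)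
  have intb: "integrable (lebesgue_on ?B) (\<lambda>x. w x * partial_deriv b (\<Psi> b) x)" if "b \<in> Basis" for b
    using wai(1) pd[OF that] that by (intro integrable_mult_test_function) auto
  have intwdv: "integrable (lebesgue_on ?B) (\<lambda>x. w x * dv x)"
    unfolding dv_def sum_distrib_left using intb by (intro Bochner_Integration.integrable_sum)
  have dvint: "integrable lborel dv"
    unfolding dv_def[abs_def] using test_function_integrable[OF pd continuous_on_const[of UNIV 1]] by (intro Bochner_Integration.integrable_sum) simp
  have dvint0: "(LINT x|lborel. dv x) = 0"
  proof -
    have "(LINT x|lborel. partial_deriv b (\<Psi> b) x) = 0" if b: "b \<in> Basis" for b
      using smooth_integral_by_parts[OF \<Psi>[OF b] C_k_const[of _ 1] b] by (simp add: partial_deriv_eq[OF has_derivative_const])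
    moreover have "(LINT x|lborel. dv x) = (\<Sum>b\<in>Basis. (LINT x|lborel. partial_deriv b (\<Psi> b) x))"
      unfolding dv_def using test_function_integrable[OF pd continuous_on_const[of UNIV 1]] by (intro Bochner_Integration.integral_sum) simp
    ultimately show ?thesis by simp
  qed
  have aeB: "AE x in lebesgue. x \<in> ?B \<longrightarrow> w x = \<phi> (norm x)"
    using w by (subst (asm) AE_restrict_space_iff) auto
  have ae0: "AE x in lebesgue. x \<noteq> (0::'a)" using AE_lborel_singleton[of "0::'a"] by (rule AE_completion)
  have aeq: "AE x in lebesgue. indicator ?B x *\<^sub>R (w x * dv x) = m x * dv x + \<phi> \<rho> * dv x"
    using aeB ae0
  proof eventually_elim
    case (elim x)
    show ?case
    proof (cases "x \<in> L")
      case True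
      then have "x \<in> ?B" "norm x \<le> \<rho>" using L \<rho> by auto
      then show ?thesis using elim by (simp add: m_def algebra_simps)
    qed (simp add: dv0)
  qed
  have intB: "integrable lebesgue (\<lambda>x. indicator ?B x *\<^sub>R (w x * dv x))"
    using intwdv by (subst (asm) integrable_restrict_space) auto
  have mm: "(\<lambda>x. m x * dv x + \<phi> \<rho> * dv x) \<in> borel_measurable lebesgue"
    by (simp add: measurable_completion)
  have "integrable lebesgue (\<lambda>x. m x * dv x + \<phi> \<rho> * dv x)"
    using intB mm aeq by (rule integrable_cong_AE_imp)
  then have "integrable lborel (\<lambda>x. m x * dv x + \<phi> \<rho> * dv x)"
    by (subst (asm) integrable_completion) simp_all
  then have "integrable lborel (\<lambda>x. (m x * dv x + \<phi> \<rho> * dv x) - \<phi> \<rho> * dv x)"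
    using dvint by (intro Bochner_Integration.integrable_diff) auto
  then have intm: "integrable lborel (\<lambda>x. m x * dv x)" by simp
  define f where "f x t = (if 0 \<le> t \<and> t < m x then dv x else 0)" for x and t :: real
  have f: "f x t = indicator {0..<m x} t * dv x" for x t by (simp add: f_def)
  have fint: "integrable (lborel \<Otimes>\<^sub>M lborel) (case_prod f)"
  proof (rule lborel_pair.Fubini_integrable)
    show "case_prod f \<in> borel_measurable (lborel \<Otimes>\<^sub>M lborel)" unfolding f_def by measurable
    have "(LINT t|lborel. norm (case_prod f (x, t))) = \<bar>m x * dv x\<bar>" for x
      using m0[of x] by (simp add: f abs_mult)
    then show "integrable lborel (\<lambda>x. LINT t|lborel. norm (case_prod f (x, t)))"
      using integrable_abs[OF intm] by simp
    show "AE x in lborel. integrable lborel (\<lambda>t. case_prod f (x, t))"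
      using m0 by (intro AE_I2) (simp add: f)
  qed
  have "(LINT x|lborel. m x * dv x) = (LINT x|lborel. LINT t|lborel. f x t)"
    using m0 by (simp add: f)
  also have "\<dots> = (LINT t|lborel. LINT x|lborel. f x t)"
    using lborel_pair.Fubini_integral[OF fint] by simp
  also have "0 \<le> \<dots>"
  proof (rule integral_nonneg_AE, rule AE_I2)
    fix t :: real
    have "(LINT x|lborel. f x t) = (if 0 \<le> t then (LINT x|lborel. indicator {x. t < m x} x * dv x) else 0)"
      by (auto simp: f_def intro!: Bochner_Integration.integral_cong)
    then show "0 \<le> (LINT x|lborel. f x t)" using lev(1)[of t] by simp
  qed
  finally have mnn: "0 \<le> (LINT x|lborel. m x * dv x)" .
  have "(\<Sum>b\<in>Basis. (LINT x|lebesgue_on ?B. (g x \<bullet> b) * \<Psi> b x)) = (\<Sum>b\<in>Basis. - (LINT x|lebesgue_on ?B. w x * partial_deriv b (\<Psi> b) x))"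
    using g \<Psi> by (intro sum.cong refl) (simp add: has_weak_gradient_def)
  also have "\<dots> = - (LINT x|lebesgue_on ?B. w x * dv x)"
    unfolding dv_def sum_distrib_left using intb by (simp add: Bochner_Integration.integral_sum sum_negf)
  also have "(LINT x|lebesgue_on ?B. w x * dv x) = (LINT x|lebesgue. indicator ?B x *\<^sub>R (w x * dv x))"
    by (intro integral_restrict_space) simp
  also have "\<dots> = (LINT x|lebesgue. m x * dv x + \<phi> \<rho> * dv x)"
    using intB mm aeq by (intro integral_cong_AE) auto
  also have "\<dots> = (LINT x|lborel. m x * dv x + \<phi> \<rho> * dv x)" by (intro integral_completion) simp
  also have "\<dots> = (LINT x|lborel. m x * dv x)" using intm dvint dvint0 by simp
  finally show ?thesis using mnn by simp
qed


text \<open>Fields \<open>\<psi> x\<close> with nonnegative \<open>\<psi>\<close> show that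
  \<open>g\<close> points inwards. Rotational fields in the plane of two basis vectors are
  tangential, hence admissible with both signs, and show that \<open>g\<close> is parallel to
  \<open>x\<close>. Together this is equality in the Cauchy--Schwarz inequality, with negative
  sign.\<close>

lemma radial_decreasing_gradient:
  fixes w :: "'a::euclidean_space \<Rightarrow> real"
  assumes w: "spherically_decreasing_on (ball 0 R) w" and g: "has_weak_gradient (ball 0 R) w g"
  shows "AE x in lebesgue_on (ball 0 R). x \<bullet> g x = - (norm x * norm (g x))"
proof -
  let ?B = "ball (0::'a) R"
  obtain \<phi> where \<phi>: "antimono_on (norm ` (?B - {0})) \<phi>" "AE x in lebesgue_on ?B. w x = \<phi> (norm x)"
    using w by (auto simp: spherically_decreasing_on_def)
  have gai: "(\<lambda>x. g x \<bullet> c) absolutely_integrable_on K" if "compact K" "K \<subseteq> ?B" for K c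
  proof -
    have "integrable lebesgue (\<lambda>x. (indicator K x *\<^sub>R g x) \<bullet> c)"
      using g that by (intro integrable_inner_left) (simp add: has_weak_gradient_def set_integrable_def)
    then show ?thesis by (simp add: set_integrable_def)
  qed
  have gai2: "(\<lambda>x. (x \<bullet> b) * (g x \<bullet> c)) absolutely_integrable_on K" if K: "compact K" "K \<subseteq> ?B" for K b c
  proof -
    obtain C where C: "\<And>x. x \<in> K \<Longrightarrow> norm x \<le> C" using compact_imp_bounded[OF K(1)] by (auto simp: bounded_iff)
    have "integrable lebesgue (\<lambda>x. (indicator K x * (x \<bullet> b)) * (indicator K x * (g x \<bullet> c)))"
    proof (rule integrable_mult_bounded[where C="\<bar>C\<bar> * norm b"])
      show "integrable lebesgue (\<lambda>x. indicator K x * (g x \<bullet> c))" using gai[OF K, of c] by (simp add: set_integrable_def)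
      have [measurable]: "K \<in> sets borel" using K(1) by (rule borel_compact)
      have "(\<lambda>x. indicator K x * (x \<bullet> b)) \<in> borel_measurable borel" by measurable
      then show "(\<lambda>x. indicator K x * (x \<bullet> b)) \<in> borel_measurable lebesgue" by (simp add: measurable_completion)
      have "\<bar>x \<bullet> b\<bar> \<le> \<bar>C\<bar> * norm b" if "x \<in> K" for x
        using C[OF that] by (intro order_trans[OF Cauchy_Schwarz_ineq2 mult_right_mono]) auto
      then show "AE x in lebesgue. \<bar>indicator K x * (x \<bullet> b)\<bar> \<le> \<bar>C\<bar> * norm b"
        by (intro AE_I2) (auto simp: indicator_def)
    qed
    moreover have "(\<lambda>x. (indicator K x * (x \<bullet> b)) * (indicator K x * (g x \<bullet> c))) = (\<lambda>x. indicator K x *\<^sub>R ((x \<bullet> b) * (g x \<bullet> c)))"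
      by (auto simp: indicator_def)
    ultimately show ?thesis by (simp add: set_integrable_def)
  qed
  have field: "(\<Sum>b\<in>Basis. (LINT x|lebesgue_on ?B. (g x \<bullet> b) * \<Psi> b x)) \<le> 0"
    if "\<And>b. b \<in> Basis \<Longrightarrow> test_function ?B (\<Psi> b)" "\<And>x. 0 \<le> (\<Sum>b\<in>Basis. (x \<bullet> b) * \<Psi> b x)" for \<Psi>
    using that \<phi> g by (rule radial_decreasing_outward_field)
  have inward: "AE x in lebesgue_on ?B. 0 \<le> - (x \<bullet> g x)"
  proof (rule AE_nonneg_if_test_integral_nonneg)
    have sum_eq: "(\<lambda>x. - (x \<bullet> g x)) = (\<lambda>x. - (\<Sum>b\<in>Basis. (x \<bullet> b) * (g x \<bullet> b)))"
      by (simp add: euclidean_inner[of _ "g _"])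
    show "(\<lambda>x. - (x \<bullet> g x)) absolutely_integrable_on K" if "compact K" "K \<subseteq> ?B" for K
    proof -
      have "integrable lebesgue (\<lambda>x. \<Sum>b\<in>Basis. indicator K x *\<^sub>R ((x \<bullet> b) * (g x \<bullet> b)))"
        using gai2[OF that] by (intro Bochner_Integration.integrable_sum) (simp add: set_integrable_def)
      then have "integrable lebesgue (\<lambda>x. - (\<Sum>b\<in>Basis. indicator K x *\<^sub>R ((x \<bullet> b) * (g x \<bullet> b))))" by (rule integrable_minus)
      then show ?thesis unfolding sum_eq set_integrable_def scaleR_minus_right scaleR_sum_right .
    qed
    fix \<psi> assume \<psi>: "test_function ?B \<psi>" "\<And>x::'a. 0 \<le> \<psi> x"
    have t: "test_function ?B (\<lambda>x. (x \<bullet> b) * \<psi> x)" for b by (intro test_function_mult \<psi> C_k_inner)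
    have "(\<Sum>b\<in>Basis. (LINT x|lebesgue_on ?B. (g x \<bullet> b) * ((x \<bullet> b) * \<psi> x))) \<le> 0"
    proof (rule field[OF t])
      fix x :: 'a
      have "(\<Sum>b\<in>Basis. (x \<bullet> b) * ((x \<bullet> b) * \<psi> x)) = (\<Sum>b\<in>Basis. (x \<bullet> b)\<^sup>2 * \<psi> x)"
        by (simp add: power2_eq_square mult.assoc)
      also have "0 \<le> \<dots>" using \<psi>(2) by (intro sum_nonneg) simp
      finally show "0 \<le> (\<Sum>b\<in>Basis. (x \<bullet> b) * ((x \<bullet> b) * \<psi> x))" .
    qed
    moreover have "(\<Sum>b\<in>Basis. (LINT x|lebesgue_on ?B. (g x \<bullet> b) * ((x \<bullet> b) * \<psi> x))) = (LINT x|lebesgue_on ?B. (\<Sum>b\<in>Basis. (g x \<bullet> b) * ((x \<bullet> b) * \<psi> x)))"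
      using integrable_mult_test_function[OF _ gai t] by (intro Bochner_Integration.integral_sum[symmetric]) simp
    moreover have "(\<Sum>b\<in>Basis. (g x \<bullet> b) * ((x \<bullet> b) * \<psi> x)) = (x \<bullet> g x) * \<psi> x" for x
      by (simp add: euclidean_inner[of x "g x"] sum_distrib_left mult_ac)
    ultimately show "0 \<le> (LINT x|lebesgue_on ?B. - (x \<bullet> g x) * \<psi> x)" by simp
  qed simp
  have parallel: "AE x in lebesgue_on ?B. (x \<bullet> c) * (g x \<bullet> b) - (x \<bullet> b) * (g x \<bullet> c) = 0" if bc: "b \<in> Basis" "c \<in> Basis" for b c
  proof (cases "b = c")
    case False
    show ?thesis
    proof (rule AE_zero_if_test_integral_zero)
      show "(\<lambda>x. (x \<bullet> c) * (g x \<bullet> b) - (x \<bullet> b) * (g x \<bullet> c)) absolutely_integrable_on K" if "compact K" "K \<subseteq> ?B" for K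
        by (rule set_integral_diff(1)[OF gai2[OF that] gai2[OF that]])
      fix \<psi> assume \<psi>: "test_function ?B \<psi>"
      have t: "test_function ?B (\<lambda>x. (x \<bullet> b) * \<psi> x)" for b by (intro test_function_mult \<psi> C_k_inner)
      \<comment> \<open>The rotation with component \<open>x \<bullet> c\<close> along
        \<open>b\<close> and \<open>- (x \<bullet> b)\<close> along \<open>c\<close>, times
        \<open>\<psi>\<close>; it is orthogonal to \<open>x\<close>, so the field and its negative
        both count as outward.\<close>
      define \<Psi> where "\<Psi> d x = ((if d = b then x \<bullet> c else 0) - (if d = c then x \<bullet> b else 0)) * \<psi> x" for d and x :: 'a
      have \<Psi>: "test_function ?B (\<Psi> d)" for d
      proof -
        have "C_k k (\<lambda>x::'a. if P then x \<bullet> e else 0)" for k P e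
          by (cases P) (simp_all only: if_True if_False C_k_inner C_k_const)
        then show ?thesis unfolding \<Psi>_def by (intro test_function_mult[OF \<psi>] C_k_diff)
      qed
      have z: "(\<Sum>d\<in>Basis. (x \<bullet> d) * \<Psi> d x) = 0" for x
      proof -
        have "(\<Sum>d\<in>Basis. (x \<bullet> d) * \<Psi> d x) = (\<Sum>d\<in>{b, c}. (x \<bullet> d) * \<Psi> d x)"
          using bc by (intro sum.mono_neutral_right) (auto simp: \<Psi>_def)
        then show ?thesis using False by (simp add: \<Psi>_def)
      qed
      have "test_function ?B (\<lambda>x. (-1) * \<Psi> d x)" for d by (intro test_function_mult \<Psi> C_k_const)
      then have \<Psi>': "test_function ?B (\<lambda>x. - \<Psi> d x)" for d by simp
      have z': "(\<Sum>d\<in>Basis. (x \<bullet> d) * - \<Psi> d x) = 0" for x using z[of x] by (simp add: sum_negf)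
      have "(\<Sum>d\<in>Basis. (LINT x|lebesgue_on ?B. (g x \<bullet> d) * \<Psi> d x)) \<le> 0" by (rule field) (use \<Psi> z in auto)
      moreover have "(\<Sum>d\<in>Basis. (LINT x|lebesgue_on ?B. (g x \<bullet> d) * - \<Psi> d x)) \<le> 0" by (rule field[OF \<Psi>']) (simp only: z')
      ultimately have "(\<Sum>d\<in>Basis. (LINT x|lebesgue_on ?B. (g x \<bullet> d) * \<Psi> d x)) = 0" by (simp add: sum_negf)
      moreover have "(\<Sum>d\<in>Basis. (LINT x|lebesgue_on ?B. (g x \<bullet> d) * \<Psi> d x)) = (LINT x|lebesgue_on ?B. (\<Sum>d\<in>Basis. (g x \<bullet> d) * \<Psi> d x))"
        using integrable_mult_test_function[OF _ gai \<Psi>] by (intro Bochner_Integration.integral_sum[symmetric]) simp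
      moreover have "(\<Sum>d\<in>Basis. (g x \<bullet> d) * \<Psi> d x) = ((x \<bullet> c) * (g x \<bullet> b) - (x \<bullet> b) * (g x \<bullet> c)) * \<psi> x" for x
      proof -
        have "(\<Sum>d\<in>Basis. (g x \<bullet> d) * \<Psi> d x) = (\<Sum>d\<in>{b, c}. (g x \<bullet> d) * \<Psi> d x)"
          using bc by (intro sum.mono_neutral_right) (auto simp: \<Psi>_def)
        then show ?thesis using False by (simp add: \<Psi>_def algebra_simps)
      qed
      ultimately show "(LINT x|lebesgue_on ?B. ((x \<bullet> c) * (g x \<bullet> b) - (x \<bullet> b) * (g x \<bullet> c)) * \<psi> x) = 0" by simp
    qed simp
  qed simp
  then have "AE x in lebesgue_on ?B. \<forall>b\<in>Basis. \<forall>c\<in>Basis. (x \<bullet> c) * (g x \<bullet> b) - (x \<bullet> b) * (g x \<bullet> c) = 0"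
    by (simp add: AE_finite_all)
  with inward show ?thesis
  proof eventually_elim
    case (elim x)
    \<comment> \<open>Multiplying the parallelity relations by \<open>x \<bullet> c\<close> and
      summing over \<open>c\<close> gives \<open>(norm x)^2 g = (x \<bullet> g) x\<close>.\<close>
    have comp: "(norm x)\<^sup>2 * (g x \<bullet> b) = (x \<bullet> g x) * (x \<bullet> b)" if b: "b \<in> Basis" for b
    proof -
      have "(norm x)\<^sup>2 * (g x \<bullet> b) = (\<Sum>c\<in>Basis. (x \<bullet> c) * ((x \<bullet> c) * (g x \<bullet> b)))"
        by (simp add: power2_norm_eq_inner euclidean_inner[of x x] sum_distrib_right mult.assoc)
      also have "\<dots> = (\<Sum>c\<in>Basis. (x \<bullet> c) * ((x \<bullet> b) * (g x \<bullet> c)))"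
        using elim(2) b by (intro sum.cong refl) simp
      also have "\<dots> = (x \<bullet> g x) * (x \<bullet> b)"
        by (simp add: euclidean_inner[of x "g x"] sum_distrib_left mult_ac)
      finally show ?thesis .
    qed
    have eq: "(norm x)\<^sup>2 *\<^sub>R g x = (x \<bullet> g x) *\<^sub>R x"
      by (rule euclidean_eqI) (simp only: inner_scaleR_left comp)
    have "(norm x)\<^sup>2 * norm (g x) = \<bar>x \<bullet> g x\<bar> * norm x"
      using arg_cong[OF eq, of norm] by (simp only: norm_scaleR abs_power2)
    moreover have "a = c" if "y\<^sup>2 * b = c * y" "a = y * b" "y \<noteq> 0" for a b c y :: real
      using that by (simp add: power2_eq_square)
    ultimately have "x \<noteq> 0 \<Longrightarrow> norm x * norm (g x) = \<bar>x \<bullet> g x\<bar>"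
      by (metis norm_eq_zero)
    then show ?case using elim(1) by (cases "x = 0") auto
  qed
qed

lemma W1p_0_radial_integral_eq:
  fixes w :: "'a::euclidean_space \<Rightarrow> real"
  assumes p: "1 \<le> p" and w: "in_W1p_0 (ball 0 R) p w" and rad: "spherically_decreasing_on (ball 0 R) w"
  shows "real DIM('a) * (LINT x|lebesgue_on (ball 0 R). w x) = (LINT x|lebesgue_on (ball 0 R). norm x * norm (weak_gradient (ball 0 R) w x))"
proof -
  let ?B = "ball (0::'a) R" and ?g = "weak_gradient (ball 0 R) w"
  have B: "open ?B" "bounded ?B" by auto
  have "AE x in lebesgue_on ?B. x \<bullet> ?g x = - (norm x * norm (?g x))"
    by (rule radial_decreasing_gradient[OF rad W1p_0_integrable(3)[OF B p w]])
  then have "(LINT x|lebesgue_on ?B. x \<bullet> ?g x) = (LINT x|lebesgue_on ?B. - (norm x * norm (?g x)))"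
    using W1p_0_inner_integrable[OF B p w] W1p_0_norm_integrable[OF B p w] by (intro integral_cong_AE) auto
  then show ?thesis using W1p_0_integral_eq[OF B p w] by simp
qed

section \<open>Rearrangements\<close>

text \<open>\<open>ennreal\<close> sends negative reals to 0, so \<open>ennreal (v x - k)\<close> is
  the positive part of the excess over \<open>k\<close>. All excess integrals below use this
  encoding.\<close>

lemma nn_integral_layer_cake:
  assumes "sigma_finite_measure M" and v[measurable]: "v \<in> borel_measurable M"
  shows "(\<integral>\<^sup>+x. ennreal (v x - k) \<partial>M) = (\<integral>\<^sup>+t. indicator {k<..} t * emeasure M {x \<in> space M. t < v x} \<partial>lborel)"
proof -
  interpret M: sigma_finite_measure M by fact
  interpret P: pair_sigma_finite M "lborel :: real measure" ..
  have 1: "ennreal (v x - k) = (\<integral>\<^sup>+t. indicator {k<..} t * indicator {x \<in> space M. t < v x} x \<partial>lborel)" if "x \<in> space M" for x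
  proof -
    have "(\<integral>\<^sup>+t. indicator {k<..} t * indicator {x \<in> space M. t < v x} x \<partial>lborel) = (\<integral>\<^sup>+t. indicator {k<..<v x} t \<partial>lborel)"
      using that by (intro nn_integral_cong) (auto simp: indicator_def)
    also have "\<dots> = ennreal (v x - k)" by (cases "k \<le> v x") (auto simp: ennreal_neg)
    finally show ?thesis by simp
  qed
  have "(\<integral>\<^sup>+x. ennreal (v x - k) \<partial>M) = (\<integral>\<^sup>+x. \<integral>\<^sup>+t. indicator {k<..} t * indicator {x \<in> space M. t < v x} x \<partial>lborel \<partial>M)"
    by (intro nn_integral_cong 1)
  also have "\<dots> = (\<integral>\<^sup>+t. \<integral>\<^sup>+x. indicator {k<..} t * indicator {x \<in> space M. t < v x} x \<partial>M \<partial>lborel)"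
    by (rule P.Fubini'[symmetric]) measurable
  also have "\<dots> = (\<integral>\<^sup>+t. indicator {k<..} t * emeasure M {x \<in> space M. t < v x} \<partial>lborel)"
    by (intro nn_integral_cong) (simp add: nn_integral_cmult)
  finally show ?thesis .
qed

lemma distr_fun_eq_emeasure:
  assumes D: "D \<in> lmeasurable" and g: "g \<in> borel_measurable (lebesgue_on D)"
  shows "{x \<in> D. t < \<bar>g x\<bar>} \<in> lmeasurable" "emeasure (lebesgue_on D) {x \<in> D. t < \<bar>g x\<bar>} = ennreal (distr_fun D g t)"
proof -
  have "{x \<in> space (lebesgue_on D). t < \<bar>g x\<bar>} \<in> sets (lebesgue_on D)" using g by measurable
  then have s: "{x \<in> D. t < \<bar>g x\<bar>} \<in> sets lebesgue" using D by (auto simp: sets_restrict_space_iff fmeasurableD)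
  then show m: "{x \<in> D. t < \<bar>g x\<bar>} \<in> lmeasurable" using D by (rule fmeasurableI2[rotated -1]) auto
  then show "emeasure (lebesgue_on D) {x \<in> D. t < \<bar>g x\<bar>} = ennreal (distr_fun D g t)"
    using D by (subst emeasure_restrict_space) (auto simp: distr_fun_def fmeasurableD emeasure_eq_measure2)
qed

lemma distr_fun_antimono:
  assumes D: "D \<in> lmeasurable" and g: "g \<in> borel_measurable (lebesgue_on D)" and "s \<le> t"
  shows "distr_fun D g t \<le> distr_fun D g s"
  unfolding distr_fun_def using distr_fun_eq_emeasure(1)[OF D g] \<open>s \<le> t\<close>
  by (intro measure_mono_fmeasurable) (auto simp: fmeasurableD)

lemma distr_fun_le:
  assumes D: "D \<in> lmeasurable" and g: "g \<in> borel_measurable (lebesgue_on D)"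
  shows "distr_fun D g t \<le> measure lebesgue D"
  unfolding distr_fun_def using distr_fun_eq_emeasure(1)[OF D g] D
  by (intro measure_mono_fmeasurable) (auto simp: fmeasurableD)

lemma distr_fun_nonneg: "0 \<le> distr_fun D g t"
  by (simp add: distr_fun_def)

lemma distr_fun_measurable:
  assumes D: "D \<in> lmeasurable" and g: "g \<in> borel_measurable (lebesgue_on D)"
  shows "distr_fun D g \<in> borel_measurable borel"
proof -
  have "mono (\<lambda>t. - distr_fun D g t)" using distr_fun_antimono[OF D g] by (intro monoI) simp
  then have "(\<lambda>t. - distr_fun D g t) \<in> borel_measurable borel" by (rule borel_measurable_mono)
  then have "(\<lambda>t. - (- distr_fun D g t)) \<in> borel_measurable borel" by (rule borel_measurable_uminus)
  then show ?thesis by simp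
qed

lemma distr_fun_right_continuous:
  assumes D: "D \<in> lmeasurable" and g: "g \<in> borel_measurable (lebesgue_on D)"
  shows "(\<lambda>k. distr_fun D g (t + inverse (Suc k))) \<longlonglongrightarrow> distr_fun D g t"
proof -
  let ?A = "\<lambda>k. {x \<in> D. t + inverse (real (Suc k)) < \<bar>g x\<bar>}"
  note m = distr_fun_eq_emeasure(1)[OF D g]
  have U: "(\<Union>k. ?A k) = {x \<in> D. t < \<bar>g x\<bar>}"
  proof (intro equalityI subsetI)
    fix x assume x: "x \<in> {x \<in> D. t < \<bar>g x\<bar>}"
    then obtain k where "inverse (real (Suc k)) < \<bar>g x\<bar> - t" using reals_Archimedean[of "\<bar>g x\<bar> - t"] by auto
    with x show "x \<in> (\<Union>k. ?A k)" by (auto intro!: exI[of _ k])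
  next
    fix x assume "x \<in> (\<Union>k. ?A k)"
    then obtain k where "x \<in> D" "t + inverse (real (Suc k)) < \<bar>g x\<bar>" by blast
    moreover have "0 < inverse (real (Suc k))" by simp
    ultimately show "x \<in> {x \<in> D. t < \<bar>g x\<bar>}" by (simp del: of_nat_Suc inverse_positive_iff_positive)
  qed
  have "(\<lambda>k. measure lebesgue (?A k)) \<longlonglongrightarrow> measure lebesgue (\<Union>k. ?A k)"
  proof (rule Lim_measure_incseq)
    show "range ?A \<subseteq> sets lebesgue" using m by (auto dest: fmeasurableD)
    show "incseq ?A"
    proof (rule monoI, rule subsetI)
      fix k l x assume "k \<le> l" "x \<in> ?A k"
      then have x: "x \<in> D" "t + inverse (real (Suc k)) < \<bar>g x\<bar>" by blast+
      from \<open>k \<le> l\<close> have "inverse (real (Suc l)) \<le> inverse (real (Suc k))" by simp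
      with x(2) have "t + inverse (real (Suc l)) < \<bar>g x\<bar>" by linarith
      with x(1) show "x \<in> ?A l" by blast
    qed
    show "emeasure lebesgue (\<Union>k. ?A k) \<noteq> \<infinity>" unfolding U using fmeasurableD2[OF m] by simp
  qed
  then show ?thesis unfolding U distr_fun_def .
qed

text \<open>\<open>g\<close> is real-valued, so the superlevel sets decrease to the empty set. This
  makes the infimum that defines the rearrangement run over a nonempty set for
  \<open>s > 0\<close>.\<close>

lemma distr_fun_tendsto_0:
  assumes D: "D \<in> lmeasurable" and g: "g \<in> borel_measurable (lebesgue_on D)"
  shows "(\<lambda>k. distr_fun D g (real k)) \<longlonglongrightarrow> 0"
proof -
  let ?A = "\<lambda>k. {x \<in> D. real k < \<bar>g x\<bar>}"
  note m = distr_fun_eq_emeasure(1)[OF D g]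
  have "x \<notin> (\<Inter>k. ?A k)" for x
  proof -
    obtain k :: nat where "\<bar>g x\<bar> \<le> real k" using real_arch_simple by blast
    then show ?thesis by (auto simp: not_less)
  qed
  then have U: "(\<Inter>k. ?A k) = {}" by blast
  have "(\<lambda>k. measure lebesgue (?A k)) \<longlonglongrightarrow> measure lebesgue (\<Inter>k. ?A k)"
  proof (rule Lim_measure_decseq)
    show "range ?A \<subseteq> sets lebesgue" using m by (auto dest: fmeasurableD)
    show "decseq ?A" by (intro antimonoI) (auto intro: order.strict_trans1)
    show "emeasure lebesgue (?A k) \<noteq> \<infinity>" for k using fmeasurableD2[OF m] by simp
  qed
  then show ?thesis unfolding U distr_fun_def by simp
qed

lemma decr_rearr_ne:
  assumes D: "D \<in> lmeasurable" and g: "g \<in> borel_measurable (lebesgue_on D)" and s: "0 < s"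
  shows "{t. 0 \<le> t \<and> distr_fun D g t < s} \<noteq> {}"
proof -
  have "\<forall>\<^sub>F k in sequentially. distr_fun D g (real k) < s"
    using order_tendstoD(2)[OF distr_fun_tendsto_0[OF D g] s] .
  then obtain k :: nat where "distr_fun D g (real k) < s" by (auto simp: eventually_sequentially)
  then show ?thesis by (auto intro!: exI[of _ "real k"])
qed

lemma decr_rearr_nonneg:
  assumes D: "D \<in> lmeasurable" and g: "g \<in> borel_measurable (lebesgue_on D)" and s: "0 < s"
  shows "0 \<le> decr_rearr D g s"
  unfolding decr_rearr_def using decr_rearr_ne[OF assms] by (intro cInf_greatest) auto

text \<open>Together with \<open>less_decr_rearrI\<close> a near-equivalence between
  \<open>t < decr_rearr D g s\<close> and \<open>s \<le> distr_fun D g t\<close>; the two can differ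
  only at \<open>s = distr_fun D g t\<close>.\<close>

lemma less_decr_rearr_imp:
  assumes "0 \<le> t" "t < decr_rearr D g s"
  shows "s \<le> distr_fun D g t"
proof (rule ccontr)
  assume "\<not> s \<le> distr_fun D g t"
  then have "decr_rearr D g s \<le> t"
    unfolding decr_rearr_def using assms by (intro cInf_lower) (auto intro: bdd_belowI[of _ 0])
  with assms show False by simp
qed

text \<open>Right continuity of the distribution function carries the strict inequality to a
  slightly larger level, which yields strictness for the infimum.\<close>

lemma less_decr_rearrI:
  assumes D: "D \<in> lmeasurable" and g: "g \<in> borel_measurable (lebesgue_on D)" and s: "0 < s"
    and lt: "s < distr_fun D g t"
  shows "t < decr_rearr D g s"
proof -
  have "\<forall>\<^sub>F k in sequentially. s < distr_fun D g (t + inverse (real (Suc k)))"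
    using order_tendstoD(1)[OF distr_fun_right_continuous[OF D g] lt] .
  then obtain k where k: "s < distr_fun D g (t + inverse (real (Suc k)))" by (auto simp: eventually_sequentially)
  have "t + inverse (real (Suc k)) \<le> decr_rearr D g s"
    unfolding decr_rearr_def
  proof (intro cInf_greatest decr_rearr_ne[OF D g s])
    fix r assume "r \<in> {t. 0 \<le> t \<and> distr_fun D g t < s}"
    then show "t + inverse (real (Suc k)) \<le> r"
      using k distr_fun_antimono[OF D g, of r "t + inverse (real (Suc k))"] by (auto intro: leI)
  qed
  then show ?thesis by (rule less_le_trans[rotated]) simp
qed

lemma decr_rearr_antimono:
  assumes D: "D \<in> lmeasurable" and g: "g \<in> borel_measurable (lebesgue_on D)" and s: "0 < s" "s \<le> s'"
  shows "decr_rearr D g s' \<le> decr_rearr D g s"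
  unfolding decr_rearr_def using s
  by (intro cInf_superset_mono decr_rearr_ne[OF D g]) (auto intro: bdd_belowI[of _ 0])

section \<open>The volume coordinate on the ball\<close>

text \<open>The volume of the centred ball through \<open>x\<close>: the variable at which the
  one-dimensional rearrangements are evaluated, and in which Lebesgue measure on the ball becomes
  Lebesgue measure on an interval.\<close>

definition ball_vol :: "'a::euclidean_space \<Rightarrow> real" where
  "ball_vol x = unit_ball_vol DIM('a) * norm x ^ DIM('a)"

lemma ball_vol_nonneg: "0 \<le> ball_vol x"
  by (simp add: ball_vol_def)

lemma ball_vol_measurable [measurable]: "ball_vol \<in> borel_measurable borel"
  unfolding ball_vol_def[abs_def] by measurable

lemma unit_ball_vol_DIM_pos: "0 < unit_ball_vol (real DIM('a::euclidean_space))"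
  by simp

lemma ball_vol_less_iff:
  fixes x :: "'a::euclidean_space"
  assumes "0 \<le> a"
  shows "ball_vol x < a \<longleftrightarrow> x \<in> ball 0 (root DIM('a) (a / unit_ball_vol DIM('a)))"
    and "ball_vol x \<le> a \<longleftrightarrow> x \<in> cball 0 (root DIM('a) (a / unit_ball_vol DIM('a)))"
proof -
  let ?n = "DIM('a)" and ?w = "unit_ball_vol DIM('a)"
  have w: "0 < ?w" by (rule unit_ball_vol_DIM_pos)
  have nx: "norm x = root ?n (norm x ^ ?n)" by (simp add: real_root_power_cancel)
  have "ball_vol x < a \<longleftrightarrow> norm x ^ ?n < a / ?w" using w by (simp add: ball_vol_def pos_less_divide_eq mult.commute)
  also have "\<dots> \<longleftrightarrow> norm x < root ?n (a / ?w)" by (subst (2) nx) (simp add: real_root_less_iff)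
  finally show "ball_vol x < a \<longleftrightarrow> x \<in> ball 0 (root ?n (a / ?w))" by simp
  have "ball_vol x \<le> a \<longleftrightarrow> norm x ^ ?n \<le> a / ?w" using w by (simp add: ball_vol_def pos_le_divide_eq mult.commute)
  also have "\<dots> \<longleftrightarrow> norm x \<le> root ?n (a / ?w)" by (subst (2) nx) (simp add: real_root_le_iff)
  finally show "ball_vol x \<le> a \<longleftrightarrow> x \<in> cball 0 (root ?n (a / ?w))" by simp
qed

lemma sharp_ball_eq: "sharp_ball D = {x. ball_vol x < measure lebesgue D}"
  by (simp only: sharp_ball_def set_eq_iff mem_Collect_eq ball_vol_less_iff(1)[OF measure_nonneg] simp_thms)

lemma emeasure_ball_vol_le: "0 \<le> a \<Longrightarrow> emeasure lborel {x::'a::euclidean_space. ball_vol x \<le> a} = ennreal a"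
proof -
  assume a: "0 \<le> a"
  let ?n = "DIM('a)" and ?w = "unit_ball_vol DIM('a)"
  have w: "0 < ?w" by (rule unit_ball_vol_DIM_pos)
  have "{x::'a. ball_vol x \<le> a} = cball 0 (root ?n (a / ?w))" by (simp only: set_eq_iff mem_Collect_eq ball_vol_less_iff(2)[OF a] simp_thms)
  moreover have "0 \<le> root ?n (a / ?w)" using a w by simp
  moreover have "?w * root ?n (a / ?w) ^ ?n = a"
    using a w by (simp add: order.strict_implies_not_eq[OF w, symmetric] del: unit_ball_vol_pos)
  ultimately show ?thesis using emeasure_cball[of "root ?n (a / ?w)" "0::'a"] by simp
qed

lemma sharp_ball_sets [measurable]: "sharp_ball D \<in> sets borel"
  by (simp add: sharp_ball_def)

text \<open>Replaces polar coordinates: integrals of radial functions over the ball become integrals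
  over \<open>{0..<measure lebesgue D}\<close> in the volume variable. It suffices to compare the
  two measures on the half-lines \<open>{a<..}\<close>.\<close>

lemma distr_ball_vol:
  fixes D :: "'a::euclidean_space set"
  shows "distr (density lborel (indicator (sharp_ball D))) borel ball_vol = density lborel (indicator {0..<measure lebesgue D})"
    (is "?L = ?R")
proof (rule measure_eqI_lessThan)
  let ?M = "measure lebesgue D"
  have L: "emeasure ?L {a<..} = emeasure lborel {x \<in> sharp_ball D. a < ball_vol x}" for a
  proof -
    have "emeasure ?L {a<..} = (\<integral>\<^sup>+x. indicator (sharp_ball D) x * indicator (ball_vol -` {a<..}) x \<partial>lborel)"
      using measurable_sets[OF ball_vol_measurable[where 'a='a], of "{a<..}"] by (subst emeasure_distr) (simp_all add: emeasure_density)
    also have "\<dots> = (\<integral>\<^sup>+x. indicator {x \<in> sharp_ball D. a < ball_vol x} x \<partial>lborel)"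
      by (intro nn_integral_cong) (auto simp: indicator_def)
    also have "\<dots> = emeasure lborel {x \<in> sharp_ball D. a < ball_vol x}" by (subst nn_integral_indicator) auto
    finally show ?thesis .
  qed
  have R: "emeasure ?R {a<..} = ennreal (?M - max 0 a)" for a
  proof -
    have "emeasure ?R {a<..} = (\<integral>\<^sup>+s. indicator {0..<?M} s * indicator {a<..} s \<partial>lborel)" by (simp add: emeasure_density)
    also have "\<dots> = (\<integral>\<^sup>+s. indicator ({max 0 a..<?M}) s \<partial>lborel)"
      using AE_lborel_singleton[of "max 0 a"] AE_lborel_singleton[of a] by (intro nn_integral_cong_AE) (auto simp: indicator_def)
    also have "\<dots> = ennreal (?M - max 0 a)" by (cases "max 0 a \<le> ?M") (auto simp: ennreal_neg)
    finally show ?thesis .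
  qed
  have S: "sharp_ball D = ball 0 (root DIM('a) (?M / unit_ball_vol DIM('a)))" by (simp add: sharp_ball_def)
  have eM: "emeasure lborel (sharp_ball D) = ennreal ?M"
  proof -
    have "measure lborel (sharp_ball D) = ?M" using measure_sharp_ball[of D] by simp
    moreover have "emeasure lborel (sharp_ball D) < \<infinity>" unfolding S by (rule emeasure_lborel_ball_finite)
    ultimately show ?thesis by (metis emeasure_eq_ennreal_measure less_irrefl infinity_ennreal_def)
  qed
  have eq: "emeasure lborel {x \<in> sharp_ball D. a < ball_vol x} = ennreal (?M - max 0 a)" for a
  proof -
    consider "a < 0" | "0 \<le> a" "a < ?M" | "0 \<le> a" "?M \<le> a" by linarith
    then show ?thesis
    proof cases
      case 1
      then have "{x \<in> sharp_ball D. a < ball_vol x} = sharp_ball D" using ball_vol_nonneg by (auto intro: less_le_trans)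
      then show ?thesis using eM 1 by simp
    next
      case 2
      have "{x \<in> sharp_ball D. a < ball_vol x} = sharp_ball D - {x. ball_vol x \<le> a}" by auto
      also have "emeasure lborel \<dots> = emeasure lborel (sharp_ball D) - emeasure lborel {x::'a. ball_vol x \<le> a}"
        using 2 by (intro emeasure_Diff) (auto simp: emeasure_ball_vol_le sharp_ball_eq)
      finally show ?thesis using 2 eM by (simp add: emeasure_ball_vol_le ennreal_minus)
    next
      case 3
      then have e: "{x \<in> sharp_ball D. a < ball_vol x} = {}" by (auto simp: sharp_ball_eq)
      show ?thesis unfolding e using 3 by (simp add: ennreal_neg)
    qed
  qed
  show "emeasure ?L {x<..} < \<infinity>" for x unfolding L eq by simp
  show "emeasure ?L {x<..} = emeasure ?R {x<..}" for x unfolding L eq R by simp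
qed simp_all

lemma nn_integral_sharp_ball:
  fixes D :: "'a::euclidean_space set"
  assumes [measurable]: "h \<in> borel_measurable borel"
  shows "(\<integral>\<^sup>+x. indicator (sharp_ball D) x * h (ball_vol (x::'a)) \<partial>lborel) = (\<integral>\<^sup>+s. indicator {0..<measure lebesgue D} s * h s \<partial>lborel)"
proof -
  have "(\<integral>\<^sup>+x. indicator (sharp_ball D) x * h (ball_vol (x::'a)) \<partial>lborel)
      = (\<integral>\<^sup>+s. h s \<partial>distr (density lborel (indicator (sharp_ball D))) borel (ball_vol :: 'a \<Rightarrow> real))"
    by (subst nn_integral_distr) (auto simp: nn_integral_density)
  also have "\<dots> = (\<integral>\<^sup>+s. indicator {0..<measure lebesgue D} s * h s \<partial>lborel)"
    unfolding distr_ball_vol by (subst nn_integral_density) auto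
  finally show ?thesis .
qed

lemma incr_rearr_measurable:
  assumes D: "D \<in> lmeasurable" and g: "g \<in> borel_measurable (lebesgue_on D)"
  shows "incr_rearr D g \<in> borel_measurable (restrict_space borel {..<measure lebesgue D})"
proof (rule borel_measurable_mono_on_fnc)
  show "mono_on {..<measure lebesgue D} (incr_rearr D g)"
    unfolding incr_rearr_def by (intro mono_onI decr_rearr_antimono[OF D g]) auto
qed

text \<open>The centre of the ball and the complement of the ball are cut off: there the rearrangements
  are unspecified.\<close>

lemma sph_incr_rearr_measurable:
  fixes g :: "'a::euclidean_space \<Rightarrow> real"
  assumes D: "D \<in> lmeasurable" and g: "g \<in> borel_measurable (lebesgue_on D)"
  shows "(\<lambda>x. indicator (sharp_ball D) x * sph_incr_rearr D g x) \<in> borel_measurable borel"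
proof -
  have "(\<lambda>s. indicator {..<measure lebesgue D} s * incr_rearr D g s) \<in> borel_measurable borel"
    using incr_rearr_measurable[OF D g] by (subst (asm) borel_measurable_restrict_space_iff) auto
  then have "(\<lambda>x::'a. indicator {..<measure lebesgue D} (ball_vol x) * incr_rearr D g (ball_vol x)) \<in> borel_measurable borel"
    by measurable
  moreover have "indicator {..<measure lebesgue D} (ball_vol x) * incr_rearr D g (ball_vol x) = indicator (sharp_ball D) x * sph_incr_rearr D g x" for x
    by (auto simp: sharp_ball_eq sph_incr_rearr_def ball_vol_def indicator_def)
  ultimately show ?thesis by simp
qed

text \<open>The superlevel set lies between the outer shells on which the volume coordinate is
  above, respectively at least, the measure of \<open>D\<close> minus
  \<open>distr_fun D g t\<close>. These differ by a sphere and have volume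
  \<open>distr_fun D g t\<close>.\<close>

lemma emeasure_sph_incr_rearr:
  fixes g :: "'a::euclidean_space \<Rightarrow> real"
  assumes D: "D \<in> lmeasurable" and g: "g \<in> borel_measurable (lebesgue_on D)" and t: "0 \<le> t"
  shows "emeasure lborel {x \<in> sharp_ball D. t < sph_incr_rearr D g x} = ennreal (distr_fun D g t)"
proof -
  let ?M = "measure lebesgue D" and ?\<mu> = "distr_fun D g t"
  have \<mu>: "0 \<le> ?\<mu>" "?\<mu> \<le> ?M" using distr_fun_nonneg distr_fun_le[OF D g] by auto
  have eq: "emeasure lborel {x \<in> sharp_ball D. P (ball_vol x)} = (\<integral>\<^sup>+s. indicator {0..<?M} s * indicator {s. P s} s \<partial>lborel)"
    if [measurable]: "Measurable.pred borel P" for P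
  proof -
    have "emeasure lborel {x \<in> sharp_ball D. P (ball_vol x)} = (\<integral>\<^sup>+x. indicator {x \<in> sharp_ball D. P (ball_vol x)} x \<partial>lborel)"
      by (subst nn_integral_indicator) auto
    also have "\<dots> = (\<integral>\<^sup>+x. indicator (sharp_ball D) x * indicator {s. P s} (ball_vol x) \<partial>lborel)"
      by (intro nn_integral_cong) (auto simp: indicator_def)
    also have "\<dots> = (\<integral>\<^sup>+s. indicator {0..<?M} s * indicator {s. P s} s \<partial>lborel)"
      by (rule nn_integral_sharp_ball) measurable
    finally show ?thesis .
  qed
  have val: "(\<integral>\<^sup>+s. indicator {?M - ?\<mu>..<?M} s \<partial>lborel) = ennreal ?\<mu>" using \<mu> by simp
  have "{x \<in> sharp_ball D. t < sph_incr_rearr D g x} \<subseteq> {x \<in> sharp_ball D. ?M - ?\<mu> \<le> ball_vol x}"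
    using less_decr_rearr_imp[OF t, of D g] by (force simp: sph_incr_rearr_def incr_rearr_def ball_vol_def)
  then have "emeasure lborel {x \<in> sharp_ball D. t < sph_incr_rearr D g x} \<le> emeasure lborel {x \<in> sharp_ball D. ?M - ?\<mu> \<le> ball_vol x}"
    by (intro emeasure_mono) auto
  also have "\<dots> = (\<integral>\<^sup>+s. indicator {?M - ?\<mu>..<?M} s \<partial>lborel)"
    unfolding eq[of "\<lambda>s. ?M - ?\<mu> \<le> s", simplified] using \<mu> by (intro nn_integral_cong) (auto simp: indicator_def)
  finally have up: "emeasure lborel {x \<in> sharp_ball D. t < sph_incr_rearr D g x} \<le> ennreal ?\<mu>" by (simp only: val)
  have "{x \<in> sharp_ball D. ?M - ?\<mu> < ball_vol x} \<subseteq> {x \<in> sharp_ball D. t < sph_incr_rearr D g x}"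
    using less_decr_rearrI[OF D g] by (auto simp: sph_incr_rearr_def incr_rearr_def ball_vol_def sharp_ball_eq)
  moreover have "{x \<in> sharp_ball D. t < sph_incr_rearr D g x} \<in> sets lborel"
  proof -
    note [measurable] = sph_incr_rearr_measurable[OF D g]
    have "{x \<in> sharp_ball D. t < sph_incr_rearr D g x} = {x \<in> space lborel. t < indicator (sharp_ball D) x * sph_incr_rearr D g x}"
      using t by (auto simp: indicator_def split: if_splits)
    also have "\<dots> \<in> sets lborel" by measurable
    finally show ?thesis .
  qed
  ultimately have "emeasure lborel {x \<in> sharp_ball D. ?M - ?\<mu> < ball_vol x} \<le> emeasure lborel {x \<in> sharp_ball D. t < sph_incr_rearr D g x}"
    by (intro emeasure_mono)
  moreover have "emeasure lborel {x \<in> sharp_ball D. ?M - ?\<mu> < ball_vol x} = (\<integral>\<^sup>+s. indicator {?M - ?\<mu>..<?M} s \<partial>lborel)"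
    unfolding eq[of "\<lambda>s. ?M - ?\<mu> < s", simplified] using \<mu> AE_lborel_singleton[of "?M - ?\<mu>"]
    by (intro nn_integral_cong_AE) (auto simp: indicator_def)
  ultimately show ?thesis using up by (simp only: val antisym)
qed

text \<open>Equimeasurability, turned into equality of excess integrals by the layer cake on both
  sides.\<close>

lemma nn_integral_sph_incr_rearr_excess:
  fixes g :: "'a::euclidean_space \<Rightarrow> real"
  assumes D: "D \<in> lmeasurable" and g[measurable]: "g \<in> borel_measurable (lebesgue_on D)" and k: "0 \<le> k"
  shows "(\<integral>\<^sup>+x. indicator (sharp_ball D) x * ennreal (sph_incr_rearr D g x - k) \<partial>lborel) = (\<integral>\<^sup>+x. ennreal (\<bar>g x\<bar> - k) \<partial>lebesgue_on D)"
proof -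
  have sf: "sigma_finite_measure (lebesgue_on D)"
    using finite_measure_lebesgue_on[OF D] by (rule finite_measure.axioms(1))
  let ?f = "\<lambda>x. indicator (sharp_ball D) x * sph_incr_rearr D g x"
  note [measurable] = sph_incr_rearr_measurable[OF D g]
  have "(\<integral>\<^sup>+x. indicator (sharp_ball D) x * ennreal (sph_incr_rearr D g x - k) \<partial>lborel) = (\<integral>\<^sup>+x. ennreal (?f x - k) \<partial>lborel)"
    using k by (intro nn_integral_cong) (auto simp: indicator_def ennreal_neg)
  also have "\<dots> = (\<integral>\<^sup>+t. indicator {k<..} t * emeasure lborel {x \<in> space lborel. t < ?f x} \<partial>lborel)"
    by (intro nn_integral_layer_cake sigma_finite_lborel) measurable
  also have "\<dots> = (\<integral>\<^sup>+t. indicator {k<..} t * emeasure (lebesgue_on D) {x \<in> space (lebesgue_on D). t < \<bar>g x\<bar>} \<partial>lborel)"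
  proof (intro nn_integral_cong)
    fix t :: real
    show "indicator {k<..} t * emeasure lborel {x \<in> space lborel. t < ?f x} = indicator {k<..} t * emeasure (lebesgue_on D) {x \<in> space (lebesgue_on D). t < \<bar>g x\<bar>}"
    proof (cases "k < t")
      case True
      then have "{x \<in> space lborel. t < ?f x} = {x \<in> sharp_ball D. t < sph_incr_rearr D g x}"
        using k by (auto simp: indicator_def split: if_splits)
      then show ?thesis using emeasure_sph_incr_rearr[OF D g, of t] distr_fun_eq_emeasure(2)[OF D g, of t] True k by simp
    qed simp
  qed
  also have "\<dots> = (\<integral>\<^sup>+x. ennreal (\<bar>g x\<bar> - k) \<partial>lebesgue_on D)"
    by (intro nn_integral_layer_cake[symmetric] sf) measurable
  finally show ?thesis .
qed

section \<open>Perimeters of level sets\<close>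

text \<open>The gradient is uniformly continuous because its support is compact, so the mean value
  inequality holds with the gradient at the centre and a uniform error \<open>\<eta>\<close>.
  Keeping the gradient at \<open>x\<close>, rather than its maximum, is what lets the perimeter
  bound end in the integral of \<open>norm (grad \<phi> x)\<close>.\<close>

lemma test_function_uniform_increment:
  fixes \<phi> :: "'a::euclidean_space \<Rightarrow> real"
  assumes \<phi>: "test_function D \<phi>" and \<eta>: "0 < \<eta>"
  obtains \<epsilon>0 where "0 < \<epsilon>0" "\<And>x y \<epsilon>. dist x y < \<epsilon> \<Longrightarrow> \<epsilon> \<le> \<epsilon>0 \<Longrightarrow> \<bar>\<phi> y\<bar> \<le> \<bar>\<phi> x\<bar> + \<epsilon> * (norm (grad \<phi> x) + \<eta>)"
proof -
  obtain K where K: "compact K" "K \<subseteq> D" "\<And>x. x \<notin> K \<Longrightarrow> \<phi> x = 0" using test_functionE[OF \<phi>] by metis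
  have gK: "grad \<phi> x = 0" if "x \<notin> K" for x
  proof -
    have "partial_deriv b \<phi> x = 0" for b using K(1,3) that by (rule partial_deriv_outside_support)
    then show ?thesis by (simp add: grad_def)
  qed
  \<comment> \<open>The closed 1-neighbourhood of \<open>K\<close>: two points at distance below 1
    either both lie in it or both lie outside \<open>K\<close>, where the gradient vanishes.\<close>
  define L where "L = {x + y | x y. x \<in> K \<and> y \<in> cball 0 (1::real)}"
  have "compact L" unfolding L_def using K(1) compact_cball by (rule compact_sums)
  then have "uniformly_continuous_on L (grad \<phi>)"
    using continuous_on_grad_test[OF \<phi>] by (intro compact_uniformly_continuous) (auto intro: continuous_on_subset)
  then obtain d where d: "0 < d" "\<And>x y. x \<in> L \<Longrightarrow> y \<in> L \<Longrightarrow> dist y x < d \<Longrightarrow> dist (grad \<phi> y) (grad \<phi> x) < \<eta>"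
    unfolding uniformly_continuous_on_def using \<eta> by metis
  have KL: "K \<subseteq> L" unfolding L_def by (force intro: exI[of _ 0])
  have near: "dist (grad \<phi> y) (grad \<phi> x) < \<eta>" if xy: "dist y x < min d 1" for x y
  proof -
    have inL: "q \<in> L" if "p \<in> K" "dist q p < 1" for p q
    proof -
      have "q = p + (q - p)" "q - p \<in> cball 0 1" using that by (auto simp: dist_norm norm_minus_commute)
      then show ?thesis using that(1) unfolding L_def by blast
    qed
    consider "x \<in> K" | "y \<in> K" | "x \<notin> K" "y \<notin> K" by blast
    then show ?thesis
    proof cases
      case 1
      then show ?thesis using d(2)[of x y] inL[of x y] KL xy by auto
    next
      case 2
      then show ?thesis using d(2)[of x y] inL[of y x] KL xy by (auto simp: dist_commute)
    next
      case 3
      then show ?thesis using \<eta> by (simp add: gK)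
    qed
  qed
  show ?thesis
  proof (rule that[of "min d 1"])
    show "0 < min d 1" using d by simp
    fix x y :: 'a and \<epsilon> :: real assume xy: "dist x y < \<epsilon>" "\<epsilon> \<le> min d 1"
    have der: "(\<phi> has_derivative (\<lambda>h. grad \<phi> z \<bullet> h)) (at z within ball x \<epsilon>)" for z
      using has_derivative_grad[OF test_function_differentiable[OF \<phi>]] by (rule has_derivative_at_withinI)
    have "norm (\<phi> y - \<phi> x) \<le> (norm (grad \<phi> x) + \<eta>) * norm (y - x)"
    proof (rule differentiable_bound[OF convex_ball der])
      have "0 < \<epsilon>" using xy(1) zero_le_dist[of x y] by linarith
      then show "y \<in> ball x \<epsilon>" "x \<in> ball x \<epsilon>" using xy by auto
      fix z assume z: "z \<in> ball x \<epsilon>"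
      have "dist (grad \<phi> z) (grad \<phi> x) < \<eta>" using near[of z x] z xy by (auto simp: dist_commute)
      then have "norm (grad \<phi> z) \<le> norm (grad \<phi> x) + \<eta>"
        using norm_triangle_ineq2[of "grad \<phi> z" "grad \<phi> x"] by (simp add: dist_norm)
      moreover have "onorm (\<lambda>h. grad \<phi> z \<bullet> h) \<le> norm (grad \<phi> z)"
        by (intro onorm_le) (metis Cauchy_Schwarz_ineq2 real_norm_def)
      ultimately show "onorm (\<lambda>h. grad \<phi> z \<bullet> h) \<le> norm (grad \<phi> x) + \<eta>" by linarith
    qed
    also have "\<dots> \<le> (norm (grad \<phi> x) + \<eta>) * \<epsilon>"
      using xy \<eta> by (intro mult_left_mono) (auto simp: dist_norm norm_minus_commute add_nonneg_nonneg)
    finally show "\<bar>\<phi> y\<bar> \<le> \<bar>\<phi> x\<bar> + \<epsilon> * (norm (grad \<phi> x) + \<eta>)" by (simp add: mult.commute)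
  qed
qed

lemma ball_perimeter_nonneg: "0 \<le> n \<Longrightarrow> 0 \<le> ball_perimeter n s"
  by (simp add: ball_perimeter_def)

lemma ball_perimeter_mono: "1 \<le> n \<Longrightarrow> 0 \<le> s \<Longrightarrow> s \<le> t \<Longrightarrow> ball_perimeter n s \<le> ball_perimeter n t"
  unfolding ball_perimeter_def by (intro mult_left_mono powr_mono2) (auto simp: divide_le_eq_1)

lemma ball_perimeter_measurable [measurable]: "ball_perimeter n \<in> borel_measurable borel"
  unfolding ball_perimeter_def[abs_def] by measurable

text \<open>Coarea and isoperimetric inequality in one step. The
  \<open>\<epsilon>\<close>-enlargement of the superlevel set at \<open>\<tau>\<close> stays in the
  region where \<open>V = \<bar>\<phi>\<bar> + \<epsilon> (norm (grad \<phi>) + \<eta>)\<close>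
  exceeds \<open>\<tau>\<close>, so \<open>\<epsilon>\<close> times the perimeter is at most the
  volume of the region \<open>\<bar>\<phi>\<bar> \<le> \<tau> < V\<close>. After integration over
  \<open>\<tau>\<close> and exchange of integrals this volume becomes the length
  \<open>V - \<bar>\<phi>\<bar>\<close>, from which \<open>\<epsilon>\<close> cancels.\<close>

lemma test_function_level_perimeter:
  fixes \<phi> :: "'a::euclidean_space \<Rightarrow> real"
  assumes \<phi>: "test_function D \<phi>" and \<delta>: "0 < \<delta>" "\<delta> \<le> a"
  shows "(\<integral>\<^sup>+\<tau>. indicator {a<..<b} \<tau> * ennreal (ball_perimeter DIM('a) (measure lborel {x. \<tau> < \<bar>\<phi> x\<bar>})) \<partial>lborel)
    \<le> (\<integral>\<^sup>+x. indicator {x. a - \<delta> < \<bar>\<phi> x\<bar> \<and> \<bar>\<phi> x\<bar> < b} x * ennreal (norm (grad \<phi> x)) \<partial>lborel)"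
    (is "?I \<le> ?J")
proof -
  let ?c = "\<lambda>\<tau>. ball_perimeter DIM('a) (measure lborel {x. \<tau> < \<bar>\<phi> x\<bar>})"
  let ?S = "{x. a - \<delta> < \<bar>\<phi> x\<bar> \<and> \<bar>\<phi> x\<bar> < b}"
  obtain K where K: "compact K" "K \<subseteq> D" "\<And>x. x \<notin> K \<Longrightarrow> \<phi> x = 0" using test_functionE[OF \<phi>] by metis
  obtain C where C: "0 < C" "\<And>x. norm (grad \<phi> x) \<le> C" using grad_test_bounded[OF \<phi>] by metis
  have [measurable]: "\<phi> \<in> borel_measurable borel" "grad \<phi> \<in> borel_measurable borel"
    by (intro test_function_measurable[OF \<phi>] borel_measurable_continuous_onI continuous_on_grad_test[OF \<phi>])+
  note cont = test_function_continuous[OF \<phi>]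
  have lev_K: "{x. \<tau> < \<bar>\<phi> x\<bar>} \<subseteq> K" if "0 \<le> \<tau>" for \<tau> using K(3) that by force
  have lev_open: "open {x. \<tau> < \<bar>\<phi> x\<bar>}" for \<tau> by (intro open_Collect_less continuous_intros cont)
  have bK: "bounded K" using K(1) by (rule compact_imp_bounded)
  have SK: "?S \<subseteq> K" using lev_K[of "a - \<delta>"] \<delta> by auto
  have [measurable]: "K \<in> sets borel" using K(1) by (rule borel_compact)
  have eK: "emeasure lborel K < \<infinity>" using K(1) by (rule emeasure_compact_finite)
  have step: "?I \<le> (\<integral>\<^sup>+x. indicator ?S x * ennreal (norm (grad \<phi> x) + \<eta>) \<partial>lborel)" if \<eta>: "0 < \<eta>" for \<eta>
  proof -
    obtain \<epsilon>0 where e0: "0 < \<epsilon>0" "\<And>x y \<epsilon>. dist x y < \<epsilon> \<Longrightarrow> \<epsilon> \<le> \<epsilon>0 \<Longrightarrow> \<bar>\<phi> y\<bar> \<le> \<bar>\<phi> x\<bar> + \<epsilon> * (norm (grad \<phi> x) + \<eta>)"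
      using test_function_uniform_increment[OF \<phi> \<eta>] by metis
    \<comment> \<open>The second bound keeps \<open>V\<close> within \<open>\<delta>\<close> of
      \<open>\<bar>\<phi>\<bar>\<close>, so points with \<open>a < V\<close> satisfy
      \<open>a - \<delta> < \<bar>\<phi>\<bar>\<close>; as \<open>\<delta> \<le> a\<close>, they
      also stay in the compact support.\<close>
    define \<epsilon> where "\<epsilon> = min \<epsilon>0 (\<delta> / (C + \<eta>))"
    have \<epsilon>: "0 < \<epsilon>" "\<epsilon> \<le> \<epsilon>0" "\<epsilon> * (C + \<eta>) \<le> \<delta>"
    proof -
      have "0 < C + \<eta>" using C \<eta> by simp
      then show "0 < \<epsilon>" "\<epsilon> \<le> \<epsilon>0" "\<epsilon> * (C + \<eta>) \<le> \<delta>"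
        using e0 \<delta> by (auto simp: \<epsilon>_def pos_le_divide_eq[symmetric])
    qed
    define V where "V x = \<bar>\<phi> x\<bar> + \<epsilon> * (norm (grad \<phi> x) + \<eta>)" for x
    have [measurable]: "V \<in> borel_measurable borel" unfolding V_def by measurable
    have V\<phi>: "\<bar>\<phi> x\<bar> \<le> V x" for x using \<epsilon> \<eta> by (simp add: V_def add_nonneg_nonneg)
    have V\<delta>: "V x \<le> \<bar>\<phi> x\<bar> + \<delta>" for x
    proof -
      have "\<epsilon> * (norm (grad \<phi> x) + \<eta>) \<le> \<epsilon> * (C + \<eta>)" using C(2)[of x] \<epsilon> by (intro mult_left_mono) auto
      then show ?thesis using \<epsilon>(3) by (simp add: V_def)
    qed
    have lev: "\<epsilon> * ?c \<tau> \<le> measure lborel {x. \<bar>\<phi> x\<bar> \<le> \<tau> \<and> \<tau> < V x}" if \<tau>: "a < \<tau>" for \<tau>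
    proof -
      let ?A = "{x. \<tau> < \<bar>\<phi> x\<bar>}"
      have A: "open ?A" "bounded ?A" "?A \<in> fmeasurable lborel"
        using lev_open lev_K[of \<tau>] bK \<tau> \<delta> by (auto intro: bounded_subset fmeasurable_lborel_open_bounded)
      have VK: "{x. \<tau> < V x} \<subseteq> K"
      proof
        fix x assume "x \<in> {x. \<tau> < V x}"
        then have "0 < \<bar>\<phi> x\<bar>" using V\<delta>[of x] \<tau> \<delta> by auto
        then show "x \<in> K" using K(3)[of x] by auto
      qed
      have fV: "{x. \<tau> < V x} \<in> fmeasurable lborel"
      proof (rule fmeasurableI)
        show "emeasure lborel {x. \<tau> < V x} < \<infinity>"
          using VK K(1) by (intro le_less_trans[OF emeasure_mono eK]) (auto simp: borel_compact)
      qed measurable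
      have "mink_sum ?A (ball 0 \<epsilon>) \<subseteq> {x. \<tau> < V x}"
      proof
        fix z assume "z \<in> mink_sum ?A (ball 0 \<epsilon>)"
        then obtain x y where xy: "\<tau> < \<bar>\<phi> x\<bar>" "norm y < \<epsilon>" "z = x + y" by (auto simp: mem_mink_sum)
        have "dist z x < \<epsilon>" using xy by (simp add: dist_norm)
        from e0(2)[OF this \<epsilon>(2)] show "z \<in> {x. \<tau> < V x}" using xy by (simp add: V_def)
      qed
      then have "measure lborel (mink_sum ?A (ball 0 \<epsilon>)) \<le> measure lborel {x. \<tau> < V x}"
        using fV A by (intro measure_mono_fmeasurable) (auto intro!: borel_open open_mink_sum)
      also have "{x. \<tau> < V x} = ?A \<union> {x. \<bar>\<phi> x\<bar> \<le> \<tau> \<and> \<tau> < V x}"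
        using V\<phi> by (auto intro: less_le_trans)
      also have "measure lborel \<dots> = measure lborel ?A + measure lborel {x. \<bar>\<phi> x\<bar> \<le> \<tau> \<and> \<tau> < V x}"
      proof (rule measure_Un3[THEN trans])
        show "?A \<in> fmeasurable lborel" by fact
        show "{x. \<bar>\<phi> x\<bar> \<le> \<tau> \<and> \<tau> < V x} \<in> fmeasurable lborel"
          by (rule fmeasurableI2[OF fV]) auto
        have 0: "?A \<inter> {x. \<bar>\<phi> x\<bar> \<le> \<tau> \<and> \<tau> < V x} = {}" by auto
        show "measure lborel ?A + measure lborel {x. \<bar>\<phi> x\<bar> \<le> \<tau> \<and> \<tau> < V x} - measure lborel (?A \<inter> {x. \<bar>\<phi> x\<bar> \<le> \<tau> \<and> \<tau> < V x})
          = measure lborel ?A + measure lborel {x. \<bar>\<phi> x\<bar> \<le> \<tau> \<and> \<tau> < V x}" unfolding 0 by simp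
      qed
      finally show ?thesis using measure_enlarge_ge[OF A(1,2) \<epsilon>(1)] by linarith
    qed
    let ?f = "\<lambda>x \<tau>. indicator {p. a < snd p \<and> snd p < b \<and> \<bar>\<phi> (fst p)\<bar> \<le> snd p \<and> snd p < V (fst p)} (x, \<tau>) :: ennreal"
    have "ennreal \<epsilon> * ?I = (\<integral>\<^sup>+\<tau>. indicator {a<..<b} \<tau> * ennreal (\<epsilon> * ?c \<tau>) \<partial>lborel)"
    proof -
      have meas: "(\<lambda>\<tau>. measure lborel {x. \<tau> < \<bar>\<phi> x\<bar>}) \<in> borel_measurable lborel"
      proof -
        have "(\<lambda>\<tau>. measure lborel (Pair \<tau> -` {p. fst p < \<bar>\<phi> (snd p)\<bar>})) \<in> borel_measurable lborel"
          unfolding measure_def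
        proof (intro borel_measurable_enn2real sigma_finite_measure.measurable_emeasure_Pair[OF sigma_finite_lborel])
          have "{p \<in> space (borel \<Otimes>\<^sub>M borel). fst p < \<bar>\<phi> (snd p)\<bar>} \<in> sets (borel \<Otimes>\<^sub>M borel)" by measurable
          then show "{p. fst p < \<bar>\<phi> (snd p)\<bar>} \<in> sets (lborel \<Otimes>\<^sub>M lborel)" by (simp add: space_pair_measure)
        qed
        then show ?thesis by (simp add: vimage_def)
      qed
      have "?c \<in> borel_measurable lborel" using meas by measurable
      then show ?thesis using \<epsilon>
        by (subst nn_integral_cmult[symmetric]) (auto intro!: nn_integral_cong simp: ennreal_mult ball_perimeter_nonneg indicator_def)
    qed
    also have "\<dots> \<le> (\<integral>\<^sup>+\<tau>. \<integral>\<^sup>+x. ?f x \<tau> \<partial>lborel \<partial>lborel)"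
    proof (intro nn_integral_mono)
      fix \<tau>
      show "indicator {a<..<b} \<tau> * ennreal (\<epsilon> * ?c \<tau>) \<le> (\<integral>\<^sup>+x. ?f x \<tau> \<partial>lborel)"
      proof (cases "a < \<tau> \<and> \<tau> < b")
        case True
        have "(\<integral>\<^sup>+x. ?f x \<tau> \<partial>lborel) = (\<integral>\<^sup>+x. indicator {x. \<bar>\<phi> x\<bar> \<le> \<tau> \<and> \<tau> < V x} x \<partial>lborel)"
          using True by (intro nn_integral_cong) (auto simp: indicator_def)
        also have "\<dots> = emeasure lborel {x. \<bar>\<phi> x\<bar> \<le> \<tau> \<and> \<tau> < V x}" by (subst nn_integral_indicator) auto
        also have "ennreal (\<epsilon> * ?c \<tau>) \<le> \<dots>"
        proof (cases "emeasure lborel {x. \<bar>\<phi> x\<bar> \<le> \<tau> \<and> \<tau> < V x} = \<infinity>")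
          case False
          then show ?thesis using lev[of \<tau>] True by (simp add: emeasure_eq_ennreal_measure ennreal_leI)
        qed simp
        finally show ?thesis using True by simp
      qed simp
    qed
    also have "\<dots> = (\<integral>\<^sup>+x. \<integral>\<^sup>+\<tau>. ?f x \<tau> \<partial>lborel \<partial>lborel)"
      by (rule lborel_pair.Fubini') measurable
    also have "\<dots> \<le> (\<integral>\<^sup>+x. ennreal \<epsilon> * (indicator ?S x * ennreal (norm (grad \<phi> x) + \<eta>)) \<partial>lborel)"
    proof (intro nn_integral_mono)
      fix x
      show "(\<integral>\<^sup>+\<tau>. ?f x \<tau> \<partial>lborel) \<le> ennreal \<epsilon> * (indicator ?S x * ennreal (norm (grad \<phi> x) + \<eta>))"
      proof (cases "x \<in> ?S")
        case True
        have "(\<integral>\<^sup>+\<tau>. ?f x \<tau> \<partial>lborel) \<le> (\<integral>\<^sup>+\<tau>. indicator {\<bar>\<phi> x\<bar>..<V x} \<tau> \<partial>lborel)"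
          by (intro nn_integral_mono) (auto simp: indicator_def)
        also have "\<dots> = ennreal (V x - \<bar>\<phi> x\<bar>)" using V\<phi> by simp
        also have "\<dots> = ennreal \<epsilon> * ennreal (norm (grad \<phi> x) + \<eta>)" using \<epsilon> \<eta> by (simp add: V_def ennreal_mult)
        finally show ?thesis using True by simp
      next
        case False
        have "?f x \<tau> = 0" for \<tau> using False V\<delta>[of x] by (auto simp: indicator_def)
        then show ?thesis by simp
      qed
    qed
    also have "\<dots> = ennreal \<epsilon> * (\<integral>\<^sup>+x. indicator ?S x * ennreal (norm (grad \<phi> x) + \<eta>) \<partial>lborel)"
      by (rule nn_integral_cmult) measurable
    finally have "ennreal \<epsilon> * ?I \<le> ennreal \<epsilon> * (\<integral>\<^sup>+x. indicator ?S x * ennreal (norm (grad \<phi> x) + \<eta>) \<partial>lborel)" .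
    then show ?thesis using \<epsilon>(1) by (subst (asm) ennreal_mult_le_mult_iff) auto
  qed
  \<comment> \<open>The leftover \<open>\<eta>\<close> is integrated over a set of finite measure
    and disappears in the limit.\<close>
  have "?I \<le> ?J + ennreal \<eta> * emeasure lborel K" if \<eta>: "0 < \<eta>" for \<eta>
  proof -
    have "?I \<le> (\<integral>\<^sup>+x. indicator ?S x * ennreal (norm (grad \<phi> x)) + ennreal \<eta> * indicator K x \<partial>lborel)"
      using SK \<eta> by (intro order_trans[OF step[OF \<eta>] nn_integral_mono]) (auto simp: indicator_def)
    also have "\<dots> = ?J + ennreal \<eta> * emeasure lborel K"
      by (subst nn_integral_add) (simp_all add: nn_integral_cmult)
    finally show ?thesis .
  qed
  note bound = this
  show ?thesis
  proof (rule ennreal_le_epsilon)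
    fix e :: real assume e: "0 < e"
    have fin: "emeasure lborel K = ennreal (measure lborel K)" using eK by (intro emeasure_eq_ennreal_measure) auto
    define \<eta> where "\<eta> = e / (measure lborel K + 1)"
    have m: "0 < measure lborel K + 1" by (simp add: add_nonneg_pos)
    have \<eta>: "0 < \<eta>" using e m by (simp add: \<eta>_def)
    have "\<eta> * measure lborel K \<le> \<eta> * (measure lborel K + 1)" using \<eta> by simp
    also have "\<dots> = e"
    proof -
      have "e / P * P = e" if "0 < P" for P :: real using that by simp
      from this[OF m] show ?thesis by (simp only: \<eta>_def)
    qed
    finally have "ennreal \<eta> * emeasure lborel K \<le> ennreal e"
      using \<eta> by (simp add: fin ennreal_mult[symmetric] ennreal_leI)
    then show "?I \<le> ?J + ennreal e" using bound[OF \<eta>] by (meson add_left_mono order_trans)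
  qed
qed

section \<open>From test functions to Sobolev functions\<close>

lemma excess_integral_small:
  assumes g: "integrable M g" and e: "0 < e"
  obtains k :: nat where "(\<integral>\<^sup>+x. ennreal (g x - real k) \<partial>M) < ennreal e"
proof -
  have [measurable]: "g \<in> borel_measurable M" using g by auto
  have "(\<lambda>k. \<integral>\<^sup>+x. ennreal (g x - real k) \<partial>M) \<longlonglongrightarrow> (\<integral>\<^sup>+x. 0 \<partial>M)"
  proof (rule nn_integral_dominated_convergence[where w="\<lambda>x. ennreal (norm (g x))"])
    show "(\<integral>\<^sup>+x. ennreal (norm (g x)) \<partial>M) < \<infinity>" using g by (simp add: integrable_iff_bounded)
    show "AE x in M. (\<lambda>k. ennreal (g x - real k)) \<longlonglongrightarrow> 0"
    proof (rule AE_I2)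
      fix x
      obtain n :: nat where n: "g x \<le> real n" using real_arch_simple by blast
      have "\<forall>\<^sub>F k in sequentially. ennreal (g x - real k) = 0"
        using eventually_ge_at_top[of n] by eventually_elim (use n in \<open>auto intro!: ennreal_neg\<close>)
      then show "(\<lambda>k. ennreal (g x - real k)) \<longlonglongrightarrow> 0" by (rule tendsto_eventually)
    qed
    show "AE x in M. ennreal (g x - real k) \<le> ennreal (norm (g x))" for k
      by (intro AE_I2 ennreal_leI) (auto intro: order_trans[OF _ abs_ge_self])
  qed measurable
  then have "\<forall>\<^sub>F k in sequentially. (\<integral>\<^sup>+x. ennreal (g x - real k) \<partial>M) < ennreal e"
    using e by (intro order_tendstoD(2)) auto
  then show ?thesis using that by (auto simp: eventually_sequentially)
qed

text \<open>Split at a height \<open>k\<close> for which the excess integral is below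
  \<open>e / 2\<close>; the part below that height contributes at most \<open>k\<close> times the
  measure of \<open>E\<close>.\<close>

lemma nn_integral_absolutely_continuous:
  assumes g: "integrable M g" and e: "0 < e"
  obtains d where "0 < d" "\<And>E. E \<in> sets M \<Longrightarrow> emeasure M E \<le> ennreal d \<Longrightarrow> (\<integral>\<^sup>+x. indicator E x * ennreal (g x) \<partial>M) \<le> ennreal e"
proof -
  have [measurable]: "g \<in> borel_measurable M" using g by auto
  obtain k :: nat where k: "(\<integral>\<^sup>+x. ennreal (g x - real k) \<partial>M) < ennreal (e / 2)"
    using excess_integral_small[OF g, of "e / 2"] e by auto
  define d where "d = e / (2 * (real k + 1))"
  have d: "0 < d" "real k * d \<le> e / 2"
  proof -
    show "0 < d" using e by (simp add: d_def)
    have "real k * d = e / 2 * (real k / (real k + 1))" by (simp add: d_def)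
    also have "\<dots> \<le> e / 2 * 1" using e by (intro mult_left_mono) auto
    finally show "real k * d \<le> e / 2" by simp
  qed
  show ?thesis
  proof (rule that[OF d(1)])
    fix E assume E[measurable]: "E \<in> sets M" and small: "emeasure M E \<le> ennreal d"
    have "(\<integral>\<^sup>+x. indicator E x * ennreal (g x) \<partial>M) \<le> (\<integral>\<^sup>+x. ennreal (real k) * indicator E x + ennreal (g x - real k) \<partial>M)"
    proof (rule nn_integral_mono)
      fix x
      have "ennreal (g x) \<le> ennreal (real k) + ennreal (g x - real k)"
        by (cases "real k \<le> g x") (auto simp: ennreal_plus[symmetric] ennreal_neg intro: ennreal_leI simp del: ennreal_plus)
      then show "indicator E x * ennreal (g x) \<le> ennreal (real k) * indicator E x + ennreal (g x - real k)"
        by (auto simp: indicator_def)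
    qed
    also have "\<dots> = ennreal (real k) * emeasure M E + (\<integral>\<^sup>+x. ennreal (g x - real k) \<partial>M)"
      by (subst nn_integral_add) (simp_all add: nn_integral_cmult)
    also have "\<dots> \<le> ennreal (real k) * ennreal d + ennreal (e / 2)"
      using k small by (intro add_mono mult_left_mono) auto
    also have "\<dots> = ennreal (real k * d + e / 2)" using d e by (simp add: ennreal_mult[symmetric] ennreal_plus[symmetric] del: ennreal_plus)
    also have "\<dots> \<le> ennreal e" using d by (intro ennreal_leI) simp
    finally show "(\<integral>\<^sup>+x. indicator E x * ennreal (g x) \<partial>M) \<le> ennreal e" .
  qed
qed

lemma nn_integral_lebesgue_on_lborel:
  fixes f :: "'a::euclidean_space \<Rightarrow> ennreal"
  assumes D: "D \<in> sets lebesgue" and f: "f \<in> borel_measurable borel" and z: "\<And>x. x \<notin> D \<Longrightarrow> f x = 0"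
  shows "(\<integral>\<^sup>+x. f x \<partial>lborel) = (\<integral>\<^sup>+x. f x \<partial>lebesgue_on D)"
proof -
  have "(\<integral>\<^sup>+x. f x \<partial>lebesgue_on D) = (\<integral>\<^sup>+x. f x * indicator D x \<partial>lebesgue)"
    using D by (intro nn_integral_restrict_space) simp
  also have "\<dots> = (\<integral>\<^sup>+x. f x \<partial>lebesgue)" using z by (intro nn_integral_cong) (auto simp: indicator_def)
  also have "\<dots> = (\<integral>\<^sup>+x. f x \<partial>lborel)" using f by (intro nn_integral_completion)
  finally show ?thesis by simp
qed

lemma ball_perimeter_tendsto:
  assumes n: "1 < n" and f: "(f \<longlongrightarrow> s) F" "\<forall>\<^sub>F x in F. 0 \<le> f x"
  shows "((\<lambda>x. ball_perimeter n (f x)) \<longlongrightarrow> ball_perimeter n s) F"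
  unfolding ball_perimeter_def using n f by (intro tendsto_mult tendsto_const tendsto_powr') auto

text \<open>Approximation in the 1-norm does not control level sets pointwise. By Chebyshev's
  inequality \<open>u\<close> and \<open>\<phi>\<close> differ by at least \<open>e\<close> only on
  a small set \<open>E\<close>, so distribution functions compare after shifting level and volume by
  \<open>e\<close>, while the gradient contributes little over \<open>E\<close>. Fatou's lemma and
  right continuity of \<open>\<mu>\<close> then remove the shifts.\<close>

lemma W1p_0_level_perimeter:
  fixes u :: "'a::euclidean_space \<Rightarrow> real"
  assumes D: "open D" "bounded D" and n: "2 \<le> DIM('a)" and p: "1 \<le> p" and u: "in_W1p_0 D p u" and t': "0 \<le> t'"
  shows "(\<integral>\<^sup>+\<tau>. indicator {t'<..<t} \<tau> * ennreal (ball_perimeter DIM('a) (distr_fun D u \<tau>)) \<partial>lborel)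
    \<le> (\<integral>\<^sup>+x. indicator {x. t' < \<bar>u x\<bar> \<and> \<bar>u x\<bar> < t} x * ennreal (norm (weak_gradient D u x)) \<partial>lebesgue_on D)"
    (is "_ \<le> ?R")
proof -
  let ?N = "lebesgue_on D" and ?g = "weak_gradient D u" and ?c = "ball_perimeter (real DIM('a))" and ?\<mu> = "distr_fun D u"
  have Dm: "D \<in> lmeasurable" and Ds: "D \<in> sets lebesgue" using D lmeasurable_open_bounded by auto
  interpret finite_measure ?N using Dm by (rule finite_measure_lebesgue_on)
  note int = W1p_0_integrable[OF D p u]
  have um[measurable]: "u \<in> borel_measurable ?N" and [measurable]: "?g \<in> borel_measurable ?N" using int(1,2) by auto
  note [measurable] = distr_fun_measurable[OF Dm um]
  define e where "e m = inverse (real (Suc m))" for m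
  have e: "0 < e m" for m by (simp add: e_def)
  have e0: "e \<longlonglongrightarrow> 0" unfolding e_def by (rule LIMSEQ_inverse_real_of_nat)
  \<comment> \<open>Of the lower margin \<open>3 e\<close>, one \<open>e\<close> is spent as the
    \<open>\<delta>\<close> of the bound for test functions; the remaining two exceed the gap
    between \<open>u\<close> and \<open>\<phi>\<close> off \<open>E\<close>, as does the margin
    \<open>2 e\<close> at the top. The \<open>max\<close> keeps the volume nonnegative.\<close>
  define F where "F m \<tau> = indicator {t' + 3 * e m<..<t - 2 * e m} \<tau> * ennreal (?c (max 0 (?\<mu> (\<tau> + e m) - e m)))" for m \<tau>
  have [measurable]: "F m \<in> borel_measurable lborel" for m unfolding F_def by measurable
  have bound: "(\<integral>\<^sup>+\<tau>. F m \<tau> \<partial>lborel) \<le> ?R + ennreal (2 * e m)" for m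
  proof -
    let ?e = "e m"
    obtain d where d: "0 < d" "\<And>E. E \<in> sets ?N \<Longrightarrow> emeasure ?N E \<le> ennreal d \<Longrightarrow> (\<integral>\<^sup>+x. indicator E x * ennreal (norm (?g x)) \<partial>?N) \<le> ennreal ?e"
      using nn_integral_absolutely_continuous[OF integrable_norm[OF int(2)] e] by metis
    \<comment> \<open>The second bound turns Chebyshev's inequality into a measure of
      \<open>E\<close> below both \<open>e\<close> and \<open>d\<close>; the first one controls the
      error in the gradient.\<close>
    define \<eta> where "\<eta> = min ?e (?e * min ?e d)"
    have \<eta>: "0 < \<eta>" "\<eta> \<le> ?e" "\<eta> \<le> ?e * min ?e d" using e[of m] d by (auto simp: \<eta>_def)
    obtain \<phi> where \<phi>: "test_function D \<phi>" "(LINT x|?N. \<bar>u x - \<phi> x\<bar>) < \<eta>" "(LINT x|?N. norm (?g x - grad \<phi> x)) < \<eta>"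
      using W1p_0_approx[OF D p u \<eta>(1)] by metis
    have \<phi>i: "integrable ?N \<phi>" "integrable ?N (grad \<phi>)"
      by (intro L1_bound_of_Lp(1)[OF Dm, of 1] in_Lp_test[OF Dm _ \<phi>(1)]; simp)+
    have \<phi>b[measurable]: "\<phi> \<in> borel_measurable borel" "grad \<phi> \<in> borel_measurable borel"
      by (intro test_function_measurable[OF \<phi>(1)] borel_measurable_continuous_onI continuous_on_grad_test[OF \<phi>(1)])+
    have \<phi>m[measurable]: "\<phi> \<in> borel_measurable ?N" "grad \<phi> \<in> borel_measurable ?N" using \<phi>i by auto
    have \<phi>0: "\<phi> x = 0" if "x \<notin> D" for x using test_functionE[OF \<phi>(1)] that by (metis subsetD)
    define E where "E = {x \<in> space ?N. ?e \<le> \<bar>u x - \<phi> x\<bar>}"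
    have Es[measurable]: "E \<in> sets ?N" unfolding E_def by measurable
    have "?e * measure ?N E \<le> (LINT x|?N. \<bar>u x - \<phi> x\<bar>)"
    proof -
      have "E \<inter> D = E" by (auto simp: E_def)
      then have "?e * measure ?N E = (LINT x|?N. ?e * indicator E x)" by simp
      also have "\<dots> \<le> (LINT x|?N. \<bar>u x - \<phi> x\<bar>)"
      proof (rule integral_mono)
        show "integrable ?N (\<lambda>x. ?e * indicator E x)"
          using Es by (intro integrable_mult_right integrable_real_indicator) (auto simp: less_top[symmetric])
        show "integrable ?N (\<lambda>x. \<bar>u x - \<phi> x\<bar>)" using int(1) \<phi>i by simp
        show "?e * indicator E x \<le> \<bar>u x - \<phi> x\<bar>" for x by (auto simp: E_def indicator_def)
      qed
      finally show ?thesis .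
    qed
    then have "?e * measure ?N E < ?e * min ?e d" using \<phi>(2) \<eta>(3) by linarith
    then have mE: "measure ?N E < ?e" "measure ?N E < d" using e[of m] by (auto simp: mult_less_cancel_left_pos)
    have dist: "?\<mu> (\<tau> + ?e) - ?e \<le> distr_fun D \<phi> \<tau>" for \<tau>
    proof -
      have EL: "E \<in> lmeasurable" using Es Dm by (auto simp: sets_restrict_space_iff fmeasurableD E_def intro: fmeasurableI2)
      have mEL: "measure lebesgue E = measure ?N E" using EL Ds by (subst measure_restrict_space) (auto simp: E_def)
      have "?\<mu> (\<tau> + ?e) \<le> measure lebesgue ({x \<in> D. \<tau> < \<bar>\<phi> x\<bar>} \<union> E)"
        unfolding distr_fun_def
        using distr_fun_eq_emeasure(1)[OF Dm um] distr_fun_eq_emeasure(1)[OF Dm \<phi>m(1)] EL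
        by (intro measure_mono_fmeasurable fmeasurable.Un) (auto simp: E_def fmeasurableD)
      also have "\<dots> \<le> distr_fun D \<phi> \<tau> + measure lebesgue E"
        unfolding distr_fun_def using distr_fun_eq_emeasure(1)[OF Dm \<phi>m(1)] EL
        by (intro measure_Un_le) (auto simp: fmeasurableD)
      finally show ?thesis using mE mEL by linarith
    qed
    have "(\<integral>\<^sup>+\<tau>. F m \<tau> \<partial>lborel) \<le> (\<integral>\<^sup>+\<tau>. indicator {t' + 3 * ?e<..<t - 2 * ?e} \<tau> * ennreal (?c (measure lborel {x. \<tau> < \<bar>\<phi> x\<bar>})) \<partial>lborel)"
    proof (rule nn_integral_mono)
      fix \<tau>
      show "F m \<tau> \<le> indicator {t' + 3 * ?e<..<t - 2 * ?e} \<tau> * ennreal (?c (measure lborel {x. \<tau> < \<bar>\<phi> x\<bar>}))"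
      proof (cases "\<tau> \<in> {t' + 3 * ?e<..<t - 2 * ?e}")
        case True
        then have "0 < \<tau>" using t' e[of m] by auto
        then have "{x. \<tau> < \<bar>\<phi> x\<bar>} = {x \<in> D. \<tau> < \<bar>\<phi> x\<bar>}" using \<phi>0 by force
        moreover have "{x. \<tau> < \<bar>\<phi> x\<bar>} \<in> sets borel" by measurable
        ultimately have "measure lborel {x. \<tau> < \<bar>\<phi> x\<bar>} = distr_fun D \<phi> \<tau>" by (simp add: distr_fun_def)
        then have "?c (max 0 (?\<mu> (\<tau> + ?e) - ?e)) \<le> ?c (measure lborel {x. \<tau> < \<bar>\<phi> x\<bar>})"
          using dist[of \<tau>] distr_fun_nonneg[of D \<phi> \<tau>] n by (intro ball_perimeter_mono) auto
        then show ?thesis using True by (simp add: F_def ennreal_leI)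
      qed (simp add: F_def)
    qed
    also have "\<dots> \<le> (\<integral>\<^sup>+x. indicator {x. t' + 3 * ?e - ?e < \<bar>\<phi> x\<bar> \<and> \<bar>\<phi> x\<bar> < t - 2 * ?e} x * ennreal (norm (grad \<phi> x)) \<partial>lborel)"
      using e[of m] t' by (intro test_function_level_perimeter[OF \<phi>(1)]) auto
    also have "\<dots> = (\<integral>\<^sup>+x. indicator {x. t' + 3 * ?e - ?e < \<bar>\<phi> x\<bar> \<and> \<bar>\<phi> x\<bar> < t - 2 * ?e} x * ennreal (norm (grad \<phi> x)) \<partial>?N)"
      using \<phi>0 t' e[of m] by (intro nn_integral_lebesgue_on_lborel Ds) (auto simp: indicator_def)
    also have "\<dots> \<le> (\<integral>\<^sup>+x. ennreal (norm (?g x - grad \<phi> x)) + (indicator {x. t' < \<bar>u x\<bar> \<and> \<bar>u x\<bar> < t} x * ennreal (norm (?g x)) + indicator E x * ennreal (norm (?g x))) \<partial>?N)"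
    proof (rule nn_integral_mono)
      fix x assume x: "x \<in> space ?N"
      show "indicator {x. t' + 3 * ?e - ?e < \<bar>\<phi> x\<bar> \<and> \<bar>\<phi> x\<bar> < t - 2 * ?e} x * ennreal (norm (grad \<phi> x))
        \<le> ennreal (norm (?g x - grad \<phi> x)) + (indicator {x. t' < \<bar>u x\<bar> \<and> \<bar>u x\<bar> < t} x * ennreal (norm (?g x)) + indicator E x * ennreal (norm (?g x)))"
      proof (cases "t' + 3 * ?e - ?e < \<bar>\<phi> x\<bar> \<and> \<bar>\<phi> x\<bar> < t - 2 * ?e")
        case True
        have tri: "ennreal (norm (grad \<phi> x)) \<le> ennreal (norm (?g x - grad \<phi> x)) + ennreal (norm (?g x))"
          using norm_triangle_ineq2[of "grad \<phi> x" "?g x"] by (simp add: ennreal_plus[symmetric] norm_minus_commute ennreal_leI del: ennreal_plus)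
        have "x \<in> E \<or> (t' < \<bar>u x\<bar> \<and> \<bar>u x\<bar> < t)" using True x e[of m] by (auto simp: E_def)
        then have "ennreal (norm (?g x)) \<le> indicator {x. t' < \<bar>u x\<bar> \<and> \<bar>u x\<bar> < t} x * ennreal (norm (?g x)) + indicator E x * ennreal (norm (?g x))"
          by (auto simp: indicator_def)
        then show ?thesis using True tri by (simp) (meson add_left_mono order_trans)
      qed simp
    qed
    also have "\<dots> = (\<integral>\<^sup>+x. ennreal (norm (?g x - grad \<phi> x)) \<partial>?N) + (?R + (\<integral>\<^sup>+x. indicator E x * ennreal (norm (?g x)) \<partial>?N))"
      by (simp add: nn_integral_add)
    also have "\<dots> \<le> ennreal ?e + (?R + ennreal ?e)"
    proof (intro add_mono order_refl)
      have "(\<integral>\<^sup>+x. ennreal (norm (?g x - grad \<phi> x)) \<partial>?N) = ennreal (LINT x|?N. norm (?g x - grad \<phi> x))"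
        using int(2) \<phi>i by (intro nn_integral_eq_integral) auto
      then show "(\<integral>\<^sup>+x. ennreal (norm (?g x - grad \<phi> x)) \<partial>?N) \<le> ennreal ?e" using \<phi>(3) \<eta> by (simp add: ennreal_leI)
      show "(\<integral>\<^sup>+x. indicator E x * ennreal (norm (?g x)) \<partial>?N) \<le> ennreal ?e"
        using mE by (intro d(2) Es) (simp add: emeasure_eq_measure ennreal_leI)
    qed
    also have "\<dots> = ?R + ennreal (2 * ?e)" using e[of m] by (simp add: ennreal_plus[symmetric] add_ac del: ennreal_plus)
    finally show ?thesis .
  qed
  have "(\<integral>\<^sup>+\<tau>. indicator {t'<..<t} \<tau> * ennreal (?c (?\<mu> \<tau>)) \<partial>lborel) \<le> (\<integral>\<^sup>+\<tau>. liminf (\<lambda>m. F m \<tau>) \<partial>lborel)"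
  proof (rule nn_integral_mono)
    fix \<tau>
    show "indicator {t'<..<t} \<tau> * ennreal (?c (?\<mu> \<tau>)) \<le> liminf (\<lambda>m. F m \<tau>)"
    proof (cases "\<tau> \<in> {t'<..<t}")
      case True
      have "(\<lambda>m. ?\<mu> (\<tau> + e m) - e m) \<longlonglongrightarrow> ?\<mu> \<tau> - 0"
        using distr_fun_right_continuous[OF Dm um, of \<tau>] by (intro tendsto_diff e0) (simp add: e_def)
      then have "(\<lambda>m. max 0 (?\<mu> (\<tau> + e m) - e m)) \<longlonglongrightarrow> max 0 (?\<mu> \<tau>)" by (intro tendsto_max tendsto_const) simp
      then have "(\<lambda>m. ?c (max 0 (?\<mu> (\<tau> + e m) - e m))) \<longlonglongrightarrow> ?c (?\<mu> \<tau>)"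
        using n distr_fun_nonneg[of D u \<tau>] by (intro ball_perimeter_tendsto) (auto simp: max_def)
      then have lim: "(\<lambda>m. ennreal (?c (max 0 (?\<mu> (\<tau> + e m) - e m)))) \<longlonglongrightarrow> ennreal (?c (?\<mu> \<tau>))" by (rule tendsto_ennrealI)
      have "\<forall>\<^sub>F m in sequentially. e m < min ((\<tau> - t') / 3) ((t - \<tau>) / 2)"
        using True by (intro order_tendstoD(2)[OF e0]) auto
      then have "\<forall>\<^sub>F m in sequentially. ennreal (?c (max 0 (?\<mu> (\<tau> + e m) - e m))) = F m \<tau>"
        by eventually_elim (auto simp: F_def indicator_def)
      with lim have "(\<lambda>m. F m \<tau>) \<longlonglongrightarrow> ennreal (?c (?\<mu> \<tau>))" by (rule Lim_transform_eventually)
      then have "liminf (\<lambda>m. F m \<tau>) = ennreal (?c (?\<mu> \<tau>))" by (intro lim_imp_Liminf) auto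
      then show ?thesis using True by simp
    qed simp
  qed
  also have "\<dots> \<le> liminf (\<lambda>m. \<integral>\<^sup>+\<tau>. F m \<tau> \<partial>lborel)" by (rule nn_integral_liminf) measurable
  also have "\<dots> \<le> liminf (\<lambda>m. ?R + ennreal (2 * e m))" by (intro Liminf_mono always_eventually allI bound)
  also have "\<dots> = ?R"
  proof (intro lim_imp_Liminf)
    have "(\<lambda>m. ennreal (2 * e m)) \<longlonglongrightarrow> ennreal (2 * 0)" by (intro tendsto_ennrealI tendsto_mult tendsto_const e0)
    then have "(\<lambda>m. ?R + ennreal (2 * e m)) \<longlonglongrightarrow> ?R + ennreal (2 * 0)" by (intro tendsto_add tendsto_const)
    then show "(\<lambda>m. ?R + ennreal (2 * e m)) \<longlonglongrightarrow> ?R" by simp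
  qed simp
  finally show ?thesis .
qed

section \<open>The gradient profile\<close>

text \<open>Half-open cells of a grid tile the line without overlap. Keeping those that meet
  \<open>K\<close>, with length \<open>d\<close> such that the balls of radius \<open>d\<close>
  around \<open>K\<close> lie in \<open>U\<close>, gives a cover inside \<open>U\<close>.\<close>

lemma half_open_grid_cover:
  fixes K :: "real set"
  assumes K: "compact K" and U: "open U" "K \<subseteq> U"
  obtains J :: "int set" and d :: real where "0 < d" "finite J" "K \<subseteq> (\<Union>j\<in>J. {of_int j * d..<(of_int j + 1) * d})"
    "(\<Union>j\<in>J. {of_int j * d..<(of_int j + 1) * d}) \<subseteq> U" "\<And>i j :: int. i \<noteq> j \<Longrightarrow> {of_int i * d..<(of_int i + 1) * d} \<inter> {of_int j * d..<(of_int j + 1) * d} = {}"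
proof -
  obtain d where d: "0 < d" "(\<Union>x\<in>K. ball x d) \<subseteq> U"
    using compact_subset_open_imp_ball_epsilon_subset[OF K U] by metis
  define J where "J = (\<lambda>x. \<lfloor>x / d\<rfloor>) ` K"
  have cell: "x \<in> {of_int j * d..<(of_int j + 1) * d} \<longleftrightarrow> \<lfloor>x / d\<rfloor> = j" for x j
    using d by (auto simp: floor_eq_iff pos_le_divide_eq pos_divide_less_eq)
  obtain B where B: "\<And>x. x \<in> K \<Longrightarrow> \<bar>x\<bar> \<le> B" using compact_imp_bounded[OF K] by (auto simp: bounded_iff)
  have "J \<subseteq> {\<lfloor>- B / d\<rfloor>..\<lfloor>B / d\<rfloor>}"
  proof
    fix j assume "j \<in> J"
    then obtain x where x: "x \<in> K" "j = \<lfloor>x / d\<rfloor>" by (auto simp: J_def)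
    have "- B / d \<le> x / d" "x / d \<le> B / d" using B[OF x(1)] d by (intro divide_right_mono; simp)+
    then show "j \<in> {\<lfloor>- B / d\<rfloor>..\<lfloor>B / d\<rfloor>}" unfolding x(2) using floor_mono by auto
  qed
  then have fin: "finite J" by (rule finite_subset) simp
  show ?thesis
  proof (rule that[OF d(1) fin])
    show "K \<subseteq> (\<Union>j\<in>J. {of_int j * d..<(of_int j + 1) * d})"
      unfolding J_def by (auto simp only: UN_iff cell image_iff)
    show "(\<Union>j\<in>J. {of_int j * d..<(of_int j + 1) * d}) \<subseteq> U"
    proof
      fix y assume "y \<in> (\<Union>j\<in>J. {of_int j * d..<(of_int j + 1) * d})"
      then obtain j where j: "j \<in> J" "y \<in> {of_int j * d..<(of_int j + 1) * d}" by blast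
      then obtain x where x: "x \<in> K" "j = \<lfloor>x / d\<rfloor>" by (auto simp: J_def)
      have "x \<in> {of_int j * d..<(of_int j + 1) * d}" using x cell by auto
      then have "\<bar>x - y\<bar> < d" using j(2) by (auto simp: algebra_simps)
      then have "y \<in> ball x d" by (simp add: dist_real_def)
      then show "y \<in> U" using d(2) x(1) by blast
    qed
    show "{of_int i * d..<(of_int i + 1) * d} \<inter> {of_int j * d..<(of_int j + 1) * d} = {}" if "i \<noteq> j" for i j
    proof -
      have False if "x \<in> {of_int i * d..<(of_int i + 1) * d}" "x \<in> {of_int j * d..<(of_int j + 1) * d}" for x
        using that \<open>i \<noteq> j\<close> unfolding cell by simp
      then show ?thesis by blast
    qed
  qed
qed

section \<open>The push-forward of the perimeter measure\<close>

locale sobolev_profile =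
  fixes D :: "'a::euclidean_space set" and p :: real and u :: "'a \<Rightarrow> real"
  assumes D: "open D" "bounded D" and dim: "2 \<le> DIM('a)" and p: "1 \<le> p" and u: "in_W1p_0 D p u"
begin

abbreviation "N \<equiv> lebesgue_on D"
abbreviation "\<mu> \<equiv> distr_fun D u"
abbreviation "g \<equiv> (\<lambda>x. norm (weak_gradient D u x))"

lemma D_lmeasurable: "D \<in> lmeasurable" using D by (rule lmeasurable_open_bounded)

lemma finite_N: "finite_measure N" using D_lmeasurable by (rule finite_measure_lebesgue_on)

lemma u_meas [measurable]: "u \<in> borel_measurable N" using W1p_0_integrable(1)[OF D p u] by auto

lemma wg_meas [measurable]: "weak_gradient D u \<in> borel_measurable N" using W1p_0_integrable(2)[OF D p u] by auto

lemma g_int: "integrable N g" using W1p_0_integrable(2)[OF D p u] by (rule integrable_norm)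

lemma \<mu>_meas [measurable]: "\<mu> \<in> borel_measurable borel" by (rule distr_fun_measurable[OF D_lmeasurable u_meas])

lemma \<mu>_antimono: "s \<le> t \<Longrightarrow> \<mu> t \<le> \<mu> s" by (rule distr_fun_antimono[OF D_lmeasurable u_meas])

lemma emeasure_level: "emeasure N {x \<in> D. t < \<bar>u x\<bar>} = ennreal (\<mu> t)"
  by (rule distr_fun_eq_emeasure(2)[OF D_lmeasurable u_meas])

lemma level_sets: "{x \<in> D. t < \<bar>u x\<bar>} \<in> sets N"
proof -
  have "{x \<in> space N. t < \<bar>u x\<bar>} \<in> sets N" by measurable
  then show ?thesis by simp
qed

lemma emeasure_level_between:
  assumes "s \<le> t"
  shows "emeasure N {x \<in> D. s < \<bar>u x\<bar> \<and> \<bar>u x\<bar> \<le> t} = ennreal (\<mu> s - \<mu> t)"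
proof -
  have "{x \<in> D. s < \<bar>u x\<bar> \<and> \<bar>u x\<bar> \<le> t} = {x \<in> D. s < \<bar>u x\<bar>} - {x \<in> D. t < \<bar>u x\<bar>}" by auto
  also have "emeasure N \<dots> = emeasure N {x \<in> D. s < \<bar>u x\<bar>} - emeasure N {x \<in> D. t < \<bar>u x\<bar>}"
    using assms by (intro emeasure_Diff level_sets) (auto simp: emeasure_level)
  also have "\<dots> = ennreal (\<mu> s - \<mu> t)" by (simp add: emeasure_level ennreal_minus distr_fun_nonneg)
  finally show ?thesis .
qed

text \<open>Negative levels are cut off: there \<open>\<mu>\<close> is constantly the measure of
  \<open>D\<close>, and the total mass could be infinite.\<close>

definition level_perimeter :: "real measure" where
  "level_perimeter = density lborel (\<lambda>t. indicator {0<..} t * ennreal (ball_perimeter DIM('a) (\<mu> t)))"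

lemma sets_level_perimeter [simp, measurable_cong]: "sets level_perimeter = sets borel"
  by (simp add: level_perimeter_def)

lemma level_perimeter_le:
  assumes "0 \<le> t'"
  shows "emeasure level_perimeter {t'<..<t} \<le> (\<integral>\<^sup>+x. indicator {x. t' < \<bar>u x\<bar> \<and> \<bar>u x\<bar> < t} x * ennreal (g x) \<partial>N)"
proof -
  have "emeasure level_perimeter {t'<..<t} = (\<integral>\<^sup>+\<tau>. indicator {t'<..<t} \<tau> * ennreal (ball_perimeter DIM('a) (\<mu> \<tau>)) \<partial>lborel)"
    using assms by (auto simp: level_perimeter_def emeasure_density indicator_def intro!: nn_integral_cong)
  then show ?thesis using W1p_0_level_perimeter[OF D dim p u assms, of t] by simp
qed

lemma level_perimeter_UNIV: "emeasure level_perimeter UNIV \<le> (\<integral>\<^sup>+x. ennreal (g x) \<partial>N)"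
proof -
  have "emeasure level_perimeter UNIV = emeasure level_perimeter {0<..}"
    by (auto simp: level_perimeter_def emeasure_density indicator_def intro!: nn_integral_cong)
  also have "{0<..} = (\<Union>m::nat. {0<..<real m})" using reals_Archimedean2 by auto
  also have "emeasure level_perimeter \<dots> = (SUP m::nat. emeasure level_perimeter {0<..<real m})"
    by (intro SUP_emeasure_incseq[symmetric]) (auto intro!: monoI)
  also have "\<dots> \<le> (\<integral>\<^sup>+x. ennreal (g x) \<partial>N)"
    by (intro SUP_least order_trans[OF level_perimeter_le] nn_integral_mono) (auto simp: indicator_def)
  finally show ?thesis .
qed

text \<open>For smooth \<open>\<mu>\<close> with negative derivative, the density at
  \<open>s = \<mu> \<tau>\<close> is \<open>c s / (- \<mu>' \<tau>)\<close>, the classical formula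
  for the length of the gradient of the decreasing rearrangement at volume \<open>s\<close>. As a
  push-forward it makes sense for every \<open>\<mu>\<close>.\<close>

definition profile_measure :: "real measure" where
  "profile_measure = distr level_perimeter borel \<mu>"

lemma sets_profile_measure [simp, measurable_cong]: "sets profile_measure = sets borel"
  by (simp add: profile_measure_def)

lemma nn_integral_profile_measure:
  assumes [measurable]: "F \<in> borel_measurable borel"
  shows "(\<integral>\<^sup>+s. F s \<partial>profile_measure) = (\<integral>\<^sup>+t. indicator {0<..} t * ennreal (ball_perimeter DIM('a) (\<mu> t)) * F (\<mu> t) \<partial>lborel)"
  unfolding profile_measure_def level_perimeter_def
  by (subst nn_integral_distr) (auto simp: nn_integral_density)

lemma emeasure_profile_measure:
  assumes [measurable]: "E \<in> sets borel"
  shows "emeasure profile_measure E = emeasure level_perimeter {t. \<mu> t \<in> E}"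
  unfolding profile_measure_def by (subst emeasure_distr) (auto simp: vimage_def level_perimeter_def)

lemma profile_measure_UNIV: "emeasure profile_measure UNIV \<le> (\<integral>\<^sup>+x. ennreal (g x) \<partial>N)"
  using level_perimeter_UNIV by (simp add: emeasure_profile_measure)

lemma g_finite: "(\<integral>\<^sup>+x. ennreal (g x) \<partial>N) < \<infinity>"
  using g_int by (simp add: integrable_iff_bounded)

text \<open>By monotonicity the positive levels with \<open>\<mu>\<close> in \<open>{a..<b}\<close>
  form an interval, bounded because \<open>0 < a\<close>. Its end points are null for the perimeter
  measure, so \<open>S\<close> may use the open interval of levels; this excludes level sets of
  positive measure at the ends and gives the bound \<open>b - a\<close> for the measure of
  \<open>S\<close>.\<close>

lemma profile_measure_interval:
  assumes a: "0 < a"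
  shows "\<exists>S\<in>sets N. S \<subseteq> {x \<in> D. \<mu> \<bar>u x\<bar> \<in> {a..<b}} \<and> emeasure N S \<le> ennreal (b - a) \<and>
    emeasure profile_measure {a..<b} \<le> (\<integral>\<^sup>+x. indicator S x * ennreal (g x) \<partial>N)"
proof -
  define T where "T = {t. 0 < t \<and> \<mu> t \<in> {a..<b}}"
  have Tm[measurable]: "T \<in> sets borel"
  proof -
    have "{t \<in> space borel. 0 < t \<and> \<mu> t \<in> {a..<b}} \<in> sets borel" by measurable
    then show ?thesis by (simp add: T_def)
  qed
  have eT: "emeasure profile_measure {a..<b} = emeasure level_perimeter T"
    by (subst emeasure_profile_measure) (auto simp: level_perimeter_def emeasure_density indicator_def T_def intro!: nn_integral_cong)
  show ?thesis
  proof (cases "T = {}")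
    case True
    then show ?thesis using eT by (intro bexI[of _ "{}"]) auto
  next
    case False
    obtain K where K: "0 \<le> K" "\<mu> K < a" using decr_rearr_ne[OF D_lmeasurable u_meas a] by auto
    have Tlt: "t < K" if t: "t \<in> T" for t
    proof (rule ccontr)
      assume "\<not> t < K"
      then have "\<mu> t \<le> \<mu> K" by (intro \<mu>_antimono) simp
      then show False using K t by (simp add: T_def)
    qed
    have ba: "bdd_above T" "bdd_below T"
      by (rule bdd_aboveI[of _ K], drule Tlt, simp, rule bdd_belowI[of _ 0], simp add: T_def)
    have conv: "r \<in> T" if "p \<in> T" "q \<in> T" "p \<le> r" "r \<le> q" for p q r
      using that \<mu>_antimono[of p r] \<mu>_antimono[of r q] by (auto simp: T_def)
    define t' where "t' = Inf T"
    define t where "t = Sup T"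
    have t'0: "0 \<le> t'" unfolding t'_def using False by (intro cInf_greatest) (auto simp: T_def)
    have sub: "T \<subseteq> {t'..t}" unfolding t'_def t_def using ba by (auto intro: cInf_lower cSup_upper)
    have sup: "{t'<..<t} \<subseteq> T"
    proof
      fix r assume r: "r \<in> {t'<..<t}"
      obtain p where "p \<in> T" "p < r" using r cInf_less_iff[OF False ba(2), of r] by (auto simp: t'_def)
      moreover obtain q where "q \<in> T" "r < q" using r less_cSup_iff[OF False ba(1), of r] by (auto simp: t_def)
      ultimately show "r \<in> T" using conv[of p q r] by simp
    qed
    define S where "S = {x \<in> D. t' < \<bar>u x\<bar> \<and> \<bar>u x\<bar> < t}"
    have Sm: "S \<in> sets N"
    proof -
      have "{x \<in> space N. t' < \<bar>u x\<bar> \<and> \<bar>u x\<bar> < t} \<in> sets N" by measurable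
      then show ?thesis by (simp add: S_def)
    qed
    have SD: "S \<subseteq> {x \<in> D. \<mu> \<bar>u x\<bar> \<in> {a..<b}}" using sup by (force simp: S_def T_def)
    have "emeasure level_perimeter T \<le> emeasure level_perimeter {t'..t}" using sub by (intro emeasure_mono) auto
    also have "\<dots> = emeasure level_perimeter {t'<..<t}"
      unfolding level_perimeter_def using AE_lborel_singleton[of t] AE_lborel_singleton[of t']
      by (simp add: emeasure_density) (intro nn_integral_cong_AE; auto simp: indicator_def)
    also have "\<dots> \<le> (\<integral>\<^sup>+x. indicator {x. t' < \<bar>u x\<bar> \<and> \<bar>u x\<bar> < t} x * ennreal (g x) \<partial>N)" by (rule level_perimeter_le[OF t'0])
    also have "\<dots> = (\<integral>\<^sup>+x. indicator S x * ennreal (g x) \<partial>N)" by (intro nn_integral_cong) (auto simp: S_def indicator_def)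
    finally have le: "emeasure profile_measure {a..<b} \<le> (\<integral>\<^sup>+x. indicator S x * ennreal (g x) \<partial>N)" unfolding eT .
    have "emeasure N S \<le> ennreal (b - a)"
    proof (cases "t' < t")
      case True
      \<comment> \<open>The factor \<open>1 / (k + 3)\<close> makes \<open>2 * e k < t - t'\<close>
        already at \<open>k = 0\<close>, so that \<open>t' + e k\<close> and \<open>t - e k\<close>
        are levels in \<open>T\<close>, in this order.\<close>
      define e where "e k = (t - t') * inverse (real (Suc (k + 2)))" for k
      have e: "0 < e k" "2 * e k < t - t'" for k
      proof -
        show "0 < e k" using True by (simp add: e_def)
        have "inverse (real (Suc (k + 2))) \<le> inverse 3" by (intro le_imp_inverse_le) auto
        then have "e k \<le> (t - t') * inverse 3" unfolding e_def using True by (intro mult_left_mono) auto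
        then show "2 * e k < t - t'" using True by simp
      qed
      have e_anti: "e l \<le> e k" if "k \<le> l" for k l
        unfolding e_def using that True by (intro mult_left_mono le_imp_inverse_le) auto
      have e0: "e \<longlonglongrightarrow> 0"
        using tendsto_mult[OF tendsto_const[of "t - t'"] LIMSEQ_ignore_initial_segment[OF LIMSEQ_inverse_real_of_nat, of 2]]
        unfolding e_def[abs_def] by simp
      let ?A = "\<lambda>k. {x \<in> D. t' + e k < \<bar>u x\<bar> \<and> \<bar>u x\<bar> \<le> t - e k}"
      have "S = (\<Union>k. ?A k)"
      proof (intro equalityI subsetI)
        fix x assume x: "x \<in> S"
        then have "0 < min (\<bar>u x\<bar> - t') (t - \<bar>u x\<bar>)" by (auto simp: S_def)
        then have "\<forall>\<^sub>F k in sequentially. e k < min (\<bar>u x\<bar> - t') (t - \<bar>u x\<bar>)" by (rule order_tendstoD(2)[OF e0])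
        then obtain k where "e k < min (\<bar>u x\<bar> - t') (t - \<bar>u x\<bar>)" by (auto simp: eventually_sequentially)
        then have "x \<in> ?A k" using x by (auto simp: S_def)
        then show "x \<in> (\<Union>k. ?A k)" by blast
      next
        fix x assume "x \<in> (\<Union>k. ?A k)"
        then obtain k where "x \<in> ?A k" by blast
        then show "x \<in> S" using e(1)[of k] by (auto simp: S_def)
      qed
      also have "emeasure N \<dots> = (SUP k. emeasure N (?A k))"
      proof (rule SUP_emeasure_incseq[symmetric])
        have "{x \<in> space N. t' + e k < \<bar>u x\<bar> \<and> \<bar>u x\<bar> \<le> t - e k} \<in> sets N" for k by measurable
        then show "range ?A \<subseteq> sets N" by auto
        show "incseq ?A"
        proof (rule monoI)
          fix k l :: nat assume "k \<le> l"
          from e_anti[OF this] show "?A k \<subseteq> ?A l" by auto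
        qed
      qed
      also have "\<dots> \<le> ennreal (b - a)"
      proof (rule SUP_least)
        fix k
        have "t' + e k \<in> T" "t - e k \<in> T" using e[of k] sup by (auto simp: subset_iff)
        then have "\<mu> (t' + e k) - \<mu> (t - e k) \<le> b - a" by (auto simp: T_def)
        then show "emeasure N (?A k) \<le> ennreal (b - a)"
          using e[of k] by (subst emeasure_level_between) (auto intro: ennreal_leI)
      qed
      finally show ?thesis .
    next
      case False
      then have "S = {}" by (auto simp: S_def)
      then show ?thesis by simp
    qed
    with Sm SD le show ?thesis by blast
  qed
qed

text \<open>Each cell of a disjoint cover by intervals of length \<open>d\<close> is charged to a
  set \<open>S j\<close> of measure at most \<open>d\<close>, and these sets are disjoint. Bounding
  \<open>g\<close> on them by \<open>k\<close> plus the excess over \<open>k\<close> produces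
  \<open>k\<close> times the total cell length, which is close to the measure of \<open>K\<close>,
  plus a single excess integral.\<close>

lemma profile_measure_compact:
  assumes K: "compact K" "K \<subseteq> {0<..}" and k: "0 \<le> k"
  shows "emeasure profile_measure K \<le> ennreal k * emeasure lborel K + (\<integral>\<^sup>+x. ennreal (g x - k) \<partial>N)"
proof (rule ennreal_le_epsilon)
  fix e :: real assume e: "0 < e"
  have Kb: "K \<in> sets borel" using K(1) by (rule borel_compact)
  \<comment> \<open>Chosen so that the surplus \<open>k * \<epsilon>\<close> of the cover is at most
    \<open>e\<close>; the denominator \<open>k + 1\<close> also allows \<open>k = 0\<close>.\<close>
  define \<epsilon> where "\<epsilon> = e / (k + 1)"
  have \<epsilon>: "0 < \<epsilon>" "k * \<epsilon> \<le> e"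
  proof -
    show "0 < \<epsilon>" using e k by (simp add: \<epsilon>_def)
    have "k * \<epsilon> = e * (k / (k + 1))" by (simp add: \<epsilon>_def)
    also have "\<dots> \<le> e * 1" using e k by (intro mult_left_mono) auto
    finally show "k * \<epsilon> \<le> e" by simp
  qed
  obtain U where U: "open U" "K \<subseteq> U" "emeasure lborel (U - K) < ennreal \<epsilon>" using outer_regular_lborel[OF Kb \<epsilon>(1)] .
  have V: "open (U \<inter> {0<..})" "K \<subseteq> U \<inter> {0<..}" using U K by auto
  obtain J :: "int set" and d where J: "0 < d" "finite J" "K \<subseteq> (\<Union>j\<in>J. {of_int j * d..<(of_int j + 1) * d})"
    "(\<Union>j\<in>J. {of_int j * d..<(of_int j + 1) * d}) \<subseteq> U \<inter> {0<..}" "\<And>i j :: int. i \<noteq> j \<Longrightarrow> {of_int i * d..<(of_int i + 1) * d} \<inter> {of_int j * d..<(of_int j + 1) * d} = {}"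
    by (rule half_open_grid_cover[OF K(1) V]) (rule that)
  let ?I = "\<lambda>j::int. {of_int j * d..<(of_int j + 1) * d}"
  have pos: "0 < of_int j * d" if "j \<in> J" for j :: int
  proof -
    have "of_int j * d \<in> ?I j" using J(1) by (simp add: algebra_simps)
    then show ?thesis using J(4) that by blast
  qed
  define P where "P j S \<longleftrightarrow> S \<in> sets N \<and> S \<subseteq> {x \<in> D. \<mu> \<bar>u x\<bar> \<in> ?I j} \<and> emeasure N S \<le> ennreal d \<and>
    emeasure profile_measure (?I j) \<le> (\<integral>\<^sup>+x. indicator S x * ennreal (g x) \<partial>N)" for j S
  have "\<exists>S. P j S" if "j \<in> J" for j
    using profile_measure_interval[OF pos[OF that], of "(of_int j + 1) * d"] unfolding P_def by (auto simp: algebra_simps)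
  then obtain S where PS: "\<And>j. j \<in> J \<Longrightarrow> P j (S j)" by metis
  have Sm: "S j \<in> sets N" and SD: "S j \<subseteq> {x \<in> D. \<mu> \<bar>u x\<bar> \<in> ?I j}" and Sd: "emeasure N (S j) \<le> ennreal d"
    and Sle: "emeasure profile_measure (?I j) \<le> (\<integral>\<^sup>+x. indicator (S j) x * ennreal (g x) \<partial>N)" if "j \<in> J" for j
    using PS[OF that] by (simp_all only: P_def)
  have disjI: "disjoint_family_on ?I J" using J(5) by (auto simp: disjoint_family_on_def)
  have disjS: "disjoint_family_on S J"
    unfolding disjoint_family_on_def
  proof (intro ballI impI)
    fix i j assume ij: "i \<in> J" "j \<in> J" "i \<noteq> j"
    then show "S i \<inter> S j = {}" using SD[OF ij(1)] SD[OF ij(2)] J(5)[OF ij(3)] by blast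
  qed
  have len: "ennreal d * of_nat (card J) \<le> emeasure lborel K + ennreal \<epsilon>"
  proof -
    have "ennreal d * of_nat (card J) = (\<Sum>j\<in>J. emeasure lborel (?I j))" using J(1) by (simp add: algebra_simps)
    also have "\<dots> = emeasure lborel (\<Union>j\<in>J. ?I j)" using disjI J(2) by (intro sum_emeasure) auto
    also have "\<dots> \<le> emeasure lborel (K \<union> (U - K))" using J(4) U(1) Kb by (intro emeasure_mono) (auto intro!: borel_open sets.Un sets.Diff)
    also have "\<dots> \<le> emeasure lborel K + emeasure lborel (U - K)" using U(1) Kb by (intro emeasure_subadditive) auto
    also have "\<dots> \<le> emeasure lborel K + ennreal \<epsilon>" using U(3) by (intro add_left_mono) simp
    finally show ?thesis .
  qed
  have "emeasure profile_measure K \<le> emeasure profile_measure (\<Union>j\<in>J. ?I j)" using J(3) by (intro emeasure_mono) (auto intro!: sets.finite_UN J(2))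
  also have "\<dots> = (\<Sum>j\<in>J. emeasure profile_measure (?I j))" using disjI J(2) by (intro sum_emeasure[symmetric]) auto
  also have "\<dots> \<le> (\<Sum>j\<in>J. (\<integral>\<^sup>+x. indicator (S j) x * ennreal (g x) \<partial>N))" by (intro sum_mono Sle)
  also have "\<dots> \<le> (\<Sum>j\<in>J. (\<integral>\<^sup>+x. ennreal k * indicator (S j) x + indicator (S j) x * ennreal (g x - k) \<partial>N))"
  proof (intro sum_mono nn_integral_mono)
    fix j x
    have "ennreal (g x) \<le> ennreal k + ennreal (g x - k)"
      using k by (cases "k \<le> g x") (auto simp: ennreal_plus[symmetric] ennreal_neg intro: ennreal_leI simp del: ennreal_plus)
    then show "indicator (S j) x * ennreal (g x) \<le> ennreal k * indicator (S j) x + indicator (S j) x * ennreal (g x - k)"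
      by (auto simp: indicator_def)
  qed
  also have "\<dots> = (\<Sum>j\<in>J. ennreal k * emeasure N (S j) + (\<integral>\<^sup>+x. indicator (S j) x * ennreal (g x - k) \<partial>N))"
    using Sm by (intro sum.cong refl) (simp add: nn_integral_add nn_integral_cmult)
  also have "\<dots> = (\<Sum>j\<in>J. ennreal k * emeasure N (S j)) + (\<Sum>j\<in>J. (\<integral>\<^sup>+x. indicator (S j) x * ennreal (g x - k) \<partial>N))"
    by (rule sum.distrib)
  also have "\<dots> \<le> (\<Sum>j\<in>J. ennreal k * ennreal d) + (\<integral>\<^sup>+x. ennreal (g x - k) \<partial>N)"
  proof (intro add_mono sum_mono mult_left_mono)
    show "emeasure N (S j) \<le> ennreal d" if "j \<in> J" for j using that by (rule Sd)
    have "(\<Sum>j\<in>J. (\<integral>\<^sup>+x. indicator (S j) x * ennreal (g x - k) \<partial>N)) = (\<integral>\<^sup>+x. (\<Sum>j\<in>J. indicator (S j) x * ennreal (g x - k)) \<partial>N)"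
    proof (intro nn_integral_sum[symmetric])
      fix j assume "j \<in> J"
      note [measurable] = Sm[OF this]
      show "(\<lambda>x. indicator (S j) x * ennreal (g x - k)) \<in> borel_measurable N" by measurable
    qed
    also have "\<dots> \<le> (\<integral>\<^sup>+x. ennreal (g x - k) \<partial>N)"
    proof (rule nn_integral_mono)
      fix x
      have "(\<Sum>j\<in>J. indicator (S j) x) = (indicator (\<Union>j\<in>J. S j) x :: ennreal)"
        by (rule indicator_UN_disjoint[symmetric]) (use J(2) disjS in auto)
      then have "(\<Sum>j\<in>J. indicator (S j) x * ennreal (g x - k)) = indicator (\<Union>j\<in>J. S j) x * ennreal (g x - k)"
        by (simp add: sum_distrib_right[symmetric])
      then show "(\<Sum>j\<in>J. indicator (S j) x * ennreal (g x - k)) \<le> ennreal (g x - k)" by (auto simp: indicator_def)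
    qed
    finally show "(\<Sum>j\<in>J. (\<integral>\<^sup>+x. indicator (S j) x * ennreal (g x - k) \<partial>N)) \<le> (\<integral>\<^sup>+x. ennreal (g x - k) \<partial>N)" .
  qed auto
  also have "(\<Sum>j\<in>J. ennreal k * ennreal d) = ennreal k * (ennreal d * of_nat (card J))" by (simp add: mult_ac)
  also have "\<dots> \<le> ennreal k * (emeasure lborel K + ennreal \<epsilon>)" using len by (intro mult_left_mono) auto
  also have "\<dots> = ennreal k * emeasure lborel K + ennreal (k * \<epsilon>)" using k \<epsilon>(1) by (simp add: distrib_left ennreal_mult)
  also have "\<dots> \<le> ennreal k * emeasure lborel K + ennreal e" using \<epsilon>(2) by (intro add_left_mono ennreal_leI)
  finally show "emeasure profile_measure K \<le> ennreal k * emeasure lborel K + (\<integral>\<^sup>+x. ennreal (g x - k) \<partial>N) + ennreal e"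
    by (simp add: add_ac add_mono)
qed

text \<open>Inner regularity of the finite measure \<open>profile_measure\<close> extends the bound
  from compact sets.\<close>

lemma profile_measure_borel:
  assumes E: "E \<in> sets borel" "E \<subseteq> {0<..}" and k: "0 \<le> k"
  shows "emeasure profile_measure E \<le> ennreal k * emeasure lborel E + (\<integral>\<^sup>+x. ennreal (g x - k) \<partial>N)"
proof -
  have fin: "emeasure profile_measure (space profile_measure) \<noteq> \<infinity>"
    using le_less_trans[OF profile_measure_UNIV g_finite] by (simp add: profile_measure_def)
  have "emeasure profile_measure E = (SUP K\<in>{K. K \<subseteq> E \<and> compact K}. emeasure profile_measure K)"
    using fin E by (intro inner_regular) auto
  also have "\<dots> \<le> ennreal k * emeasure lborel E + (\<integral>\<^sup>+x. ennreal (g x - k) \<partial>N)"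
  proof (rule SUP_least)
    fix K assume K: "K \<in> {K. K \<subseteq> E \<and> compact K}"
    then have "emeasure profile_measure K \<le> ennreal k * emeasure lborel K + (\<integral>\<^sup>+x. ennreal (g x - k) \<partial>N)"
      using E k by (intro profile_measure_compact) auto
    also have "\<dots> \<le> ennreal k * emeasure lborel E + (\<integral>\<^sup>+x. ennreal (g x - k) \<partial>N)"
      using K E by (intro add_right_mono mult_left_mono emeasure_mono) auto
    finally show "emeasure profile_measure K \<le> \<dots>" .
  qed
  finally show ?thesis .
qed

text \<open>\<open>\<mu>\<close> takes values between 0 and the measure of \<open>D\<close>, and at
  the value 0 the density \<open>c\<close> vanishes.\<close>

lemma profile_measure_outside:
  assumes E: "E \<in> sets borel" "E \<inter> {0<..measure lebesgue D} = {}"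
  shows "emeasure profile_measure E = 0"
proof -
  have "emeasure profile_measure E = (\<integral>\<^sup>+s. indicator E s \<partial>profile_measure)" using E by simp
  also have "\<dots> = (\<integral>\<^sup>+t. indicator {0<..} t * ennreal (ball_perimeter DIM('a) (\<mu> t)) * indicator E (\<mu> t) \<partial>lborel)"
    using E by (intro nn_integral_profile_measure) auto
  also have "\<dots> = (\<integral>\<^sup>+t. 0 \<partial>(lborel :: real measure))"
  proof (intro nn_integral_cong)
    fix t
    have "\<mu> t \<le> measure lebesgue D" by (rule distr_fun_le[OF D_lmeasurable u_meas])
    then have "\<mu> t \<in> E \<Longrightarrow> \<mu> t = 0" using E(2) distr_fun_nonneg[of D u t] by force
    then show "indicator {0<..} t * ennreal (ball_perimeter DIM('a) (\<mu> t)) * indicator E (\<mu> t) = 0" by (auto simp: indicator_def ball_perimeter_def)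
  qed
  finally show ?thesis by simp
qed

text \<open>On a null set the bound for Borel sets leaves only the excess integral of
  \<open>g\<close> over \<open>k\<close>, which is arbitrarily small for large
  \<open>k\<close>.\<close>

lemma profile_measure_absolutely_continuous: "absolutely_continuous lborel profile_measure"
  unfolding absolutely_continuous_def
proof
  fix E :: "real set" assume E: "E \<in> null_sets lborel"
  then have Eb: "E \<in> sets borel" by auto
  have small: "emeasure profile_measure (E \<inter> {0<..}) \<le> ennreal e" if e: "0 < e" for e
  proof -
    obtain k :: nat where k: "(\<integral>\<^sup>+x. ennreal (g x - real k) \<partial>N) < ennreal e" using excess_integral_small[OF g_int e] .
    have "E \<inter> {0<..} \<in> null_sets lborel" using E by (rule null_set_Int2) simp
    then have null: "emeasure lborel (E \<inter> {0<..}) = 0" by (rule null_setsD1)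
    have "E \<inter> {0<..} \<in> sets borel" using Eb by simp
    from profile_measure_borel[OF this Int_lower2 of_nat_0_le_iff[of k]]
    have "emeasure profile_measure (E \<inter> {0<..}) \<le> (\<integral>\<^sup>+x. ennreal (g x - real k) \<partial>N)" by (simp only: null mult_zero_right add_0_left)
    then show ?thesis using k by (meson order_trans less_imp_le)
  qed
  have zero: "emeasure profile_measure (E \<inter> {0<..}) = 0"
  proof -
    have "emeasure profile_measure (E \<inter> {0<..}) \<le> 0"
    proof (rule ennreal_le_epsilon)
      fix e :: real assume "0 < e"
      from small[OF this] show "emeasure profile_measure (E \<inter> {0<..}) \<le> 0 + ennreal e" by (simp only: add_0_left)
    qed
    then show ?thesis by simp
  qed
  have "emeasure profile_measure (E - {0<..}) = 0"
  proof (rule profile_measure_outside)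
    show "E - {0<..} \<in> sets borel" using Eb by simp
    show "(E - {0<..}) \<inter> {0<..measure lebesgue D} = {}" by auto
  qed
  moreover have "emeasure profile_measure E = emeasure profile_measure (E \<inter> {0<..}) + emeasure profile_measure (E - {0<..})"
  proof -
    have "E = (E \<inter> {0<..}) \<union> (E - {0<..})" by blast
    moreover have "emeasure profile_measure ((E \<inter> {0<..}) \<union> (E - {0<..})) = emeasure profile_measure (E \<inter> {0<..}) + emeasure profile_measure (E - {0<..})"
      using Eb by (intro plus_emeasure[symmetric]) auto
    ultimately show ?thesis by (simp only:)
  qed
  ultimately have "emeasure profile_measure E = 0" using zero by simp
  then show "E \<in> null_sets profile_measure" using Eb by (auto simp: null_sets_def)
qed

text \<open>The Radon--Nikodym density, changed on a null set so as to be real-valued and to vanish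
  off \<open>{0<..measure lebesgue D}\<close>. The last property is the transfer rule between levels
  \<open>t\<close> and volumes \<open>s\<close> on which the later computations rest.\<close>

lemma obtain_profile:
  obtains h :: "real \<Rightarrow> real" where "h \<in> borel_measurable borel" "\<And>s. 0 \<le> h s"
    "\<And>s. s \<notin> {0<..measure lebesgue D} \<Longrightarrow> h s = 0"
    "\<And>k. 0 \<le> k \<Longrightarrow> (\<integral>\<^sup>+s. ennreal (h s - k) \<partial>lborel) \<le> (\<integral>\<^sup>+x. ennreal (g x - k) \<partial>N)"
    "\<And>F. F \<in> borel_measurable borel \<Longrightarrow>
      (\<integral>\<^sup>+t. indicator {0<..} t * ennreal (ball_perimeter DIM('a) (\<mu> t)) * F (\<mu> t) \<partial>lborel) = (\<integral>\<^sup>+s. ennreal (h s) * F s \<partial>lborel)"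
proof -
  obtain f where f[measurable]: "f \<in> borel_measurable lborel" and fd: "density lborel f = profile_measure"
    using sigma_finite_measure.Radon_Nikodym[OF sigma_finite_lborel profile_measure_absolutely_continuous] by auto
  let ?M = "measure lebesgue D"
  have "(\<integral>\<^sup>+s. f s \<partial>lborel) = emeasure profile_measure UNIV" unfolding fd[symmetric] by (simp add: emeasure_density)
  also have "\<dots> < \<infinity>" using le_less_trans[OF profile_measure_UNIV g_finite] .
  finally have "AE s in lborel. f s \<noteq> \<infinity>" by (intro nn_integral_PInf_AE) auto
  moreover have "AE s in lborel. f s * indicator (- {0<..?M}) s = 0"
  proof -
    have "(\<integral>\<^sup>+s. f s * indicator (- {0<..?M}) s \<partial>lborel) = emeasure profile_measure (- {0<..?M})"
      unfolding fd[symmetric] by (simp add: emeasure_density)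
    also have "\<dots> = 0" by (intro profile_measure_outside) auto
    finally show ?thesis by (subst (asm) nn_integral_0_iff_AE) auto
  qed
  define h where "h s = (if s \<in> {0<..?M} then enn2real (f s) else 0)" for s
  have [measurable]: "h \<in> borel_measurable borel" unfolding h_def by measurable
  have "AE s in lborel. f s = ennreal (h s)"
    using \<open>AE s in lborel. f s \<noteq> \<infinity>\<close> \<open>AE s in lborel. f s * indicator (- {0<..?M}) s = 0\<close>
    by eventually_elim (auto simp: h_def less_top)
  then have hd: "density lborel (\<lambda>s. ennreal (h s)) = profile_measure"
    unfolding fd[symmetric] by (intro density_cong) auto
  show ?thesis
  proof (rule that[of h])
    show "h \<in> borel_measurable borel" by measurable
    show "0 \<le> h s" for s by (simp add: h_def)
    show "h s = 0" if "s \<notin> {0<..?M}" for s using that unfolding h_def by (rule if_not_P)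
    show "(\<integral>\<^sup>+t. indicator {0<..} t * ennreal (ball_perimeter DIM('a) (\<mu> t)) * F (\<mu> t) \<partial>lborel) = (\<integral>\<^sup>+s. ennreal (h s) * F s \<partial>lborel)"
      if [measurable]: "F \<in> borel_measurable borel" for F
    proof -
      have "(\<integral>\<^sup>+s. F s \<partial>profile_measure) = (\<integral>\<^sup>+s. ennreal (h s) * F s \<partial>lborel)"
        unfolding hd[symmetric] by (simp add: nn_integral_density)
      then show ?thesis using nn_integral_profile_measure[OF that] by simp
    qed
    fix k :: real assume k: "0 \<le> k"
    \<comment> \<open>On the set where \<open>h\<close> exceeds \<open>k\<close> the bound for Borel
      sets says that the integral of \<open>h\<close> is at most \<open>k\<close> times the measure
      of \<open>E\<close> plus the excess of \<open>g\<close>; subtracting that finite multiple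
      leaves the excess of \<open>h\<close>.\<close>
    define E where "E = {s \<in> {0<..?M}. k < h s}"
    have [measurable]: "E \<in> sets borel" unfolding E_def by measurable
    have Efin: "emeasure lborel E < \<infinity>"
    proof -
      have "emeasure lborel E \<le> emeasure lborel {0<..?M}" by (intro emeasure_mono) (auto simp: E_def)
      then show ?thesis by (rule le_less_trans) simp
    qed
    have "(\<integral>\<^sup>+s. ennreal (h s - k) \<partial>lborel) + ennreal k * emeasure lborel E = (\<integral>\<^sup>+s. ennreal (h s - k) + ennreal k * indicator E s \<partial>lborel)"
      by (subst nn_integral_add) (simp_all add: nn_integral_cmult)
    also have "\<dots> = (\<integral>\<^sup>+s. ennreal (h s) * indicator E s \<partial>lborel)"
    proof (intro nn_integral_cong)
      fix s
      show "ennreal (h s - k) + ennreal k * indicator E s = ennreal (h s) * indicator E s"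
      proof (cases "s \<in> E")
        case True
        then have "ennreal (h s - k) + ennreal k = ennreal (h s)"
          using k by (subst ennreal_plus[symmetric]) (auto simp: E_def)
        then show ?thesis using True by simp
      next
        case False
        then have "h s \<le> k" using k by (cases "s \<in> {0<..?M}") (auto simp: E_def not_less h_def)
        then show ?thesis using False by (simp add: ennreal_neg)
      qed
    qed
    also have "\<dots> = emeasure profile_measure E" unfolding hd[symmetric] by (simp add: emeasure_density)
    also have "\<dots> \<le> ennreal k * emeasure lborel E + (\<integral>\<^sup>+x. ennreal (g x - k) \<partial>N)"
      using k by (intro profile_measure_borel) (auto simp: E_def)
    finally have "ennreal k * emeasure lborel E + (\<integral>\<^sup>+s. ennreal (h s - k) \<partial>lborel) \<le> ennreal k * emeasure lborel E + (\<integral>\<^sup>+x. ennreal (g x - k) \<partial>N)"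
      by (simp add: add.commute)
    then show "(\<integral>\<^sup>+s. ennreal (h s - k) \<partial>lborel) \<le> (\<integral>\<^sup>+x. ennreal (g x - k) \<partial>N)"
      using Efin by (subst (asm) ennreal_add_left_cancel_le) (auto simp: ennreal_mult_eq_top_iff)
  qed
qed

end

section \<open>The gradient of the decreasing rearrangement\<close>

text \<open>The usual surface area of a sphere. The centre is treated apart because in dimension 1
  the power \<open>0 ^ 0\<close> is 1, whereas \<open>0 powr 0\<close> is 0.\<close>

lemma ball_perimeter_ball_vol:
  fixes x :: "'a::euclidean_space"
  shows "ball_perimeter DIM('a) (ball_vol x) = (if x = 0 then 0 else unit_ball_vol DIM('a) * DIM('a) * norm x ^ (DIM('a) - 1))"
proof (cases "x = 0")
  case False
  let ?n = "DIM('a)" and ?w = "unit_ball_vol DIM('a)"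
  have w: "0 < ?w" by (rule unit_ball_vol_DIM_pos)
  have r: "0 < norm x" using False by simp
  have "(norm x ^ ?n) powr (1 - 1 / ?n) = norm x powr (real ?n * (1 - 1 / ?n))"
    using r by (simp only: powr_realpow[symmetric] powr_powr)
  also have "real ?n * (1 - 1 / ?n) = real (?n - 1)" by (simp add: right_diff_distrib of_nat_diff)
  also have "norm x powr real (?n - 1) = norm x ^ (?n - 1)" using r by (rule powr_realpow)
  finally have 1: "(norm x ^ ?n) powr (1 - 1 / ?n) = norm x ^ (?n - 1)" .
  have 2: "?w powr (1 / ?n) * ?w powr (1 - 1 / ?n) = ?w"
    using w by (simp only: powr_add[symmetric]) simp
  have "ball_perimeter ?n (ball_vol x) = ?n * ?w powr (1 / ?n) * (?w powr (1 - 1 / ?n) * (norm x ^ ?n) powr (1 - 1 / ?n))"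
    using w by (simp add: ball_perimeter_def ball_vol_def powr_mult)
  also have "\<dots> = ?n * (?w powr (1 / ?n) * ?w powr (1 - 1 / ?n)) * norm x ^ (?n - 1)" by (simp only: 1 mult.assoc)
  also have "\<dots> = ?w * ?n * norm x ^ (?n - 1)" by (simp only: 2 mult_ac)
  finally show ?thesis using False by simp
qed (simp add: ball_perimeter_def ball_vol_def)

lemma ball_perimeter_pos: "0 < n \<Longrightarrow> 0 < s \<Longrightarrow> 0 < ball_perimeter n s"
proof -
  assume "0 < n" "0 < s"
  moreover from this have "unit_ball_vol n \<noteq> 0" using unit_ball_vol_pos[of n] by (metis less_imp_le less_irrefl)
  ultimately show ?thesis unfolding ball_perimeter_def by (intro mult_pos_pos) auto
qed

text \<open>The relation through which the integral of \<open>\<bar>u\<bar>\<close> turns into an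
  integral against \<open>norm x\<close>.\<close>

lemma ball_vol_eq_norm_perimeter:
  fixes x :: "'a::euclidean_space"
  shows "real DIM('a) * ball_vol x = norm x * ball_perimeter DIM('a) (ball_vol x)"
proof (cases "x = 0")
  case False
  have "norm x * norm x ^ (DIM('a) - 1) = norm x ^ DIM('a)" by (simp add: power_Suc[symmetric] del: power_Suc)
  then show ?thesis using False by (simp add: ball_perimeter_ball_vol) (simp add: ball_vol_def mult_ac)
qed (simp add: ball_vol_def)

lemma finite_measures_eqI_lessThan:
  fixes M N :: "real measure"
  assumes "sets M = sets borel" "sets N = sets borel" "finite_measure M" "\<And>s. emeasure M {..<s} = emeasure N {..<s}"
  shows "M = N"
proof (rule measure_eqI_generator_eq[where E="range lessThan" and \<Omega>=UNIV and A="\<lambda>i. {..<real i}"])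
  show "Int_stable (range (lessThan :: real \<Rightarrow> real set))"
  proof (unfold Int_stable_def, safe)
    fix a b :: real
    have "{..<a} \<inter> {..<b} = {..<min a b}" by auto
    then show "{..<a} \<inter> {..<b} \<in> range lessThan" by simp
  qed
  show "sets M = sigma_sets UNIV (range lessThan)" "sets N = sigma_sets UNIV (range lessThan)"
    using assms(1,2) by (simp_all add: borel_Iio)
  show "(\<Union>i. {..<real i}) = UNIV" using reals_Archimedean2 by auto
  show "emeasure M {..<real i} \<noteq> \<infinity>" for i using finite_measure.emeasure_finite[OF assms(3)] by simp
qed (use assms in auto)

text \<open>The radial cutoff with the unit ball volume as factor and the dimension as exponent;
  differentiating the volume in the radius produces the perimeter.\<close>

lemma ball_vol_test_function_perimeter:
  fixes \<psi> :: "'a::euclidean_space \<Rightarrow> real"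
  assumes \<psi>: "test_function D \<psi>" and b: "b \<in> Basis"
  shows "(LINT x|lborel. max 0 (s - ball_vol x) * partial_deriv b \<psi> x)
      = (LINT x|lborel. indicator {x. ball_vol x < s} x * (ball_perimeter DIM('a) (ball_vol x) * (sgn x \<bullet> b) * \<psi> x))"
    and "integrable lborel (\<lambda>x. indicator {x. ball_vol x < s} x * (ball_perimeter DIM('a) (ball_vol x) * (sgn x \<bullet> b) * \<psi> x))"
proof -
  let ?n = "DIM('a)" and ?w = "unit_ball_vol DIM('a)"
  have w: "0 < ?w" by (rule unit_ball_vol_DIM_pos)
  have n: "1 \<le> ?n" by (simp add: Suc_leI)
  have eq: "(if ?w * norm x ^ ?n < s then ?w * (?n * norm x ^ (?n - 1)) * (sgn x \<bullet> b) else 0) * \<psi> x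
      = indicator {x. ball_vol x < s} x * (ball_perimeter ?n (ball_vol x) * (sgn x \<bullet> b) * \<psi> x)" for x
    by (cases "x = 0") (auto simp: ball_perimeter_ball_vol ball_vol_def[symmetric] indicator_def)
  show "(LINT x|lborel. max 0 (s - ball_vol x) * partial_deriv b \<psi> x)
      = (LINT x|lborel. indicator {x. ball_vol x < s} x * (ball_perimeter ?n (ball_vol x) * (sgn x \<bullet> b) * \<psi> x))"
    using radial_cutoff_integral_by_parts[OF \<psi> b w n, of s] unfolding eq by (simp add: ball_vol_def)
  show "integrable lborel (\<lambda>x. indicator {x. ball_vol x < s} x * (ball_perimeter ?n (ball_vol x) * (sgn x \<bullet> b) * \<psi> x))"
    using radial_cutoff_integrable[OF \<psi> b w, of ?n s] unfolding eq .
qed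

lemma abs_sgn_inner_le_1: "b \<in> Basis \<Longrightarrow> \<bar>sgn x \<bullet> b\<bar> \<le> 1"
  for x :: "'a::euclidean_space"
  using Cauchy_Schwarz_ineq2[of "sgn x" b] by (auto simp: norm_sgn split: if_splits)

section \<open>Flux of a test function through spheres\<close>

text \<open>By the divergence theorem the right-hand side is the flux of the field
  \<open>\<psi> b\<close> through the sphere enclosing volume \<open>\<sigma>\<close>, which is
  bounded by \<open>C\<close> times its area. In place of surface measure, the flux is a limit of
  averages over shells of volume \<open>e k\<close>.\<close>

lemma integral_ball_partial_deriv_ge:
  fixes \<psi> :: "'a::euclidean_space \<Rightarrow> real"
  assumes \<psi>: "test_function D \<psi>" and b: "b \<in> Basis" and C: "\<And>x. \<bar>\<psi> x\<bar> \<le> C" and \<sigma>: "0 \<le> \<sigma>" and n: "2 \<le> DIM('a)"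
  shows "- (C * ball_perimeter DIM('a) \<sigma>) \<le> (LINT x|lborel. indicator {x. ball_vol x \<le> \<sigma>} x * partial_deriv b \<psi> x)"
proof -
  let ?c = "ball_perimeter (real DIM('a))" and ?p = "partial_deriv b \<psi>"
  define e where "e k = inverse (real (Suc k))" for k
  have e: "0 < e k" for k by (simp add: e_def)
  have e0: "e \<longlonglongrightarrow> 0" unfolding e_def by (rule LIMSEQ_inverse_real_of_nat)
  have C0: "0 \<le> C" using C[of 0] by linarith
  note pd = test_function_partial_deriv[OF \<psi> b]
  have [measurable]: "?p \<in> borel_measurable borel" "\<psi> \<in> borel_measurable borel" using pd \<psi> by (auto intro: test_function_measurable)
  have pint: "integrable lborel ?p" using test_function_integrable[OF pd continuous_on_const[of UNIV 1]] by simp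
  have bvc: "continuous_on UNIV (ball_vol :: 'a \<Rightarrow> real)" unfolding ball_vol_def[abs_def] by (intro continuous_intros)
  have maxint: "integrable lborel (\<lambda>x. max 0 (s - ball_vol x) * ?p x)" for s
    by (intro test_function_integrable[OF pd] continuous_intros bvc)
  \<comment> \<open>A trapezoidal cutoff: 1 up to volume \<open>\<sigma>\<close>, 0 from
    \<open>\<sigma> + e k\<close> on, and linear in the volume coordinate in between.\<close>
  define Q where "Q k x = (max 0 (\<sigma> + e k - ball_vol x) - max 0 (\<sigma> - ball_vol x)) / e k" for k and x :: 'a
  have lim: "(\<lambda>k. LINT x|lborel. Q k x * ?p x) \<longlonglongrightarrow> (LINT x|lborel. indicator {x. ball_vol x \<le> \<sigma>} x * ?p x)"
  proof (rule integral_dominated_convergence[where w="\<lambda>x. \<bar>?p x\<bar>"])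
    show "integrable lborel (\<lambda>x. \<bar>?p x\<bar>)" using pint by (rule integrable_abs)
    have "0 \<le> Q k x \<and> Q k x \<le> 1" for k x using e[of k] by (auto simp: Q_def max_def divide_simps)
    then show "AE x in lborel. norm (Q k x * ?p x) \<le> \<bar>?p x\<bar>" for k
      unfolding real_norm_def abs_mult by (intro AE_I2 mult_left_le_one_le) auto
    show "AE x in lborel. (\<lambda>k. Q k x * ?p x) \<longlonglongrightarrow> indicator {x. ball_vol x \<le> \<sigma>} x * ?p x"
    proof (intro AE_I2 tendsto_mult tendsto_const)
      fix x :: 'a
      show "(\<lambda>k. Q k x) \<longlonglongrightarrow> indicator {x. ball_vol x \<le> \<sigma>} x"
      proof (cases "ball_vol x \<le> \<sigma>")
        case True
        then have "Q k x = 1" for k using e[of k] by (simp add: Q_def)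
        then show ?thesis using True by simp
      next
        case False
        have "\<forall>\<^sub>F k in sequentially. e k < ball_vol x - \<sigma>" using False by (intro order_tendstoD(2)[OF e0]) simp
        then have "\<forall>\<^sub>F k in sequentially. Q k x = indicator {x. ball_vol x \<le> \<sigma>} x"
          by eventually_elim (use False in \<open>auto simp: Q_def\<close>)
        then show ?thesis by (rule tendsto_eventually)
      qed
    qed
  qed (unfold Q_def, measurable)
  have lower: "- (C * ?c (\<sigma> + e k)) \<le> (LINT x|lborel. Q k x * ?p x)" for k
  proof -
    let ?s = "\<sigma> + e k"
    define a where "a x = ?c (ball_vol x) * (sgn x \<bullet> b) * \<psi> x" for x
    let ?S = "{x::'a. \<sigma> \<le> ball_vol x \<and> ball_vol x < ?s}"
    have [measurable]: "?S \<in> sets borel"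
    proof -
      have "{x \<in> space borel. \<sigma> \<le> ball_vol x \<and> ball_vol x < ?s} \<in> sets borel" by measurable
      then show ?thesis by simp
    qed
    have eS: "emeasure lborel ?S \<le> ennreal (e k)"
    proof -
      have "?S \<subseteq> {x. ball_vol x \<le> ?s} - {x. ball_vol x < \<sigma>}" by auto
      have "emeasure lborel ?S + emeasure lborel {x::'a. ball_vol x < \<sigma>} = emeasure lborel (?S \<union> {x::'a. ball_vol x < \<sigma>})"
        by (intro plus_emeasure) (auto simp: not_less)
      also have "\<dots> \<le> emeasure lborel {x::'a. ball_vol x \<le> ?s}" using e[of k] by (intro emeasure_mono) auto
      also have "\<dots> = ennreal (e k) + ennreal \<sigma>" using \<sigma> e[of k] by (subst emeasure_ball_vol_le) (auto simp: ennreal_plus[symmetric] add.commute simp del: ennreal_plus)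
      also have "ennreal \<sigma> = emeasure lborel {x::'a. ball_vol x < \<sigma>}"
      proof -
        have "{x::'a. ball_vol x < \<sigma>} = ball 0 (root DIM('a) (\<sigma> / unit_ball_vol DIM('a)))"
          by (simp only: set_eq_iff mem_Collect_eq ball_vol_less_iff(1)[OF \<sigma>] simp_thms)
        moreover have "{x::'a. ball_vol x \<le> \<sigma>} = cball 0 (root DIM('a) (\<sigma> / unit_ball_vol DIM('a)))"
          by (simp only: set_eq_iff mem_Collect_eq ball_vol_less_iff(2)[OF \<sigma>] simp_thms)
        moreover have "0 \<le> root DIM('a) (\<sigma> / unit_ball_vol DIM('a))" using \<sigma> by simp
        ultimately show ?thesis using emeasure_ball_vol_le[OF \<sigma>, where 'a='a] by (simp add: emeasure_ball emeasure_cball)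
      qed
      finally have "emeasure lborel ?S + emeasure lborel {x::'a. ball_vol x < \<sigma>} \<le> ennreal (e k) + emeasure lborel {x::'a. ball_vol x < \<sigma>}" .
      moreover have "emeasure lborel {x::'a. ball_vol x < \<sigma>} \<noteq> \<infinity>"
      proof -
        have "emeasure lborel {x::'a. ball_vol x < \<sigma>} \<le> emeasure lborel {x::'a. ball_vol x \<le> \<sigma>}" by (intro emeasure_mono) auto
        also have "\<dots> < \<infinity>" using \<sigma> by (simp add: emeasure_ball_vol_le)
        finally show ?thesis by simp
      qed
      ultimately show ?thesis by (simp add: ennreal_add_left_cancel_le add.commute[of _ "emeasure lborel {x::'a. ball_vol x < \<sigma>}"])
    qed
    have mS: "measure lborel ?S \<le> e k" unfolding measure_def using enn2real_mono[OF eS] e[of k] by simp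
    have Sfin: "emeasure lborel ?S < \<infinity>" using eS by (rule le_less_trans) simp
    have aint: "integrable lborel (\<lambda>x. indicator {x. ball_vol x < s} x * a x)" for s
      unfolding a_def by (rule ball_vol_test_function_perimeter(2)[OF \<psi> b])
    have by_parts: "(LINT x|lborel. max 0 (s - ball_vol x) * ?p x) = (LINT x|lborel. indicator {x. ball_vol x < s} x * a x)" for s
      unfolding a_def by (rule ball_vol_test_function_perimeter(1)[OF \<psi> b])
    have "(LINT x|lborel. Q k x * ?p x) = (LINT x|lborel. inverse (e k) * (max 0 (?s - ball_vol x) * ?p x - max 0 (\<sigma> - ball_vol x) * ?p x))"
      by (simp add: Q_def divide_inverse algebra_simps)
    also have "\<dots> = inverse (e k) * ((LINT x|lborel. max 0 (?s - ball_vol x) * ?p x) - (LINT x|lborel. max 0 (\<sigma> - ball_vol x) * ?p x))"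
      using maxint by simp
    also have "\<dots> = inverse (e k) * (LINT x|lborel. indicator {x. ball_vol x < ?s} x * a x - indicator {x. ball_vol x < \<sigma>} x * a x)"
      unfolding by_parts using aint by simp
    also have "(\<lambda>x. indicator {x. ball_vol x < ?s} x * a x - indicator {x. ball_vol x < \<sigma>} x * a x) = (\<lambda>x. indicator ?S x * a x)"
      using e[of k] by (auto simp: indicator_def)
    finally have Qeq: "(LINT x|lborel. Q k x * ?p x) = inverse (e k) * (LINT x|lborel. indicator ?S x * a x)" .
    have "(LINT x|lborel. indicator ?S x * - (C * ?c ?s)) \<le> (LINT x|lborel. indicator ?S x * a x)"
    proof (rule integral_mono)
      show "integrable lborel (\<lambda>x. indicator ?S x * - (C * ?c ?s))" using Sfin by (intro integrable_mult_left integrable_real_indicator) auto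
      have "(\<lambda>x. indicator ?S x * a x) = (\<lambda>x. indicator {x. ball_vol x < ?s} x * a x - indicator {x. ball_vol x < \<sigma>} x * a x)"
        using e[of k] by (auto simp: indicator_def)
      then show "integrable lborel (\<lambda>x. indicator ?S x * a x)" using aint by simp
      fix x
      have "\<bar>a x\<bar> \<le> C * ?c ?s" if x: "x \<in> ?S"
      proof -
        have c: "0 \<le> ?c (ball_vol x)" "?c (ball_vol x) \<le> ?c ?s"
          using x n ball_vol_nonneg[of x] by (auto intro!: ball_perimeter_nonneg ball_perimeter_mono)
        have "\<bar>a x\<bar> = ?c (ball_vol x) * \<bar>sgn x \<bullet> b\<bar> * \<bar>\<psi> x\<bar>" using c by (simp add: a_def abs_mult)
        also have "\<dots> \<le> ?c ?s * 1 * C" using c abs_sgn_inner_le_1[OF b] C by (intro mult_mono) auto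
        finally show ?thesis by (simp add: mult.commute)
      qed
      then show "indicator ?S x * - (C * ?c ?s) \<le> indicator ?S x * a x" by (auto simp: indicator_def abs_le_iff)
    qed
    then have "- (C * ?c ?s) * measure lborel ?S \<le> (LINT x|lborel. indicator ?S x * a x)" by (simp add: mult_ac)
    moreover have "- (C * ?c ?s) * e k \<le> - (C * ?c ?s) * measure lborel ?S"
      using mS C0 ball_perimeter_nonneg[of "real DIM('a)" ?s] by (intro mult_left_mono_neg) auto
    ultimately have "- (C * ?c ?s) * e k \<le> (LINT x|lborel. indicator ?S x * a x)" by linarith
    moreover have "A \<le> inverse E * I" if "A * E \<le> I" "0 < E" for A E I :: real
      using that by (simp add: field_simps)
    ultimately show ?thesis unfolding Qeq using e[of k] by blast
  qed
  have "(\<lambda>k. - (C * ?c (\<sigma> + e k))) \<longlonglongrightarrow> - (C * ?c (\<sigma> + 0))"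
    using n \<sigma> e by (intro tendsto_minus tendsto_mult tendsto_const ball_perimeter_tendsto tendsto_add e0)
      (auto intro!: always_eventually add_nonneg_pos less_imp_le)
  from LIMSEQ_le[OF this lim] show ?thesis using lower by auto
qed

lemma emeasure_lborel_Ico_eq: "emeasure lborel {l..<u} = ennreal (if l \<le> u then u - l else 0)" for l u :: real
  by (cases "l \<le> u") auto

text \<open>The one-sided bound applied to \<open>\<psi>\<close> and to its negative.\<close>

lemma abs_integral_ball_partial_deriv_le:
  fixes \<psi> :: "'a::euclidean_space \<Rightarrow> real"
  assumes \<psi>: "test_function D \<psi>" and b: "b \<in> Basis" and C: "\<And>x. \<bar>\<psi> x\<bar> \<le> C" and \<sigma>: "0 \<le> \<sigma>" and n: "2 \<le> DIM('a)"
  shows "\<bar>LINT x|lborel. indicator {x. ball_vol x \<le> \<sigma>} x * partial_deriv b \<psi> x\<bar> \<le> C * ball_perimeter DIM('a) \<sigma>"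
proof -
  have m: "test_function D (\<lambda>x. - 1 * \<psi> x)" by (rule test_function_mult[OF \<psi> C_k_const])
  have "partial_deriv b (\<lambda>x. - 1 * \<psi> x) x = - partial_deriv b \<psi> x" for x
  proof (rule partial_deriv_eq[THEN trans])
    show "((\<lambda>x. - 1 * \<psi> x) has_derivative (\<lambda>h. - 1 * frechet_derivative \<psi> (at x) h)) (at x)"
      using test_function_differentiable[OF \<psi>, of x] by (intro has_derivative_mult_right) (simp add: frechet_derivative_works[symmetric])
  qed (simp add: partial_deriv_def)
  then show ?thesis
    using integral_ball_partial_deriv_ge[OF \<psi> b C \<sigma> n] integral_ball_partial_deriv_ge[OF m b _ \<sigma> n, of C] C by (simp add: abs_le_iff)
qed

lemma integral_ball_partial_deriv_measurable:
  fixes f :: "'a::euclidean_space \<Rightarrow> real"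
  assumes [measurable]: "f \<in> borel_measurable borel"
  shows "(\<lambda>\<sigma>. LINT x|lborel. indicator {x. ball_vol x \<le> \<sigma>} x * f x) \<in> borel_measurable borel"
proof -
  have "(\<lambda>\<sigma>. LINT x|lborel. (if ball_vol x \<le> \<sigma> then f x else 0)) \<in> borel_measurable borel" by measurable
  moreover have "(\<lambda>x. indicator {x. ball_vol x \<le> \<sigma>} x * f x) = (\<lambda>x. if ball_vol x \<le> \<sigma> then f x else 0)" for \<sigma>
    by (auto simp: indicator_def)
  ultimately show ?thesis by simp
qed

text \<open>The cutoff is an integral of indicators of balls, since \<open>max 0 (s - v)\<close> is
  the length of \<open>{v..<s}\<close>.\<close>

lemma integral_ball_vol_cutoff_swap:
  fixes \<psi> :: "'a::euclidean_space \<Rightarrow> real"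
  assumes \<psi>: "test_function D \<psi>"
  shows "(LINT x|lborel. max 0 (s - ball_vol x) * \<psi> x)
      = (LINT \<sigma>|lborel. indicator {0..<s} \<sigma> * (LINT x|lborel. indicator {x. ball_vol x \<le> \<sigma>} x * \<psi> x))"
proof -
  have [measurable]: "\<psi> \<in> borel_measurable borel" using \<psi> by (rule test_function_measurable)
  have bvc: "continuous_on UNIV (ball_vol :: 'a \<Rightarrow> real)" unfolding ball_vol_def[abs_def] by (intro continuous_intros)
  define f where "f x \<sigma> = (if 0 \<le> \<sigma> \<and> \<sigma> < s \<and> ball_vol x \<le> \<sigma> then \<psi> x else 0)" for x \<sigma>
  have f_eq: "f x = (\<lambda>\<sigma>. indicator {ball_vol x..<s} \<sigma> * \<psi> x)" for x
    using ball_vol_nonneg[of x] by (intro ext) (auto simp: f_def indicator_def)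
  have cont: "measure lborel {a..<s} = max 0 (s - a)" for a :: real by (simp add: measure_def max_def)
  have f_int: "integrable lborel (f x)" "(LINT \<sigma>|lborel. f x \<sigma>) = max 0 (s - ball_vol x) * \<psi> x" "(LINT \<sigma>|lborel. norm (f x \<sigma>)) = max 0 (s - ball_vol x) * \<bar>\<psi> x\<bar>" for x
  proof -
    show "integrable lborel (f x)" unfolding f_eq by (intro integrable_mult_left) (simp add: emeasure_lborel_Ico_eq)
    show "(LINT \<sigma>|lborel. f x \<sigma>) = max 0 (s - ball_vol x) * \<psi> x" unfolding f_eq by (simp add: cont)
    show "(LINT \<sigma>|lborel. norm (f x \<sigma>)) = max 0 (s - ball_vol x) * \<bar>\<psi> x\<bar>" unfolding f_eq by (simp add: cont abs_mult)
  qed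
  have "integrable (lborel \<Otimes>\<^sub>M lborel) (case_prod f)"
  proof (rule lborel_pair.Fubini_integrable)
    show "case_prod f \<in> borel_measurable (lborel \<Otimes>\<^sub>M lborel)" unfolding f_def by measurable
    have "integrable lborel (\<lambda>x. max 0 (s - ball_vol x) * \<psi> x)"
      by (intro test_function_integrable[OF \<psi>] continuous_intros bvc)
    then have "integrable lborel (\<lambda>x. \<bar>max 0 (s - ball_vol x) * \<psi> x\<bar>)" by (rule integrable_abs)
    then show "integrable lborel (\<lambda>x. LINT \<sigma>|lborel. norm (case_prod f (x, \<sigma>)))" by (simp add: f_int(3)[unfolded real_norm_def] abs_mult)
  qed (simp add: f_int)
  from lborel_pair.Fubini_integral[OF this]
  have "(LINT \<sigma>|lborel. LINT x|lborel. f x \<sigma>) = (LINT x|lborel. LINT \<sigma>|lborel. f x \<sigma>)" by simp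
  moreover have "(LINT x|lborel. f x \<sigma>) = indicator {0..<s} \<sigma> * (LINT x|lborel. indicator {x. ball_vol x \<le> \<sigma>} x * \<psi> x)" for \<sigma>
  proof (cases "\<sigma> \<in> {0..<s}")
    case True
    then have "(\<lambda>x. f x \<sigma>) = (\<lambda>x. indicator {x. ball_vol x \<le> \<sigma>} x * \<psi> x)" by (auto simp: f_def indicator_def)
    then show ?thesis using True by simp
  next
    case False
    then have "(\<lambda>x. f x \<sigma>) = (\<lambda>x. 0)" by (auto simp: f_def)
    then show ?thesis using False by simp
  qed
  ultimately show ?thesis by (simp add: f_int(2))
qed

lemma integral_ball_vol_perimeter:
  fixes E :: "'a::euclidean_space set"
  assumes s: "s \<le> measure lebesgue E" and n: "2 \<le> DIM('a)"
  shows "integrable lborel (\<lambda>x::'a. indicator {x. ball_vol x < s} x * ball_perimeter DIM('a) (ball_vol x))" (is ?A)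
    and "integrable lborel (\<lambda>\<sigma>. indicator {0..<s} \<sigma> * ball_perimeter DIM('a) \<sigma>)" (is ?B)
    and "(LINT x|lborel. indicator {x::'a. ball_vol x < s} x * ball_perimeter DIM('a) (ball_vol x))
      = (LINT \<sigma>|lborel. indicator {0..<s} \<sigma> * ball_perimeter DIM('a) \<sigma>)" (is ?C)
proof -
  let ?c = "ball_perimeter DIM('a)" and ?M = "measure lebesgue E"
  have c0: "0 \<le> ?c \<sigma>" for \<sigma> by (simp add: ball_perimeter_nonneg)
  define X where "X = (\<integral>\<^sup>+\<sigma>. ennreal (indicator {0..<s} \<sigma> * ?c \<sigma>) \<partial>lborel)"
  have [measurable]: "{x::'a. ball_vol x < s} \<in> sets borel"
  proof -
    have "{x::'a \<in> space borel. ball_vol x < s} \<in> sets borel" by measurable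
    then show ?thesis by simp
  qed
  have "(\<integral>\<^sup>+x. ennreal (indicator {x::'a. ball_vol x < s} x * ?c (ball_vol x)) \<partial>lborel)
      = (\<integral>\<^sup>+x. indicator (sharp_ball E) (x::'a) * (indicator {..<s} (ball_vol x) * ennreal (?c (ball_vol x))) \<partial>lborel)"
    using s by (intro nn_integral_cong) (auto simp: sharp_ball_eq indicator_def)
  also have "\<dots> = (\<integral>\<^sup>+\<sigma>. indicator {0..<?M} \<sigma> * (indicator {..<s} \<sigma> * ennreal (?c \<sigma>)) \<partial>lborel)"
    by (rule nn_integral_sharp_ball) measurable
  also have "\<dots> = X"
    unfolding X_def using s by (intro nn_integral_cong) (auto simp: indicator_def)
  finally have eq: "(\<integral>\<^sup>+x. ennreal (indicator {x::'a. ball_vol x < s} x * ?c (ball_vol x)) \<partial>lborel) = X" .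
  have "X \<le> (\<integral>\<^sup>+\<sigma>. ennreal (?c s) * indicator {0..<s} \<sigma> \<partial>lborel)"
    unfolding X_def using n by (intro nn_integral_mono) (auto simp: indicator_def intro!: ennreal_leI ball_perimeter_mono)
  also have "\<dots> < \<infinity>" by (subst nn_integral_cmult_indicator) (auto simp: emeasure_lborel_Ico_eq ennreal_mult_less_top)
  finally have fin: "X < \<infinity>" .
  show ?A by (rule integrableI_nonneg) (use eq fin c0 in auto)
  show ?B by (rule integrableI_nonneg) (use fin c0 in \<open>auto simp: X_def\<close>)
  show ?C using eq c0 by (subst (1 2) integral_eq_nn_integral) (auto simp: X_def)
qed

text \<open>For \<open>q\<close> the indicator of \<open>{..<s}\<close> both sides equal the
  integral of \<open>max 0 (s - ball_vol x)\<close> against the partial derivative. General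
  \<open>q\<close> follows by viewing both sides as integrals of \<open>q\<close> against measures
  with equal distribution functions. To work with measures instead of signed ones, \<open>C\<close>
  times the perimeter is added on both sides and removed at the end.\<close>

lemma ball_vol_pairing:
  fixes \<psi> :: "'a::euclidean_space \<Rightarrow> real" and E :: "'a set"
  assumes \<psi>: "test_function D \<psi>" and b: "b \<in> Basis" and n: "2 \<le> DIM('a)"
    and [measurable]: "q \<in> borel_measurable borel" and q: "\<And>\<sigma>. 0 \<le> q \<sigma>"
    and fin: "(\<integral>\<^sup>+\<sigma>. indicator {0..<measure lebesgue E} \<sigma> * ennreal (q \<sigma> * ball_perimeter DIM('a) \<sigma>) \<partial>lborel) < \<infinity>"
  shows "(LINT x|lborel. indicator (sharp_ball E) x * (q (ball_vol x) * (ball_perimeter DIM('a) (ball_vol x) * (sgn x \<bullet> b) * \<psi> x)))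
    = (LINT \<sigma>|lborel. indicator {0..<measure lebesgue E} \<sigma> * (q \<sigma> * (LINT x|lborel. indicator {x. ball_vol x \<le> \<sigma>} x * partial_deriv b \<psi> x)))"
proof -
  let ?c = "ball_perimeter DIM('a)" and ?M = "measure lebesgue E" and ?B = "sharp_ball E"
  define J where "J \<sigma> = (LINT x|lborel. indicator {x. ball_vol x \<le> \<sigma>} x * partial_deriv b \<psi> x)" for \<sigma>
  define a where "a x = ?c (ball_vol x) * (sgn x \<bullet> b) * \<psi> x" for x
  have c0: "0 \<le> ?c \<sigma>" for \<sigma> by (simp add: ball_perimeter_nonneg)
  obtain C where C: "0 < C" "\<And>x. \<bar>\<psi> x\<bar> \<le> C" using test_function_bounded[OF \<psi>] by metis
  have [measurable]: "partial_deriv b \<psi> \<in> borel_measurable borel" "\<psi> \<in> borel_measurable borel"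
    using test_function_partial_deriv[OF \<psi> b] \<psi> by (auto intro: test_function_measurable)
  have [measurable]: "J \<in> borel_measurable borel" unfolding J_def by (rule integral_ball_partial_deriv_measurable) measurable
  have [measurable]: "a \<in> borel_measurable borel" unfolding a_def by measurable
  have J: "\<bar>J \<sigma>\<bar> \<le> C * ?c \<sigma>" if "0 \<le> \<sigma>" for \<sigma>
    unfolding J_def by (rule abs_integral_ball_partial_deriv_le[OF \<psi> b C(2) that n])
  have aC: "\<bar>a x\<bar> \<le> C * ?c (ball_vol x)" for x
  proof -
    have "\<bar>a x\<bar> = ?c (ball_vol x) * \<bar>sgn x \<bullet> b\<bar> * \<bar>\<psi> x\<bar>" using c0 by (simp add: a_def abs_mult)
    also have "\<dots> \<le> ?c (ball_vol x) * 1 * C" using c0 abs_sgn_inner_le_1[OF b] C by (intro mult_mono) auto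
    finally show ?thesis by (simp add: mult.commute)
  qed
  define A where "A x = a x + C * ?c (ball_vol x)" for x
  define K where "K \<sigma> = J \<sigma> + C * ?c \<sigma>" for \<sigma>
  have A0: "0 \<le> A x" for x using aC[of x] by (simp add: A_def abs_le_iff)
  have K0: "0 \<le> K \<sigma>" if "0 \<le> \<sigma>" for \<sigma> using J[OF that] by (simp add: K_def abs_le_iff)
  have [measurable]: "A \<in> borel_measurable borel" "K \<in> borel_measurable borel" unfolding A_def K_def by measurable
  have cdf: "(\<integral>\<^sup>+x. ennreal (indicator {x. ball_vol x < s} x * A x) \<partial>lborel) = (\<integral>\<^sup>+\<sigma>. ennreal (indicator {0..<s} \<sigma> * K \<sigma>) \<partial>lborel)"
      "(\<integral>\<^sup>+x. ennreal (indicator {x. ball_vol x < s} x * A x) \<partial>lborel) < \<infinity>" if s: "s \<le> ?M" for s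
  proof -
    note cc = integral_ball_vol_perimeter[OF s n]
    have ia: "integrable lborel (\<lambda>x. indicator {x. ball_vol x < s} x * a x)"
      unfolding a_def by (rule ball_vol_test_function_perimeter(2)[OF \<psi> b])
    have ea: "(LINT x|lborel. indicator {x. ball_vol x < s} x * a x) = (LINT \<sigma>|lborel. indicator {0..<s} \<sigma> * J \<sigma>)"
      unfolding a_def J_def ball_vol_test_function_perimeter(1)[OF \<psi> b, symmetric]
      by (rule integral_ball_vol_cutoff_swap[OF test_function_partial_deriv[OF \<psi> b]])
    have iJ: "integrable lborel (\<lambda>\<sigma>. indicator {0..<s} \<sigma> * J \<sigma>)"
    proof (rule Bochner_Integration.integrable_bound)
      show "integrable lborel (\<lambda>\<sigma>. C * (indicator {0..<s} \<sigma> * ?c \<sigma>))" using cc(2) by simp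
      show "AE \<sigma> in lborel. norm (indicator {0..<s} \<sigma> * J \<sigma>) \<le> norm (C * (indicator {0..<s} \<sigma> * ?c \<sigma>))"
        using J C(1) c0 by (intro AE_I2) (auto simp: indicator_def abs_mult)
    qed measurable
    have A_eq: "(\<lambda>x. indicator {x. ball_vol x < s} x * A x) = (\<lambda>x. indicator {x. ball_vol x < s} x * a x + C * (indicator {x. ball_vol x < s} x * ?c (ball_vol x)))"
      by (simp add: A_def algebra_simps)
    have K_eq: "(\<lambda>\<sigma>. indicator {0..<s} \<sigma> * K \<sigma>) = (\<lambda>\<sigma>. indicator {0..<s} \<sigma> * J \<sigma> + C * (indicator {0..<s} \<sigma> * ?c \<sigma>))"
      by (simp add: K_def algebra_simps)
    have iA: "integrable lborel (\<lambda>x. indicator {x. ball_vol x < s} x * A x)" unfolding A_eq using ia cc(1) by simp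
    have iK: "integrable lborel (\<lambda>\<sigma>. indicator {0..<s} \<sigma> * K \<sigma>)" unfolding K_eq using iJ cc(2) by simp
    have "(LINT x|lborel. indicator {x. ball_vol x < s} x * A x) = (LINT \<sigma>|lborel. indicator {0..<s} \<sigma> * K \<sigma>)"
      unfolding A_eq K_eq using ia cc iJ ea by simp
    moreover have "(\<integral>\<^sup>+x. ennreal (indicator {x. ball_vol x < s} x * A x) \<partial>lborel) = ennreal (LINT x|lborel. indicator {x. ball_vol x < s} x * A x)"
      using A0 by (intro nn_integral_eq_integral[OF iA]) auto
    moreover have "(\<integral>\<^sup>+\<sigma>. ennreal (indicator {0..<s} \<sigma> * K \<sigma>) \<partial>lborel) = ennreal (LINT \<sigma>|lborel. indicator {0..<s} \<sigma> * K \<sigma>)"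
      using K0 by (intro nn_integral_eq_integral[OF iK]) (auto simp: indicator_def)
    ultimately show "(\<integral>\<^sup>+x. ennreal (indicator {x. ball_vol x < s} x * A x) \<partial>lborel) = (\<integral>\<^sup>+\<sigma>. ennreal (indicator {0..<s} \<sigma> * K \<sigma>) \<partial>lborel)"
      "(\<integral>\<^sup>+x. ennreal (indicator {x. ball_vol x < s} x * A x) \<partial>lborel) < \<infinity>" by simp_all
  qed
  \<comment> \<open>Left: the push-forward of a density on the ball under the volume coordinate.
    Right: a density on the line. They agree on half-lines by \<open>cdf\<close>.\<close>
  let ?f = "\<lambda>x. indicator ?B x * ennreal (A x)" and ?k = "\<lambda>\<sigma>. indicator {0..<?M} \<sigma> * ennreal (K \<sigma>)"
  let ?L = "distr (density lborel ?f) borel (ball_vol :: 'a \<Rightarrow> real)" and ?R = "density lborel ?k"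
  have "?L = ?R"
  proof (rule finite_measures_eqI_lessThan)
    have e: "emeasure ?L {..<s} = (\<integral>\<^sup>+x. ennreal (indicator {x. ball_vol x < min s ?M} x * A x) \<partial>lborel)" for s
    proof -
      have "ball_vol -` {..<s} \<inter> space (density lborel ?f) \<in> sets (density lborel ?f)" by measurable
      then have "emeasure ?L {..<s} = (\<integral>\<^sup>+x. ?f x * indicator (ball_vol -` {..<s}) x \<partial>lborel)"
        by (subst emeasure_distr) (auto simp: emeasure_density)
      also have "\<dots> = (\<integral>\<^sup>+x. ennreal (indicator {x. ball_vol x < min s ?M} x * A x) \<partial>lborel)"
        by (intro nn_integral_cong) (auto simp: sharp_ball_eq indicator_def)
      finally show ?thesis .
    qed
    show "emeasure ?L {..<s} = emeasure ?R {..<s}" for s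
    proof -
      have "emeasure ?R {..<s} = (\<integral>\<^sup>+\<sigma>. ?k \<sigma> * indicator {..<s} \<sigma> \<partial>lborel)" by (subst emeasure_density) auto
      also have "\<dots> = (\<integral>\<^sup>+\<sigma>. ennreal (indicator {0..<min s ?M} \<sigma> * K \<sigma>) \<partial>lborel)"
        by (intro nn_integral_cong) (auto simp: indicator_def)
      finally show ?thesis unfolding e using cdf(1)[of "min s ?M"] by simp
    qed
    show "finite_measure ?L"
    proof (rule finite_measureI)
      have "emeasure ?L (space ?L) = (\<integral>\<^sup>+x. ?f x \<partial>lborel)" by (subst emeasure_distr) (auto simp: emeasure_density)
      also have "\<dots> = (\<integral>\<^sup>+x. ennreal (indicator {x. ball_vol x < ?M} x * A x) \<partial>lborel)"
        by (intro nn_integral_cong) (auto simp: sharp_ball_eq indicator_def)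
      finally show "emeasure ?L (space ?L) \<noteq> \<infinity>" using cdf(2)[of ?M] by simp
    qed
  qed simp_all
  then have "(\<integral>\<^sup>+\<sigma>. ennreal (q \<sigma>) \<partial>?L) = (\<integral>\<^sup>+\<sigma>. ennreal (q \<sigma>) \<partial>?R)" by simp
  moreover have "(\<integral>\<^sup>+\<sigma>. ennreal (q \<sigma>) \<partial>?L) = (\<integral>\<^sup>+x. ?f x * ennreal (q (ball_vol x)) \<partial>lborel)"
    by (subst nn_integral_distr) (auto simp: nn_integral_density)
  moreover have "(\<integral>\<^sup>+\<sigma>. ennreal (q \<sigma>) \<partial>?R) = (\<integral>\<^sup>+\<sigma>. ?k \<sigma> * ennreal (q \<sigma>) \<partial>lborel)"
    by (subst nn_integral_density) auto
  ultimately have "(\<integral>\<^sup>+x. ?f x * ennreal (q (ball_vol x)) \<partial>lborel) = (\<integral>\<^sup>+\<sigma>. ?k \<sigma> * ennreal (q \<sigma>) \<partial>lborel)" by simp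
  moreover have "?f x * ennreal (q (ball_vol x)) = ennreal (indicator ?B x * (q (ball_vol x) * A x))" for x
    using A0 q by (auto simp: indicator_def ennreal_mult mult.commute)
  moreover have "?k \<sigma> * ennreal (q \<sigma>) = ennreal (indicator {0..<?M} \<sigma> * (q \<sigma> * K \<sigma>))" for \<sigma>
    using K0 q by (auto simp: indicator_def ennreal_mult mult.commute)
  ultimately have AK: "(\<integral>\<^sup>+x. ennreal (indicator ?B x * (q (ball_vol x) * A x)) \<partial>lborel) = (\<integral>\<^sup>+\<sigma>. ennreal (indicator {0..<?M} \<sigma> * (q \<sigma> * K \<sigma>)) \<partial>lborel)"
    by simp
  then have AK': "(LINT x|lborel. indicator ?B x * (q (ball_vol x) * A x)) = (LINT \<sigma>|lborel. indicator {0..<?M} \<sigma> * (q \<sigma> * K \<sigma>))"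
    using A0 K0 q by (subst (1 2) integral_eq_nn_integral) (auto simp: indicator_def)
  have qc: "(\<integral>\<^sup>+x. indicator ?B x * ennreal (q (ball_vol x) * ?c (ball_vol x)) \<partial>lborel) = (\<integral>\<^sup>+\<sigma>. indicator {0..<?M} \<sigma> * ennreal (q \<sigma> * ?c \<sigma>) \<partial>lborel)"
    by (rule nn_integral_sharp_ball) measurable
  have e1: "indicator ?B x * ennreal (q (ball_vol x) * ?c (ball_vol x)) = ennreal (indicator ?B x * (q (ball_vol x) * ?c (ball_vol x)))" for x
    by (auto simp: indicator_def)
  have e2: "indicator {0..<?M} \<sigma> * ennreal (q \<sigma> * ?c \<sigma>) = ennreal (indicator {0..<?M} \<sigma> * (q \<sigma> * ?c \<sigma>))" for \<sigma>
    by (auto simp: indicator_def)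
  have ic: "integrable lborel (\<lambda>x. indicator ?B x * (q (ball_vol x) * ?c (ball_vol x)))"
    by (rule integrableI_nonneg) (use qc fin c0 q in \<open>auto simp: e1 e2\<close>)
  have ic': "integrable lborel (\<lambda>\<sigma>. indicator {0..<?M} \<sigma> * (q \<sigma> * ?c \<sigma>))"
    by (rule integrableI_nonneg) (use fin c0 q in \<open>auto simp: e2\<close>)
  have cc: "(LINT x|lborel. indicator ?B x * (q (ball_vol x) * ?c (ball_vol x))) = (LINT \<sigma>|lborel. indicator {0..<?M} \<sigma> * (q \<sigma> * ?c \<sigma>))"
    using c0 q qc by (subst (1 2) integral_eq_nn_integral) (auto simp: e1 e2)
  have ia: "integrable lborel (\<lambda>x. indicator ?B x * (q (ball_vol x) * a x))"
  proof (rule Bochner_Integration.integrable_bound)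
    show "integrable lborel (\<lambda>x. C * (indicator ?B x * (q (ball_vol x) * ?c (ball_vol x))))" using ic by simp
    have "q (ball_vol x) * \<bar>a x\<bar> \<le> C * (q (ball_vol x) * ?c (ball_vol x))" for x
      using mult_left_mono[OF aC[of x] q[of "ball_vol x"]] by (simp add: mult_ac)
    then show "AE x in lborel. norm (indicator ?B x * (q (ball_vol x) * a x)) \<le> norm (C * (indicator ?B x * (q (ball_vol x) * ?c (ball_vol x))))"
      using C(1) c0 q by (intro AE_I2) (auto simp: indicator_def abs_mult)
  qed measurable
  have iJ: "integrable lborel (\<lambda>\<sigma>. indicator {0..<?M} \<sigma> * (q \<sigma> * J \<sigma>))"
  proof (rule Bochner_Integration.integrable_bound)
    show "integrable lborel (\<lambda>\<sigma>. C * (indicator {0..<?M} \<sigma> * (q \<sigma> * ?c \<sigma>)))" using ic' by simp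
    have "q \<sigma> * \<bar>J \<sigma>\<bar> \<le> C * (q \<sigma> * ?c \<sigma>)" if "0 \<le> \<sigma>" for \<sigma>
      using mult_left_mono[OF J[OF that] q[of \<sigma>]] by (simp add: mult_ac)
    then show "AE \<sigma> in lborel. norm (indicator {0..<?M} \<sigma> * (q \<sigma> * J \<sigma>)) \<le> norm (C * (indicator {0..<?M} \<sigma> * (q \<sigma> * ?c \<sigma>)))"
      using C(1) c0 q by (intro AE_I2) (auto simp: indicator_def abs_mult)
  qed measurable
  have "(\<lambda>x. indicator ?B x * (q (ball_vol x) * A x)) = (\<lambda>x. indicator ?B x * (q (ball_vol x) * a x) + C * (indicator ?B x * (q (ball_vol x) * ?c (ball_vol x))))"
    by (simp add: A_def algebra_simps)
  moreover have "(\<lambda>\<sigma>. indicator {0..<?M} \<sigma> * (q \<sigma> * K \<sigma>)) = (\<lambda>\<sigma>. indicator {0..<?M} \<sigma> * (q \<sigma> * J \<sigma>) + C * (indicator {0..<?M} \<sigma> * (q \<sigma> * ?c \<sigma>)))"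
    by (simp add: K_def algebra_simps)
  ultimately have "(LINT x|lborel. indicator ?B x * (q (ball_vol x) * a x)) = (LINT \<sigma>|lborel. indicator {0..<?M} \<sigma> * (q \<sigma> * J \<sigma>))"
    using AK' ia iJ ic ic' cc by simp
  then show ?thesis by (simp only: a_def J_def)
qed

lemma absolutely_integrable_on_compact_if_borel:
  fixes f :: "'a::euclidean_space \<Rightarrow> 'b::euclidean_space"
  assumes [measurable]: "f \<in> borel_measurable borel"
    and K: "compact K" "K \<subseteq> B" and fin: "(\<integral>\<^sup>+x. indicator B x * ennreal (norm (f x)) \<partial>lborel) < \<infinity>"
  shows "f absolutely_integrable_on K"
proof -
  have [measurable]: "K \<in> sets borel" using K(1) by (rule borel_compact)
  have "integrable lborel (\<lambda>x. indicator K x *\<^sub>R f x)"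
  proof (rule integrableI_bounded)
    have "(\<integral>\<^sup>+x. ennreal (norm (indicator K x *\<^sub>R f x)) \<partial>lborel) \<le> (\<integral>\<^sup>+x. indicator B x * ennreal (norm (f x)) \<partial>lborel)"
      using K(2) by (intro nn_integral_mono) (auto simp: indicator_def)
    then show "(\<integral>\<^sup>+x. ennreal (norm (indicator K x *\<^sub>R f x)) \<partial>lborel) < \<infinity>" using fin by (rule le_less_trans)
  qed measurable
  then have "integrable lebesgue (\<lambda>x. indicator K x *\<^sub>R f x)" by (rule integrable_completion[THEN iffD2, rotated]) measurable
  then show ?thesis by (simp add: set_integrable_def)
qed

section \<open>The decreasing rearrangement and its weak gradient\<close>

context sobolev_profile
begin

text \<open>The transfer rule with \<open>1 / c\<close> on \<open>{s..}\<close> cancels the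
  perimeter and leaves the length of the set of levels with \<open>s \<le> \<mu> t\<close>, which is
  the value of the rearrangement at \<open>s\<close>. Thus \<open>h / c\<close> plays the part of
  minus its derivative in the volume variable.\<close>

lemma decr_rearr_eq_profile_integral:
  assumes [measurable]: "h \<in> borel_measurable borel"
    and h: "\<And>F. F \<in> borel_measurable borel \<Longrightarrow>
      (\<integral>\<^sup>+t. indicator {0<..} t * ennreal (ball_perimeter DIM('a) (\<mu> t)) * F (\<mu> t) \<partial>lborel) = (\<integral>\<^sup>+\<sigma>. ennreal (h \<sigma>) * F \<sigma> \<partial>lborel)"
    and s: "0 < s"
  shows "ennreal (decr_rearr D u s) = (\<integral>\<^sup>+\<sigma>. ennreal (h \<sigma>) * (ennreal (inverse (ball_perimeter DIM('a) \<sigma>)) * indicator {s..} \<sigma>) \<partial>lborel)"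
proof -
  let ?c = "ball_perimeter DIM('a)" and ?U = "decr_rearr D u s"
  define X where "X = (\<integral>\<^sup>+t. indicator {t. 0 < t \<and> s \<le> \<mu> t} t \<partial>lborel)"
  have "(\<integral>\<^sup>+\<sigma>. ennreal (h \<sigma>) * (ennreal (inverse (?c \<sigma>)) * indicator {s..} \<sigma>) \<partial>lborel)
      = (\<integral>\<^sup>+t. indicator {0<..} t * ennreal (?c (\<mu> t)) * (ennreal (inverse (?c (\<mu> t))) * indicator {s..} (\<mu> t)) \<partial>lborel)"
    by (rule h[symmetric]) measurable
  also have "\<dots> = X"
    unfolding X_def
  proof (intro nn_integral_cong)
    fix t
    have "ennreal (?c (\<mu> t)) * ennreal (inverse (?c (\<mu> t))) = 1" if "s \<le> \<mu> t"
      using ball_perimeter_pos[of "real DIM('a)" "\<mu> t"] that s by (simp add: ennreal_mult[symmetric])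
    then show "indicator {0<..} t * ennreal (?c (\<mu> t)) * (ennreal (inverse (?c (\<mu> t))) * indicator {s..} (\<mu> t)) = indicator {t. 0 < t \<and> s \<le> \<mu> t} t"
      by (auto simp: indicator_def)
  qed
  also have "X = ennreal ?U"
  proof (rule antisym)
    have "X \<le> (\<integral>\<^sup>+t. indicator {0..?U} t \<partial>lborel)"
      unfolding X_def
    proof (intro nn_integral_mono)
      fix t
      have "t \<le> ?U" if "0 < t" "s \<le> \<mu> t"
      proof (rule ccontr)
        assume "\<not> t \<le> ?U"
        then have "?U < t" by simp
        then obtain r where r: "r \<in> {t. 0 \<le> t \<and> \<mu> t < s}" "r < t"
          unfolding decr_rearr_def using cInf_lessD[OF decr_rearr_ne[OF D_lmeasurable u_meas s]] by blast
        then show False using \<mu>_antimono[of r t] that(2) by simp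
      qed
      then show "(indicator {t. 0 < t \<and> s \<le> \<mu> t} t :: ennreal) \<le> indicator {0..?U} t" by (auto simp: indicator_def)
    qed
    then show "X \<le> ennreal ?U" using decr_rearr_nonneg[OF D_lmeasurable u_meas s] by simp
    have "(\<integral>\<^sup>+t. indicator {0<..<?U} t \<partial>lborel) \<le> X"
      unfolding X_def by (intro nn_integral_mono) (auto simp: indicator_def intro: less_decr_rearr_imp)
    then show "ennreal ?U \<le> X" using decr_rearr_nonneg[OF D_lmeasurable u_meas s] by simp
  qed
  finally show ?thesis by simp
qed

text \<open>The transfer rule with \<open>s / c s\<close>, applied to the layer cake formula for
  \<open>\<bar>u\<bar>\<close>. Where \<open>\<mu>\<close> vanishes the perimeter cannot be
  cancelled, but both integrands are 0.\<close>

lemma nn_integral_abs_eq_profile: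
  assumes [measurable]: "h \<in> borel_measurable borel"
    and h: "\<And>F. F \<in> borel_measurable borel \<Longrightarrow>
      (\<integral>\<^sup>+t. indicator {0<..} t * ennreal (ball_perimeter DIM('a) (\<mu> t)) * F (\<mu> t) \<partial>lborel) = (\<integral>\<^sup>+\<sigma>. ennreal (h \<sigma>) * F \<sigma> \<partial>lborel)"
  shows "(\<integral>\<^sup>+x. ennreal \<bar>u x\<bar> \<partial>N) = (\<integral>\<^sup>+\<sigma>. ennreal (h \<sigma>) * ennreal (inverse (ball_perimeter DIM('a) \<sigma>) * \<sigma>) \<partial>lborel)"
proof -
  let ?c = "ball_perimeter DIM('a)"
  interpret N: finite_measure N by (rule finite_N)
  have "(\<integral>\<^sup>+x. ennreal \<bar>u x\<bar> \<partial>N) = (\<integral>\<^sup>+x. ennreal (\<bar>u x\<bar> - 0) \<partial>N)" by simp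
  also have "\<dots> = (\<integral>\<^sup>+t. indicator {0<..} t * emeasure N {x\<in>space N. t < \<bar>u x\<bar>} \<partial>lborel)"
    by (rule nn_integral_layer_cake) (auto intro: N.sigma_finite_measure_axioms)
  also have "\<dots> = (\<integral>\<^sup>+t. indicator {0<..} t * ennreal (?c (\<mu> t)) * ennreal (inverse (?c (\<mu> t)) * \<mu> t) \<partial>lborel)"
  proof (intro nn_integral_cong)
    fix t
    have "ennreal (?c (\<mu> t)) * ennreal (inverse (?c (\<mu> t)) * \<mu> t) = ennreal (\<mu> t)"
    proof (cases "\<mu> t = 0")
      case False
      then have "0 < \<mu> t" using distr_fun_nonneg[of D u t] by simp
      then show ?thesis using ball_perimeter_pos[of "real DIM('a)" "\<mu> t"] by (simp add: ennreal_mult[symmetric])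
    qed simp
    then show "indicator {0<..} t * emeasure N {x\<in>space N. t < \<bar>u x\<bar>} = indicator {0<..} t * ennreal (?c (\<mu> t)) * ennreal (inverse (?c (\<mu> t)) * \<mu> t)"
      using emeasure_level[of t] by (simp add: mult.assoc space_restrict_space)
  qed
  also have "\<dots> = (\<integral>\<^sup>+\<sigma>. ennreal (h \<sigma>) * ennreal (inverse (?c \<sigma>) * \<sigma>) \<partial>lborel)" by (rule h) measurable
  finally show ?thesis .
qed

text \<open>Off the origin the rearrangement is \<open>U (ball_vol x)\<close> with \<open>U\<close>
  the tail integral of \<open>q = h / c\<close>. Fubini rewrites its pairing with a partial
  derivative as the integral of \<open>q \<sigma>\<close> times the flux \<open>J \<sigma>\<close>,
  and \<open>ball_vol_pairing\<close> converts this back into an integral over the ball, with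
  \<open>q c = h\<close> along the radial direction.\<close>

lemma has_weak_gradient_sph_decr_rearr:
  assumes hm[measurable]: "h \<in> borel_measurable borel" and h0: "\<And>\<sigma>. 0 \<le> h \<sigma>"
    and hz: "\<And>\<sigma>. \<sigma> \<notin> {0<..measure lebesgue D} \<Longrightarrow> h \<sigma> = 0"
    and hfin: "(\<integral>\<^sup>+\<sigma>. ennreal (h \<sigma>) \<partial>lborel) < \<infinity>"
    and h: "\<And>F. F \<in> borel_measurable borel \<Longrightarrow>
      (\<integral>\<^sup>+t. indicator {0<..} t * ennreal (ball_perimeter DIM('a) (\<mu> t)) * F (\<mu> t) \<partial>lborel) = (\<integral>\<^sup>+\<sigma>. ennreal (h \<sigma>) * F \<sigma> \<partial>lborel)"
  shows "has_weak_gradient (sharp_ball D) (sph_decr_rearr D u) (\<lambda>x. - h (ball_vol x) *\<^sub>R sgn x)"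
proof -
  let ?c = "ball_perimeter DIM('a)" and ?B = "sharp_ball D" and ?M = "measure lebesgue D"
  \<comment> \<open>Division by the perimeter loses nothing: \<open>h\<close> vanishes at
    nonpositive volumes, so \<open>q \<sigma> * c \<sigma> = h \<sigma>\<close> everywhere.\<close>
  define q where "q \<sigma> = h \<sigma> * inverse (?c \<sigma>)" for \<sigma>
  have [measurable]: "q \<in> borel_measurable borel" unfolding q_def by measurable
  have c0: "0 \<le> ?c \<sigma>" for \<sigma> by (simp add: ball_perimeter_nonneg)
  have q0: "0 \<le> q \<sigma>" for \<sigma> using h0 c0 by (simp add: q_def)
  have qz: "q \<sigma> = 0" if "\<sigma> \<notin> {0<..?M}" for \<sigma> using hz[OF that] by (simp add: q_def)
  have qc: "q \<sigma> * ?c \<sigma> = h \<sigma>" for \<sigma>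
    using hz[of \<sigma>] ball_perimeter_pos[of "real DIM('a)" \<sigma>] by (cases "0 < \<sigma>") (auto simp: q_def)
  \<comment> \<open>\<open>enn2real\<close> would replace an infinite tail integral by 0; for
    \<open>s > 0\<close> the integral is the finite value of the rearrangement, so the truncation
    can act only at \<open>s \<le> 0\<close>.\<close>
  define U where "U s = enn2real (\<integral>\<^sup>+\<sigma>. ennreal (q \<sigma> * indicator {s..} \<sigma>) \<partial>lborel)" for s
  have qi: "ennreal (h \<sigma>) * (ennreal (inverse (?c \<sigma>)) * indicator {s..} \<sigma>) = ennreal (q \<sigma> * indicator {s..} \<sigma>)" for s \<sigma>
    using h0 c0 by (auto simp: q_def indicator_def ennreal_mult)
  have U_eq: "ennreal (U s) = (\<integral>\<^sup>+\<sigma>. ennreal (q \<sigma> * indicator {s..} \<sigma>) \<partial>lborel)" "decr_rearr D u s = U s" if s: "0 < s" for s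
  proof -
    have e: "ennreal (decr_rearr D u s) = (\<integral>\<^sup>+\<sigma>. ennreal (q \<sigma> * indicator {s..} \<sigma>) \<partial>lborel)"
      using decr_rearr_eq_profile_integral[OF hm h s] unfolding qi .
    show "decr_rearr D u s = U s" unfolding U_def e[symmetric] using decr_rearr_nonneg[OF D_lmeasurable u_meas s] by simp
    then show "ennreal (U s) = (\<integral>\<^sup>+\<sigma>. ennreal (q \<sigma> * indicator {s..} \<sigma>) \<partial>lborel)" using e by simp
  qed
  have [measurable]: "U \<in> borel_measurable borel"
  proof -
    have "(\<lambda>s. enn2real (\<integral>\<^sup>+\<sigma>. ennreal (if s \<le> \<sigma> then q \<sigma> else 0) \<partial>lborel)) \<in> borel_measurable borel" by measurable
    moreover have "(if s \<le> \<sigma> then q \<sigma> else 0) = q \<sigma> * indicator {s..} \<sigma>" for s \<sigma> by (simp add: indicator_def)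
    ultimately show ?thesis by (simp add: U_def[abs_def])
  qed
  \<comment> \<open>\<open>U\<close> may blow up at the centre. Its integral over the ball is
    bounded through Fubini by that of \<open>q \<sigma> * \<sigma>\<close>, which is the integral of
    \<open>\<bar>u\<bar>\<close>.\<close>
  have qid_fin: "(\<integral>\<^sup>+\<sigma>. ennreal (q \<sigma> * \<sigma>) \<partial>lborel) < \<infinity>"
  proof -
    have "ennreal (h \<sigma>) * ennreal (inverse (?c \<sigma>) * \<sigma>) = ennreal (q \<sigma> * \<sigma>)" for \<sigma>
      using h0 c0 by (simp add: q_def ennreal_mult'[symmetric] mult.assoc)
    then have "(\<integral>\<^sup>+\<sigma>. ennreal (q \<sigma> * \<sigma>) \<partial>lborel) = (\<integral>\<^sup>+x. ennreal \<bar>u x\<bar> \<partial>N)"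
      using nn_integral_abs_eq_profile[OF hm h] by simp
    also have "\<dots> < \<infinity>" using W1p_0_integrable(1)[OF D p u] by (simp add: integrable_iff_bounded)
    finally show ?thesis .
  qed
  have ball_fin: "(\<integral>\<^sup>+x. indicator ?B x * ennreal (norm (U (ball_vol x))) \<partial>lborel) < \<infinity>"
  proof -
    have "(\<integral>\<^sup>+x. indicator ?B x * ennreal (norm (U (ball_vol x))) \<partial>lborel) = (\<integral>\<^sup>+s. indicator {0..<?M} s * ennreal (norm (U s)) \<partial>lborel)"
      by (rule nn_integral_sharp_ball) measurable
    also have "\<dots> = (\<integral>\<^sup>+s. (\<integral>\<^sup>+\<sigma>. indicator {0..<?M} s * ennreal (if s \<le> \<sigma> then q \<sigma> else 0) \<partial>lborel) \<partial>lborel)"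
    proof (intro nn_integral_cong_AE, rule AE_mp[OF AE_lborel_singleton[of 0]], intro AE_I2 impI)
      fix s :: real assume "s \<noteq> 0"
      show "indicator {0..<?M} s * ennreal (norm (U s)) = (\<integral>\<^sup>+\<sigma>. indicator {0..<?M} s * ennreal (if s \<le> \<sigma> then q \<sigma> else 0) \<partial>lborel)"
      proof (cases "s \<in> {0..<?M}")
        case True
        with \<open>s \<noteq> 0\<close> have s: "0 < s" by simp
        have "U s \<ge> 0" by (simp add: U_def)
        then have "ennreal (norm (U s)) = (\<integral>\<^sup>+\<sigma>. ennreal (q \<sigma> * indicator {s..} \<sigma>) \<partial>lborel)" using U_eq(1)[OF s] by simp
        also have "\<dots> = (\<integral>\<^sup>+\<sigma>. ennreal (if s \<le> \<sigma> then q \<sigma> else 0) \<partial>lborel)" by (intro nn_integral_cong) (simp add: indicator_def)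
        finally show ?thesis using True by simp
      qed simp
    qed
    also have "\<dots> = (\<integral>\<^sup>+\<sigma>. (\<integral>\<^sup>+s. indicator {0..<?M} s * ennreal (if s \<le> \<sigma> then q \<sigma> else 0) \<partial>lborel) \<partial>lborel)"
      by (rule lborel_pair.Fubini'[symmetric]) measurable
    also have "\<dots> \<le> (\<integral>\<^sup>+\<sigma>. ennreal (q \<sigma> * \<sigma>) \<partial>lborel)"
    proof (intro nn_integral_mono)
      fix \<sigma> :: real
      show "(\<integral>\<^sup>+s. indicator {0..<?M} s * ennreal (if s \<le> \<sigma> then q \<sigma> else 0) \<partial>lborel) \<le> ennreal (q \<sigma> * \<sigma>)"
      proof (cases "0 < \<sigma>")
        case True
        have "(\<integral>\<^sup>+s. indicator {0..<?M} s * ennreal (if s \<le> \<sigma> then q \<sigma> else 0) \<partial>lborel) \<le> (\<integral>\<^sup>+s. ennreal (q \<sigma>) * indicator {0..\<sigma>} s \<partial>lborel)"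
          by (intro nn_integral_mono) (auto simp: indicator_def)
        also have "\<dots> = ennreal (q \<sigma> * \<sigma>)" using True q0 by (subst nn_integral_cmult_indicator) (auto simp: ennreal_mult)
        finally show ?thesis .
      next
        case False
        then have "q \<sigma> = 0" using qz[of \<sigma>] by simp
        then show ?thesis by (simp cong: if_cong)
      qed
    qed
    also note qid_fin
    finally show ?thesis .
  qed
  have hball: "(\<integral>\<^sup>+x. indicator ?B x * ennreal (norm (- h (ball_vol x) *\<^sub>R sgn x)) \<partial>lborel) < \<infinity>"
  proof -
    have "(\<integral>\<^sup>+x. indicator ?B x * ennreal (norm (- h (ball_vol x) *\<^sub>R sgn x)) \<partial>lborel) \<le> (\<integral>\<^sup>+x. indicator ?B (x::'a) * ennreal (h (ball_vol x)) \<partial>lborel)"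
      using h0 by (intro nn_integral_mono) (auto simp: indicator_def norm_sgn)
    also have "\<dots> = (\<integral>\<^sup>+s. indicator {0..<?M} s * ennreal (h s) \<partial>lborel)" by (rule nn_integral_sharp_ball) measurable
    also have "\<dots> \<le> (\<integral>\<^sup>+s. ennreal (h s) \<partial>lborel)" by (intro nn_integral_mono) (auto simp: indicator_def)
    also note hfin
    finally show ?thesis .
  qed
  have sph: "sph_decr_rearr D u x = U (ball_vol x)" if "x \<noteq> 0" for x
  proof -
    have "0 < ball_vol x" using that unit_ball_vol_DIM_pos[where 'a='a] by (simp add: ball_vol_def)
    then show ?thesis using U_eq(2) by (simp add: sph_decr_rearr_def ball_vol_def)
  qed
  have Bs: "?B \<in> sets lebesgue" using sharp_ball_sets by (rule sets_completionI_sets[of _ lborel, simplified])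
  have aeB: "AE x in lebesgue_on S. x \<noteq> 0" if "S \<in> sets lebesgue" for S :: "'a set"
    using AE_completion[OF AE_lborel_singleton[of 0]] that by (auto simp: AE_restrict_space_iff elim: eventually_mono)
  show ?thesis
    unfolding has_weak_gradient_def
  proof (intro conjI allI impI ballI)
    fix K assume K: "compact K \<and> K \<subseteq> ?B"
    have "(\<lambda>x. U (ball_vol x)) absolutely_integrable_on K"
      using K ball_fin by (intro absolutely_integrable_on_compact_if_borel) auto
    then show "sph_decr_rearr D u absolutely_integrable_on K"
      by (rule absolutely_integrable_spike[of _ _ "{0}"]) (use sph in auto)
    show "(\<lambda>x. - h (ball_vol x) *\<^sub>R sgn x) absolutely_integrable_on K"
      using K hball by (intro absolutely_integrable_on_compact_if_borel) auto
  next
    fix \<psi> b assume \<psi>: "test_function ?B \<psi>" and b: "b \<in> (Basis :: 'a set)"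
    let ?p = "partial_deriv b \<psi>"
    note pd = test_function_partial_deriv[OF \<psi> b]
    have [measurable]: "?p \<in> borel_measurable borel" "\<psi> \<in> borel_measurable borel" using pd \<psi> by (auto intro: test_function_measurable)
    obtain C where C: "0 < C" "\<And>x. \<bar>?p x\<bar> \<le> C" using test_function_bounded[OF pd] by metis
    have pz: "?p x = 0" "\<psi> x = 0" if "x \<notin> ?B" for x
    proof -
      show "?p x = 0" using test_functionE[OF pd] that by (metis subsetD)
      show "\<psi> x = 0" using test_functionE[OF \<psi>] that by (metis subsetD)
    qed
    define f where "f x \<sigma> = (if ball_vol x \<le> \<sigma> then q \<sigma> * ?p x else 0)" for x \<sigma>
    have fx: "f x = (\<lambda>\<sigma>. (q \<sigma> * indicator {ball_vol x..} \<sigma>) * ?p x)" for x by (auto simp: f_def indicator_def)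
    have qint: "integrable lborel (\<lambda>\<sigma>. q \<sigma> * indicator {s..} \<sigma>)" "(LINT \<sigma>|lborel. q \<sigma> * indicator {s..} \<sigma>) = U s" if "0 < s" for s
    proof -
      show "integrable lborel (\<lambda>\<sigma>. q \<sigma> * indicator {s..} \<sigma>)"
        by (rule integrableI_nonneg) (use U_eq(1)[OF that, symmetric] q0 in \<open>auto simp: ennreal_less_top\<close>)
      show "(LINT \<sigma>|lborel. q \<sigma> * indicator {s..} \<sigma>) = U s" unfolding U_def using q0 by (intro integral_eq_nn_integral) auto
    qed
    have bv0: "0 < ball_vol x" if "x \<noteq> 0" for x :: 'a using that unit_ball_vol_DIM_pos[where 'a='a] by (simp add: ball_vol_def)
    have "integrable (lborel \<Otimes>\<^sub>M lborel) (case_prod f)"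
    proof (rule lborel_pair.Fubini_integrable)
      show fm: "case_prod f \<in> borel_measurable (lborel \<Otimes>\<^sub>M lborel)" unfolding f_def by measurable
      have "integrable lborel (\<lambda>x. indicator ?B x * U (ball_vol x) * C)"
      proof (intro integrable_mult_left integrableI_bounded)
        have "ennreal (norm (indicator ?B x * U (ball_vol x))) = indicator ?B x * ennreal (norm (U (ball_vol x)))" for x
          by (auto simp: indicator_def)
        then show "(\<integral>\<^sup>+x. ennreal (norm (indicator ?B x * U (ball_vol x))) \<partial>lborel) < \<infinity>" using ball_fin by simp
      qed measurable
      then show "integrable lborel (\<lambda>x. LINT \<sigma>|lborel. norm (case_prod f (x, \<sigma>)))"
      proof (rule Bochner_Integration.integrable_bound)
        show "(\<lambda>x. LINT \<sigma>|lborel. norm (case_prod f (x, \<sigma>))) \<in> borel_measurable lborel" using fm by measurable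
        show "AE x in lborel. norm (LINT \<sigma>|lborel. norm (case_prod f (x, \<sigma>))) \<le> norm (indicator ?B x * U (ball_vol x) * C)"
        proof (rule AE_mp[OF AE_lborel_singleton[of 0]], intro AE_I2 impI)
          fix x :: 'a assume x: "x \<noteq> 0"
          have "(LINT \<sigma>|lborel. norm (f x \<sigma>)) = U (ball_vol x) * \<bar>?p x\<bar>"
            unfolding fx using qint[OF bv0[OF x]] q0 by (simp add: abs_mult)
          moreover have "0 \<le> U (ball_vol x)" by (simp add: U_def)
          ultimately show "norm (LINT \<sigma>|lborel. norm (case_prod f (x, \<sigma>))) \<le> norm (indicator ?B x * U (ball_vol x) * C)"
            using C pz(1)[of x] by (cases "x \<in> ?B") (auto simp: abs_mult intro!: mult_left_mono)
        qed
      qed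
      show "AE x in lborel. integrable lborel (\<lambda>\<sigma>. case_prod f (x, \<sigma>))"
        by (rule AE_mp[OF AE_lborel_singleton[of 0]], intro AE_I2 impI) (simp add: fx qint bv0)
    qed
    from lborel_pair.Fubini_integral[OF this]
    have sw: "(LINT \<sigma>|lborel. LINT x|lborel. f x \<sigma>) = (LINT x|lborel. LINT \<sigma>|lborel. f x \<sigma>)" by simp
    have sx: "(LINT \<sigma>|lborel. f x \<sigma>) = U (ball_vol x) * ?p x" if "x \<noteq> 0" for x
      unfolding fx using qint[OF bv0[OF that]] by simp
    define J where "J \<sigma> = (LINT x|lborel. indicator {x. ball_vol x \<le> \<sigma>} x * ?p x)" for \<sigma>
    have [measurable]: "J \<in> borel_measurable borel" unfolding J_def by (rule integral_ball_partial_deriv_measurable) measurable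
    have "(LINT x|lebesgue_on ?B. sph_decr_rearr D u x * ?p x) = (LINT x|lebesgue_on ?B. U (ball_vol x) * ?p x)"
    proof (rule integral_cong_AE)
      show "AE x in lebesgue_on ?B. sph_decr_rearr D u x * ?p x = U (ball_vol x) * ?p x" using aeB[OF Bs] by eventually_elim (simp add: sph)
      have m: "(\<lambda>x. U (ball_vol x) * ?p x) \<in> borel_measurable (lebesgue_on ?B)" by (intro borel_measurable_lebesgue_on) measurable
      then show "(\<lambda>x. U (ball_vol x) * ?p x) \<in> borel_measurable (lebesgue_on ?B)" .
      \<comment> \<open>The value of the rearrangement at the origin is unspecified, so
        measurability is argued with that point as a separate case.\<close>
      have e: "(\<lambda>x. sph_decr_rearr D u x * ?p x) = (\<lambda>x. if x = 0 then sph_decr_rearr D u 0 * ?p 0 else U (ball_vol x) * ?p x)"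
        by (intro ext) (auto simp: sph)
      show "(\<lambda>x. sph_decr_rearr D u x * ?p x) \<in> borel_measurable (lebesgue_on ?B)"
        unfolding e by (intro borel_measurable_lebesgue_on) measurable
    qed
    also have "\<dots> = (LINT x|lborel. U (ball_vol x) * ?p x)" by (rule lebesgue_on_eq_lborel[OF Bs]) (auto simp: pz)
    also have "\<dots> = (LINT x|lborel. LINT \<sigma>|lborel. f x \<sigma>)"
    proof (rule integral_cong_AE)
      show "AE x in lborel. U (ball_vol x) * ?p x = (LINT \<sigma>|lborel. f x \<sigma>)"
        by (rule AE_mp[OF AE_lborel_singleton[of 0]], intro AE_I2 impI) (simp add: sx)
      show "(\<lambda>x. LINT \<sigma>|lborel. f x \<sigma>) \<in> borel_measurable lborel" unfolding f_def by measurable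
    qed measurable
    also have "\<dots> = (LINT \<sigma>|lborel. q \<sigma> * J \<sigma>)"
    proof -
      have "f x \<sigma> = q \<sigma> * (indicator {x. ball_vol x \<le> \<sigma>} x * ?p x)" for x \<sigma> by (simp add: f_def indicator_def)
      then show ?thesis unfolding sw[symmetric] by (simp add: J_def)
    qed
    \<comment> \<open>\<open>q\<close> vanishes off \<open>{0<..measure lebesgue D}\<close>; on
      passing to the half-open interval only its right end point matters, which is a null
      set.\<close>
    also have "\<dots> = (LINT \<sigma>|lborel. indicator {0..<?M} \<sigma> * (q \<sigma> * J \<sigma>))"
    proof (rule integral_cong_AE)
      show "AE \<sigma> in lborel. q \<sigma> * J \<sigma> = indicator {0..<?M} \<sigma> * (q \<sigma> * J \<sigma>)"
      proof (rule AE_mp[OF AE_lborel_singleton[of ?M]], intro AE_I2 impI)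
        fix \<sigma> assume "\<sigma> \<noteq> ?M"
        then show "q \<sigma> * J \<sigma> = indicator {0..<?M} \<sigma> * (q \<sigma> * J \<sigma>)"
          using qz[of \<sigma>] by (cases "\<sigma> \<in> {0..<?M}") auto
      qed
    qed measurable
    also have "\<dots> = (LINT x|lborel. indicator ?B x * (q (ball_vol x) * (?c (ball_vol x) * (sgn x \<bullet> b) * \<psi> x)))"
    proof -
      have "(\<integral>\<^sup>+\<sigma>. indicator {0..<?M} \<sigma> * ennreal (q \<sigma> * ?c \<sigma>) \<partial>lborel) \<le> (\<integral>\<^sup>+\<sigma>. ennreal (h \<sigma>) \<partial>lborel)"
        by (intro nn_integral_mono) (auto simp: indicator_def qc)
      then have "(\<integral>\<^sup>+\<sigma>. indicator {0..<?M} \<sigma> * ennreal (q \<sigma> * ?c \<sigma>) \<partial>lborel) < \<infinity>" using hfin by (rule le_less_trans)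
      from ball_vol_pairing[OF \<psi> b dim _ q0 this] show ?thesis unfolding J_def by simp
    qed
    also have "\<dots> = (LINT x|lborel. - (((- h (ball_vol x) *\<^sub>R sgn x) \<bullet> b) * \<psi> x))"
    proof (intro Bochner_Integration.integral_cong refl)
      fix x :: 'a
      have "q (ball_vol x) * (?c (ball_vol x) * (sgn x \<bullet> b) * \<psi> x) = (q (ball_vol x) * ?c (ball_vol x)) * (sgn x \<bullet> b) * \<psi> x" by (simp only: mult.assoc)
      then show "indicator ?B x * (q (ball_vol x) * (?c (ball_vol x) * (sgn x \<bullet> b) * \<psi> x)) = - (((- h (ball_vol x) *\<^sub>R sgn x) \<bullet> b) * \<psi> x)"
        using pz(2)[of x] by (cases "x \<in> ?B") (auto simp: qc)
    qed
    also have "\<dots> = - (LINT x|lborel. ((- h (ball_vol x) *\<^sub>R sgn x) \<bullet> b) * \<psi> x)" by (rule Bochner_Integration.integral_minus)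
    also have "\<dots> = - (LINT x|lebesgue_on ?B. ((- h (ball_vol x) *\<^sub>R sgn x) \<bullet> b) * \<psi> x)"
      by (subst lebesgue_on_eq_lborel[OF Bs]) (auto simp: pz)
    finally show "(LINT x|lebesgue_on ?B. sph_decr_rearr D u x * ?p x) = - (LINT x|lebesgue_on ?B. ((- h (ball_vol x) *\<^sub>R sgn x) \<bullet> b) * \<psi> x)" .
  qed
qed

end

section \<open>Comparison of the solutions\<close>

text \<open>The factor \<open>norm x\<close> is the length of \<open>{0<..<norm x}\<close>, and
  Tonelli's theorem exchanges the integrals.\<close>

lemma nn_integral_layer_cake_outside:
  fixes v :: "'a::euclidean_space \<Rightarrow> real"
  assumes [measurable]: "w \<in> borel_measurable borel"
  shows "(\<integral>\<^sup>+x. ennreal (norm x) * w x \<partial>lborel) = (\<integral>\<^sup>+r. indicator {0<..} r * (\<integral>\<^sup>+x. indicator {x::'a. r < norm x} x * w x \<partial>lborel) \<partial>lborel)"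
proof -
  have "(\<integral>\<^sup>+r. indicator {0<..} r * (\<integral>\<^sup>+x. indicator {x::'a. r < norm x} x * w x \<partial>lborel) \<partial>lborel)
      = (\<integral>\<^sup>+r. (\<integral>\<^sup>+x. (if 0 < r \<and> r < norm (x::'a) then w x else 0) \<partial>lborel) \<partial>lborel)"
  proof (intro nn_integral_cong)
    fix r :: real
    show "indicator {0<..} r * (\<integral>\<^sup>+x. indicator {x::'a. r < norm x} x * w x \<partial>lborel) = (\<integral>\<^sup>+x. (if 0 < r \<and> r < norm (x::'a) then w x else 0) \<partial>lborel)"
      by (cases "0 < r") (auto intro!: nn_integral_cong simp: indicator_def)
  qed
  also have "\<dots> = (\<integral>\<^sup>+x. (\<integral>\<^sup>+r. (if 0 < r \<and> r < norm (x::'a) then w x else 0) \<partial>lborel) \<partial>lborel)"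
    by (rule lborel_pair.Fubini') measurable
  also have "\<dots> = (\<integral>\<^sup>+x. ennreal (norm x) * w x \<partial>lborel)"
  proof (intro nn_integral_cong)
    fix x :: 'a
    have "(\<integral>\<^sup>+r. (if 0 < r \<and> r < norm x then w x else 0) \<partial>lborel) = (\<integral>\<^sup>+r. w x * indicator {0<..<norm x} r \<partial>lborel)"
      by (intro nn_integral_cong) (auto simp: indicator_def)
    also have "\<dots> = w x * emeasure lborel {0<..<norm x}" by (rule nn_integral_cmult_indicator) simp
    finally show "(\<integral>\<^sup>+r. (if 0 < r \<and> r < norm x then w x else 0) \<partial>lborel) = ennreal (norm x) * w x" by (simp add: mult.commute)
  qed
  finally show ?thesis by simp
qed

text \<open>By the layer cake in \<open>norm x\<close> it suffices to compare integrals over the shells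
  \<open>r < norm x\<close> of the ball. There the rearrangement lies above its value \<open>k\<close> at radius \<open>r\<close>,
  while elsewhere it lies below, so the excess over \<open>k\<close> is carried by the shell.\<close>

lemma nn_integral_norm_le_sph_incr_rearr:
  fixes f v :: "'a::euclidean_space \<Rightarrow> real"
  assumes D: "D \<in> lmeasurable" and f: "f \<in> borel_measurable (lebesgue_on D)"
    and v0: "\<And>x. x \<in> sharp_ball D \<Longrightarrow> 0 \<le> v x"
    and v: "(\<lambda>x. indicator (sharp_ball D) x * v x) \<in> borel_measurable borel"
    and le: "\<And>k. 0 \<le> k \<Longrightarrow> (\<integral>\<^sup>+x. indicator (sharp_ball D) x * ennreal (v x - k) \<partial>lborel) \<le> (\<integral>\<^sup>+x. ennreal (\<bar>f x\<bar> - k) \<partial>lebesgue_on D)"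
  shows "(\<integral>\<^sup>+x. indicator (sharp_ball D) x * ennreal (norm x * v x) \<partial>lborel)
    \<le> (\<integral>\<^sup>+x. indicator (sharp_ball D) x * ennreal (norm x * sph_incr_rearr D f x) \<partial>lborel)"
proof -
  let ?B = "sharp_ball D" and ?G = "sph_incr_rearr D f" and ?M = "measure lebesgue D"
  have Bpos: "0 < ?M - ball_vol x" if "x \<in> ?B" for x :: 'a using that by (simp add: sharp_ball_eq)
  have G_eq: "?G x = decr_rearr D f (?M - ball_vol x)" for x by (simp add: sph_incr_rearr_def incr_rearr_def ball_vol_def)
  have G0: "0 \<le> ?G x" if "x \<in> ?B" for x unfolding G_eq using D f Bpos[OF that] by (rule decr_rearr_nonneg)
  note Gm = sph_incr_rearr_measurable[OF D f]
  have ind: "indicator ?B x * ennreal (t x) = ennreal (indicator ?B x * t x)" for t and x :: 'a by (simp add: indicator_def)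
  have vm: "(\<lambda>x. indicator ?B x * ennreal (v x)) \<in> borel_measurable borel" unfolding ind using v by measurable
  have Gem: "(\<lambda>x. indicator ?B x * ennreal (?G x)) \<in> borel_measurable borel" unfolding ind using Gm by measurable
  have shell: "(\<integral>\<^sup>+x. indicator {x. r < norm x} x * (indicator ?B x * ennreal (v x)) \<partial>lborel)
      \<le> (\<integral>\<^sup>+x. indicator {x. r < norm x} x * (indicator ?B x * ennreal (?G x)) \<partial>lborel)" if r: "0 < r" for r
  proof (cases "unit_ball_vol DIM('a) * r ^ DIM('a) < ?M")
    \<comment> \<open>The shell lies outside the ball, so the left-hand side is 0.\<close>
    case False
    have "r < norm x \<Longrightarrow> x \<notin> ?B" for x :: 'a
    proof -
      assume "r < norm x"
      then have "r ^ DIM('a) \<le> norm x ^ DIM('a)" using r by (intro power_mono) auto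
      then have "unit_ball_vol DIM('a) * r ^ DIM('a) \<le> ball_vol x"
        unfolding ball_vol_def using unit_ball_vol_DIM_pos[where 'a='a] by (intro mult_left_mono) auto
      then show ?thesis using False by (simp add: sharp_ball_eq)
    qed
    then have z: "(\<lambda>x. indicator {x. r < norm x} x * (indicator ?B x * ennreal (v x))) = (\<lambda>x. 0)"
      by (intro ext) (auto simp: indicator_def)
    show ?thesis unfolding z by simp
  next
    case True
    define \<rho> where "\<rho> = unit_ball_vol DIM('a) * r ^ DIM('a)"
    define k where "k = decr_rearr D f (?M - \<rho>)"
    have \<rho>: "\<rho> < ?M" using True by (simp add: \<rho>_def)
    have k0: "0 \<le> k" unfolding k_def using \<rho> by (intro decr_rearr_nonneg[OF D f]) simp
    have out: "k \<le> ?G x" if "x \<in> ?B" "r < norm x" for x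
    proof -
      have "r ^ DIM('a) \<le> norm x ^ DIM('a)" using r that by (intro power_mono) auto
      then have "\<rho> \<le> ball_vol x"
        unfolding ball_vol_def \<rho>_def using unit_ball_vol_DIM_pos[where 'a='a] by (intro mult_left_mono) auto
      then show ?thesis unfolding k_def G_eq using Bpos[OF that(1)] by (intro decr_rearr_antimono[OF D f]) auto
    qed
    have inn: "?G x \<le> k" if "\<not> r < norm x" for x
    proof -
      have "norm x ^ DIM('a) \<le> r ^ DIM('a)" using that by (intro power_mono) auto
      then have "ball_vol x \<le> \<rho>"
        unfolding ball_vol_def \<rho>_def using unit_ball_vol_DIM_pos[where 'a='a] by (intro mult_left_mono) auto
      then show ?thesis unfolding k_def G_eq using \<rho> by (intro decr_rearr_antimono[OF D f]) auto
    qed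
    let ?S = "{x::'a. r < norm x}"
    have Sm: "?S \<in> sets borel" by (intro borel_open open_Collect_less continuous_intros)
    have m1: "(\<lambda>x. indicator ?B x * ennreal (v x - k)) \<in> borel_measurable borel"
    proof -
      have "(\<lambda>x. ennreal (indicator ?B x * v x - indicator ?B x * k)) \<in> borel_measurable borel" using v by measurable
      moreover have "indicator ?B x * ennreal (v x - k) = ennreal (indicator ?B x * v x - indicator ?B x * k)" for x :: 'a by (simp add: indicator_def)
      ultimately show ?thesis by simp
    qed
    have m2: "(\<lambda>x. indicator ?B x * ennreal (?G x - k)) \<in> borel_measurable borel"
    proof -
      have "(\<lambda>x. ennreal (indicator ?B x * ?G x - indicator ?B x * k)) \<in> borel_measurable borel" using Gm by measurable
      moreover have "indicator ?B x * ennreal (?G x - k) = ennreal (indicator ?B x * ?G x - indicator ?B x * k)" for x :: 'a by (simp add: indicator_def)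
      ultimately show ?thesis by simp
    qed
    have ek: "ennreal a \<le> ennreal (a - k) + ennreal k" for a
      using k0 by (cases "k \<le> a") (auto simp: ennreal_plus[symmetric] ennreal_neg intro!: ennreal_leI simp del: ennreal_plus)
    have m3: "(\<lambda>x. indicator ?S x * (indicator ?B x * ennreal k)) \<in> borel_measurable lborel" using Sm by measurable
    have "(\<integral>\<^sup>+x. indicator ?S x * (indicator ?B x * ennreal (v x)) \<partial>lborel)
        \<le> (\<integral>\<^sup>+x. indicator ?B x * ennreal (v x - k) + indicator ?S x * (indicator ?B x * ennreal k) \<partial>lborel)"
      using ek by (intro nn_integral_mono) (auto simp: indicator_def)
    also have "\<dots> = (\<integral>\<^sup>+x. indicator ?B x * ennreal (v x - k) \<partial>lborel) + (\<integral>\<^sup>+x. indicator ?S x * (indicator ?B x * ennreal k) \<partial>lborel)"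
      by (rule nn_integral_add) (use m1 m3 in auto)
    also have "\<dots> \<le> (\<integral>\<^sup>+x. indicator ?B x * ennreal (?G x - k) \<partial>lborel) + (\<integral>\<^sup>+x. indicator ?S x * (indicator ?B x * ennreal k) \<partial>lborel)"
      using le[OF k0] nn_integral_sph_incr_rearr_excess[OF D f k0] by (intro add_right_mono) simp
    also have "\<dots> = (\<integral>\<^sup>+x. indicator ?B x * ennreal (?G x - k) + indicator ?S x * (indicator ?B x * ennreal k) \<partial>lborel)"
      by (rule nn_integral_add[symmetric]) (use m2 m3 in auto)
    also have "\<dots> = (\<integral>\<^sup>+x. indicator ?S x * (indicator ?B x * ennreal (?G x)) \<partial>lborel)"
    proof (intro nn_integral_cong)
      fix x :: 'a
      show "indicator ?B x * ennreal (?G x - k) + indicator ?S x * (indicator ?B x * ennreal k) = indicator ?S x * (indicator ?B x * ennreal (?G x))"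
      proof (cases "x \<in> ?B \<and> r < norm x")
        case True
        then have "ennreal (?G x - k) + ennreal k = ennreal (?G x)" using out[of x] k0 by (subst ennreal_plus[symmetric]) auto
        then show ?thesis using True by simp
      next
        case False
        then show ?thesis using inn[of x] by (auto simp: indicator_def ennreal_neg)
      qed
    qed
    finally show ?thesis .
  qed
  have n: "indicator ?B x * ennreal (norm x * t x) = ennreal (norm x) * (indicator ?B x * ennreal (t x))" for t and x :: 'a
    by (auto simp: indicator_def ennreal_mult')
  show ?thesis
    unfolding n nn_integral_layer_cake_outside[OF vm] nn_integral_layer_cake_outside[OF Gem]
    using shell by (intro nn_integral_mono) (auto simp: indicator_def)
qed

section \<open>Norms of radial solutions and the final comparison\<close>

lemma Lp_norm_1: "Lp_norm D 1 v = (LINT x|lebesgue_on D. \<bar>v x\<bar>)" for v :: "'a::euclidean_space \<Rightarrow> real"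
  by (simp add: Lp_norm_def)

text \<open>Lets the results on rearrangements over a general domain be used with the ball itself as
  domain, as the gradient of the rearranged function requires.\<close>

lemma sharp_ball_sharp_ball: "sharp_ball (sharp_ball D) = sharp_ball D"
  by (subst sharp_ball_def[of "sharp_ball D"]) (simp only: measure_sharp_ball, rule sharp_ball_def[symmetric])

lemma sharp_ball_lmeasurable: "sharp_ball D \<in> lmeasurable"
  by (simp add: sharp_ball_def)

lemma indicator_mult_ennreal: "indicator B x * ennreal t = ennreal (indicator B x * t)"
  by (simp add: indicator_def)

text \<open>The identity for the integral of \<open>w\<close> and the bound for that of
  \<open>\<bar>w\<bar>\<close> have the same right-hand side. Hence the integrals of
  \<open>w\<close> and \<open>\<bar>w\<bar>\<close> coincide, and the norm is determined by the
  prescribed gradient length alone.\<close>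

lemma radial_solution_L1_norm:
  fixes w G :: "'a::euclidean_space \<Rightarrow> real"
  assumes p: "1 \<le> p" and w: "eikonal_solution (sharp_ball D) p G w" and rad: "spherically_decreasing_on (sharp_ball D) w"
    and G: "(\<lambda>x. indicator (sharp_ball D) x * G x) \<in> borel_measurable borel"
  shows "ennreal (real DIM('a) * Lp_norm (sharp_ball D) 1 w) = (\<integral>\<^sup>+x. indicator (sharp_ball D) x * ennreal (norm x * G x) \<partial>lborel)"
proof -
  let ?B = "sharp_ball D" and ?n = "real DIM('a)"
  let ?g = "\<lambda>x. norm (weak_gradient ?B w x)"
  have B: "open ?B" "bounded ?B" by (auto simp: sharp_ball_def)
  have W: "in_W1p_0 ?B p w" and ae: "AE x in lebesgue_on ?B. ?g x = G x" using w by (auto simp: eikonal_solution_def)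
  have eq: "?n * (LINT x|lebesgue_on ?B. w x) = (LINT x|lebesgue_on ?B. norm x * ?g x)"
    using W1p_0_radial_integral_eq[OF p W[unfolded sharp_ball_def] rad[unfolded sharp_ball_def]] unfolding sharp_ball_def .
  have "(LINT x|lebesgue_on ?B. w x) \<le> (LINT x|lebesgue_on ?B. \<bar>w x\<bar>)"
    using W1p_0_integrable(1)[OF B p W] by (intro integral_mono) auto
  then have "?n * (LINT x|lebesgue_on ?B. w x) \<le> ?n * (LINT x|lebesgue_on ?B. \<bar>w x\<bar>)" by (intro mult_left_mono) auto
  then have "?n * Lp_norm ?B 1 w = (LINT x|lebesgue_on ?B. norm x * ?g x)"
    using W1p_0_L1_bound[OF B p W] eq by (simp add: Lp_norm_1)
  then have "ennreal (?n * Lp_norm ?B 1 w) = (\<integral>\<^sup>+x. ennreal (norm x * ?g x) \<partial>lebesgue_on ?B)"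
    using W1p_0_norm_integrable[OF B p W] by (subst nn_integral_eq_integral) auto
  also have "\<dots> = (\<integral>\<^sup>+x. indicator ?B x * ennreal (norm x * G x) \<partial>lebesgue_on ?B)"
  proof (rule nn_integral_cong_AE)
    have "AE x in lebesgue_on ?B. x \<in> ?B" by (rule AE_I2) (simp add: space_restrict_space)
    with ae show "AE x in lebesgue_on ?B. ennreal (norm x * ?g x) = indicator ?B x * ennreal (norm x * G x)"
      by eventually_elim simp
  qed
  also have "\<dots> = (\<integral>\<^sup>+x. indicator ?B x * ennreal (norm x * G x) \<partial>lborel)"
  proof (rule nn_integral_lebesgue_on_lborel[symmetric])
    have "(\<lambda>x. ennreal (norm x * (indicator ?B x * G x))) \<in> borel_measurable borel" using G by measurable
    then show "(\<lambda>x. indicator ?B x * ennreal (norm x * G x)) \<in> borel_measurable borel"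
      by (simp add: indicator_mult_ennreal mult.left_commute)
  qed (use B in auto)
  finally show ?thesis .
qed

context sobolev_profile
begin

text \<open>Collects what is used of the rearranged function. The last identity computes the norm of
  \<open>u\<close> itself and is the counterpart of the formula for radial solutions.\<close>

lemma obtain_rearrangement_profile:
  obtains h :: "real \<Rightarrow> real" where "h \<in> borel_measurable borel" "\<And>\<sigma>. 0 \<le> h \<sigma>"
    "has_weak_gradient (sharp_ball D) (sph_decr_rearr D u) (\<lambda>x. - h (ball_vol x) *\<^sub>R sgn x)"
    "\<And>k. 0 \<le> k \<Longrightarrow> (\<integral>\<^sup>+x. indicator (sharp_ball D) (x::'a) * ennreal (h (ball_vol x) - k) \<partial>lborel) \<le> (\<integral>\<^sup>+x. ennreal (g x - k) \<partial>N)"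
    "ennreal (real DIM('a) * Lp_norm D 1 u) = (\<integral>\<^sup>+x. indicator (sharp_ball D) (x::'a) * ennreal (norm x * h (ball_vol x)) \<partial>lborel)"
proof -
  let ?c = "ball_perimeter DIM('a)" and ?M = "measure lebesgue D" and ?B = "sharp_ball D"
  obtain h :: "real \<Rightarrow> real" where hm [measurable]: "h \<in> borel_measurable borel" and h0: "\<And>s. 0 \<le> h s"
    and hz: "\<And>s. s \<notin> {0<..?M} \<Longrightarrow> h s = 0"
    and hk: "\<And>k. 0 \<le> k \<Longrightarrow> (\<integral>\<^sup>+s. ennreal (h s - k) \<partial>lborel) \<le> (\<integral>\<^sup>+x. ennreal (g x - k) \<partial>N)"
    and h: "\<And>F. F \<in> borel_measurable borel \<Longrightarrow>
      (\<integral>\<^sup>+t. indicator {0<..} t * ennreal (?c (\<mu> t)) * F (\<mu> t) \<partial>lborel) = (\<integral>\<^sup>+s. ennreal (h s) * F s \<partial>lborel)"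
    by (rule obtain_profile) (rule that)
  have hfin: "(\<integral>\<^sup>+s. ennreal (h s) \<partial>lborel) < \<infinity>"
    using le_less_trans[OF hk[of 0]] g_finite by simp
  show ?thesis
  proof (rule that)
    show "has_weak_gradient ?B (sph_decr_rearr D u) (\<lambda>x. - h (ball_vol x) *\<^sub>R sgn x)"
      by (rule has_weak_gradient_sph_decr_rearr[OF hm h0 hz hfin h])
    show "(\<integral>\<^sup>+x. indicator ?B (x::'a) * ennreal (h (ball_vol x) - k) \<partial>lborel) \<le> (\<integral>\<^sup>+x. ennreal (g x - k) \<partial>N)" if "0 \<le> k" for k
    proof -
      have "(\<integral>\<^sup>+x. indicator ?B (x::'a) * ennreal (h (ball_vol x) - k) \<partial>lborel) = (\<integral>\<^sup>+s. indicator {0..<?M} s * ennreal (h s - k) \<partial>lborel)"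
        by (rule nn_integral_sharp_ball) measurable
      also have "\<dots> \<le> (\<integral>\<^sup>+s. ennreal (h s - k) \<partial>lborel)" by (intro nn_integral_mono) (auto simp: indicator_def)
      also note hk[OF that]
      finally show ?thesis .
    qed
    let ?n = "real DIM('a)"
    have "ennreal (?n * Lp_norm D 1 u) = ennreal ?n * ennreal (LINT x|N. \<bar>u x\<bar>)" by (simp add: Lp_norm_1 ennreal_mult')
    also have "ennreal (LINT x|N. \<bar>u x\<bar>) = (\<integral>\<^sup>+x. ennreal \<bar>u x\<bar> \<partial>N)"
      using W1p_0_integrable(1)[OF D p u] by (intro nn_integral_eq_integral[symmetric]) auto
    also have "\<dots> = (\<integral>\<^sup>+\<sigma>. ennreal (h \<sigma>) * ennreal (inverse (?c \<sigma>) * \<sigma>) \<partial>lborel)"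
      by (rule nn_integral_abs_eq_profile[OF hm h])
    also have "\<dots> = (\<integral>\<^sup>+\<sigma>. indicator {0..<?M} \<sigma> * (ennreal (h \<sigma>) * ennreal (inverse (?c \<sigma>) * \<sigma>)) \<partial>lborel)"
    proof (intro nn_integral_cong_AE, rule AE_mp[OF AE_lborel_singleton[of ?M]], intro AE_I2 impI)
      fix \<sigma> assume "\<sigma> \<noteq> ?M"
      then show "ennreal (h \<sigma>) * ennreal (inverse (?c \<sigma>) * \<sigma>) = indicator {0..<?M} \<sigma> * (ennreal (h \<sigma>) * ennreal (inverse (?c \<sigma>) * \<sigma>))"
        using hz[of \<sigma>] by (cases "\<sigma> \<in> {0..<?M}") auto
    qed
    also have "\<dots> = (\<integral>\<^sup>+x. indicator ?B (x::'a) * (ennreal (h (ball_vol x)) * ennreal (inverse (?c (ball_vol x)) * ball_vol x)) \<partial>lborel)"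
      by (rule nn_integral_sharp_ball[symmetric]) measurable
    also have "ennreal ?n * \<dots> = (\<integral>\<^sup>+x. ennreal ?n * (indicator ?B (x::'a) * (ennreal (h (ball_vol x)) * ennreal (inverse (?c (ball_vol x)) * ball_vol x))) \<partial>lborel)"
      by (rule nn_integral_cmult[symmetric]) measurable
    also have "\<dots> = (\<integral>\<^sup>+x. indicator ?B (x::'a) * ennreal (norm x * h (ball_vol x)) \<partial>lborel)"
    proof (intro nn_integral_cong)
      fix x :: 'a
      have c0: "0 \<le> ?c (ball_vol x)" by (simp add: ball_perimeter_nonneg)
      \<comment> \<open>\<open>n * ball_vol x\<close> divided by the perimeter is
        \<open>norm x\<close>; at volume 0, where the quotient breaks down, \<open>h\<close> is
        0.\<close>
      have "?n * (h (ball_vol x) * (inverse (?c (ball_vol x)) * ball_vol x)) = norm x * h (ball_vol x)"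
      proof (cases "0 < ball_vol x")
        case True
        have "?n * (h (ball_vol x) * (inverse (?c (ball_vol x)) * ball_vol x)) = h (ball_vol x) * inverse (?c (ball_vol x)) * (?n * ball_vol x)" by (simp only: mult_ac)
        also have "\<dots> = norm x * h (ball_vol x)"
          unfolding ball_vol_eq_norm_perimeter using ball_perimeter_pos[OF _ True, of ?n] by simp
        finally show ?thesis .
      next
        case False
        then have "h (ball_vol x) = 0" by (intro hz) simp
        then show ?thesis by simp
      qed
      moreover have "ennreal ?n * (ennreal (h (ball_vol x)) * ennreal (inverse (?c (ball_vol x)) * ball_vol x)) = ennreal (?n * (h (ball_vol x) * (inverse (?c (ball_vol x)) * ball_vol x)))"
        using h0 c0 ball_vol_nonneg[of x] by (simp add: ennreal_mult)
      ultimately show "ennreal ?n * (indicator ?B x * (ennreal (h (ball_vol x)) * ennreal (inverse (?c (ball_vol x)) * ball_vol x))) = indicator ?B x * ennreal (norm x * h (ball_vol x))"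
        by (cases "x \<in> ?B") (simp only: indicator_simps mult_1_left, simp)
    qed
    finally show "ennreal (?n * Lp_norm D 1 u) = (\<integral>\<^sup>+x. indicator ?B (x::'a) * ennreal (norm x * h (ball_vol x)) \<partial>lborel)" .
  qed (fact hm, fact h0)
qed

text \<open>Both inequalities compare a competitor with an increasing rearrangement. In the first,
  the competitor is \<open>h (ball_vol x)\<close>, which has the same excess integrals as the
  gradient of the rearranged function. In the second, it is the increasing rearrangement of that
  gradient length, whose excess integrals are bounded by those of \<open>f\<close> through the
  profile bound.\<close>

lemma L1_norm_chain:
  fixes f uG usG :: "'a \<Rightarrow> real"
  defines "v \<equiv> \<lambda>x. norm (weak_gradient (sharp_ball D) (sph_decr_rearr D u) x)"
  assumes f: "f \<in> borel_measurable N" and ae: "AE x in N. g x = f x"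
    and uG: "eikonal_solution (sharp_ball D) p (sph_incr_rearr D f) uG" "spherically_decreasing_on (sharp_ball D) uG"
    and usG: "eikonal_solution (sharp_ball D) p (sph_incr_rearr (sharp_ball D) v) usG" "spherically_decreasing_on (sharp_ball D) usG"
  shows "Lp_norm D 1 u \<le> Lp_norm (sharp_ball D) 1 usG" "Lp_norm (sharp_ball D) 1 usG \<le> Lp_norm (sharp_ball D) 1 uG"
proof -
  let ?B = "sharp_ball D" and ?n = "real DIM('a)"
  obtain h :: "real \<Rightarrow> real" where hm [measurable]: "h \<in> borel_measurable borel" and h0: "\<And>s. 0 \<le> h s"
    and hw: "has_weak_gradient ?B (sph_decr_rearr D u) (\<lambda>x. - h (ball_vol x) *\<^sub>R sgn x)"
    and hk: "\<And>k. 0 \<le> k \<Longrightarrow> (\<integral>\<^sup>+x. indicator ?B (x::'a) * ennreal (h (ball_vol x) - k) \<partial>lborel) \<le> (\<integral>\<^sup>+x. ennreal (g x - k) \<partial>N)"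
    and hu: "ennreal (?n * Lp_norm D 1 u) = (\<integral>\<^sup>+x. indicator ?B (x::'a) * ennreal (norm x * h (ball_vol x)) \<partial>lborel)"
    by (rule obtain_rearrangement_profile) (rule that)
  have B: "open ?B" by (simp add: sharp_ball_def)
  note Bm = sharp_ball_lmeasurable[of D]
  have Bs: "?B \<in> sets lebesgue" using Bm by (rule fmeasurableD)
  have wg: "has_weak_gradient ?B (sph_decr_rearr D u) (weak_gradient ?B (sph_decr_rearr D u))"
    using hw by (rule has_weak_gradient_weak_gradient)
  have "weak_gradient ?B (sph_decr_rearr D u) \<in> borel_measurable (lebesgue_on ?B)"
    using wg by (intro measurable_lebesgue_on_if_compact[OF B]) (simp add: has_weak_gradient_def)
  from measurable_compose[OF this borel_measurable_norm]
  have vm: "v \<in> borel_measurable (lebesgue_on ?B)" unfolding v_def .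
  \<comment> \<open>The hypotheses speak of the chosen representative of the gradient; uniqueness
    identifies its length with the profile almost everywhere, the origin aside, where
    \<open>sgn\<close> is 0.\<close>
  have vh: "AE x in lebesgue_on ?B. v x = h (ball_vol x)"
  proof -
    have "AE x in lebesgue_on ?B. x \<noteq> 0"
      using AE_completion[OF AE_lborel_singleton[of 0]] Bs by (auto simp: AE_restrict_space_iff elim: eventually_mono)
    with has_weak_gradient_unique[OF B wg hw] show ?thesis
      by eventually_elim (use h0 in \<open>simp add: v_def norm_sgn\<close>)
  qed
  have v_excess: "(\<integral>\<^sup>+x. ennreal (\<bar>v x\<bar> - k) \<partial>lebesgue_on ?B) = (\<integral>\<^sup>+x. indicator ?B (x::'a) * ennreal (h (ball_vol x) - k) \<partial>lborel)" for k
  proof -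
    have "(\<integral>\<^sup>+x. ennreal (\<bar>v x\<bar> - k) \<partial>lebesgue_on ?B) = (\<integral>\<^sup>+x. indicator ?B (x::'a) * ennreal (h (ball_vol x) - k) \<partial>lebesgue_on ?B)"
    proof (rule nn_integral_cong_AE)
      have "AE x in lebesgue_on ?B. x \<in> ?B" by (rule AE_I2) (simp add: space_restrict_space)
      with vh show "AE x in lebesgue_on ?B. ennreal (\<bar>v x\<bar> - k) = indicator ?B x * ennreal (h (ball_vol x) - k)"
        by eventually_elim (use h0 in simp)
    qed
    also have "\<dots> = (\<integral>\<^sup>+x. indicator ?B (x::'a) * ennreal (h (ball_vol x) - k) \<partial>lborel)"
    proof (rule nn_integral_lebesgue_on_lborel[symmetric, OF Bs])
      show "(\<lambda>x. indicator ?B (x::'a) * ennreal (h (ball_vol x) - k)) \<in> borel_measurable borel" by measurable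
    qed simp
    finally show ?thesis .
  qed
  have vs0: "0 \<le> sph_incr_rearr ?B v x" if "x \<in> ?B" for x
  proof -
    have "0 < measure lebesgue D - ball_vol x" using that by (simp add: sharp_ball_eq)
    from decr_rearr_nonneg[OF Bm vm this] show ?thesis
      by (simp add: sph_incr_rearr_def incr_rearr_def measure_sharp_ball ball_vol_def)
  qed
  note vsm = sph_incr_rearr_measurable[OF Bm vm, unfolded sharp_ball_sharp_ball]
  have "ennreal (?n * Lp_norm D 1 u) \<le> (\<integral>\<^sup>+x. indicator ?B x * ennreal (norm x * sph_incr_rearr ?B v x) \<partial>lborel)"
    unfolding hu
  proof (rule nn_integral_norm_le_sph_incr_rearr[OF Bm vm, unfolded sharp_ball_sharp_ball])
    show "(\<lambda>x::'a. indicator ?B x * h (ball_vol x)) \<in> borel_measurable borel" by measurable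
  qed (simp_all add: h0 v_excess)
  also have us: "\<dots> = ennreal (?n * Lp_norm ?B 1 usG)"
    by (rule radial_solution_L1_norm[OF p usG vsm, symmetric])
  finally have "?n * Lp_norm D 1 u \<le> ?n * Lp_norm ?B 1 usG" by (subst (asm) ennreal_le_iff) (auto simp: Lp_norm_def)
  then show "Lp_norm D 1 u \<le> Lp_norm ?B 1 usG" by simp
  have "ennreal (?n * Lp_norm ?B 1 usG) \<le> (\<integral>\<^sup>+x. indicator ?B x * ennreal (norm x * sph_incr_rearr D f x) \<partial>lborel)"
    unfolding us[symmetric]
  proof (rule nn_integral_norm_le_sph_incr_rearr[OF D_lmeasurable f vs0 vsm])
    fix k :: real assume k: "0 \<le> k"
    have "(\<integral>\<^sup>+x. indicator ?B x * ennreal (sph_incr_rearr ?B v x - k) \<partial>lborel) = (\<integral>\<^sup>+x. ennreal (\<bar>v x\<bar> - k) \<partial>lebesgue_on ?B)"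
      using nn_integral_sph_incr_rearr_excess[OF Bm vm k] unfolding sharp_ball_sharp_ball .
    also have "\<dots> \<le> (\<integral>\<^sup>+x. ennreal (g x - k) \<partial>N)" unfolding v_excess by (rule hk[OF k])
    also have "\<dots> = (\<integral>\<^sup>+x. ennreal (\<bar>f x\<bar> - k) \<partial>N)"
    proof (rule nn_integral_cong_AE)
      show "AE x in N. ennreal (g x - k) = ennreal (\<bar>f x\<bar> - k)" using ae
        by eventually_elim (metis abs_norm_cancel)
    qed
    finally show "(\<integral>\<^sup>+x. indicator ?B x * ennreal (sph_incr_rearr ?B v x - k) \<partial>lborel) \<le> (\<integral>\<^sup>+x. ennreal (\<bar>f x\<bar> - k) \<partial>N)" .
  qed
  also have "\<dots> = ennreal (?n * Lp_norm ?B 1 uG)"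
    by (rule radial_solution_L1_norm[OF p uG sph_incr_rearr_measurable[OF D_lmeasurable f], symmetric])
  finally have "?n * Lp_norm ?B 1 usG \<le> ?n * Lp_norm ?B 1 uG" by (subst (asm) ennreal_le_iff) (auto simp: Lp_norm_def)
  then show "Lp_norm ?B 1 usG \<le> Lp_norm ?B 1 uG" by simp
qed

end

theorem theorem1p3:
  fixes \<Omega> :: "(real ^ 'n) set"
    and f u uG usG :: "real ^ 'n \<Rightarrow> real"
    and p :: real
  assumes "CARD('n) \<ge> 2"
    and "open \<Omega>" and "bounded \<Omega>"
    and "p \<ge> 1"
    and "in_Lp \<Omega> p f"
    and "AE x in lebesgue_on \<Omega>. 0 \<le> f x"
    and "eikonal_solution \<Omega> p f u"
    and "eikonal_solution (sharp_ball \<Omega>) p (sph_incr_rearr \<Omega> f) uG"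
    and "spherically_decreasing_on (sharp_ball \<Omega>) uG"
    and "eikonal_solution (sharp_ball \<Omega>) p
           (sph_incr_rearr (sharp_ball \<Omega>)
             (\<lambda>x. norm (weak_gradient (sharp_ball \<Omega>) (sph_decr_rearr \<Omega> u) x))) usG"
    and "spherically_decreasing_on (sharp_ball \<Omega>) usG"
  shows "Lp_norm \<Omega> 1 u \<le> Lp_norm (sharp_ball \<Omega>) 1 usG \<and>
         Lp_norm (sharp_ball \<Omega>) 1 usG \<le> Lp_norm (sharp_ball \<Omega>) 1 uG"
proof -
  interpret sobolev_profile \<Omega> p u
    using assms(1-4,7) by unfold_locales (auto simp: eikonal_solution_def)
  have "f \<in> borel_measurable (lebesgue_on \<Omega>)" "AE x in lebesgue_on \<Omega>. norm (weak_gradient \<Omega> u x) = f x"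
    using assms(5,7) by (auto simp: in_Lp_def eikonal_solution_def)
  then show ?thesis using L1_norm_chain assms(8-11) by blast
qed

end
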